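(* Suppose $M$ is a real analytic strictly pseudoconvex CR manifold of dimension three, and let $\lambda\in\mathbb{R}$. Let $g^\lambda_{IJ}$ be the formal solution, i.e. the ACH metric on $M\times[0,\infty)_\rho$ in normal form for a real analytic contact form $\theta$, determined modulo $O(\rho^\infty)$ by $$\mathrm{Ric}_{IJ}+\frac32g^\lambda_{IJ}=O(\rho^\infty),\qquad W^-_{IJKL}=O(\rho^6),\qquad\eta=\lambda\mathcal{O}.$$ Then the formal solution $g^\lambda_{IJ}$ (its Taylor series in $\rho$ along $M$) converges to a real analytic ACH metric near $M$.
   Context: **CR structure.** $M$ is a 3-manifold with a rank 2 subbundle $H\subset TM$ and an almost complex structure $J$ on $H$ (integrability is automatic in dimension three), here all real analytic; $T^{1,0}M\subset\mathbb{C}H$ is the $i$-eigenbundle of $J$. For a real 1-form $\theta$ with $\ker\theta=H$, the Levi form is $h_\theta(Z,\overline W)=-i\,d\theta(Z,\overline W)$, $Z,W\in T^{1,0}M$. $M$ is strictly pseudoconvex if $h_\theta$ is positive definite for some $\theta$; such $\theta$ are called contact forms, and any two differ by a positive factor, $\hat\theta=e^\Upsilon\theta$. The Reeb field $T$ satisfies $\theta(T)=1$, $T\lrcorner d\theta=0$. An admissible frame is $\{T,Z_1,Z_{\overline1}=\overline{Z_1}\}$ with $Z_1$ a local frame of $T^{1,0}M$ (taken real analytic here); the dual coframe $\{\theta,\theta^1,\theta^{\overline1}\}$ satisfies $d\theta=ih_{1\overline1}\theta^1\wedge\theta^{\overline1}$. Indices are raised and lowered by $h_{1\overline1}$. **Densities.**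 For real $w$, a density in $\mathcal{E}(w,w)$ is equivalent to an assignment $\theta\mapsto f_\theta\in C^\infty(M)$ with $f_{e^\Upsilon\theta}=e^{w\Upsilon}f_\theta$. **Tanaka–Webster connection.** For a fixed $\theta$, it is the linear connection $\nabla$ on $TM$ preserving $T^{1,0}M$ with $\nabla T=0$, $\nabla h_\theta=0$ and $d\theta^1=\theta^1\wedge\omega_1{}^1+A^1{}_{\overline1}\theta\wedge\theta^{\overline1}$, where $\omega_1{}^1$ is the connection form; $A_{11}=\overline{A_{\overline1\overline1}}$ is the torsion, and the scalar curvature $\mathrm{Scal}^{TW}$ is defined by $d\omega_1{}^1=\mathrm{Scal}^{TW}h_{1\overline1}\theta^1\wedge\theta^{\overline1}+A_{11,}{}^1\theta^1\wedge\theta-A^1{}_{\overline1,1}\theta^{\overline1}\wedge\theta$. Indices after a comma (or added to a function) denote covariant derivatives, taken in the order written, $0$ denoting the $T$ direction. The Cartan tensor is $$Q_{11}=\tfrac16\mathrm{Scal}^{TW}_{11}+\tfrac i2\mathrm{Scal}^{TW}A_{11}-A_{11,0}-\tfrac{2i}{3}A_{11,\overline1}{}^{\overline1},$$ and the obstruction density is $\mathcal{O}=(\nabla^1\nabla^1-iA^{11})Q_{11}$, computed with $\theta$; it is a real CR invariant density in $\mathcal{E}(-3,-3)$. **$\Theta$-frames and normal form ACH metrics.** Given $\theta$ and an admissible frame, put on $M\times[0,\infty)_\rho$: $\mathbf{Z}_\infty=\rho\partial_\rho$, $\mathbf{Z}_0=\rho^2T$, $\mathbf{Z}_1=\rho Z_1$,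 $\mathbf{Z}_{\overline1}=\rho Z_{\overline1}$. These form a frame of a (complexified) vector bundle over $M\times[0,\infty)$, the $\Theta$-tangent bundle, which agrees with the tangent bundle over $\rho>0$; indices $I,J,\dots$ run over $\infty,0,1,\overline1$ and components are taken in this frame. A $\Theta$-metric is a fiber metric on this bundle (smooth up to $\rho=0$); a tensor is $O(\rho^m)$ if all its components in this frame are $O(\rho^m)$, and $O(\rho^\infty)$ means $O(\rho^m)$ for all $m$. A $\Theta$-metric $g$ is a normal form ACH metric for $\theta$ if $g_{\infty\infty}=4$, $g_{\infty0}=g_{\infty1}=0$, $g_{00}=1+O(\rho)$, $g_{01}=O(\rho)$, $g_{11}=O(\rho)$, $g_{1\overline1}=h_{1\overline1}+O(\rho)$. It is real analytic near $M$ if the components $g_{IJ}$ are real analytic in a neighborhood of $M\times\{0\}$, up to $\rho=0$. **Curvature.** $R_I{}^J{}_{KL}$ is defined by $(\nabla_V\nabla_WY-\nabla_W\nabla_VY-\nabla_{[V,W]}Y)^J=R_I{}^J{}_{KL}Y^IV^KW^L$ for the Levi-Civita connection of $g$; $\mathrm{Ric}_{IJ}=R_J{}^K{}_{KI}$, $P_{IJ}=\frac12\mathrm{Ric}_{IJ}-\frac1{12}\mathrm{Scal}\,g_{IJ}$, $W_{IJKL}=R_{IJKL}+g_{IK}P_{JL}-g_{JK}P_{IL}+g_{JL}P_{IK}-g_{IL}P_{JK}$ (with $R_{IJKL}=g_{JM}R_I{}^M{}_{KL}$). The orientation is such that $\theta\wedge d\theta\wedge d\rho>0$, $\varepsilon_{IJKL}$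 is the volume form of $g$, and $W^-_{IJKL}=\frac12\bigl(W_{IJKL}-\frac12\varepsilon_{KL}{}^{PQ}W_{IJPQ}\bigr)$. **The condition $\eta=\lambda\mathcal{O}$.** For $g$ in normal form for $\theta$ with $W^-_{IJKL}=O(\rho^6)$, $\eta_\theta=(\rho^{-6}W^-_{\infty0\infty0})|_M$, and the condition means $\eta_\theta=\lambda\mathcal{O}_\theta$, where $\mathcal{O}_\theta$ is the function representing $\mathcal{O}$ for $\theta$. **Existence.** For each $\lambda\in\mathbb{R}$ and each contact form $\theta$, a normal form ACH metric satisfying the three conditions exists and is unique modulo $O(\rho^\infty)$. *)

theory Defs
  imports "HOL-Analysis.Analysis"
begin

section \<open>Smooth and real analytic functions on open sets of a Euclidean space\<close>

text \<open>All regularity predicates are meant for open sets \<open>S\<close>.\<close>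

datatype regularity = Smooth | Analytic

fun Ck_on :: "nat \<Rightarrow> ('e::euclidean_space \<Rightarrow> complex) \<Rightarrow> 'e set \<Rightarrow> bool" where
  "Ck_on 0 f S \<longleftrightarrow> continuous_on S f"
| "Ck_on (Suc k) f S \<longleftrightarrow>
     f differentiable_on S \<and> (\<forall>b\<in>Basis. Ck_on k (\<lambda>x. frechet_derivative f (at x) b) S)"

text \<open>Multi-indices are the functions \<open>Basis \<rightarrow>\<^sub>E UNIV\<close> from the coordinates to \<open>nat\<close>.\<close>

definition real_analytic_on :: "('e::euclidean_space \<Rightarrow> complex) \<Rightarrow> 'e set \<Rightarrow> bool" where
  "real_analytic_on f S \<longleftrightarrow>
     (\<forall>x\<in>S. \<exists>r>0. \<exists>c :: ('e \<Rightarrow> nat) \<Rightarrow> complex. \<forall>y\<in>ball x r.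
        ((\<lambda>\<alpha>. c \<alpha> * of_real (\<Prod>b\<in>Basis. ((y - x) \<bullet> b) ^ \<alpha> b)) has_sum f y)
          (Basis \<rightarrow>\<^sub>E (UNIV :: nat set)))"

fun regular_on :: "regularity \<Rightarrow> ('e::euclidean_space \<Rightarrow> complex) \<Rightarrow> 'e set \<Rightarrow> bool" where
  "regular_on Smooth f S \<longleftrightarrow> (\<forall>k. Ck_on k f S)"
| "regular_on Analytic f S \<longleftrightarrow> real_analytic_on f S"


section \<open>Real analytic 3-manifolds\<close>

text \<open>The underlying space is the whole type \<open>'a\<close> (Hausdorff, second countable); the manifold
  structure is a real analytic atlas, not necessarily maximal. The inverse of a chart \<open>(V, \<phi>)\<close> is
  \<open>inv_into V \<phi>\<close>.\<close>

type_synonym 'a atlas = "('a set \<times> ('a \<Rightarrow> real ^ 3)) set"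

definition analytic_atlas :: "('a::{t2_space, second_countable_topology}) atlas \<Rightarrow> bool" where
  "analytic_atlas M \<longleftrightarrow>
     (\<Union>(U, \<phi>)\<in>M. U) = UNIV \<and>
     (\<forall>(U, \<phi>)\<in>M. open U \<and> open (\<phi> ` U) \<and> homeomorphism U (\<phi> ` U) \<phi> (inv_into U \<phi>)) \<and>
     (\<forall>(U, \<phi>)\<in>M. \<forall>(V, \<psi>)\<in>M. \<forall>i.
        regular_on Analytic (\<lambda>x. of_real (\<phi> (inv_into V \<psi> x) $ i)) (\<psi> ` (U \<inter> V)))"

definition regular_fun :: "regularity \<Rightarrow> ('a::{t2_space, second_countable_topology}) atlas \<Rightarrow>
    ('a \<Rightarrow> complex) \<Rightarrow> 'a set \<Rightarrow> bool" where
  "regular_fun k M f U \<longleftrightarrow>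
     (\<forall>(V, \<phi>)\<in>M. regular_on k (f \<circ> inv_into V \<phi>) (\<phi> ` (U \<inter> V)))"

definition smooth_near :: "('a::{t2_space, second_countable_topology}) atlas \<Rightarrow> 'a \<Rightarrow>
    ('a \<Rightarrow> complex) \<Rightarrow> bool" where
  "smooth_near M p f \<longleftrightarrow> (\<exists>U. open U \<and> p \<in> U \<and> regular_fun Smooth M f U)"


section \<open>Tangent vectors, vector fields and 1-forms\<close>

text \<open>A complex tangent vector at \<open>p\<close> is the derivation it induces on complex functions that are
  smooth near \<open>p\<close>. To make it a unique HOL object it is extended by 0 to all other functions.
  Complex 1-forms are maps that are complex linear on complexified tangent spaces; a real 1-form is
  identified with its complex linear extension.\<close>

type_synonym 'a cvec = "('a \<Rightarrow> complex) \<Rightarrow> complex"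
type_synonym 'a form = "'a \<Rightarrow> 'a cvec \<Rightarrow> complex"

definition lincomb :: "complex \<Rightarrow> 'a cvec \<Rightarrow> complex \<Rightarrow> 'a cvec \<Rightarrow> 'a cvec" where
  "lincomb a X b Y = (\<lambda>f. a * X f + b * Y f)"

definition zero_vec :: "'a cvec" where
  "zero_vec = (\<lambda>f. 0)"

definition conj_vec :: "'a cvec \<Rightarrow> 'a cvec" where
  "conj_vec X = (\<lambda>f. cnj (X (\<lambda>p. cnj (f p))))"

definition coord_vec :: "('a::{t2_space, second_countable_topology}) atlas \<Rightarrow>
    'a set \<Rightarrow> ('a \<Rightarrow> real ^ 3) \<Rightarrow> 3 \<Rightarrow> 'a \<Rightarrow> 'a cvec" where
  "coord_vec M V \<phi> i p =
     (\<lambda>f. if smooth_near M p f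
           then frechet_derivative (f \<circ> inv_into V \<phi>) (at (\<phi> p)) (axis i 1) else 0)"

definition ctangent :: "('a::{t2_space, second_countable_topology}) atlas \<Rightarrow> 'a \<Rightarrow> 'a cvec set" where
  "ctangent M p =
     {X. \<exists>(V, \<phi>)\<in>M. p \<in> V \<and>
        (\<exists>c :: complex ^ 3. X = (\<lambda>f. \<Sum>i\<in>UNIV. c $ i * coord_vec M V \<phi> i p f))}"

definition rtangent :: "('a::{t2_space, second_countable_topology}) atlas \<Rightarrow> 'a \<Rightarrow> 'a cvec set" where
  "rtangent M p = {X \<in> ctangent M p. conj_vec X = X}"

definition vector_field :: "regularity \<Rightarrow> ('a::{t2_space, second_countable_topology}) atlas \<Rightarrow>
    'a set \<Rightarrow> ('a \<Rightarrow> 'a cvec) \<Rightarrow> bool" where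
  "vector_field k M U X \<longleftrightarrow>
     (\<forall>p\<in>U. X p \<in> ctangent M p) \<and>
     (\<forall>(V, \<phi>)\<in>M. \<forall>i. regular_fun k M (\<lambda>p. X p (\<lambda>q. of_real (\<phi> q $ i))) (U \<inter> V))"

definition one_form :: "regularity \<Rightarrow> ('a::{t2_space, second_countable_topology}) atlas \<Rightarrow>
    'a set \<Rightarrow> 'a form \<Rightarrow> bool" where
  "one_form k M U \<alpha> \<longleftrightarrow>
     (\<forall>p\<in>U. \<forall>X\<in>ctangent M p. \<forall>Y\<in>ctangent M p. \<forall>a b.
        \<alpha> p (lincomb a X b Y) = a * \<alpha> p X + b * \<alpha> p Y) \<and>
     (\<forall>(V, \<phi>)\<in>M. \<forall>i. regular_fun k M (\<lambda>p. \<alpha> p (coord_vec M V \<phi> i p)) (U \<inter> V))"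

definition conj_form :: "'a form \<Rightarrow> 'a form" where
  "conj_form \<alpha> = (\<lambda>p X. cnj (\<alpha> p (conj_vec X)))"

definition wedge :: "'a form \<Rightarrow> 'a form \<Rightarrow> 'a \<Rightarrow> 'a cvec \<Rightarrow> 'a cvec \<Rightarrow> complex" where
  "wedge \<alpha> \<beta> p X Y = \<alpha> p X * \<beta> p Y - \<alpha> p Y * \<beta> p X"

definition lie_bracket :: "('a::{t2_space, second_countable_topology}) atlas \<Rightarrow>
    ('a \<Rightarrow> 'a cvec) \<Rightarrow> ('a \<Rightarrow> 'a cvec) \<Rightarrow> 'a \<Rightarrow> 'a cvec" where
  "lie_bracket M X Y p =
     (\<lambda>f. if smooth_near M p f then X p (\<lambda>q. Y q f) - Y p (\<lambda>q. X q f) else 0)"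

definition ext_d :: "('a::{t2_space, second_countable_topology}) atlas \<Rightarrow> 'a form \<Rightarrow>
    ('a \<Rightarrow> 'a cvec) \<Rightarrow> ('a \<Rightarrow> 'a cvec) \<Rightarrow> 'a \<Rightarrow> complex" where
  "ext_d M \<alpha> X Y p =
     X p (\<lambda>q. \<alpha> q (Y q)) - Y p (\<lambda>q. \<alpha> q (X q)) - \<alpha> p (lie_bracket M X Y p)"


section \<open>CR structures and contact forms\<close>

text \<open>\<open>H p\<close> is a real plane in the tangent space at \<open>p\<close>, and \<open>J p\<close> an endomorphism of it with
  square \<open>-1\<close>, both real analytic in \<open>p\<close>.\<close>

definition cr_structure :: "('a::{t2_space, second_countable_topology}) atlas \<Rightarrow>
    ('a \<Rightarrow> 'a cvec set) \<Rightarrow> ('a \<Rightarrow> 'a cvec \<Rightarrow> 'a cvec) \<Rightarrow> bool" where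
  "cr_structure M H J \<longleftrightarrow>
     analytic_atlas M \<and>
     (\<forall>p. H p \<subseteq> rtangent M p \<and> J p ` H p \<subseteq> H p \<and>
       (\<forall>X\<in>H p. \<forall>Y\<in>H p. \<forall>a b :: real.
          J p (lincomb (of_real a) X (of_real b) Y) = lincomb (of_real a) (J p X) (of_real b) (J p Y)) \<and>
       (\<forall>X\<in>H p. J p (J p X) = lincomb (-1) X 0 X)) \<and>
     (\<forall>p. \<exists>U X Y. open U \<and> p \<in> U \<and>
        vector_field Analytic M U X \<and> vector_field Analytic M U Y \<and>
        (\<forall>q\<in>U. H q = {lincomb (of_real a) (X q) (of_real b) (Y q) | a b :: real. True} \<and>
           (\<forall>a b :: real. lincomb (of_real a) (X q) (of_real b) (Y q) = zero_vec \<longrightarrow> a = 0 \<and> b = 0)) \<and>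
        vector_field Analytic M U (\<lambda>q. J q (X q)) \<and> vector_field Analytic M U (\<lambda>q. J q (Y q)))"

text \<open>The fibre of \<open>T\<^sup>1\<^sup>,\<^sup>0M\<close>: the vectors \<open>X + iY\<close> of the complexification of \<open>H\<close> with
  \<open>JX + iJY = i(X + iY)\<close>.\<close>

definition T10 :: "('a \<Rightarrow> 'a cvec set) \<Rightarrow> ('a \<Rightarrow> 'a cvec \<Rightarrow> 'a cvec) \<Rightarrow> 'a \<Rightarrow> 'a cvec set" where
  "T10 H J p =
     {lincomb 1 X \<i> Y | X Y. X \<in> H p \<and> Y \<in> H p \<and>
        lincomb 1 (J p X) \<i> (J p Y) = lincomb \<i> X (-1) Y}"

definition levi_form :: "('a::{t2_space, second_countable_topology}) atlas \<Rightarrow> 'a form \<Rightarrow>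
    ('a \<Rightarrow> 'a cvec) \<Rightarrow> ('a \<Rightarrow> 'a cvec) \<Rightarrow> 'a \<Rightarrow> complex" where
  "levi_form M \<theta> Z W p = - \<i> * ext_d M \<theta> Z (\<lambda>q. conj_vec (W q)) p"

definition contact_form :: "regularity \<Rightarrow> ('a::{t2_space, second_countable_topology}) atlas \<Rightarrow>
    ('a \<Rightarrow> 'a cvec set) \<Rightarrow> ('a \<Rightarrow> 'a cvec \<Rightarrow> 'a cvec) \<Rightarrow> 'a form \<Rightarrow> bool" where
  "contact_form k M H J \<theta> \<longleftrightarrow>
     one_form k M UNIV \<theta> \<and>
     (\<forall>p. \<forall>X\<in>rtangent M p. \<theta> p X \<in> \<real>) \<and>
     (\<forall>p. H p = {X \<in> rtangent M p. \<theta> p X = 0}) \<and>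
     (\<forall>U Z. open U \<and> vector_field Smooth M U Z \<and> (\<forall>p\<in>U. Z p \<in> T10 H J p) \<longrightarrow>
        (\<forall>p\<in>U. Z p \<noteq> zero_vec \<longrightarrow> levi_form M \<theta> Z Z p \<in> \<real> \<and> Re (levi_form M \<theta> Z Z p) > 0))"

definition strictly_pseudoconvex :: "('a::{t2_space, second_countable_topology}) atlas \<Rightarrow>
    ('a \<Rightarrow> 'a cvec set) \<Rightarrow> ('a \<Rightarrow> 'a cvec \<Rightarrow> 'a cvec) \<Rightarrow> bool" where
  "strictly_pseudoconvex M H J \<longleftrightarrow> (\<exists>\<theta>. contact_form Smooth M H J \<theta>)"

definition reeb_field :: "('a::{t2_space, second_countable_topology}) atlas \<Rightarrow> 'a form \<Rightarrow>
    'a \<Rightarrow> 'a cvec" where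
  "reeb_field M \<theta> =
     (THE T. vector_field Smooth M UNIV T \<and> (\<forall>p. T p \<in> rtangent M p \<and> \<theta> p (T p) = 1) \<and>
        (\<forall>U X. open U \<and> vector_field Smooth M U X \<longrightarrow> (\<forall>p\<in>U. ext_d M \<theta> T X p = 0)))"

text \<open>As the Reeb field is determined by \<open>\<theta>\<close>, an admissible frame on the open set \<open>U\<close> is given by
  its member \<open>Z = Z\<^sub>1\<close>.\<close>

definition admissible_frame :: "('a::{t2_space, second_countable_topology}) atlas \<Rightarrow>
    ('a \<Rightarrow> 'a cvec set) \<Rightarrow> ('a \<Rightarrow> 'a cvec \<Rightarrow> 'a cvec) \<Rightarrow> 'a set \<Rightarrow> ('a \<Rightarrow> 'a cvec) \<Rightarrow> bool" where
  "admissible_frame M H J U Z \<longleftrightarrow>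
     open U \<and> vector_field Analytic M U Z \<and> (\<forall>p\<in>U. Z p \<in> T10 H J p \<and> Z p \<noteq> zero_vec)"

text \<open>The member \<open>\<theta>\<^sup>1\<close> of the dual coframe.\<close>

definition coframe1 :: "('a::{t2_space, second_countable_topology}) atlas \<Rightarrow> 'a form \<Rightarrow>
    ('a \<Rightarrow> 'a cvec) \<Rightarrow> 'a form" where
  "coframe1 M \<theta> Z p X =
     (THE c. \<exists>a b. X = (\<lambda>f. a * reeb_field M \<theta> p f + c * Z p f + b * conj_vec (Z p) f))"


section \<open>Tanaka--Webster connection and obstruction density\<close>

text \<open>\<open>tanaka_webster M \<theta> Z U \<omega> \<tau>\<close>: on \<open>U\<close>, \<open>\<omega>\<close> is the connection form \<open>\<omega>\<^sub>1\<^sup>1\<close> and \<open>\<tau>\<close> the torsion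
  component with upper index \<open>1\<close> and lower index \<open>1\<close>-bar. The connection is
  \<open>\<nabla>T = 0\<close>, \<open>\<nabla>Z = \<omega> \<otimes> Z\<close>, so that \<open>\<nabla>h = 0\<close> reads \<open>dh = (\<omega> + conj \<omega>) h\<close>.\<close>

definition tanaka_webster :: "('a::{t2_space, second_countable_topology}) atlas \<Rightarrow> 'a form \<Rightarrow>
    ('a \<Rightarrow> 'a cvec) \<Rightarrow> 'a set \<Rightarrow> 'a form \<Rightarrow> ('a \<Rightarrow> complex) \<Rightarrow> bool" where
  "tanaka_webster M \<theta> Z U \<omega> \<tau> \<longleftrightarrow>
     one_form Smooth M U \<omega> \<and> regular_fun Smooth M \<tau> U \<and>
     (\<forall>X Y. vector_field Smooth M U X \<and> vector_field Smooth M U Y \<longrightarrow>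
        (\<forall>p\<in>U. ext_d M (coframe1 M \<theta> Z) X Y p =
           wedge (coframe1 M \<theta> Z) \<omega> p (X p) (Y p) +
           \<tau> p * wedge \<theta> (conj_form (coframe1 M \<theta> Z)) p (X p) (Y p))) \<and>
     (\<forall>X. vector_field Smooth M U X \<longrightarrow>
        (\<forall>p\<in>U. X p (levi_form M \<theta> Z Z) =
           (\<omega> p (X p) + conj_form \<omega> p (X p)) * levi_form M \<theta> Z Z p))"

definition tw_form :: "('a::{t2_space, second_countable_topology}) atlas \<Rightarrow> 'a form \<Rightarrow>
    ('a \<Rightarrow> 'a cvec) \<Rightarrow> 'a set \<Rightarrow> 'a form" where
  "tw_form M \<theta> Z U = (SOME \<omega>. \<exists>\<tau>. tanaka_webster M \<theta> Z U \<omega> \<tau>)"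

text \<open>\<open>A\<^sub>1\<^sub>1\<close>, the conjugate of the torsion \<open>\<tau>\<close> with its upper index lowered by \<open>h\<close>.\<close>

definition tw_torsion :: "('a::{t2_space, second_countable_topology}) atlas \<Rightarrow> 'a form \<Rightarrow>
    ('a \<Rightarrow> 'a cvec) \<Rightarrow> 'a set \<Rightarrow> 'a \<Rightarrow> complex" where
  "tw_torsion M \<theta> Z U p =
     cnj (levi_form M \<theta> Z Z p * (SOME \<tau>. \<exists>\<omega>. tanaka_webster M \<theta> Z U \<omega> \<tau>) p)"

text \<open>The structure equation for \<open>d\<omega>\<close> evaluated on \<open>(Z\<^sub>1, conj Z\<^sub>1)\<close>: the terms that contain \<open>\<theta>\<close> vanish,
  and \<open>d\<omega>(Z\<^sub>1, conj Z\<^sub>1) = Scal h\<close> remains.\<close>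

definition tw_scal :: "('a::{t2_space, second_countable_topology}) atlas \<Rightarrow> 'a form \<Rightarrow>
    ('a \<Rightarrow> 'a cvec) \<Rightarrow> 'a set \<Rightarrow> 'a \<Rightarrow> complex" where
  "tw_scal M \<theta> Z U p =
     ext_d M (tw_form M \<theta> Z U) Z (\<lambda>q. conj_vec (Z q)) p / levi_form M \<theta> Z Z p"

text \<open>Covariant derivative along \<open>X\<close> of a tensor component \<open>t\<close> with \<open>m\<close> lower indices \<open>1\<close> and \<open>n\<close>
  lower indices \<open>1\<close>-bar.\<close>

definition tw_deriv :: "('a::{t2_space, second_countable_topology}) atlas \<Rightarrow> 'a form \<Rightarrow>
    ('a \<Rightarrow> 'a cvec) \<Rightarrow> 'a set \<Rightarrow> nat \<Rightarrow> nat \<Rightarrow> ('a \<Rightarrow> 'a cvec) \<Rightarrow> ('a \<Rightarrow> complex) \<Rightarrow> 'a \<Rightarrow> complex" where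
  "tw_deriv M \<theta> Z U m n X t p =
     X p t - (of_nat m * tw_form M \<theta> Z U p (X p) +
              of_nat n * conj_form (tw_form M \<theta> Z U) p (X p)) * t p"

text \<open>Since \<open>\<nabla>h = 0\<close>, an index of a covariant derivative is raised by dividing by \<open>h\<close> at the end: the
  last term of \<open>Q\<^sub>1\<^sub>1\<close> comes from differentiating \<open>A\<^sub>1\<^sub>1\<close> first along \<open>conj Z\<^sub>1\<close>, then along \<open>Z\<^sub>1\<close>,
  and \<open>\<nabla>\<^sup>1\<nabla>\<^sup>1\<close> is twice the derivative along \<open>conj Z\<^sub>1\<close>.\<close>

definition cartan_tensor :: "('a::{t2_space, second_countable_topology}) atlas \<Rightarrow> 'a form \<Rightarrow>
    ('a \<Rightarrow> 'a cvec) \<Rightarrow> 'a set \<Rightarrow> 'a \<Rightarrow> complex" where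
  "cartan_tensor M \<theta> Z U p =
     (let Zb = (\<lambda>q. conj_vec (Z q)); D = tw_deriv M \<theta> Z U;
          S = tw_scal M \<theta> Z U; A = tw_torsion M \<theta> Z U
      in 1/6 * D 1 0 Z (D 0 0 Z S) p + \<i>/2 * S p * A p - D 2 0 (reeb_field M \<theta>) A p
         - 2 * \<i> / 3 * (D 2 1 Z (D 2 0 Zb A) p / levi_form M \<theta> Z Z p))"

definition obstruction :: "('a::{t2_space, second_countable_topology}) atlas \<Rightarrow> 'a form \<Rightarrow>
    ('a \<Rightarrow> 'a cvec) \<Rightarrow> 'a set \<Rightarrow> 'a \<Rightarrow> complex" where
  "obstruction M \<theta> Z U p =
     (let Zb = (\<lambda>q. conj_vec (Z q)); D = tw_deriv M \<theta> Z U; Q = cartan_tensor M \<theta> Z U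
      in (D 2 1 Zb (D 2 0 Zb Q) p - \<i> * cnj (tw_torsion M \<theta> Z U p) * Q p)
         / (levi_form M \<theta> Z Z p)\<^sup>2)"


section \<open>The Theta-tangent bundle and normal form ACH metrics\<close>

text \<open>The order \<open>O(\<rho>\<^sup>m)\<close> is locally uniform on \<open>U \<subseteq> M\<close>.\<close>

definition O_rho :: "('a::topological_space) set \<Rightarrow> nat \<Rightarrow> ('a \<times> real \<Rightarrow> complex) \<Rightarrow> bool" where
  "O_rho U m F \<longleftrightarrow>
     (\<forall>p\<in>U. \<exists>V C \<epsilon>. open V \<and> p \<in> V \<and> \<epsilon> > 0 \<and>
        (\<forall>q\<in>V \<inter> U. \<forall>\<rho>\<in>{0<..<\<epsilon>}. norm (F (q, \<rho>)) \<le> C * \<rho> ^ m))"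

text \<open>Regularity on a relatively open subset \<open>N\<close> of \<open>M \<times> [0,\<infinity>)\<close>, up to the boundary: in a chart,
  \<open>F\<close> extends locally across \<open>\<rho> = 0\<close> to a regular function on an open set. It is also used for open
  sets \<open>N\<close> with \<open>\<rho> > 0\<close>.\<close>

definition regular_bfun :: "regularity \<Rightarrow> ('a::{t2_space, second_countable_topology}) atlas \<Rightarrow>
    ('a \<times> real \<Rightarrow> complex) \<Rightarrow> ('a \<times> real) set \<Rightarrow> bool" where
  "regular_bfun k M F N \<longleftrightarrow>
     (\<forall>(p, \<rho>)\<in>N. \<exists>(V, \<phi>)\<in>M. p \<in> V \<and>
        (\<exists>W G. open W \<and> (\<phi> p, \<rho>) \<in> W \<and> regular_on k G W \<and>
           (\<forall>q\<in>V. \<forall>r. (\<phi> q, r) \<in> W \<and> (q, r) \<in> N \<longrightarrow> F (q, r) = G (\<phi> q, r))))"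

text \<open>Given \<open>\<theta>\<close>, the (complexified) fibre of the \<open>\<Theta>\<close>-tangent bundle at \<open>(p, \<rho>)\<close> is identified with
  \<open>\<complex> \<oplus> \<complex>T\<^sub>pM\<close>: the pair \<open>(a, V)\<close> stands for
  \<open>a \<rho>\<partial>\<^sub>\<rho> + \<theta>(V) \<rho>\<^sup>2T + \<rho>(V - \<theta>(V)T)\<close>. The frame then consists of the pairs
  \<open>(1, 0)\<close>, \<open>(0, T)\<close>, \<open>(0, Z\<^sub>1)\<close>, \<open>(0, conj Z\<^sub>1)\<close>, for \<open>\<rho> = 0\<close> as well, and replacing \<open>Z\<^sub>1\<close> by \<open>uZ\<^sub>1\<close>
  changes both sides in the same way.\<close>

type_synonym 'a tvec = "complex \<times> 'a cvec"
type_synonym 'a tmetric = "'a \<times> real \<Rightarrow> 'a tvec \<Rightarrow> 'a tvec \<Rightarrow> complex"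

definition theta_fiber :: "('a::{t2_space, second_countable_topology}) atlas \<Rightarrow> 'a \<Rightarrow> 'a tvec set" where
  "theta_fiber M p = UNIV \<times> ctangent M p"

definition real_theta_fiber :: "('a::{t2_space, second_countable_topology}) atlas \<Rightarrow> 'a \<Rightarrow>
    'a tvec set" where
  "real_theta_fiber M p = \<real> \<times> rtangent M p"

definition tlincomb :: "complex \<Rightarrow> 'a tvec \<Rightarrow> complex \<Rightarrow> 'a tvec \<Rightarrow> 'a tvec" where
  "tlincomb a u b v = (a * fst u + b * fst v, lincomb a (snd u) b (snd v))"

text \<open>The frame indices \<open>\<infinity>, 0, 1, 1\<close>-bar.\<close>

datatype idx = Xinf | X0 | X1 | X1bar

lemma UNIV_idx: "UNIV = {Xinf, X0, X1, X1bar}"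
  using idx.exhaust by auto

instance idx :: finite
  by standard (simp add: UNIV_idx)

fun theta_frame :: "('a::{t2_space, second_countable_topology}) atlas \<Rightarrow> 'a form \<Rightarrow>
    ('a \<Rightarrow> 'a cvec) \<Rightarrow> idx \<Rightarrow> 'a \<Rightarrow> 'a tvec" where
  "theta_frame M \<theta> Z Xinf p = (1, zero_vec)"
| "theta_frame M \<theta> Z X0 p = (0, reeb_field M \<theta> p)"
| "theta_frame M \<theta> Z X1 p = (0, Z p)"
| "theta_frame M \<theta> Z X1bar p = (0, conj_vec (Z p))"

definition gcomp :: "('a::{t2_space, second_countable_topology}) atlas \<Rightarrow> 'a form \<Rightarrow>
    ('a \<Rightarrow> 'a cvec) \<Rightarrow> 'a tmetric \<Rightarrow> idx \<Rightarrow> idx \<Rightarrow> 'a \<times> real \<Rightarrow> complex" where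
  "gcomp M \<theta> Z g I J x = g x (theta_frame M \<theta> Z I (fst x)) (theta_frame M \<theta> Z J (fst x))"

text \<open>A fibre metric is represented by its complex bilinear extension.\<close>

definition theta_metric :: "regularity \<Rightarrow> ('a::{t2_space, second_countable_topology}) atlas \<Rightarrow>
    ('a \<Rightarrow> 'a cvec set) \<Rightarrow> ('a \<Rightarrow> 'a cvec \<Rightarrow> 'a cvec) \<Rightarrow> 'a form \<Rightarrow> ('a \<times> real) set \<Rightarrow>
    'a tmetric \<Rightarrow> bool" where
  "theta_metric k M H J \<theta> N g \<longleftrightarrow>
     (\<forall>(p, \<rho>)\<in>N.
        (\<forall>u\<in>theta_fiber M p. \<forall>v\<in>theta_fiber M p. g (p, \<rho>) u v = g (p, \<rho>) v u) \<and>
        (\<forall>u\<in>theta_fiber M p. \<forall>v\<in>theta_fiber M p. \<forall>w\<in>theta_fiber M p. \<forall>a b.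
           g (p, \<rho>) (tlincomb a u b v) w = a * g (p, \<rho>) u w + b * g (p, \<rho>) v w) \<and>
        (\<forall>u\<in>real_theta_fiber M p. \<forall>v\<in>real_theta_fiber M p. g (p, \<rho>) u v \<in> \<real>) \<and>
        (\<forall>u\<in>real_theta_fiber M p. u \<noteq> (0, zero_vec) \<longrightarrow> Re (g (p, \<rho>) u u) > 0)) \<and>
     (\<forall>U Z. admissible_frame M H J U Z \<longrightarrow>
        (\<forall>I K. regular_bfun k M (gcomp M \<theta> Z g I K) (N \<inter> U \<times> UNIV)))"

definition normal_form_ACH :: "('a::{t2_space, second_countable_topology}) atlas \<Rightarrow>
    ('a \<Rightarrow> 'a cvec set) \<Rightarrow> ('a \<Rightarrow> 'a cvec \<Rightarrow> 'a cvec) \<Rightarrow> 'a form \<Rightarrow> ('a \<times> real) set \<Rightarrow>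
    'a tmetric \<Rightarrow> bool" where
  "normal_form_ACH M H J \<theta> N g \<longleftrightarrow>
     (\<forall>U Z. admissible_frame M H J U Z \<longrightarrow>
        (\<forall>x\<in>N \<inter> U \<times> UNIV. gcomp M \<theta> Z g Xinf Xinf x = 4 \<and>
           gcomp M \<theta> Z g Xinf X0 x = 0 \<and> gcomp M \<theta> Z g Xinf X1 x = 0) \<and>
        O_rho U 1 (\<lambda>x. gcomp M \<theta> Z g X0 X0 x - 1) \<and>
        O_rho U 1 (gcomp M \<theta> Z g X0 X1) \<and>
        O_rho U 1 (gcomp M \<theta> Z g X1 X1) \<and>
        O_rho U 1 (\<lambda>x. gcomp M \<theta> Z g X1 X1bar x - levi_form M \<theta> Z Z (fst x)))"


section \<open>Curvature\<close>

text \<open>Over \<open>\<rho> > 0\<close> the \<open>\<Theta>\<close>-frame acts on functions, and the Levi-Civita connection and its curvature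
  are expressed in it. Behaviour at \<open>\<rho> = 0\<close> is only ever accessed as a limit \<open>\<rho> \<rightarrow> 0\<close>.\<close>

fun frame_deriv :: "('a::{t2_space, second_countable_topology}) atlas \<Rightarrow> 'a form \<Rightarrow>
    ('a \<Rightarrow> 'a cvec) \<Rightarrow> idx \<Rightarrow> ('a \<times> real \<Rightarrow> complex) \<Rightarrow> 'a \<times> real \<Rightarrow> complex" where
  "frame_deriv M \<theta> Z Xinf F (p, \<rho>) = of_real \<rho> * vector_derivative (\<lambda>r. F (p, r)) (at \<rho>)"
| "frame_deriv M \<theta> Z X0 F (p, \<rho>) = of_real (\<rho>\<^sup>2) * reeb_field M \<theta> p (\<lambda>q. F (q, \<rho>))"
| "frame_deriv M \<theta> Z X1 F (p, \<rho>) = of_real \<rho> * Z p (\<lambda>q. F (q, \<rho>))"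
| "frame_deriv M \<theta> Z X1bar F (p, \<rho>) = of_real \<rho> * conj_vec (Z p) (\<lambda>q. F (q, \<rho>))"

text \<open>\<open>\<Gamma> I J K\<close> is the coefficient of the \<open>K\<close>-th frame vector in the derivative of the \<open>J\<close>-th along the
  \<open>I\<close>-th. The two conditions are vanishing torsion, tested on functions, and \<open>\<nabla>g = 0\<close>.\<close>

definition levi_civita :: "('a::{t2_space, second_countable_topology}) atlas \<Rightarrow> 'a form \<Rightarrow>
    ('a \<Rightarrow> 'a cvec) \<Rightarrow> 'a set \<Rightarrow> 'a tmetric \<Rightarrow>
    (idx \<Rightarrow> idx \<Rightarrow> idx \<Rightarrow> 'a \<times> real \<Rightarrow> complex) \<Rightarrow> bool" where
  "levi_civita M \<theta> Z U g \<Gamma> \<longleftrightarrow>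
     (\<forall>x\<in>U \<times> {0<..}.
        (\<forall>I J F. (\<exists>N. open N \<and> x \<in> N \<and> regular_bfun Smooth M F N) \<longrightarrow>
           (\<Sum>K\<in>UNIV. (\<Gamma> I J K x - \<Gamma> J I K x) * frame_deriv M \<theta> Z K F x) =
           frame_deriv M \<theta> Z I (frame_deriv M \<theta> Z J F) x
           - frame_deriv M \<theta> Z J (frame_deriv M \<theta> Z I F) x) \<and>
        (\<forall>I J K. frame_deriv M \<theta> Z K (gcomp M \<theta> Z g I J) x =
           (\<Sum>L\<in>UNIV. \<Gamma> K I L x * gcomp M \<theta> Z g L J x + \<Gamma> K J L x * gcomp M \<theta> Z g I L x)))"

definition LC :: "('a::{t2_space, second_countable_topology}) atlas \<Rightarrow> 'a form \<Rightarrow>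
    ('a \<Rightarrow> 'a cvec) \<Rightarrow> 'a set \<Rightarrow> 'a tmetric \<Rightarrow> idx \<Rightarrow> idx \<Rightarrow> idx \<Rightarrow> 'a \<times> real \<Rightarrow> complex" where
  "LC M \<theta> Z U g = (SOME \<Gamma>. levi_civita M \<theta> Z U g \<Gamma>)"

text \<open>\<open>curv I J K L\<close> is the component with lower indices \<open>I, K, L\<close> and upper index \<open>J\<close>: the \<open>J\<close>-th
  component of \<open>R(E\<^sub>K, E\<^sub>L)E\<^sub>I\<close>, where the last sum is the term with the bracket
  \<open>[E\<^sub>K, E\<^sub>L] = \<nabla>\<^sub>K E\<^sub>L - \<nabla>\<^sub>L E\<^sub>K\<close>.\<close>

definition curv :: "('a::{t2_space, second_countable_topology}) atlas \<Rightarrow> 'a form \<Rightarrow>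
    ('a \<Rightarrow> 'a cvec) \<Rightarrow> 'a set \<Rightarrow> 'a tmetric \<Rightarrow> idx \<Rightarrow> idx \<Rightarrow> idx \<Rightarrow> idx \<Rightarrow> 'a \<times> real \<Rightarrow> complex" where
  "curv M \<theta> Z U g I J K L x =
     (let \<Gamma> = LC M \<theta> Z U g
      in frame_deriv M \<theta> Z K (\<Gamma> L I J) x - frame_deriv M \<theta> Z L (\<Gamma> K I J) x
         + (\<Sum>N\<in>UNIV. \<Gamma> L I N x * \<Gamma> K N J x - \<Gamma> K I N x * \<Gamma> L N J x)
         - (\<Sum>N\<in>UNIV. (\<Gamma> K L N x - \<Gamma> L K N x) * \<Gamma> N I J x))"

definition curv_low :: "('a::{t2_space, second_countable_topology}) atlas \<Rightarrow> 'a form \<Rightarrow>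
    ('a \<Rightarrow> 'a cvec) \<Rightarrow> 'a set \<Rightarrow> 'a tmetric \<Rightarrow> idx \<Rightarrow> idx \<Rightarrow> idx \<Rightarrow> idx \<Rightarrow> 'a \<times> real \<Rightarrow> complex" where
  "curv_low M \<theta> Z U g I J K L x =
     (\<Sum>N\<in>UNIV. gcomp M \<theta> Z g J N x * curv M \<theta> Z U g I N K L x)"

definition gmat :: "('a::{t2_space, second_countable_topology}) atlas \<Rightarrow> 'a form \<Rightarrow>
    ('a \<Rightarrow> 'a cvec) \<Rightarrow> 'a tmetric \<Rightarrow> 'a \<times> real \<Rightarrow> complex ^ idx ^ idx" where
  "gmat M \<theta> Z g x = (\<chi> I J. gcomp M \<theta> Z g I J x)"

definition ginv :: "('a::{t2_space, second_countable_topology}) atlas \<Rightarrow> 'a form \<Rightarrow>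
    ('a \<Rightarrow> 'a cvec) \<Rightarrow> 'a tmetric \<Rightarrow> idx \<Rightarrow> idx \<Rightarrow> 'a \<times> real \<Rightarrow> complex" where
  "ginv M \<theta> Z g I J x = matrix_inv (gmat M \<theta> Z g x) $ I $ J"

definition ricci :: "('a::{t2_space, second_countable_topology}) atlas \<Rightarrow> 'a form \<Rightarrow>
    ('a \<Rightarrow> 'a cvec) \<Rightarrow> 'a set \<Rightarrow> 'a tmetric \<Rightarrow> idx \<Rightarrow> idx \<Rightarrow> 'a \<times> real \<Rightarrow> complex" where
  "ricci M \<theta> Z U g I J x = (\<Sum>K\<in>UNIV. curv M \<theta> Z U g J K K I x)"

definition scal :: "('a::{t2_space, second_countable_topology}) atlas \<Rightarrow> 'a form \<Rightarrow>
    ('a \<Rightarrow> 'a cvec) \<Rightarrow> 'a set \<Rightarrow> 'a tmetric \<Rightarrow> 'a \<times> real \<Rightarrow> complex" where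
  "scal M \<theta> Z U g x = (\<Sum>I\<in>UNIV. \<Sum>J\<in>UNIV. ginv M \<theta> Z g I J x * ricci M \<theta> Z U g I J x)"

definition schouten :: "('a::{t2_space, second_countable_topology}) atlas \<Rightarrow> 'a form \<Rightarrow>
    ('a \<Rightarrow> 'a cvec) \<Rightarrow> 'a set \<Rightarrow> 'a tmetric \<Rightarrow> idx \<Rightarrow> idx \<Rightarrow> 'a \<times> real \<Rightarrow> complex" where
  "schouten M \<theta> Z U g I J x =
     1/2 * ricci M \<theta> Z U g I J x - 1/12 * scal M \<theta> Z U g x * gcomp M \<theta> Z g I J x"

definition weyl :: "('a::{t2_space, second_countable_topology}) atlas \<Rightarrow> 'a form \<Rightarrow>
    ('a \<Rightarrow> 'a cvec) \<Rightarrow> 'a set \<Rightarrow> 'a tmetric \<Rightarrow> idx \<Rightarrow> idx \<Rightarrow> idx \<Rightarrow> idx \<Rightarrow> 'a \<times> real \<Rightarrow> complex" where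
  "weyl M \<theta> Z U g I J K L x =
     (let G = (\<lambda>I J. gcomp M \<theta> Z g I J x); P = (\<lambda>I J. schouten M \<theta> Z U g I J x)
      in curv_low M \<theta> Z U g I J K L x + G I K * P J L - G J K * P I L + G J L * P I K - G I L * P J K)"

text \<open>The Levi-Civita symbol with value 1 on \<open>(0, 1, 1\<close>-bar\<open>, \<infinity>)\<close>.\<close>

definition alt_symbol :: "idx \<Rightarrow> idx \<Rightarrow> idx \<Rightarrow> idx \<Rightarrow> complex" where
  "alt_symbol I J K L =
     det (\<chi> r s. if (case r of X0 \<Rightarrow> I | X1 \<Rightarrow> J | X1bar \<Rightarrow> K | Xinf \<Rightarrow> L) = s then 1 else 0)"

text \<open>The volume form. Since \<open>d\<theta> = ih \<theta>\<^sup>1 \<and> conj \<theta>\<^sup>1\<close> with \<open>h > 0\<close>, the 4-form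
  \<open>\<theta> \<and> d\<theta> \<and> d\<rho>\<close> is a positive multiple of \<open>i\<close> on \<open>(T, Z\<^sub>1, conj Z\<^sub>1, \<partial>\<^sub>\<rho>)\<close>; equivalently, the real frame
  \<open>(Z\<^sub>0, Z\<^sub>1 + conj Z\<^sub>1, i(Z\<^sub>1 - conj Z\<^sub>1), Z\<^sub>\<infinity>)\<close> is positive. The passage to it has determinant \<open>-2i\<close>.
  The volume form of \<open>g\<close> is the square root of the Gram determinant on it, whence the value
  \<open>i (- det g\<^sub>I\<^sub>J)\<^sup>1\<^sup>/\<^sup>2\<close> on \<open>(Z\<^sub>0, Z\<^sub>1, conj Z\<^sub>1, Z\<^sub>\<infinity>)\<close>; here \<open>det g\<^sub>I\<^sub>J < 0\<close> because the frame is complex.\<close>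

definition vol_form :: "('a::{t2_space, second_countable_topology}) atlas \<Rightarrow> 'a form \<Rightarrow>
    ('a \<Rightarrow> 'a cvec) \<Rightarrow> 'a tmetric \<Rightarrow> idx \<Rightarrow> idx \<Rightarrow> idx \<Rightarrow> idx \<Rightarrow> 'a \<times> real \<Rightarrow> complex" where
  "vol_form M \<theta> Z g I J K L x =
     \<i> * of_real (sqrt (- Re (det (gmat M \<theta> Z g x)))) * alt_symbol I J K L"

definition weyl_minus :: "('a::{t2_space, second_countable_topology}) atlas \<Rightarrow> 'a form \<Rightarrow>
    ('a \<Rightarrow> 'a cvec) \<Rightarrow> 'a set \<Rightarrow> 'a tmetric \<Rightarrow> idx \<Rightarrow> idx \<Rightarrow> idx \<Rightarrow> idx \<Rightarrow> 'a \<times> real \<Rightarrow> complex" where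
  "weyl_minus M \<theta> Z U g I J K L x =
     1/2 * (weyl M \<theta> Z U g I J K L x
        - 1/2 * (\<Sum>A\<in>UNIV. \<Sum>B\<in>UNIV. \<Sum>P\<in>UNIV. \<Sum>Q\<in>UNIV.
            vol_form M \<theta> Z g K L A B x * ginv M \<theta> Z g A P x * ginv M \<theta> Z g B Q x
            * weyl M \<theta> Z U g I J P Q x))"


section \<open>Formal solutions\<close>

text \<open>\<open>formal_solution M H J \<theta> lam g\<close>: the three conditions that determine the normal form metric \<open>g\<close>
  modulo \<open>O(\<rho>\<^sup>\<infinity>)\<close>. All of them are independent of the choice of the frame.\<close>

definition formal_solution :: "('a::{t2_space, second_countable_topology}) atlas \<Rightarrow>
    ('a \<Rightarrow> 'a cvec set) \<Rightarrow> ('a \<Rightarrow> 'a cvec \<Rightarrow> 'a cvec) \<Rightarrow> 'a form \<Rightarrow> real \<Rightarrow> 'a tmetric \<Rightarrow> bool" where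
  "formal_solution M H J \<theta> lam g \<longleftrightarrow>
     theta_metric Smooth M H J \<theta> (UNIV \<times> {0..}) g \<and>
     normal_form_ACH M H J \<theta> (UNIV \<times> {0..}) g \<and>
     (\<forall>U Z. admissible_frame M H J U Z \<longrightarrow>
        (\<forall>I J m. O_rho U m (\<lambda>x. ricci M \<theta> Z U g I J x + 3/2 * gcomp M \<theta> Z g I J x)) \<and>
        (\<forall>I J K L. O_rho U 6 (weyl_minus M \<theta> Z U g I J K L)) \<and>
        (\<forall>p\<in>U. ((\<lambda>\<rho>. weyl_minus M \<theta> Z U g Xinf X0 Xinf X0 (p, \<rho>) / of_real (\<rho> ^ 6))
                   \<longlongrightarrow> of_real lam * obstruction M \<theta> Z U p) (at_right 0)))"

text \<open>Taylor coefficient at the boundary point \<open>0\<close> of \<open>[0,\<infinity>)\<close>, with one-sided derivatives.\<close>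

definition taylor_coeff :: "(real \<Rightarrow> complex) \<Rightarrow> nat \<Rightarrow> complex" where
  "taylor_coeff f n =
     ((\<lambda>h r. vector_derivative h (at r within {0..})) ^^ n) f 0 / fact n"

end

theory Submission
 imports Defs
begin

text \<open>In a chart and a frame of unit Levi form, the Taylor coefficients in the boundary variable of the
metric components form a formal solution with coefficients in functions of three variables. Linearised at
the complex hyperbolic model, the Einstein equations act on the coefficient of order \<open>m\<close> by an indicial
matrix that is invertible except for \<open>m = 4, 6, 8\<close>; there the vanishing order of the anti-self-dual Weyl
tensor, the prescribed \<open>\<eta>\<close> and the component with two indices \<open>\<infinity>\<close> supply the missing equations. As the
obstruction density is real analytic, so are all coefficients, by induction on \<open>m\<close>.

For the convergence, the coefficient of order \<open>m\<close> is measured by its Taylor coefficients \<open>c \<alpha>\<close> at a point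
with the weights \<open>s\<^sup>|\<^sup>\<alpha>\<^sup>| / ((|\<alpha>| + m) choose m)\<close>. These norms are submultiplicative, and a tangential
derivative, which comes with a power of the boundary variable and so raises \<open>m\<close> by one, costs a factor
\<open>(m + 1) / s\<close>. Two such factors are absorbed by the inverse of the indicial matrix, which is \<open>O(m\<^sup>-\<^sup>2)\<close>.
Hence the tail of the series beyond the last resonance satisfies a contraction estimate and converges
jointly in all four variables.\<close>

text \<open>The curvature is linearised only once. A series is recorded by its constant term and by
  the part of its coefficients that is linear in the unknown, as with dual numbers;
  \<open>dual_calc\<close> states the rules of this calculus. One interpretation neglects real
  analytic coefficients, the other neglects what is small in norm, so the same indicial matrix
  serves for regularity and for convergence.

  The obstacle to convergence is that the equations are quasilinear: products must be small although
  the coefficients below the last resonance are not. Smallness comes from a dilation of the boundary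
  variable. In a norm with weights \<open>R ^ n\<close> these finitely many coefficients, and every
  tangential derivative, carry a factor \<open>R\<close>. The tail is then bounded by induction on
  the order of truncation; nothing has to be solved, as its coefficients already exist.

  No patching of local metrics is required. The limit is the sum of the Taylor series of
  \<open>g (p, r) u v\<close> for fixed vectors \<open>u\<close> and \<open>v\<close>, which refers
  neither to a chart nor to a frame; these enter only in the proof that the sum is analytic and
  positive definite.\<close>

type_synonym 'a i2 = "idx => idx => 'a"
type_synonym 'a i3 = "idx => idx => idx => 'a"
type_synonym 'a i4 = "idx => idx => idx => idx => 'a"

type_synonym r3 = "real ^ 3"

abbreviation "anl \<equiv> real_analytic_on"
abbreviation "regS \<equiv> regular_on Smooth"
abbreviation "regA \<equiv> regular_on Analytic"

section \<open>Absolutely convergent power series in several variables\<close>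

definition MI :: "('e::euclidean_space => nat) set" where
 "MI = Basis \<rightarrow>\<^sub>E UNIV"

definition mdeg :: "('e::euclidean_space => nat) => nat" where
 "mdeg al = (SUM b:Basis. al b)"

definition mon :: "'e::euclidean_space => ('e => nat) => real" where
 "mon y al = (\<Prod>b\<in>Basis. (y \<bullet> b) ^ al b)"

text \<open>The operations on multi-indices restrict to \<open>Basis\<close>: members of
  \<open>MI\<close> are extensional, so this keeps \<open>MI\<close> closed and lets equality be
  checked on \<open>Basis\<close> alone.\<close>

definition madd :: "('e::euclidean_space => nat) => ('e => nat) => 'e => nat" where
 "madd al be = (\<lambda>b\<in>Basis. al b + be b)"

definition msub :: "('e::euclidean_space => nat) => ('e => nat) => 'e => nat" where
 "msub al be = (\<lambda>b\<in>Basis. al b - be b)"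

definition mbelow :: "('e::euclidean_space => nat) => ('e => nat) set" where
 "mbelow ga = PiE Basis (%b. {..ga b})"

definition mzero :: "'e::euclidean_space => nat" where
 "mzero = (\<lambda>b\<in>Basis. 0)"

definition munit :: "'e::euclidean_space => 'e => nat" where
 "munit b = (\<lambda>b'\<in>Basis. if b' = b then 1 else 0)"

text \<open>A real polydisc. Cubes fit the weights better than balls: summability of
  \<open>norm (c al) * t ^ mdeg al\<close> is absolute convergence at the corners of this
  cube.\<close>

definition pd :: "'e::euclidean_space => real => 'e set" where
 "pd x t = {y. ALL b:Basis. \<bar>(y - x) \<bullet> b\<bar> < t}"

definition asum :: "(('e::euclidean_space => nat) => complex) => real => bool" where
 "asum c t \<longleftrightarrow> (%al. norm (c al) * t ^ mdeg al) summable_on MI"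

text \<open>A weighted l1 norm, submultiplicative under \<open>conv\<close>. It carries information
  only together with \<open>asum\<close>, because \<open>infsum\<close> of a non-summable family is
  0.\<close>

definition wn :: "(('e::euclidean_space => nat) => complex) => real => real" where
 "wn c t = (infsum (%al. norm (c al) * t ^ mdeg al) MI)"

definition hps :: "('e::euclidean_space => complex) => 'e => (('e => nat) => complex) => real => bool" where
 "hps f x c t \<longleftrightarrow> t > 0 & asum c t \<and>
 (ALL y:pd x t. ((%al. c al * of_real (mon (y - x) al)) has_sum f y) MI)"

definition conv :: "(('e::euclidean_space => nat) => 'c::comm_ring_1) => (('e => nat) => 'c) => ('e => nat) => 'c" where
 "conv c d ga = (SUM al:mbelow ga. c al * d (msub ga al))"

lemma madd_in [simp]: "madd al be : MI" and msub_in [simp]: "msub al be : MI"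
 and mzero_in [simp]: "mzero : MI" and munit_in [simp]: "munit b : MI" by (auto simp: MI_def madd_def msub_def mzero_def munit_def)

lemma madd_apply [simp]: "b : Basis ==> madd al be b = al b + be b"
 and msub_apply [simp]: "b : Basis ==> msub al be b = al b - be b"
 and mzero_apply [simp]: "b : Basis ==> mzero b = 0"
 and munit_apply [simp]: "b : Basis ==> munit b' b = (if b = b' then 1 else 0)" by (simp_all add: madd_def msub_def mzero_def munit_def)

lemma mbelow_finite [simp]: "finite (mbelow ga)" by (auto simp: mbelow_def intro: finite_PiE)

lemma mbelow_MI: "al : mbelow ga ==> al : MI" by (auto simp: mbelow_def MI_def)

lemma MI_eqI: "al : MI ==> be : MI ==> (!!b. b : Basis ==> al b = be b) ==> al = be" unfolding MI_def by (rule PiE_ext) auto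

lemma mon_madd: "mon y (madd al be) = mon y al * mon y be" by (simp add: mon_def power_add prod.distrib)

lemma mdeg_madd [simp]: "mdeg (madd al be) = mdeg al + mdeg be" by (simp add: mdeg_def sum.distrib)

lemma mdeg_mzero [simp]: "mdeg mzero = 0" and mon_mzero [simp]: "mon y mzero = 1" by (simp_all add: mdeg_def mon_def)

lemma madd_msub: "al : mbelow ga ==> ga : MI ==> madd al (msub ga al) = ga" by (rule MI_eqI) (auto simp: mbelow_def PiE_iff)

lemma msub_madd: "be : MI ==> msub (madd al be) al = be" by (rule MI_eqI) auto

lemma in_mbelow_madd: "al : MI ==> al : mbelow (madd al be)" by (auto simp: MI_def mbelow_def)

lemma madd_comm: "madd al be = madd be al" by (auto simp: madd_def)

lemma madd_mzero [simp]: "al : MI ==> madd mzero al = al" "al : MI ==> madd al mzero = al" by (rule MI_eqI; simp)+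

lemma mdeg_munit [simp]: "b : Basis ==> mdeg (munit b) = 1" by (simp add: mdeg_def)

lemma mon_munit [simp]: "b : Basis ==> mon y (munit b) = y \<bullet> b"
proof -
 assume b: "b : Basis"
 have "mon y (munit b) = (\<Prod>b'\<in>Basis. if b' = b then y \<bullet> b else 1)" unfolding mon_def by (rule prod.cong) auto
 thus ?thesis using b by simp
qed

lemma mon_abs_le:
 assumes "!!b. b : Basis ==> \<bar>y \<bullet> b\<bar> <= t"
 shows "\<bar>mon y al\<bar> <= t ^ mdeg al"
proof -
 have "\<bar>mon y al\<bar> = (\<Prod>b\<in>Basis. \<bar>y \<bullet> b\<bar> ^ al b)" by (simp add: mon_def abs_prod power_abs)
 also have "... <= (\<Prod>b\<in>Basis. t ^ al b)" using assms by (intro prod_mono) (auto intro: power_mono)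
 finally show ?thesis by (simp add: mdeg_def power_sum)
qed

lemma mdeg_0_iff: "al : MI ==> mdeg al = 0 \<longleftrightarrow> al = mzero" by (auto simp: mdeg_def intro: MI_eqI)

lemma mdeg_Suc_decomp:
 assumes "al : MI" "mdeg al = Suc n"
 obtains b al' where "b : Basis" "al' : MI" "al = madd al' (munit b)" "mdeg al' = n"
proof -
 obtain b where b: "b : Basis" "al b ~= 0" using assms(2) unfolding mdeg_def by (metis Suc_neq_Zero sum.neutral)
 have "al = madd (msub al (munit b)) (munit b)" by (rule MI_eqI[OF assms(1)]) (use b in auto)
 moreover from this have "mdeg al = mdeg (msub al (munit b)) + 1" using b(1) by (metis mdeg_madd mdeg_munit)
 ultimately show ?thesis using that[of b "msub al (munit b)"] b(1) assms(2) by simp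
qed

lemma asumD: "asum c t ==> (%al. norm (c al) * t ^ mdeg al) summable_on MI" by (simp add: asum_def)

lemma asum_mono:
 assumes "asum c t" "0 <= s" "s <= t" shows "asum c s" unfolding asum_def by (rule summable_on_comparison_test[OF asumD[OF assms(1)]])
 (use assms in "auto intro!: mult_left_mono power_mono")

lemma asum_at:
 assumes "asum c t" "!!b. b : Basis ==> \<bar>y \<bullet> b\<bar> <= t"
 shows "(%al. norm (c al * of_real (mon y al))) summable_on MI" by (rule summable_on_comparison_test[OF asumD[OF assms(1)]])
 (auto simp: norm_mult intro!: mult_left_mono mon_abs_le assms(2))

lemma norm_summable: "(%x. norm (f x :: 'b::banach)) summable_on A ==> f summable_on A" by (rule abs_summable_summable)

lemma norm_summable_has_sum: "(%x. norm (f x :: 'b::banach)) summable_on A ==> (f has_sum infsum f A) A"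
 by (rule has_sum_infsum[OF abs_summable_summable])

lemma hps_pos: "hps f x c t ==> t > 0"
 and hps_asum: "hps f x c t ==> asum c t"
 and hps_sum: "hps f x c t ==> y : pd x t ==>
 ((%al. c al * of_real (mon (y - x) al)) has_sum f y) MI" by (auto simp: hps_def)

lemma pd_mono: "s <= t ==> pd x s <= pd x t" by (force simp: pd_def)

lemma hps_shrink: "hps f x c t ==> 0 < s ==> s <= t ==> hps f x c s" using pd_mono[of s t x] by (auto simp: hps_def intro: asum_mono)

lemma pd_centre [simp]: "t > 0 ==> x : pd x t" by (simp add: pd_def)

lemma ball_subset_pd: "ball x t <= pd x t"
proof
 fix y assume "y : ball x t"
 hence "norm (y - x) < t" by (simp add: dist_norm norm_minus_commute)
 thus "y : pd x t" unfolding pd_def using Basis_le_norm[of _ "y - x"] by (auto intro: le_less_trans)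
qed

lemma open_pd [simp]: "open (pd x t)"
proof -
 have "pd x t = (\<Inter>b\<in>Basis. {y. \<bar>(y - x) \<bullet> b\<bar> < t})" by (auto simp: pd_def)
 thus ?thesis by (auto intro!: open_Collect_less continuous_intros)
qed

lemma convex_pd: "convex (pd x t)"
proof -
 have eq: "pd x t = (\<Inter>b\<in>Basis. {y. b \<bullet> y < t + b \<bullet> x} Int {y. b \<bullet> y > b \<bullet> x - t})"
 by (auto simp: pd_def inner_commute abs_less_iff algebra_simps)
 show ?thesis unfolding eq by (intro convex_INT convex_Int convex_halfspace_lt convex_halfspace_gt)
qed

lemma hps_cong:
 assumes "hps f x c t" "!!y. y : pd x t ==> f y = g y" shows "hps g x c t" using assms by (auto simp: hps_def)

lemma hps_in_open:
 assumes "hps f x c t" "open S" "x : S"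
 obtains s where "hps f x c s" "pd x s <= S" "s <= t"
proof -
 obtain e where e: "e > 0" "ball x e <= S" using assms by (meson open_contains_ball)
 define s where "s = min t (e / (2 * DIM('a)))"
 have s: "s > 0" using e hps_pos[OF assms(1)] by (simp add: s_def)
 have "pd x s <= ball x e"
 proof
 fix y assume y: "y : pd x s"
 have "norm (y - x) <= (SUM b:Basis. \<bar>(y - x) \<bullet> b\<bar>)" by (rule norm_le_l1)
 also have "... <= (SUM b:(Basis::'a set). s)" using y by (intro sum_mono) (auto simp: pd_def)
 also have "... = DIM('a) * s" by simp
 also have "... <= DIM('a) * (e / (2 * DIM('a)))" unfolding s_def by (intro mult_left_mono) auto
 also have "... < e" using e by simp
 finally show "y : ball x e" by (simp add: dist_norm norm_minus_commute)
 qed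
 thus ?thesis using that[of s] hps_shrink[OF assms(1) s] e by (auto simp: s_def)
qed

text \<open>A complex \<open>has_sum\<close> is automatically absolute. At the corner of a cube
  inside the ball every monomial equals \<open>t ^ mdeg al\<close>, so convergence at this single
  point is already \<open>asum c t\<close>.\<close>

lemma anl_iff_hps:
 "anl f S \<longleftrightarrow> (ALL x:S. EX c t. hps f x c t)"
proof
 assume L: "anl f S"
 show "ALL x:S. EX c t. hps f x c t"
 proof
 fix x assume "x : S"
 then obtain r c where r: "r > 0" and c: "!!y. y : ball x r ==>
 ((%al. c al * of_real (mon (y - x) al)) has_sum f y) MI" using L unfolding real_analytic_on_def mon_def MI_def by blast
 define t where "t = r / (2 * DIM('a))"
 have t: "t > 0" "DIM('a) * t < r" using r by (auto simp: t_def)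
 define y where "y = x + t *\<^sub>R (SUM b:Basis. b)"
 have yb: "(y - x) \<bullet> b = t" if "b : Basis" for b using that by (simp add: y_def if_distrib cong: if_cong)
 have small: "z : ball x r" if "!!b. b : Basis ==> \<bar>(z - x) \<bullet> b\<bar> <= t" for z
 proof -
 have "norm (z - x) <= (SUM b:Basis. \<bar>(z - x) \<bullet> b\<bar>)" by (rule norm_le_l1)
 also have "... <= (SUM b:(Basis::'a set). t)" using that by (intro sum_mono)
 finally show ?thesis using t by (simp add: dist_norm norm_minus_commute)
 qed
 have "(%al. c al * of_real (mon (y - x) al)) summable_on MI" using c[OF small, of y] yb t by (auto simp: summable_on_def)
 hence "(%al. norm (c al * of_real (mon (y - x) al))) summable_on MI" by (simp add: summable_on_iff_abs_summable_on_complex)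
 moreover have "mon (y - x) al = t ^ mdeg al" for al using yb by (simp add: mon_def mdeg_def power_sum)
 ultimately have "asum c t" using t by (simp add: asum_def norm_mult norm_power)
 hence "hps f x c t" using t c small by (auto simp: hps_def pd_def less_imp_le)
 thus "EX c t. hps f x c t" by blast
 qed
next
 assume R: "ALL x:S. EX c t. hps f x c t"
 show "anl f S" unfolding real_analytic_on_def
 proof
 fix x assume "x : S"
 then obtain c t where h: "hps f x c t" using R by blast
 show "EX r>0. EX c. ALL y:ball x r. ((%al. c al * of_real (\<Prod>b\<in>Basis. ((y - x) \<bullet> b) ^ al b)) has_sum f y)
 (Basis \<rightarrow>\<^sub>E UNIV)" using hps_sum[OF h] hps_pos[OF h] ball_subset_pd[of x t]
 unfolding mon_def MI_def by (intro exI[of _ t] conjI exI[of _ c] ballI) auto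
 qed
qed

lemma hps_const: "t > 0 ==> hps (%y. k) x (%al. if al = mzero then k else 0) t"
proof -
 assume t: "t > 0"
 have *: "((%al. if al = mzero then K else 0) has_sum K) (MI :: ('a => nat) set)"
 for K :: "'b::{comm_monoid_add,topological_space}" by (rule has_sum_finite_neutralI[of "{mzero}"]) auto
 have "asum (%al::'a=>nat. if al = mzero then k else 0) t"
 proof -
 have "(%al::'a=>nat. norm (if al = mzero then k else 0) * t ^ mdeg al) = (%al. if al = mzero then norm k else 0)" by auto
 thus ?thesis using has_sum_imp_summable[OF *[of "norm k"]] by (simp only: asum_def)
 qed
 moreover have "(%al. (if al = mzero then k else 0) * complex_of_real (mon (y - x) al)) =
 (%al. if al = mzero then k else 0)" for y :: 'a by auto
 ultimately show ?thesis using t *[of k] by (simp add: hps_def)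
qed

lemma hps_add:
 assumes "hps f x c t" "hps g x d t"
 shows "hps (%y. f y + g y) x (%al. c al + d al) t"
proof -
 have "asum (%al. c al + d al) t" unfolding asum_def
 proof (rule summable_on_comparison_test)
 show "(%al. norm (c al) * t ^ mdeg al + norm (d al) * t ^ mdeg al) summable_on MI"
 using assms by (intro summable_on_add) (auto simp: hps_def asum_def)
 show "norm (c al + d al) * t ^ mdeg al <= norm (c al) * t ^ mdeg al + norm (d al) * t ^ mdeg al" for al
 using hps_pos[OF assms(1)] norm_triangle_ineq[of "c al" "d al"] by (metis distrib_right mult_right_mono less_imp_le zero_le_power)
 qed (use hps_pos[OF assms(1)] in auto)
 thus ?thesis using assms by (auto simp: hps_def distrib_right intro!: has_sum_add)
qed

lemma hps_cmult:
 assumes "hps f x c t"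
 shows "hps (%y. k * f y) x (%al. k * c al) t" using assms
 by (auto simp: hps_def asum_def norm_mult mult.assoc intro!: summable_on_cmult_right has_sum_cmult_right)

lemma hps_cnj:
 assumes "hps f x c t"
 shows "hps (%y. cnj (f y)) x (%al. cnj (c al)) t"
proof -
 have "((%al. cnj (c al * of_real (mon (y - x) al))) has_sum cnj (f y)) MI" if "y : pd x t" for y
 using has_sum_bounded_linear[OF bounded_linear_cnj hps_sum[OF assms that]] .
 thus ?thesis using assms by (auto simp: hps_def asum_def)
qed

text \<open>Regroups the pairs \<open>(al, be)\<close> by their sum, which turns a product of two
  series into the series of the convolution.\<close>

lemma bij_conv: "bij_betw (%(ga, al). (al, msub ga al)) (Sigma MI mbelow) (MI \<times> MI)"
 by (rule bij_betw_byWitness[where f' = "%(al, be). (madd al be, al)"])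
 (auto simp: madd_msub msub_madd in_mbelow_madd mbelow_MI)

lemma conv_has_sum:
 fixes a b :: "('e::euclidean_space => nat) => 'c::{real_normed_field,banach}"
 assumes a: "(%al. norm (a al)) summable_on MI" and b: "(%al. norm (b al)) summable_on MI"
 and A: "(a has_sum A) MI" and B: "(b has_sum B) MI"
 shows "(conv a b has_sum (A * B)) MI"
proof -
 obtain NB where NB: "((%al. norm (b al)) has_sum NB) MI" using b by (auto simp: summable_on_def)
 have "(%p. norm (a (fst p)) * norm (b (snd p))) summable_on MI \<times> MI" by (rule summable_on_SigmaI[where g = "%al. norm (a al) * NB"])
 (use NB a in "auto intro!: has_sum_cmult_right summable_on_cmult_left")
 hence "(%p. a (fst p) * b (snd p)) summable_on MI \<times> MI"
 using norm_summable[of "%p. a (fst p) * b (snd p)" "MI \<times> MI"] by (simp add: norm_mult)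
 hence "((%p. a (fst p) * b (snd p)) has_sum (A * B)) (MI \<times> MI)" by (intro has_sum_SigmaI[where g = "%al. a al * B"])
 (auto intro!: has_sum_cmult_right has_sum_cmult_left A B)
 hence "((%p. a (snd p) * b (msub (fst p) (snd p))) has_sum (A * B)) (Sigma MI mbelow)"
 using has_sum_reindex_bij_betw[OF bij_conv, of "%p. a (fst p) * b (snd p)" "A * B"] by (simp add: case_prod_unfold)
 thus ?thesis by (rule has_sum_SigmaD) (auto simp: conv_def)
qed

lemma conv_norm:
 assumes "asum c t" "asum d t" "t >= 0"
 shows "asum (conv c d) t" "wn (conv c d) t <= wn c t * wn d t"
proof -
 let ?a = "%al. norm (c al) * t ^ mdeg al" and ?b = "%al. norm (d al) * t ^ mdeg al"
 have hs: "(conv ?a ?b has_sum (wn c t * wn d t)) MI" by (rule conv_has_sum) (use assms in "auto simp: asum_def wn_def")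
 have le: "norm (conv c d ga) * t ^ mdeg ga <= conv ?a ?b ga" if ga: "ga : MI" for ga
 proof -
 have "norm (conv c d ga) * t ^ mdeg ga <= (SUM al:mbelow ga. norm (c al * d (msub ga al))) * t ^ mdeg ga"
 unfolding conv_def using assms by (intro mult_right_mono norm_sum) auto
 also have "... = (SUM al:mbelow ga. norm (c al) * norm (d (msub ga al)) * t ^ mdeg (madd al (msub ga al)))"
 unfolding sum_distrib_right by (auto simp: norm_mult madd_msub ga)
 also have "... = conv ?a ?b ga" unfolding conv_def by (rule sum.cong) (auto simp: power_add)
 finally show ?thesis .
 qed
 show s: "asum (conv c d) t" unfolding asum_def
 by (rule summable_on_comparison_test[of "conv ?a ?b"]) (use hs le assms in "auto simp: summable_on_def")
 show "wn (conv c d) t <= wn c t * wn d t" unfolding wn_def[of "conv c d"] by (rule has_sum_mono[OF has_sum_infsum[OF asumD[OF s]] hs le])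
qed

lemma conv_mon:
 assumes "ga : MI"
 shows "conv (%al. c al * of_real (mon y al)) (%al. d al * of_real (mon y al)) ga =
 conv c d ga * (of_real (mon y ga) :: complex)" unfolding conv_def sum_distrib_right
by (smt (verit) assms madd_msub mon_madd mult_commute_abs of_real_mult sum.cong vector_space_over_itself.scale_scale)

lemma pd_le: "y : pd x t ==> b : Basis ==> \<bar>(y - x) \<bullet> b\<bar> <= t" by (auto simp: pd_def)

lemma hps_mult:
 assumes f: "hps f x c t" and g: "hps g x d t"
 shows "hps (%y. f y * g y) x (conv c d) t" unfolding hps_def
proof (intro conjI ballI)
 show "t > 0" by (rule hps_pos[OF f])
 thus "asum (conv c d) t" using f g by (auto simp: hps_def intro: conv_norm)
 fix y assume y: "y : pd x t"
 have "(conv (%al. c al * of_real (mon (y - x) al)) (%al. d al * of_real (mon (y - x) al)) has_sum f y * g y) MI"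
 using hps_sum[OF f y] hps_sum[OF g y] pd_le[OF y] hps_asum[OF f] hps_asum[OF g] by (intro conv_has_sum asum_at) auto
 thus "((%al. conv c d al * of_real (mon (y - x) al)) has_sum f y * g y) MI" by (rule has_sum_cong[THEN iffD1, rotated]) (rule conv_mon)
qed

fun pw :: "(('e::euclidean_space => nat) => complex) => nat => ('e => nat) => complex" where
 "pw c 0 = (%al. if al = mzero then 1 else 0)"
| "pw c (Suc n) = conv c (pw c n)"

lemma hps_pw:
 assumes "hps u x c t"
 shows "hps (%y. u y ^ n) x (pw c n) t" by (induction n) (use assms hps_pos[OF assms] in "auto intro: hps_const hps_mult")

lemma wn_nonneg: "t > 0 ==> wn c t >= 0" unfolding wn_def by (rule infsum_nonneg) auto

lemma wn_pw:
 assumes "hps u x c t"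
 shows "wn (pw c n) t <= wn c t ^ n"
proof (induction n)
 case 0
 have "(%al::'a=>nat. norm (pw c 0 al) * t ^ mdeg al) = (%al. if al = mzero then 1 else 0)" by auto
 moreover have "((%al::'a=>nat. if al = mzero then 1 else 0::real) has_sum 1) MI" by (rule has_sum_finite_neutralI[of "{mzero}"]) auto
 ultimately have "wn (pw c 0) t = 1" unfolding wn_def by (simp add: infsumI)
 thus ?case by simp
next
 case (Suc n)
 have "wn (pw c (Suc n)) t <= wn c t * wn (pw c n) t"
 using conv_norm(2)[OF hps_asum[OF assms] hps_asum[OF hps_pw[OF assms]]] hps_pos[OF assms] by simp
 also have "... <= wn c t * wn c t ^ n" using Suc wn_nonneg[OF hps_pos[OF assms]] by (intro mult_left_mono)
 finally show ?case by simp
qed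

text \<open>Fubini for a family of power series: if the double series converges absolutely at radius
  \<open>s\<close>, the coefficients may be summed first. Composition uses it with the powers of the
  inner function, recentring with the orders of the shift.\<close>

lemma hps_double:
 fixes D :: "'i => ('e::euclidean_space => nat) => complex"
 assumes s: "s > 0" and sm: "(%(i, be). norm (D i be) * s ^ mdeg be) summable_on I \<times> MI"
 and F: "!!y. y : pd x s ==> ((%(i, be). D i be * of_real (mon (y - x) be)) has_sum F y) (I \<times> MI)"
 shows "hps F x (%be. \<Sum>\<^sub>\<infinity>i\<in>I. D i be) s"
proof -
 have sm': "(%(be, i). norm (D i be) * s ^ mdeg be) summable_on MI \<times> I" using sm by (subst (asm) summable_on_swap) simp
 have row: "(%i. norm (D i be)) summable_on I" if "be : MI" for be using summable_on_SigmaD1[OF sm' that] s by (simp add: summable_on_cmult_left')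
 have "asum (%be. \<Sum>\<^sub>\<infinity>i\<in>I. D i be) s" unfolding asum_def
 proof (rule summable_on_comparison_test[OF summable_on_Sigma_banach[OF sm']])
 fix be :: "'e => nat" assume "be : MI"
 from norm_infsum_bound[OF row[OF this]]
 show "norm (infsum (%i. D i be) I) * s ^ mdeg be <= (infsum (%i. norm (D i be) * s ^ mdeg be) I)"
 unfolding infsum_cmult_left' using s by auto
 qed (use s in auto)
 moreover have "((%be. (infsum (%i. D i be) I) * of_real (mon (y - x) be)) has_sum F y) MI" if "y : pd x s" for y
 by (rule has_sum_SigmaD[OF F[OF that, THEN has_sum_swap[THEN iffD1]]])
 (auto intro!: has_sum_cmult_left norm_summable_has_sum row)
 ultimately show ?thesis using s by (simp add: hps_def)
qed

text \<open>The powers of \<open>u\<close> have norms at most \<open>wn c t ^ n\<close>, so the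
  outer series converges in the algebra of power series as soon as \<open>wn c t\<close> stays
  within its radius.\<close>

lemma hps_compose:
 fixes F :: "complex => complex"
 assumes u: "hps u x c t" and a: "(%n. norm (a n) * rho ^ n) summable_on UNIV" and w: "wn c t <= rho"
 and F: "!!z. norm z <= rho ==> ((%n. a n * z ^ n) has_sum F z) UNIV"
 shows "hps (%y. F (u y)) x (%ga. \<Sum>\<^sub>\<infinity>n. a n * pw c n ga) t"
proof -
 have t: "t > 0" by (rule hps_pos[OF u])
 have hp: "hps (%y. u y ^ n) x (pw c n) t" for n by (rule hps_pw[OF u])
 have hsn: "((%ga. norm (pw c n ga) * t ^ mdeg ga) has_sum wn (pw c n) t) MI" for n using hps_asum[OF hp[of n]] by (simp add: asum_def wn_def)
 have wle: "norm (a n) * wn (pw c n) t <= norm (a n) * rho ^ n" for n using wn_pw[OF u, of n] power_mono[OF w, of n] wn_nonneg[OF t, of c]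
 by (intro mult_left_mono) auto
 have s2: "(%n. norm (a n) * wn (pw c n) t) summable_on UNIV"
 by (rule summable_on_comparison_test[OF a]) (use wle in "auto intro!: mult_nonneg_nonneg wn_nonneg t")
 have big: "(%(n, ga). norm (a n * pw c n ga) * t ^ mdeg ga) summable_on UNIV \<times> MI"
 by (rule summable_on_SigmaI[where g = "%n. norm (a n) * wn (pw c n) t"])
 (use s2 hsn t in "auto simp: norm_mult mult.assoc intro!: has_sum_cmult_right")
 show ?thesis
 proof (rule hps_double[OF t big])
 fix y assume y: "y : pd x t"
 have le: "\<bar>mon (y - x) ga\<bar> <= t ^ mdeg ga" for ga using pd_le[OF y] by (rule mon_abs_le)
 have s: "(%(n, ga). a n * pw c n ga * of_real (mon (y - x) ga)) summable_on UNIV \<times> MI"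
 by (rule norm_summable[OF summable_on_comparison_test[OF big]])
 (use le in "auto simp: norm_mult intro!: mult_left_mono")
 have "norm (u y) <= wn c t"
 proof -
 note s1 = asum_at[OF hps_asum[OF u] pd_le[OF y]]
 have "norm (c al * of_real (mon (y - x) al)) <= norm (c al) * t ^ mdeg al" for al using le by (simp add: norm_mult mult_left_mono)
 thus ?thesis unfolding wn_def by (intro order_trans[OF norm_has_sum_bound[OF has_sum_infsum[OF s1] hps_sum[OF u y]]]
 infsum_mono s1 asumD[OF hps_asum[OF u]])
 qed
 hence "((%n. a n * u y ^ n) has_sum F (u y)) UNIV" using w by (intro F) auto
 thus "((%(n, ga). a n * pw c n ga * of_real (mon (y - x) ga)) has_sum F (u y)) (UNIV \<times> MI)"
 by (intro has_sum_SigmaI[OF _ _ s]) (use has_sum_cmult_right[OF hps_sum[OF hp y]] in "auto simp: mult.assoc")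
 qed
qed

text \<open>Without constant term every monomial has degree at least one, so shrinking the radius
  gains the factor \<open>s / t\<close>. This brings the inner function of a composition into the
  disc of convergence.\<close>

lemma wn_small:
 assumes "asum c t" "c mzero = 0" "0 < s" "s <= t"
 shows "wn c s <= s / t * wn c t"
proof -
 have t: "t > 0" using assms by linarith
 have "norm (c al) * s ^ mdeg al <= s / t * (norm (c al) * t ^ mdeg al)" if "al : MI" for al
 proof (cases "mdeg al")
 case 0
 hence "c al = 0" using assms mdeg_0_iff that by metis
 thus ?thesis by simp
 next
 case (Suc n)
 have "s ^ mdeg al = s * s ^ n" using Suc by simp
 also have "... <= s * t ^ n" using assms by (intro mult_left_mono power_mono) auto
 also have "... = s / t * t ^ mdeg al" using Suc t by simp
 finally have "norm (c al) * s ^ mdeg al <= norm (c al) * (s / t * t ^ mdeg al)" by (intro mult_left_mono) auto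
 thus ?thesis by (simp add: mult_ac)
 qed
 hence "wn c s <= (infsum (%al. s / t * (norm (c al) * t ^ mdeg al)) MI)" unfolding wn_def
 using assms asum_mono[OF assms(1)] by (intro infsum_mono summable_on_cmult_right) (auto simp: asum_def)
 thus ?thesis unfolding wn_def by (simp only: infsum_cmult_right')
qed

lemma hps_centre:
 assumes "hps f x c t" shows "c mzero = f x"
proof -
 have "mon 0 al = (if al = mzero then 1 else 0)" if aMI: "al : MI" for al :: "'a => nat"
 proof (cases "al = mzero")
 case False
 then obtain b where "b : Basis" "al b ~= 0" using MI_eqI[OF aMI mzero_in] by fastforce
 hence "mon 0 al = 0" unfolding mon_def by auto
 thus ?thesis using False by simp
 qed auto
 hence "((%al. c al * of_real (mon (x - x) al)) has_sum c mzero) MI" by (intro has_sum_finite_neutralI[of "{mzero}"]) auto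
 thus ?thesis using hps_sum[OF assms pd_centre] hps_pos[OF assms] has_sum_unique by blast
qed

lemma hps_compose_small:
 fixes F :: "complex => complex"
 assumes u: "hps u x c t" and u0: "u x = 0" and rho: "rho > 0"
 and a: "(%n. norm (a n) * rho ^ n) summable_on UNIV"
 and F: "!!z. norm z <= rho ==> ((%n. a n * z ^ n) has_sum F z) UNIV"
 shows "EX d s. hps (%y. F (u y)) x d s"
proof -
 have t: "t > 0" by (rule hps_pos[OF u])
 \<comment> \<open>\<open>wn_small\<close> bounds the norm at radius \<open>s\<close> by
   \<open>s / t * wn c t\<close>, which this choice makes at most \<open>rho\<close>; the
   \<open>+ 1\<close> keeps the denominator positive.\<close>
 define s where "s = min t (rho * t / (wn c t + 1))"
 have w: "wn c t >= 0" by (rule wn_nonneg[OF t])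
 have s: "0 < s" "s <= t" using t rho w by (auto simp: s_def)
 have "wn c s <= s / t * wn c t" using wn_small[OF hps_asum[OF u] _ s] hps_centre[OF u] u0 by simp
 also have "... <= (rho / (wn c t + 1)) * wn c t" using w s by (intro mult_right_mono) (auto simp: s_def divide_simps min_def)
 also have "... <= rho" using w rho by (simp add: divide_simps)
 finally show ?thesis using hps_compose[OF hps_shrink[OF u s] a _ F] by blast
qed

section \<open>Recentring, differentiation and uniqueness\<close>

definition mbin :: "('e::euclidean_space => nat) => ('e => nat) => real" where
 "mbin be ep = (\<Prod>b\<in>Basis. real ((be b + ep b) choose be b))"

lemma mbin_nonneg: "mbin be ep >= 0" unfolding mbin_def by (rule prod_nonneg) simp

lemma mon_binomial:
 assumes "al : MI"
 shows "(\<Prod>b\<in>Basis. (p b + q b) ^ al b) =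
 (SUM be:mbelow al. mbin be (msub al be) * (\<Prod>b\<in>Basis. q b ^ (msub al be b)) * (\<Prod>b\<in>Basis. (p b::real) ^ be b))"
proof -
 have "(\<Prod>b\<in>Basis. (p b + q b) ^ al b) =
 (\<Prod>b\<in>Basis. SUM k<=al b. real (al b choose k) * p b ^ k * q b ^ (al b - k))" by (simp add: binomial_ring)
 also have "... = (SUM be:mbelow al. \<Prod>b\<in>Basis. real (al b choose be b) * p b ^ be b * q b ^ (al b - be b))"
 unfolding mbelow_def by (rule prod_sum_PiE) auto
 also have "... = (SUM be:mbelow al. mbin be (msub al be) * (\<Prod>b\<in>Basis. q b ^ (msub al be b)) * (\<Prod>b\<in>Basis. p b ^ be b))"
 proof (rule sum.cong)
 fix be assume "be : mbelow al"
 hence le: "be b <= al b" if "b : Basis" for b using that by (auto simp: mbelow_def)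
 show "(\<Prod>b\<in>Basis. real (al b choose be b) * p b ^ be b * q b ^ (al b - be b)) =
 mbin be (msub al be) * (\<Prod>b\<in>Basis. q b ^ (msub al be b)) * (\<Prod>b\<in>Basis. p b ^ be b)" unfolding mbin_def prod.distrib[symmetric]
 by (rule prod.cong) (use le in auto)
 qed auto
 finally show ?thesis .
qed

text \<open>The Taylor coefficients about a point shifted by \<open>de\<close>: the binomial
  expansion of the monomials in \<open>de + z\<close>, collected by powers of
  \<open>z\<close>.\<close>

definition recoef :: "(('e::euclidean_space => nat) => complex) => 'e => ('e => nat) => complex" where
 "recoef c de be = (infsum (%ep. c (madd be ep) * of_real (mbin be ep * mon de ep)) MI)"

text \<open>Expanding a monomial in \<open>z + de\<close> with absolute values gives at most
  \<open>(s + D) ^ mdeg al\<close>, hence at most \<open>t ^ mdeg al\<close>. The expanded double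
  series therefore converges absolutely and may be rearranged.\<close>

lemma hps_recentre:
 assumes f: "hps f x c t" and D: "!!b. b : Basis ==> \<bar>(x' - x) \<bullet> b\<bar> <= D" and s: "s > 0" "D + s <= t"
 shows "hps f x' (recoef c (x' - x)) s"
proof -
 define de where "de = x' - x"
 define G where "G z be ep = c (madd be ep) * of_real (mbin be ep * mon de ep) * complex_of_real (mon z be)" for z be ep
 have A: "(%(be, ep). norm (G z be ep)) summable_on MI \<times> MI"
 and V: "((%al. c al * of_real (mon (de + z) al)) has_sum S) MI ==> ((%(be, ep). G z be ep) has_sum S) (MI \<times> MI)"
 if z: "ALL b:Basis. \<bar>z \<bullet> b\<bar> <= s" for z S
 proof -
 have inner: "(SUM be:mbelow al. norm (G z be (msub al be))) <= norm (c al) * t ^ mdeg al" if al: "al : MI" for al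
 proof -
 have "(SUM be:mbelow al. norm (G z be (msub al be))) = (SUM be:mbelow al. norm (c al) *
 (mbin be (msub al be) * (\<Prod>b\<in>Basis. \<bar>de \<bullet> b\<bar> ^ (msub al be b)) * (\<Prod>b\<in>Basis. \<bar>z \<bullet> b\<bar> ^ be b)))"
 by (rule sum.cong)
 (auto simp: G_def norm_mult madd_msub al mon_def abs_prod power_abs mbin_nonneg prod_norm[symmetric] norm_power)
 also have "... = norm (c al) * (\<Prod>b\<in>Basis. (\<bar>z \<bullet> b\<bar> + \<bar>de \<bullet> b\<bar>) ^ al b)"
 by (simp add: mon_binomial[OF al] sum_distrib_left)
 also have "... <= norm (c al) * (\<Prod>b\<in>Basis. t ^ al b)"
 proof (intro mult_left_mono prod_mono conjI power_mono)
 fix b :: 'a assume b: "b : Basis"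
 show "\<bar>z \<bullet> b\<bar> + \<bar>de \<bullet> b\<bar> <= t" using bspec[OF z b] D[OF b] s by (simp add: de_def)
 qed auto
 finally show ?thesis by (simp add: mdeg_def power_sum)
 qed
 have "(%p. norm (G z (snd p) (msub (fst p) (snd p)))) summable_on (Sigma MI mbelow)"
 proof (rule summable_on_SigmaI[where g = "%al. SUM be:mbelow al. norm (G z be (msub al be))"])
 show "(%al. SUM be:mbelow al. norm (G z be (msub al be))) summable_on MI" by (rule summable_on_comparison_test[OF asumD[OF hps_asum[OF f]]])
 (use inner in "auto intro: sum_nonneg")
 qed (auto intro: has_sum_finite)
 note sm = this norm_summable[OF this]
 thus "(%(be, ep). norm (G z be ep)) summable_on (MI \<times> MI)"
 using summable_on_reindex_bij_betw[OF bij_conv, of "%p. norm (G z (fst p) (snd p))"] by (simp add: case_prod_unfold)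
 assume S: "((%al. c al * of_real (mon (de + z) al)) has_sum S) MI"
 have "(SUM be:mbelow al. G z be (msub al be)) = c al * of_real (mon (de + z) al)" if al: "al : MI" for al
 proof -
 have "mon (de + z) al = (\<Prod>b\<in>Basis. (z \<bullet> b + de \<bullet> b) ^ al b)" by (simp add: mon_def inner_add_left add.commute)
 also have "... = (SUM be:mbelow al. mbin be (msub al be) * mon de (msub al be) * mon z be)"
 unfolding mon_def by (rule mon_binomial[OF al])
 finally show ?thesis by (simp add: sum_distrib_left G_def madd_msub al mult.assoc)
 qed
 hence "((%p. G z (snd p) (msub (fst p) (snd p))) has_sum S) (Sigma MI mbelow)" by (intro has_sum_SigmaI[OF _ S sm(2)]) (auto intro: has_sum_finiteI)
 thus "((%(be, ep). G z be ep) has_sum S) (MI \<times> MI)" using has_sum_reindex_bij_betw[OF bij_conv, of "%p. G z (fst p) (snd p)" S]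
 by (simp add: case_prod_unfold)
 qed
 \<comment> \<open>The corner of the small cube, where monomials equal \<open>s ^ mdeg be\<close>;
   there the bound \<open>A\<close> is the summability that \<open>hps_double\<close> asks
   for.\<close>
 define o' where "o' = s *\<^sub>R (SUM b:(Basis::'a set). b)"
 have ob: "o' \<bullet> b = s" if "b : Basis" for b using that by (simp add: o'_def inner_sum_left inner_Basis sum.delta cong: if_cong)
 hence mo: "mon o' be = s ^ mdeg be" for be by (simp add: mon_def mdeg_def power_sum)
 have "hps f x' (%be. \<Sum>\<^sub>\<infinity>ep\<in>MI. c (madd be ep) * of_real (mbin be ep * mon de ep)) s"
 proof (rule hps_double[OF s(1)])
 show "(%(ep, be). norm (c (madd be ep) * of_real (mbin be ep * mon de ep)) * s ^ mdeg be) summable_on MI \<times> MI"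
 by (subst summable_on_swap) (use A[of o'] ob s in "simp add: G_def mo norm_mult norm_power")
 fix y assume y: "y : pd x' s"
 have "y : pd x t" unfolding pd_def by (smt (verit, ccfv_threshold) D inner_diff_left mem_Collect_eq pd_def s(2) y)
 from hps_sum[OF f this] have "((%al. c al * of_real (mon (de + (y - x')) al)) has_sum f y) MI" by (simp add: de_def)
 from V[OF _ this] show "((%(ep, be). c (madd be ep) * of_real (mbin be ep * mon de ep) * of_real (mon (y - x') be)) has_sum f y) (MI \<times> MI)"
 by (subst has_sum_swap) (use pd_le[OF y] in "simp add: G_def")
 qed
 thus ?thesis by (simp add: recoef_def[abs_def] de_def)
qed

lemma hps_recentre':
 assumes f: "hps f x c t" and x': "x' : pd x t"
 shows "EX s. hps f x' (recoef c (x' - x)) s"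
proof -
 define D where "D = Max ((%b. \<bar>(x' - x) \<bullet> b\<bar>) ` Basis)"
 have "\<bar>(x' - x) \<bullet> b\<bar> <= D" if "b : Basis" for b unfolding D_def using that by auto
 moreover have "D < t" unfolding D_def using x' by (auto simp: pd_def)
 ultimately show ?thesis by (intro exI[of _ "t - D"] hps_recentre[OF f, of x' D]) auto
qed

text \<open>Terms of degree at least two carry a factor at most \<open>(norm h / t)^2\<close>, so
  what remains after the affine part is quadratic in \<open>norm h\<close>.\<close>

lemma hps_has_derivative:
 assumes f: "hps f x c t"
 shows "(f has_derivative (%h. SUM b:Basis. c (munit b) * of_real (h \<bullet> b))) (at x)"
proof -
 have t: "t > 0" by (rule hps_pos[OF f])
 let ?L = "%h. SUM b:Basis. c (munit b) * of_real (h \<bullet> b)"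
 define low where "low = insert mzero (munit ` (Basis :: 'a set))"
 have low: "finite low" "low <= MI" by (auto simp: low_def)
 have inj: "inj_on munit (Basis :: 'a set)"
 proof (rule inj_onI)
 fix a b :: 'a assume ab: "a : Basis" "b : Basis" "munit a = munit b"
 have "munit a a = munit b a" using ab(3) by simp
 thus "a = b" using ab(1) by (simp split: if_splits)
 qed
 have nz: "mzero ~: munit ` (Basis :: 'a set)" by (metis image_iff mdeg_munit mdeg_mzero zero_neq_one)
 have deg2: "mdeg al >= 2" if aMI: "al : MI - low" for al
 proof (rule ccontr)
 assume "~ 2 <= mdeg al"
 then consider "mdeg al = 0" | "mdeg al = Suc 0" by linarith
 thus False
 proof cases
 case 1 thus False using that mdeg_0_iff by (auto simp: low_def)
 next
 case 2
 then obtain b al' where *: "b : Basis" "al' : MI" "al = madd al' (munit b)" "mdeg al' = 0"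
 using aMI mdeg_Suc_decomp[of al 0] by (metis DiffD1)
 hence "al = munit b" using mdeg_0_iff[of al'] by simp
 thus False using that *(1) by (auto simp: low_def)
 qed
 qed
 have bound: "norm ((f y - f x) - ?L (y - x)) / norm (y - x) <= wn c t / t^2 * norm (y - x)"
 if y: "y ~= x" "dist y x < t" for y
 proof -
 define h where "h = y - x"
 have h: "h ~= 0" "norm h < t" using y by (auto simp: h_def dist_norm)
 have yp: "y : pd x t" using ball_subset_pd[of x t] y by (auto simp: dist_commute)
 have hs: "((%al. c al * of_real (mon h al)) has_sum f y) MI" using hps_sum[OF f yp] by (simp add: h_def)
 have ls: "(SUM al:low. c al * of_real (mon h al)) = f x + ?L h" unfolding low_def using nz inj hps_centre[OF f] by (simp add: sum.reindex)
 have hs2: "((%al. c al * of_real (mon h al)) has_sum (f y - (f x + ?L h))) (MI - low)"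
 using has_sum_Diff[OF hs has_sum_finite[OF low(1)] low(2)] ls by simp
 have hb: "\<bar>h \<bullet> b\<bar> <= norm h" if "b : Basis" for b using Basis_le_norm[OF that] .
 have sm: "(%al. norm (c al) * t ^ mdeg al) summable_on (MI - low)" using asumD[OF hps_asum[OF f]] by (rule summable_on_subset_banach) auto
 have le: "norm (c al * of_real (mon h al)) <= (norm h / t)^2 * (norm (c al) * t ^ mdeg al)"
 if al: "al : MI - low" for al
 proof -
 have "\<bar>mon h al\<bar> <= norm h ^ mdeg al" using hb by (rule mon_abs_le)
 also have "... = (norm h / t) ^ mdeg al * t ^ mdeg al" using t by (simp add: power_divide)
 also have "... <= (norm h / t)^2 * t ^ mdeg al" using deg2[OF al] h t by auto
 finally have "norm (c al) * \<bar>mon h al\<bar> <= norm (c al) * ((norm h / t)^2 * t ^ mdeg al)" by (intro mult_left_mono) auto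
 thus ?thesis by (simp add: norm_mult mult_ac)
 qed
 have sm2: "(%al. norm (c al * of_real (mon h al))) summable_on (MI - low)"
 by (rule summable_on_comparison_test[OF summable_on_cmult_right[OF sm]]) (use le in auto)
 have "norm (f y - (f x + ?L h)) <= (infsum (%al. norm (c al * of_real (mon h al))) (MI - low))"
 by (rule norm_has_sum_bound[OF has_sum_infsum[OF sm2] hs2])
 also have "... <= (infsum (%al. (norm h / t)^2 * (norm (c al) * t ^ mdeg al)) (MI - low))"
 by (intro infsum_mono sm2 summable_on_cmult_right sm le)
 also have "... = (norm h / t)^2 * (infsum (%al. norm (c al) * t ^ mdeg al) (MI - low))" by (rule infsum_cmult_right')
 also have "... <= (norm h / t)^2 * wn c t" unfolding wn_def using t by (intro mult_left_mono infsum_mono2 sm asumD[OF hps_asum[OF f]]) auto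
 finally have "norm (f y - f x - ?L h) / norm h <= (norm h / t)^2 * wn c t / norm h" by (intro divide_right_mono) (auto simp: diff_diff_eq)
 also have "... = wn c t / t^2 * norm h" by (simp add: power2_eq_square)
 finally show ?thesis by (simp add: h_def)
 qed
 have bl: "bounded_linear ?L" by (intro bounded_linear_sum bounded_linear_compose[OF bounded_linear_mult_right]
 bounded_linear_compose[OF bounded_linear_of_real] bounded_linear_inner_left)
 have lim: "((%y. wn c t / t^2 * norm (y - x)) \<longlongrightarrow> 0) (at x)" by (rule tendsto_eq_intros | simp)+
 show ?thesis by (rule has_derivativeI_sandwich[OF t bl _ lim]) (use bound in auto)
qed

definition dcoef :: "'e::euclidean_space => (('e => nat) => complex) => ('e => nat) => complex" where
 "dcoef b c al = of_nat (al b + 1) * c (madd al (munit b))"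

lemma mbin_munit: "b : Basis ==> mbin (munit b) ep = real (ep b + 1)"
proof -
 assume b: "b : Basis"
 have "mbin (munit b) ep = (\<Prod>b'\<in>Basis. if b' = b then real (ep b + 1) else 1)" unfolding mbin_def by (rule prod.cong) auto
 thus ?thesis using b by simp
qed

lemma hps_deriv_at:
 assumes f: "hps f x c t" and b: "b : Basis"
 shows "frechet_derivative f (at x) b = c (munit b)"
proof -
 have "frechet_derivative f (at x) = (%h. SUM b:Basis. c (munit b) * of_real (h \<bullet> b))"
 using hps_has_derivative[OF f] by (rule frechet_derivative_at[symmetric])
 hence "frechet_derivative f (at x) b = (SUM b':Basis. c (munit b') * of_real (b \<bullet> b'))" by simp
 also have "... = (SUM b':Basis. if b' = b then c (munit b) else 0)" using b by (intro sum.cong) (auto simp: inner_Basis)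
 finally show ?thesis using b by simp
qed

text \<open>The factor \<open>al b + 1\<close> is at most \<open>2 ^ mdeg al\<close>, which the
  halved radius absorbs. The value of the derivative at another point comes from recentring there
  and reading off the linear coefficient.\<close>

lemma hps_deriv:
 assumes f: "hps f x c t" and b: "b : Basis"
 shows "hps (%y. frechet_derivative f (at y) b) x (dcoef b c) (t / 2)"
proof -
 have t: "t > 0" by (rule hps_pos[OF f])
 have as: "asum (dcoef b c) (t / 2)" unfolding asum_def
 proof (rule summable_on_comparison_test)
 have inj: "inj_on (%al. madd al (munit b)) MI" by (rule inj_onI) (metis madd_comm msub_madd)
 have "(%al. norm (c al) * t ^ mdeg al) summable_on (%al. madd al (munit b)) ` MI"
 by (rule summable_on_subset_banach[OF asumD[OF hps_asum[OF f]]]) auto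
 hence "((%al. norm (c al) * t ^ mdeg al) \<circ> (%al. madd al (munit b))) summable_on MI" using summable_on_reindex[OF inj] by metis
 thus "(%al. (1 / t) * (norm (c (madd al (munit b))) * t ^ mdeg (madd al (munit b)))) summable_on MI"
 by (intro summable_on_cmult_right) (simp add: o_def)
 fix al :: "'a => nat"
 have "al b <= mdeg al" unfolding mdeg_def using b by (intro member_le_sum) auto
 moreover have "mdeg al < 2 ^ mdeg al" by simp
 ultimately have "real (al b + 1) <= 2 ^ mdeg al" by (metis Suc_eq_plus1 Suc_leI le_less_trans of_nat_le_iff of_nat_numeral of_nat_power)
 hence "real (al b + 1) * (t / 2) ^ mdeg al <= 2 ^ mdeg al * (t / 2) ^ mdeg al" using t by auto
 also have "... = t ^ mdeg al" by (simp add: power_divide)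
 finally have *: "real (al b + 1) * (t / 2) ^ mdeg al <= t ^ mdeg al" .
 have "norm (dcoef b c al) * (t / 2) ^ mdeg al = norm (c (madd al (munit b))) * (real (al b + 1) * (t / 2) ^ mdeg al)"
 unfolding dcoef_def norm_mult norm_of_nat by simp
 also have "... <= norm (c (madd al (munit b))) * t ^ mdeg al" by (rule mult_left_mono[OF *]) simp
 also have "... = (1 / t) * (norm (c (madd al (munit b))) * t ^ mdeg (madd al (munit b)))" using t b by simp
 finally show "norm (dcoef b c al) * (t / 2) ^ mdeg al <= ..." .
 qed (use t in auto)
 have "((%al. dcoef b c al * of_real (mon (y - x) al)) has_sum frechet_derivative f (at y) b) MI"
 if y: "y : pd x (t / 2)" for y
 proof -
 have y2: "y : pd x t" using y pd_mono[of "t/2" t x] t by auto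
 then obtain s where s: "hps f y (recoef c (y - x)) s" using hps_recentre'[OF f] by blast
 have "frechet_derivative f (at y) b = recoef c (y - x) (munit b)" by (rule hps_deriv_at[OF s b])
 also have "... = (infsum (%ep. dcoef b c ep * of_real (mon (y - x) ep)) MI)" unfolding recoef_def using b
 by (intro infsum_cong) (simp add: mbin_munit dcoef_def madd_comm)
 finally show ?thesis using norm_summable_has_sum[OF asum_at[OF as pd_le[OF y]]] by simp
 qed
 thus ?thesis using t as by (simp add: hps_def)
qed

lemma frechet_cong:
 assumes "open S" "x : S" "!!y. y : S ==> f y = g y"
 shows "frechet_derivative f (at x) = frechet_derivative g (at x)"
proof -
 have "(f has_derivative D) (at x) \<longleftrightarrow> (g has_derivative D) (at x)" for D
 using assms by (metis has_derivative_transform_within_open)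
 thus ?thesis by (simp add: frechet_derivative_def)
qed

lemma hps_zero_coef:
 assumes "hps f x c t" "open S" "x : S" "!!y. y : S ==> f y = 0" "al : MI"
 shows "c al = 0" using assms
proof (induction "mdeg al" arbitrary: al f c t)
 case 0
 thus ?case using hps_centre[OF 0(2)] mdeg_0_iff by metis
next
 case (Suc n)
 obtain b al' where a: "b : Basis" "al' : MI" "al = madd al' (munit b)" "mdeg al' = n" using mdeg_Suc_decomp[OF Suc(7)] Suc(2) by metis
 have "frechet_derivative f (at y) b = 0" if "y : S" for y using frechet_cong[OF Suc(4) that, of f "%_. 0"] Suc(6) by simp
 hence "dcoef b c al' = 0" using Suc(1)[OF a(4)[symmetric] hps_deriv[OF Suc(3) a(1)]] Suc(4,5) a(2) by blast
 thus ?case using a(3) by (simp add: dcoef_def del: of_nat_Suc)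
qed

text \<open>The set of points near which the two functions agree is open and closed.\<close>

lemma analytic_identity:
 assumes f: "anl f S" and g: "anl g S" and S: "open S" "connected S"
 and U: "open U" "x : U" "x : S" "!!y. y : U ==> f y = g y" and z: "z : S"
 shows "f z = g z"
proof -
 define h where "h = (%y. f y + (- 1) * g y)"
 have h: "EX c t. hps h y c t & pd y t <= S" if "y : S" for y
 proof -
 obtain c t d t' where *: "hps f y c t" "hps g y d t'" using f g \<open>y : S\<close> unfolding anl_iff_hps by blast
 have "hps h y (%al. c al + (- 1) * d al) (min t t')" unfolding h_def
 by (intro hps_add hps_cmult) (use * hps_pos[OF *(1)] hps_pos[OF *(2)] in "auto intro: hps_shrink")
 thus ?thesis using hps_in_open[OF _ S(1) that] by metis
 qed
 define A where "A = {y : S. EX V. open V & y : V & (ALL w:V. h w = 0)}"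
 have "A = {} \<or> A = S"
 proof (rule connected_clopen[THEN iffD1, OF S(2), rule_format])
 have "open A"
 proof (subst open_subopen, intro ballI)
 fix y assume "y : A"
 then obtain V where "open V" "y : V" "ALL w:V. h w = 0" "y : S" by (auto simp: A_def)
 thus "EX T. open T & y : T & T <= A" using S(1) by (auto simp: A_def)
 qed
 show "openin (top_of_set S) A & closedin (top_of_set S) A"
 proof
 show "openin (top_of_set S) A" using \<open>open A\<close> by (auto simp: A_def openin_open)
 have "y : A" if y: "y : S" "y : closure A" for y
 proof -
 obtain c t where c: "hps h y c t" "pd y t <= S" using h[OF y(1)] by blast
 have t: "t > 0" by (rule hps_pos[OF c(1)])
 have "open (pd y (t / 4))" "y : pd y (t / 4)" using t by auto
 then obtain a where a: "a : A" "a : pd y (t / 4)" using y(2) by (metis closure_iff_nhds_not_empty disjoint_iff subset_refl)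
 \<comment> \<open>A point \<open>a\<close> of \<open>A\<close> within \<open>t / 4\<close> of
   \<open>y\<close> still has the radius \<open>t / 2\<close>, so the cube around \<open>a\<close>
   on which \<open>h\<close> vanishes contains \<open>y\<close>.\<close>
 have r: "hps h a (recoef c (a - y)) (t / 2)" by (rule hps_recentre[OF c(1), of a "t / 4"]) (use pd_le[OF a(2)] t in auto)
 obtain V where "open V" "a : V" "ALL w:V. h w = 0" using a(1) by (auto simp: A_def)
 hence r0: "recoef c (a - y) al = 0" if "al : MI" for al using hps_zero_coef[OF r] that by metis
 have "h w = 0" if "w : pd a (t / 2)" for w
 proof -
 have "((%al::'a => nat. 0) has_sum h w) MI" using hps_sum[OF r that] r0 by (subst (asm) has_sum_cong[where g = "%_. 0"]) auto
 thus ?thesis using has_sum_unique[OF _ has_sum_0] by metis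
 qed
 moreover have "y : pd a (t / 2)" using a(2) t by (auto simp: pd_def inner_diff_left abs_minus_commute)
 ultimately show "y : A" using y(1) by (auto simp: A_def intro!: exI[of _ "pd a (t / 2)"])
 qed
 moreover have "A <= S" by (auto simp: A_def)
 ultimately show "closedin (top_of_set S) A" unfolding closedin_closed by (intro exI[of _ "closure A"]) (use closure_subset[of A] in blast)
 qed
 qed
 moreover have "x : A" using U by (auto simp: A_def h_def)
 ultimately have "A = S" by auto
 hence "z : A" using z by simp
 thus ?thesis by (auto simp: A_def h_def)
qed

section \<open>Calculus of smooth and real analytic functions\<close>

definition pdv :: "'e::euclidean_space => ('e => complex) => 'e => complex" where
 "pdv b f x = frechet_derivative f (at x) b"

lemma pdv_cong: "open S ==> x : S ==> (!!y. y : S ==> f y = g y) ==> pdv b f x = pdv b g x" unfolding pdv_def using frechet_cong by metis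

lemma pdvI: "(f has_derivative f') (at x) ==> pdv b f x = f' b" unfolding pdv_def using frechet_derivative_at by metis

lemma differentiable_D: "f differentiable (at x) ==> (f has_derivative (%h. pdv h f x)) (at x)"
 unfolding pdv_def by (simp add: frechet_derivative_works)

lemma differentiable_D_Basis:
 assumes "f differentiable (at x)"
 shows "pdv h f x = (SUM b:Basis. of_real (h \<bullet> b) * pdv b f x)"
proof -
 have l: "linear (%h. pdv h f x)" using differentiable_D[OF assms] has_derivative_linear by blast
 have "pdv h f x = pdv (SUM b:Basis. (h \<bullet> b) *\<^sub>R b) f x" by (simp add: euclidean_representation)
 also have "... = (SUM b:Basis. (h \<bullet> b) *\<^sub>R pdv b f x)"
 using linear_sum[OF l, of "%b. (h \<bullet> b) *\<^sub>R b" Basis] linear_scale[OF l] by simp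
 finally show ?thesis by (simp add: scaleR_conv_of_real)
qed

lemma pdv_const [simp]: "pdv b (%x. c) x = 0" by (rule pdvI) (rule has_derivative_const)

lemma pdv_add: "f differentiable (at x) ==> g differentiable (at x) ==>
 pdv b (%x. f x + g x) x = pdv b f x + pdv b g x" by (rule pdvI) (intro has_derivative_add differentiable_D)

lemma pdv_diff: "f differentiable (at x) ==> g differentiable (at x) ==>
 pdv b (%x. f x - g x) x = pdv b f x - pdv b g x" by (rule pdvI) (intro has_derivative_diff differentiable_D)

lemma pdv_mult: "f differentiable (at x) ==> g differentiable (at x) ==>
 pdv b (%x. f x * g x) x = f x * pdv b g x + pdv b f x * g x" by (rule pdvI) (intro has_derivative_mult differentiable_D)

lemma pdv_cmult: "f differentiable (at x) ==> pdv b (%x. c * f x) x = c * pdv b f x" using pdv_mult[of "%x. c" x f b] by simp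

lemma pdv_linear: "bounded_linear l ==> f differentiable (at x) ==> pdv b (%x. l (f x)) x = l (pdv b f x)"
 by (rule pdvI[OF bounded_linear.has_derivative[OF _ differentiable_D]])

lemma pdv_cnj: "f differentiable (at x) ==> pdv b (%x. cnj (f x)) x = cnj (pdv b f x)" by (rule pdv_linear[OF bounded_linear_cnj])

lemma pdv_sum: "finite I ==> (!!i. i : I ==> f i differentiable (at x)) ==>
 pdv b (%x. SUM i:I. f i x) x = (SUM i:I. pdv b (f i) x)" by (rule pdvI) (intro has_derivative_sum differentiable_D)

lemma pdv_inverse:
 assumes "f differentiable (at x)" "f x ~= 0"
 shows "pdv b (%x. 1 / f x) x = - pdv b f x * (1 / f x) * (1 / f x)"
proof -
 have "((%x. inverse (f x)) has_derivative (%h. - (inverse (f x) * pdv h f x * inverse (f x)))) (at x)"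
 by (rule Deriv.has_derivative_inverse[OF assms(2) differentiable_D[OF assms(1)]])
 from pdvI[OF this, of b] show ?thesis by (simp add: divide_inverse)
qed

text \<open>The inner map enters through its coordinates, viewed as complex functions, because all
  regularity predicates are for complex valued functions. Their derivatives are real, which lets the
  chain rule be written with \<open>pdv\<close> alone.\<close>

lemma pdv_comp:
 fixes g :: "'e::euclidean_space => 'f::euclidean_space"
 assumes f: "f differentiable (at (g x))" and g: "!!b. b : Basis ==> (%x. complex_of_real (g x \<bullet> b)) differentiable (at x)"
 shows "(%x. f (g x)) differentiable (at x)"
 and "pdv h (%x. f (g x)) x = (SUM b:Basis. pdv b f (g x) * pdv h (%x. of_real (g x \<bullet> b)) x)"
proof -
 have "((%x. g x \<bullet> b) has_derivative (%h. Re (pdv h (%x. of_real (g x \<bullet> b)) x))) (at x)" if "b : Basis" for b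
 using has_derivative_Re[OF differentiable_D[OF g[OF that]]] by simp
 hence "((%x. SUM b:Basis. (g x \<bullet> b) *\<^sub>R b) has_derivative
 (%h. SUM b:Basis. Re (pdv h (%x. of_real (g x \<bullet> b)) x) *\<^sub>R b)) (at x)" by (intro has_derivative_sum has_derivative_scaleR_left)
 hence gd: "(g has_derivative (%h. SUM b:Basis. Re (pdv h (%x. of_real (g x \<bullet> b)) x) *\<^sub>R b)) (at x)"
 by (simp add: euclidean_representation)
 have c: "((%x. f (g x)) has_derivative (%h. pdv (SUM b:Basis. Re (pdv h (%x. of_real (g x \<bullet> b)) x) *\<^sub>R b) f (g x))) (at x)"
 using diff_chain_at[OF gd differentiable_D[OF f]] by (simp add: o_def)
 thus "(%x. f (g x)) differentiable (at x)" by (auto simp: differentiable_def)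
 have re: "of_real (Re (pdv h (%x. complex_of_real (g x \<bullet> b)) x)) = pdv h (%x. of_real (g x \<bullet> b)) x" if "b : Basis" for b
 proof -
 have "pdv h (%x. cnj (complex_of_real (g x \<bullet> b))) x = cnj (pdv h (%x. complex_of_real (g x \<bullet> b)) x)"
 by (rule pdv_cnj[OF g[OF that]])
 thus ?thesis by (simp add: complex_eq_iff)
 qed
 have "pdv h (%x. f (g x)) x = pdv (SUM b:Basis. Re (pdv h (%x. of_real (g x \<bullet> b)) x) *\<^sub>R b) f (g x)" by (rule pdvI[OF c])
 also have "... = (SUM b:Basis. pdv b f (g x) * pdv h (%x. of_real (g x \<bullet> b)) x)" by (subst differentiable_D_Basis[OF f])
 (auto simp: re mult.commute)
 finally show "pdv h (%x. f (g x)) x = (SUM b:Basis. pdv b f (g x) * pdv h (%x. of_real (g x \<bullet> b)) x)" .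
qed

section \<open>Closure properties of the differentiability classes\<close>

lemma Ck_on_Suc:
 "Ck_on (Suc k) f S \<longleftrightarrow> f differentiable_on S & (ALL b:Basis. Ck_on k (pdv b f) S)" by (simp add: pdv_def[abs_def])

declare Ck_on.simps(2) [simp del]

lemma differentiable_on_D: "open S ==> f differentiable_on S ==> x : S ==> f differentiable (at x)"
 by (simp add: differentiable_on_eq_differentiable_at)

lemma Ck_on_SucI:
 assumes "open S" "!!x. x : S ==> f differentiable (at x)" "!!b. b : Basis ==> Ck_on k (pdv b f) S"
 shows "Ck_on (Suc k) f S" using assms by (simp add: Ck_on_Suc differentiable_on_eq_differentiable_at)

lemma Ck_on_SucD: "open S ==> Ck_on (Suc k) f S ==> x : S ==> f differentiable (at x)" by (simp add: Ck_on_Suc differentiable_on_D)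

lemma Ck_on_mono: "open S ==> Ck_on (Suc k) f S ==> Ck_on k f S"
proof (induction k arbitrary: f)
 case 0 thus ?case by (auto simp: Ck_on_Suc intro: differentiable_imp_continuous_on)
next
 case (Suc k) thus ?case by (metis Ck_on_Suc)
qed

lemma Ck_on_cong: "open S ==> (!!x. x : S ==> f x = g x) ==> Ck_on k f S ==> Ck_on k g S"
proof (induction k arbitrary: f g)
 case 0 thus ?case by simp
next
 case (Suc k)
 show ?case
 proof (rule Ck_on_SucI[OF Suc(2)])
 fix x assume x: "x : S"
 have "(f has_derivative (%h. pdv h f x)) (at x)" using Ck_on_SucD[OF Suc(2,4) x] by (rule differentiable_D)
 thus "g differentiable (at x)" unfolding differentiable_def
 by (intro exI[of _ "%h. pdv h f x"], rule has_derivative_transform_within_open[of f _ x UNIV S])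
 (use Suc(2,3) x in auto)
 next
 fix b :: 'a assume "b : Basis"
 thus "Ck_on k (pdv b g) S" using Suc(1)[OF Suc(2), of "pdv b f"] Suc(4) pdv_cong[OF Suc(2) _ Suc(3)] by (simp add: Ck_on_Suc)
 qed
qed

lemma Ck_on_subset: "Ck_on k f S ==> T <= S ==> Ck_on k f T"
proof (induction k arbitrary: f)
 case 0 thus ?case using continuous_on_subset by auto
next
 case (Suc k) thus ?case using differentiable_on_subset by (metis Ck_on_Suc)
qed

lemma Ck_on_const [simp]: "Ck_on k (%x. c) S"
proof (induction k arbitrary: c)
 case (Suc k)
 have "pdv b (%x. c) = (%x::'a. 0)" for b by auto
 thus ?case using Suc by (simp add: Ck_on_Suc)
qed simp

lemma Ck_on_bounded_linear:
 fixes l :: "complex => complex"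
 assumes "open S" "bounded_linear l" shows "Ck_on k f S ==> Ck_on k (%x. l (f x)) S"
proof (induction k arbitrary: f)
 case 0
 thus ?case using bounded_linear.continuous_on[OF assms(2), of S f] by simp
next
 case (Suc k)
 show ?case
 proof (rule Ck_on_SucI[OF assms(1)])
 fix x assume "x : S"
 thus "(%x. l (f x)) differentiable (at x)" using bounded_linear.has_derivative[OF assms(2) differentiable_D[OF Ck_on_SucD[OF assms(1) Suc(2)]]]
 by (auto simp: differentiable_def)
 next
 fix b :: 'a assume "b : Basis"
 hence "Ck_on k (%x. l (pdv b f x)) S" using Suc by (auto simp: Ck_on_Suc)
 thus "Ck_on k (pdv b (%x. l (f x))) S" by (rule Ck_on_cong[OF assms(1), rotated])
 (simp add: pdv_linear[OF assms(2) Ck_on_SucD[OF assms(1) Suc(2)]])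
 qed
qed

lemma Ck_on_add: "open S ==> Ck_on k f S ==> Ck_on k g S ==> Ck_on k (%x. f x + g x) S"
proof (induction k arbitrary: f g)
 case 0 thus ?case by (auto intro: continuous_on_add)
next
 case (Suc k)
 note d = Ck_on_SucD[OF Suc(2) Suc(3)] Ck_on_SucD[OF Suc(2) Suc(4)]
 show ?case
 proof (rule Ck_on_SucI[OF Suc(2)])
 fix b :: 'a assume "b : Basis"
 hence "Ck_on k (%x. pdv b f x + pdv b g x) S" using Suc by (auto simp: Ck_on_Suc)
 thus "Ck_on k (pdv b (%x. f x + g x)) S" by (rule Ck_on_cong[OF Suc(2), rotated]) (simp add: pdv_add d)
 qed (intro differentiable_add d)
qed

lemma Ck_on_mult: "open S ==> Ck_on k f S ==> Ck_on k g S ==> Ck_on k (%x. f x * g x) S"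
proof (induction k arbitrary: f g)
 case 0 thus ?case by (auto intro: continuous_on_mult)
next
 case (Suc k)
 note d = Ck_on_SucD[OF Suc(2) Suc(3)] Ck_on_SucD[OF Suc(2) Suc(4)]
 show ?case
 proof (rule Ck_on_SucI[OF Suc(2)])
 fix b :: 'a assume "b : Basis"
 hence "Ck_on k (pdv b f) S" "Ck_on k (pdv b g) S" using Suc(3,4) by (auto simp: Ck_on_Suc)
 hence "Ck_on k (%x. f x * pdv b g x + pdv b f x * g x) S"
 using Ck_on_mono[OF Suc(2,3)] Ck_on_mono[OF Suc(2,4)] Suc(1)[OF Suc(2)] Ck_on_add[OF Suc(2)] by simp
 thus "Ck_on k (pdv b (%x. f x * g x)) S" by (rule Ck_on_cong[OF Suc(2), rotated]) (simp add: pdv_mult d)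
 qed (intro differentiable_mult d)
qed

lemma Ck_on_sum: "open S ==> finite I ==> (!!i. i : I ==> Ck_on k (f i) S) ==> Ck_on k (%x. SUM i:I. f i x) S"
 by (induction I rule: infinite_finite_induct) (auto intro: Ck_on_add)

lemma Ck_on_inverse:
 assumes S: "open S" and nz: "!!x. x : S ==> f x ~= 0"
 shows "Ck_on k f S ==> Ck_on k (%x. 1 / f x) S"
proof (induction k)
 case 0 thus ?case using nz by (auto intro!: continuous_intros)
next
 case (Suc k)
 note d = Ck_on_SucD[OF S Suc(2)]
 show ?case
 proof (rule Ck_on_SucI[OF S])
 fix b :: 'a assume "b : Basis"
 hence "Ck_on k (%x. (- 1) * pdv b f x * (1 / f x) * (1 / f x)) S"
 using Suc Ck_on_mono[OF S Suc(2)] by (intro Ck_on_mult[OF S]) (auto simp: Ck_on_Suc)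
 thus "Ck_on k (pdv b (%x. 1 / f x)) S" by (rule Ck_on_cong[OF S, rotated]) (simp add: pdv_inverse d nz)
 qed (use nz d in "auto intro!: differentiable_divide")
qed

lemma Ck_on_comp:
 fixes g :: "'e::euclidean_space => 'f::euclidean_space"
 assumes S: "open S" and T: "open T" and gST: "!!x. x : S ==> g x : T"
 shows "Ck_on k f T ==> (!!b. b : Basis ==> Ck_on k (%x. of_real (g x \<bullet> b)) S) ==> Ck_on k (%x. f (g x)) S"
proof (induction k arbitrary: f)
 case 0
 have "continuous_on S (%x. Re (complex_of_real (g x \<bullet> b)))" if "b : Basis" for b using 0(2)[OF that] by simp
 hence "continuous_on S (%x. SUM b:Basis. (g x \<bullet> b) *\<^sub>R b)" by (intro continuous_on_sum continuous_on_scaleR) auto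
 hence "continuous_on S g" by (simp add: euclidean_representation)
 thus ?case using 0(1) gST continuous_on_compose2[of T f S g] by auto
next
 case (Suc k)
 note df = Ck_on_SucD[OF T Suc(2)] and dg = Ck_on_SucD[OF S Suc(3)]
 show ?case
 proof (rule Ck_on_SucI[OF S])
 fix h :: 'e assume h: "h : Basis"
 have "Ck_on k (%x. SUM b:Basis. pdv b f (g x) * pdv h (%x. of_real (g x \<bullet> b)) x) S"
 using Suc h Ck_on_mono[OF S Suc(3)] by (intro Ck_on_sum Ck_on_mult S) (auto simp: Ck_on_Suc)
 thus "Ck_on k (pdv h (%x. f (g x))) S" by (rule Ck_on_cong[OF S, rotated]) (simp add: pdv_comp(2) df dg gST)
 qed (use pdv_comp(1) df dg gST in blast)
qed

text \<open>The derivative is written with a product of three copies of the function itself, so that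
  induction on the differentiability class closes with \<open>Ck_on_mult\<close>.\<close>

lemma differentiable_rsqrt:
 assumes "f differentiable (at x)" "Re (f x) > 0"
 shows "(%x. complex_of_real (1 / sqrt (Re (f x)))) differentiable (at x)"
 and "pdv b (%x. of_real (1 / sqrt (Re (f x)))) x =
 of_real (- 1 / 2) * of_real (Re (pdv b f x)) * (of_real (1 / sqrt (Re (f x))) * of_real (1 / sqrt (Re (f x))) * of_real (1 / sqrt (Re (f x))))"
proof -
 have A: "((%x. Re (f x)) has_derivative (%h. Re (pdv h f x))) (at x)" by (intro has_derivative_Re differentiable_D assms)
 have B: "((%r. 1 / sqrt r) has_field_derivative (- 1 / 2 * (1 / sqrt (Re (f x)))^3)) (at (Re (f x)))"
 using assms(2) by (auto intro!: derivative_eq_intros simp: divide_simps power3_eq_cube)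
 from has_derivative_compose[OF A B[unfolded has_field_derivative_def]]
 have "((%x. 1 / sqrt (Re (f x))) has_derivative (%h. (- 1 / 2 * (1 / sqrt (Re (f x)))^3) * Re (pdv h f x))) (at x)" .
 hence D: "((%x. complex_of_real (1 / sqrt (Re (f x)))) has_derivative
 (%h. of_real ((- 1 / 2 * (1 / sqrt (Re (f x)))^3) * Re (pdv h f x)))) (at x)" by (rule has_derivative_of_real)
 thus "(%x. complex_of_real (1 / sqrt (Re (f x)))) differentiable (at x)" by (auto simp: differentiable_def)
 show "pdv b (%x. of_real (1 / sqrt (Re (f x)))) x =
 of_real (- 1 / 2) * of_real (Re (pdv b f x)) * (of_real (1 / sqrt (Re (f x))) * of_real (1 / sqrt (Re (f x))) * of_real (1 / sqrt (Re (f x))))"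
 unfolding pdvI[OF D] of_real_mult[symmetric] by (simp add: power3_eq_cube)
qed

lemma bounded_linear_Re_complex: "bounded_linear (%z. complex_of_real (Re z))"
 using bounded_linear_compose[OF bounded_linear_of_real bounded_linear_Re] .

lemma Ck_on_rsqrt:
 assumes S: "open S" and nz: "!!x. x : S ==> Re (f x) > 0"
 shows "Ck_on k f S ==> Ck_on k (%x. of_real (1 / sqrt (Re (f x)))) S"
proof (induction k)
 case 0
 have "sqrt (Re (f x)) ~= 0" if "x : S" for x using nz[OF that] by simp
 thus ?case using 0 by (auto intro!: continuous_intros)
next
 case (Suc k)
 note d = Ck_on_SucD[OF S Suc(2)]
 show ?case
 proof (rule Ck_on_SucI[OF S])
 fix b :: 'a assume "b : Basis"
 hence "Ck_on k (%x. of_real (- 1 / 2) * of_real (Re (pdv b f x)) *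
 (of_real (1 / sqrt (Re (f x))) * of_real (1 / sqrt (Re (f x))) * of_real (1 / sqrt (Re (f x))))) S" using Suc Ck_on_mono[OF S Suc(2)]
 by (intro Ck_on_mult[OF S] Ck_on_bounded_linear[OF S bounded_linear_Re_complex]) (auto simp: Ck_on_Suc)
 thus "Ck_on k (pdv b (%x. of_real (1 / sqrt (Re (f x))))) S" by (rule Ck_on_cong[OF S, rotated]) (simp only: differentiable_rsqrt(2) d nz)
 qed (intro differentiable_rsqrt d nz)
qed

section \<open>Closure properties shared by smooth and real analytic functions\<close>

lemma an_deriv: "anl f S ==> b : Basis ==> anl (pdv b f) S" unfolding anl_iff_hps pdv_def using hps_deriv by blast

lemma an_differentiable: "anl f S ==> x : S ==> f differentiable (at x)"
 unfolding anl_iff_hps differentiable_def using hps_has_derivative by blast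

lemma an_smooth: "open S ==> anl f S ==> Ck_on k f S"
proof (induction k arbitrary: f)
 case 0
 thus ?case using an_differentiable by (auto intro!: differentiable_imp_continuous_on simp: differentiable_on_eq_differentiable_at)
qed (auto intro!: Ck_on_SucI an_deriv an_differentiable)

lemma reg_smooth: "open S ==> regular_on k f S ==> regS f S" by (cases k) (auto intro: an_smooth)

lemma reg_cong:
 assumes "open S" "!!x. x : S ==> f x = g x" "regular_on k f S" shows "regular_on k g S"
proof (cases k)
 case Analytic
 have "EX c t. hps g x c t" if "x : S" for x
 proof -
 obtain c t where "hps f x c t" using assms(3) Analytic \<open>x : S\<close> by (auto simp: anl_iff_hps)
 from hps_in_open[OF this assms(1) that] obtain s where "hps f x c s" "pd x s <= S" by blast
 thus ?thesis using hps_cong assms(2) by blast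
 qed
 thus ?thesis using Analytic by (auto simp: anl_iff_hps)
qed (use assms Ck_on_cong[OF assms(1,2)] in auto)

lemma reg_subset: "regular_on k f S ==> T <= S ==> regular_on k f T" by (cases k) (auto simp: real_analytic_on_def intro: Ck_on_subset)

lemma an_2:
 assumes "anl f S" "anl g S" "x : S"
 obtains c d t where "hps f x c t" "hps g x d t"
by (smt (verit) anl_iff_hps assms(1,2,3) hps_pos hps_shrink)

lemma reg_const [simp]: "regular_on k (%x. c) S"
proof (cases k)
 case Analytic
 have "EX d t. hps (%x. c) x d t" for x :: 'a using hps_const[of 1 c x] by (metis zero_less_one)
 thus ?thesis using Analytic by (simp add: anl_iff_hps)
qed simp

lemma reg_add: "open S ==> regular_on k f S ==> regular_on k g S ==> regular_on k (%x. f x + g x) S"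
proof (cases k)
 case Analytic
 assume "regular_on k f S" "regular_on k g S"
 hence *: "anl f S" "anl g S" using Analytic by auto
 have "EX c t. hps (%x. f x + g x) x c t" if x: "x : S" for x
 proof -
 obtain c d t where "hps f x c t" "hps g x d t" by (rule an_2[OF * x])
 from hps_add[OF this] show ?thesis by blast
 qed
 thus ?thesis using Analytic by (simp add: anl_iff_hps)
qed (auto intro: Ck_on_add)

lemma reg_mult: "open S ==> regular_on k f S ==> regular_on k g S ==> regular_on k (%x. f x * g x) S"
proof (cases k)
 case Analytic
 assume "regular_on k f S" "regular_on k g S"
 hence *: "anl f S" "anl g S" using Analytic by auto
 have "EX c t. hps (%x. f x * g x) x c t" if x: "x : S" for x
 proof -
 obtain c d t where "hps f x c t" "hps g x d t" by (rule an_2[OF * x])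
 from hps_mult[OF this] show ?thesis by blast
 qed
 thus ?thesis using Analytic by (simp add: anl_iff_hps)
qed (auto intro: Ck_on_mult)

lemma reg_cmult: "open S ==> regular_on k f S ==> regular_on k (%x. c * f x) S" by (intro reg_mult) auto

lemma reg_minus: "open S ==> regular_on k f S ==> regular_on k (%x. - f x) S" using reg_cmult[of S k f "- 1"] by simp

lemma reg_diff: "open S ==> regular_on k f S ==> regular_on k g S ==> regular_on k (%x. f x - g x) S"
 using reg_add[of S k f "%x. - g x"] reg_minus[of S k g] by simp

lemma reg_sum: "open S ==> finite I ==> (!!i. i : I ==> regular_on k (f i) S) ==> regular_on k (%x. SUM i:I. f i x) S"
 by (induction I rule: infinite_finite_induct) (auto intro: reg_add)

lemma reg_power: "open S ==> regular_on k f S ==> regular_on k (%x. f x ^ n) S" by (induction n) (auto intro: reg_mult)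

lemma reg_cnj: "open S ==> regular_on k f S ==> regular_on k (%x. cnj (f x)) S"
proof (cases k)
 case Analytic
 assume "regular_on k f S"
 thus ?thesis using Analytic hps_cnj by (simp add: anl_iff_hps) blast
qed (auto intro: Ck_on_bounded_linear bounded_linear_cnj)

lemma reg_Re: "open S ==> regular_on k f S ==> regular_on k (%x. of_real (Re (f x))) S"
proof -
 assume *: "open S" "regular_on k f S"
 hence "regular_on k (%x. 1/2 * (f x + cnj (f x))) S" by (intro reg_mult reg_add reg_cnj) auto
 moreover have "(%x. 1/2 * (f x + cnj (f x))) = (%x. of_real (Re (f x)))" by (auto simp: complex_eq_iff)
 ultimately show ?thesis by simp
qed

lemma reg_pdv: "open S ==> regular_on k f S ==> b : Basis ==> regular_on k (pdv b f) S" by (cases k) (auto intro: an_deriv, metis Ck_on_Suc)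

lemma reg_differentiable: "open S ==> regular_on k f S ==> x : S ==> f differentiable (at x)"
 by (cases k) (auto intro: an_differentiable Ck_on_SucD)

lemma hps_coord:
 assumes "b : Basis"
 shows "EX c. hps (%x. of_real (x \<bullet> b)) x c 1"
proof -
 let ?c = "%al. if al = munit b then 1 else (0::complex)"
 have "((%al. ?c al * of_real (mon (y - x) al)) has_sum of_real ((y - x) \<bullet> b)) MI" for y
 by (rule has_sum_finite_neutralI[of "{munit b}"]) (use assms in auto)
 moreover have "((%al. norm (?c al) * 1 ^ mdeg al) has_sum 1) MI" by (rule has_sum_finite_neutralI[of "{munit b}"]) (use assms in auto)
 hence "asum ?c 1" unfolding asum_def by (rule has_sum_imp_summable)
 ultimately have "hps (%y. of_real ((y - x) \<bullet> b)) x ?c 1" by (auto simp: hps_def)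
 from hps_add[OF this hps_const[of 1 "of_real (x \<bullet> b)"]] show ?thesis by (auto simp: inner_diff_left)
qed

lemma reg_coord: "open S ==> b : Basis ==> regular_on k (%x. of_real (x \<bullet> b)) S"
proof -
 assume *: "open S" "b : Basis"
 have "anl (%x. of_real (x \<bullet> b)) S" unfolding anl_iff_hps using hps_coord[OF *(2)] by blast
 thus ?thesis by (cases k) (auto intro: an_smooth *)
qed

text \<open>Dividing by the value at the base point and subtracting 1 moves that value to 0, the
  centre of the series of \<open>F\<close>. Convergence in the open unit disc gives absolute
  convergence on the disc of radius 1/2, with the point 3/4 in between.\<close>

lemma an_compose1:
 fixes F :: "complex => complex" and x0 :: "'e::euclidean_space"
 assumes "hps f x0 c t" "f x0 = a" "a ~= 0" "!!z. norm z < 1 ==> (%n. b n * z ^ n) sums F z"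
 shows "EX d s. hps (%y. F (f y / a - 1)) x0 d s"
proof -
 have "hps (%y. (1 / a) * f y + (- 1)) x0 (%al. (1 / a) * c al + (if al = mzero then - 1 else 0)) t"
 using assms(1) by (intro hps_add hps_cmult hps_const) (auto dest: hps_pos)
 moreover have sm: "summable (%n. norm (b n * z ^ n))" if "norm z <= 1 / 2" for z
 by (rule powser_insidea[of _ "of_real (3 / 4)"]) (use assms(4)[of "of_real (3/4)"] that in \<open>auto simp: sums_iff\<close>)
 moreover have "(%n. norm (b n) * (1 / 2) ^ n) summable_on UNIV"
 proof -
 have "summable (%n. norm (b n) * (1 / 2) ^ n)" using sm[of "1 / 2"] by (simp add: norm_mult norm_power)
 thus ?thesis by (subst summable_on_UNIV_nonneg_real_iff) auto
 qed
 moreover have "((%n. b n * z ^ n) has_sum F z) UNIV" if "norm z <= 1 / 2" for z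
 by (rule norm_summable_imp_has_sum[OF sm[OF that] assms(4)]) (use that in auto)
 ultimately show ?thesis using hps_compose_small[of "%y. (1 / a) * f y + (- 1)" x0 _ t "1/2" b F] assms(2,3) by auto
qed

lemma reg_inverse:
 assumes S: "open S" and f: "regular_on k f S" and nz: "!!x. x : S ==> f x ~= 0"
 shows "regular_on k (%x. 1 / f x) S"
proof (cases k)
 case Analytic
 have "EX d s. hps (%x. 1 / f x) x0 d s" if x: "x0 : S" for x0
 proof -
 obtain c t where h: "hps f x0 c t" using f Analytic x by (auto simp: anl_iff_hps)
 have g: "(%n. (- 1) ^ n * z ^ n) sums (1 / (1 + z))" if "norm z < 1" for z :: complex
 using geometric_sums[of "- z"] that by (simp add: power_mult_distrib[symmetric])
 obtain d s where "hps (%y. 1 / (1 + (f y / f x0 - 1))) x0 d s" using an_compose1[OF h refl nz[OF x] g] by blast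
 from hps_cmult[OF this, of "1 / f x0"] show ?thesis using nz[OF x] by auto
 qed
 thus ?thesis using Analytic by (simp add: anl_iff_hps)
qed (use Ck_on_inverse[OF S nz] f in auto)

lemma reg_divide:
 assumes S: "open S" and f: "regular_on k f S" "regular_on k g S" and nz: "!!x. x : S ==> g x ~= 0"
 shows "regular_on k (%x. f x / g x) S" using reg_mult[OF S f(1) reg_inverse[OF S f(2) nz]] by simp

text \<open>In the analytic case this is the binomial series with exponent -1/2 in the relative
  deviation from the base point. Taking \<open>Re\<close> first makes the argument real and
  positive, so that the complex power agrees with the real root.\<close>

lemma reg_rsqrt:
 assumes S: "open S" and f: "regular_on k f S" and nz: "!!x. x : S ==> Re (f x) > 0"
 shows "regular_on k (%x. of_real (1 / sqrt (Re (f x)))) S"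
proof (cases k)
 case Analytic
 have "EX d s. hps (%x. of_real (1 / sqrt (Re (f x)))) x0 d s" if x: "x0 : S" for x0
 proof -
 define g where "g = (%x. complex_of_real (Re (f x)))"
 have "regular_on k g S" unfolding g_def by (rule reg_Re[OF S f])
 then obtain c t where h: "hps g x0 c t" using Analytic x by (auto simp: anl_iff_hps)
 have b: "(%n. ((- 1/2) gchoose n) * z ^ n) sums ((1 + z) powr (- 1/2))" if "norm z < 1" for z :: complex using gen_binomial_complex[OF that] .
 have g0: "g x0 ~= 0" using nz[OF x] by (auto simp: g_def)
 obtain d s where hs: "hps (%y. (1 + (g y / g x0 - 1)) powr (- 1/2)) x0 d s" using an_compose1[OF h refl g0 b] by blast
 obtain s' where s': "hps (%y. (1 + (g y / g x0 - 1)) powr (- 1/2)) x0 d s'" "pd x0 s' <= S" using hps_in_open[OF hs S x] by blast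
 have eq: "of_real (1 / sqrt (Re (f x0))) * (1 + (g y / g x0 - 1)) powr (- 1/2) = complex_of_real (1 / sqrt (Re (f y)))"
 if "y : S" for y
 proof -
 have p: "Re (f y) > 0" "Re (f x0) > 0" using nz x that by auto
 have "1 + (g y / g x0 - 1) = of_real (Re (f y) / Re (f x0))" by (simp add: g_def)
 hence "(1 + (g y / g x0 - 1)) powr (- 1/2) = of_real ((Re (f y) / Re (f x0)) powr (- 1/2))"
 using p powr_of_real[of "Re (f y) / Re (f x0)" "- 1/2"] by simp
 also have "(Re (f y) / Re (f x0)) powr (- 1/2) = sqrt (Re (f x0)) / sqrt (Re (f y))"
 using p by (simp add: powr_minus_divide powr_half_sqrt powr_divide)
 finally show ?thesis using p by simp
 qed
 have "hps (%y. of_real (1 / sqrt (Re (f y)))) x0 (%al. of_real (1 / sqrt (Re (f x0))) * d al) s'"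
 by (rule hps_cong[OF hps_cmult[OF s'(1)]]) (use eq s'(2) in blast)
 thus ?thesis by blast
 qed
 thus ?thesis using Analytic by (simp add: anl_iff_hps)
qed (use Ck_on_rsqrt[OF S nz] f in auto)

lemma reg_sqrt:
 assumes S: "open S" and f: "regular_on k f S" and nz: "!!x. x : S ==> Re (f x) > 0"
 shows "regular_on k (%x. of_real (sqrt (Re (f x)))) S"
proof (rule reg_cong[OF S _ reg_mult[OF S reg_rsqrt[OF S f nz] reg_Re[OF S f]]])
 fix x assume "x : S"
 from nz[OF this] show "of_real (1 / sqrt (Re (f x))) * complex_of_real (Re (f x)) = of_real (sqrt (Re (f x)))"
 by (simp add: real_div_sqrt flip: of_real_mult of_real_divide)
qed

lemma sm_comp:
 fixes g :: "'e::euclidean_space => 'f::euclidean_space"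
 assumes "open S" "open T" "!!x. x : S ==> g x : T" "regS f T"
 "!!b. b : Basis ==> regS (%x. of_real (g x \<bullet> b)) S"
 shows "regS (%x. f (g x)) S"
by (smt (verit, del_insts) Ck_on_comp Ck_on_cong assms(1,2,3,4,5) regular_on.simps(1))

section \<open>Symmetry of second derivatives\<close>

text \<open>The second difference is symmetric in \<open>a\<close> and \<open>b\<close>, so this
  limit taken both ways identifies the mixed derivatives. It follows from the mean value inequality
  in the direction \<open>a\<close>, with the derivative controlled by the first order expansion of
  \<open>pdv a f\<close> at \<open>x\<close>.\<close>

lemma schwarz_limit:
 assumes S: "open S" "x : S" and f: "!!y. y : S ==> f differentiable (at y)"
 and g: "pdv a f differentiable (at x)"
 shows "((%t. (f (x + t *\<^sub>R a + t *\<^sub>R b) - f (x + t *\<^sub>R a) - f (x + t *\<^sub>R b) + f x) / of_real (t^2))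
 \<longlongrightarrow> pdv b (pdv a f) x) (at_right 0)" (is "((%t. ?Q t / _) \<longlongrightarrow> _) _")
proof (rule tendstoI)
 fix e :: real assume e: "e > 0"
 define G where "G = (%h. pdv h (pdv a f) x)"
 define N where "N = norm a + norm b + 1"
 have N: "N > 0" "norm a <= N" "norm b <= N" by (auto simp: N_def intro: add_nonneg_pos)
 \<comment> \<open>The mean value inequality ends with the bound \<open>4 * ep * N\<close> for the
   difference quotient, which has to stay below \<open>e\<close>.\<close>
 define ep where "ep = e / (6 * N)"
 have ep: "ep > 0" using e N by (simp add: ep_def)
 have "(pdv a f has_derivative G) (at x)" unfolding G_def by (rule differentiable_D[OF g])
 hence Gl: "linear G" and Gd: "EX d>0. ALL y. norm (y - x) < d --> norm (pdv a f y - pdv a f x - G (y - x)) <= ep * norm (y - x)"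
 using ep by (auto simp: has_derivative_at_alt bounded_linear.linear)
 then obtain d where d: "d > 0" "!!y. norm (y - x) < d ==> norm (pdv a f y - pdv a f x - G (y - x)) <= ep * norm (y - x)" by blast
 obtain d' where d': "d' > 0" "ball x d' <= S" using S by (meson open_contains_ball)
 define m where "m = min d d' / (2 * N + 1)"
 have m: "m > 0" using d d' N by (simp add: m_def)
 have "dist (?Q t / of_real (t^2)) (G b) < e"
 if t: "0 < t" "t < m" for t
 proof -
 have near: "norm (s *\<^sub>R a + u *\<^sub>R b) < min d d'" "norm (s *\<^sub>R a + u *\<^sub>R b) <= 2 * N * t"
 if "0 <= s" "s <= t" "0 <= u" "u <= t" for s u
 proof -
 have "norm (s *\<^sub>R a + u *\<^sub>R b) <= s * norm a + u * norm b" using that by (intro norm_triangle_le) simp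
 also have "... <= t * N + t * N" using that N by (intro add_mono mult_mono) auto
 finally show le: "norm (s *\<^sub>R a + u *\<^sub>R b) <= 2 * N * t" by simp
 have "2 * N * t < 2 * N * m" using t N by simp
 also have "... < (2 * N + 1) * m" using m by simp
 also have "... = min d d'" using N by (simp add: m_def)
 finally show "norm (s *\<^sub>R a + u *\<^sub>R b) < min d d'" using le by simp
 qed
 define h where "h = (%s. f (x + s *\<^sub>R a + t *\<^sub>R b) - f (x + s *\<^sub>R a) - s *\<^sub>R (t *\<^sub>R G b))"
 define h' where "h' = (%s r. r *\<^sub>R (pdv a f (x + s *\<^sub>R a + t *\<^sub>R b) - pdv a f (x + s *\<^sub>R a) - t *\<^sub>R G b))"
 have der: "(h has_derivative h' s) (at s within {0..t})" if s: "s : {0..t}" for s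
 proof -
 have in1: "x + s *\<^sub>R a + t *\<^sub>R b : S" "x + s *\<^sub>R a : S"
 using near(1)[of s t] near(1)[of s 0] s d' by (auto simp: dist_norm norm_minus_commute algebra_simps)
 have line: "((%s. f (x + s *\<^sub>R a + v)) has_derivative (%r. r *\<^sub>R pdv a f (x + s *\<^sub>R a + v))) (at s within {0..t})"
 if "x + s *\<^sub>R a + v : S" for v
 proof -
 note D = differentiable_D[OF f[OF that]]
 have "((%s. x + s *\<^sub>R a + v) has_derivative (%r. r *\<^sub>R a)) (at s within {0..t})" by (auto intro!: derivative_eq_intros)
 from has_derivative_in_compose[OF this has_derivative_at_withinI[OF D]]
 have "((%s. f (x + s *\<^sub>R a + v)) has_derivative (%r. pdv (r *\<^sub>R a) f (x + s *\<^sub>R a + v))) (at s within {0..t})" .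
 thus ?thesis using linear_scale[OF has_derivative_linear[OF D]] by simp
 qed
 show ?thesis unfolding h_def h'_def using line[of "t *\<^sub>R b"] line[of 0] in1 by (auto intro!: derivative_eq_intros simp: algebra_simps)
 qed
 have bnd: "onorm (h' s) <= 4 * ep * N * t" if s: "s : {0..t}" for s
 proof (rule onorm_le)
 fix r
 have p1: "norm (pdv a f (x + s *\<^sub>R a + t *\<^sub>R b) - pdv a f x - G (s *\<^sub>R a + t *\<^sub>R b)) <= ep * (2 * N * t)"
 using d(2)[of "x + (s *\<^sub>R a + t *\<^sub>R b)"] near[of s t] s ep by (auto simp: add.assoc elim!: order_trans)
 have p2: "norm (pdv a f (x + s *\<^sub>R a) - pdv a f x - G (s *\<^sub>R a)) <= ep * (2 * N * t)"
 using d(2)[of "x + s *\<^sub>R a"] near[of s 0] s ep by (auto elim!: order_trans)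
 let ?B = "pdv a f (x + s *\<^sub>R a + t *\<^sub>R b) - pdv a f x - G (s *\<^sub>R a + t *\<^sub>R b)"
 and ?C = "pdv a f (x + s *\<^sub>R a) - pdv a f x - G (s *\<^sub>R a)"
 have "pdv a f (x + s *\<^sub>R a + t *\<^sub>R b) - pdv a f (x + s *\<^sub>R a) - t *\<^sub>R G b = ?B - ?C"
 by (simp add: linear_add[OF Gl] linear_scale[OF Gl])
 also have "norm ... <= norm ?B + norm ?C" by (rule norm_triangle_ineq4)
 also have "... <= ep * (2 * N * t) + ep * (2 * N * t)" by (rule add_mono[OF p1 p2])
 finally have "norm (pdv a f (x + s *\<^sub>R a + t *\<^sub>R b) - pdv a f (x + s *\<^sub>R a) - t *\<^sub>R G b) <= 4 * ep * N * t"
 by (simp add: mult_ac)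
 thus "norm (h' s r) <= 4 * ep * N * t * norm r" unfolding h'_def by (simp add: mult.commute mult_left_mono)
 qed
 have "norm (h t - h 0) <= 4 * ep * N * t * norm (t - 0)" by (rule differentiable_bound[of "{0..t}" h h', OF _ der bnd]) (use t in auto)
 also have "h t - h 0 = ?Q t - of_real (t^2) * G b" by (simp add: h_def scaleR_conv_of_real power2_eq_square)
 finally have le: "norm (?Q t - of_real (t^2) * G b) <= 4 * ep * N * t^2" using t by (simp add: power2_eq_square)
 have "dist (?Q t / of_real (t^2)) (G b)
 = norm ((?Q t - of_real (t^2) * G b) / of_real (t^2))" unfolding dist_norm using t by (simp add: diff_divide_distrib)
 also have "... <= 4 * ep * N" using le t by (simp add: norm_divide divide_simps norm_power mult_ac)
 also have "... < e" using e by (simp add: ep_def)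
 finally show ?thesis .
 qed
 thus "\<forall>\<^sub>F t in at_right 0. dist (?Q t / of_real (t^2))
 (pdv b (pdv a f) x) < e" using m by (auto simp: eventually_at_right_field G_def)
qed

lemma pdv_commute:
 assumes S: "open S" "x : S" and f: "regular_on k f S" and ab: "a : Basis" "b : Basis"
 shows "pdv a (pdv b f) x = pdv b (pdv a f) x"
proof -
 have f': "f differentiable (at y)" if "y : S" for y by (rule reg_differentiable[OF S(1) f that])
 have g': "pdv a f differentiable (at x)" "pdv b f differentiable (at x)" using reg_differentiable[OF S(1) reg_pdv[OF S(1) f] S(2)] ab by auto
 have "((%t. (f (x + t *\<^sub>R a + t *\<^sub>R b) - f (x + t *\<^sub>R a) - f (x + t *\<^sub>R b) + f x) / of_real (t^2)) \<longlongrightarrow> pdv a (pdv b f) x) (at_right 0)"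
 using schwarz_limit[OF S f' g'(2), of a] by (simp add: algebra_simps)
 with schwarz_limit[OF S f' g'(1), of b] show ?thesis using tendsto_unique[OF trivial_limit_at_right_real] by blast
qed

section \<open>Taylor coefficients along a boundary\<close>

declare regular_on.simps [simp del]

abbreviation dr :: "('x::euclidean_space \<times> real => complex) => 'x \<times> real => complex" where
 "dr F \<equiv> pdv (0, 1) F"

text \<open>Taylor coefficients in the last variable at 0, for functions smooth on both sides of the
  boundary. One-sided coefficients are reduced to these by \<open>taylor_coeff_tc\<close>.\<close>

definition tc :: "('x::euclidean_space \<times> real => complex) => nat => 'x => complex" where
 "tc F n x = ((pdv (0, 1)) ^^ n) F (x, 0) / fact n"

lemma Basis_dr: "((0::'x::euclidean_space), 1::real) : Basis" by (auto simp: Basis_prod_def)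

lemma Basis_dx: "b : Basis ==> (b, 0::real) : Basis" by (auto simp: Basis_prod_def)

lemma dr_iter_smooth:
 assumes "open S" "regS F S"
 shows "regS ((pdv (0, 1) ^^ n) F) (S :: ('x::euclidean_space \<times> real) set)" by (induction n) (use assms reg_pdv Basis_dr in auto)

lemma dr_iter_cong:
 assumes "open S" "!!y. y : S ==> F y = G y"
 shows "y : S ==> (pdv (0, 1) ^^ n) F y = (pdv (0, 1) ^^ n) G (y :: 'x::euclidean_space \<times> real)"
proof (induction n arbitrary: y)
 case (Suc n)
 thus ?case using pdv_cong[OF assms(1) Suc(2) Suc(1)] by simp
qed (use assms in auto)

lemma tc_cong: "open S ==> (x, 0) : S ==> (!!y. y : S ==> F y = G y) ==> tc F n x = tc G n x"
 unfolding tc_def using dr_iter_cong[of S F G] by metis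

lemma tc_0 [simp]: "tc F 0 x = F (x, 0)" by (simp add: tc_def)

lemma tc_dr: "tc (dr F) n x = of_nat (Suc n) * tc F (Suc n) x"
proof -
 have "(pdv (0, 1) ^^ n) (dr F) = (pdv (0, 1) ^^ Suc n) F" by (simp only: funpow_Suc_right o_def)
 thus ?thesis unfolding tc_def by (simp del: of_nat_Suc)
qed

lemma tc_dr': "tc F (Suc n) x = tc (dr F) n x / of_nat (Suc n)" unfolding tc_dr by (simp del: of_nat_Suc)

lemma tc_add:
 assumes S: "open S" "(x, 0) : S"
 shows "regS F S ==> regS G S ==> tc (%y. F y + G y) n x = tc F n x + tc G n x"
proof (induction n arbitrary: F G)
 case (Suc n)
 have "tc (dr (%y. F y + G y)) n x = tc (%y. dr F y + dr G y) n x" by (rule tc_cong[OF S]) (use pdv_add reg_differentiable S(1) Suc(2,3) in blast)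
 also have "... = tc (dr F) n x + tc (dr G) n x" by (rule Suc(1)) (intro reg_pdv S Suc(2,3) Basis_dr)+
 finally show ?case unfolding tc_dr' by (simp add: add_divide_distrib)
qed simp

text \<open>The Leibniz rule without binomial sums: taking \<open>tc\<close> turns \<open>dr\<close>
  into the formal derivative, and comparing coefficients of the derivatives of both sides gives the
  induction step.\<close>

lemma tc_mult:
 assumes S: "open S" "(x, 0) : S" and F: "regS F S" and G: "regS G S"
 shows "tc (%y. F y * G y) n x = (\<Sum>i=0..n. tc F i x * tc G (n - i) x)"
proof -
 define P where "P F = Abs_fps (%n. tc F n x)" for F :: "'a \<times> real => complex"
 have Pd: "P (dr F) = fps_deriv (P F)" for F by (rule fps_ext) (simp add: P_def tc_dr)
 have "fps_nth (P (%y. F y * G y)) n = fps_nth (P F * P G) n" using F G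
 proof (induction n arbitrary: F G)
 case 0 thus ?case by (simp add: P_def)
 next
 case (Suc n)
 have sd: "regS (dr F) S" "regS (dr G) S" using Suc(2,3) reg_pdv Basis_dr S by auto
 have "of_nat (Suc n) * fps_nth (P (%y. F y * G y)) (Suc n) = fps_nth (P (dr (%y. F y * G y))) n" by (simp add: P_def tc_dr)
 also have "... = fps_nth (P (%y. F y * dr G y + dr F y * G y)) n" unfolding P_def fps_nth_Abs_fps
 by (rule tc_cong[OF S]) (use pdv_mult reg_differentiable S(1) Suc(2,3) in blast)
 also have "... = fps_nth (P (%y. F y * dr G y)) n + fps_nth (P (%y. dr F y * G y)) n"
 unfolding P_def fps_nth_Abs_fps by (intro tc_add[OF S] reg_mult S sd Suc(2,3))
 also have "... = fps_nth (P F * fps_deriv (P G) + fps_deriv (P F) * P G) n" by (simp add: Suc(1)[OF Suc(2) sd(2)] Suc(1)[OF sd(1) Suc(3)] Pd)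
 also have "... = fps_nth (fps_deriv (P F * P G)) n" by simp
 also have "... = of_nat (Suc n) * fps_nth (P F * P G) (Suc n)" by (simp only: fps_deriv_nth Suc_eq_plus1)
 finally show ?case using of_nat_neq_0[of n, where 'a = complex] mult_left_cancel by blast
 qed
 thus ?thesis by (simp add: P_def fps_mult_nth)
qed

lemma tc_x:
 assumes "(%y. f (fst y)) = (F :: 'x::euclidean_space \<times> real => complex)"
 and S: "open S" "(x, 0) : S" and F: "regS F S"
 shows "tc F n x = (if n = 0 then f x else 0)"
proof (cases n)
 case 0 thus ?thesis using assms(1) by auto
next
 case (Suc m)
 have d0: "dr F y = 0" if "y : S" for y
 proof -
 obtain p r where y: "y = (p, r)" by (cases y)
 have D: "(F has_derivative (%h. pdv h F (p, r))) (at (p, r))" using differentiable_D[OF reg_differentiable[OF S(1) F that]] y by simp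
 have "((%s. (p, s)) has_derivative (%h. (0, h))) (at r)" by (auto intro!: derivative_eq_intros)
 from diff_chain_at[OF this D] have "((%s. f p) has_derivative (%h. pdv (0, h) F (p, r))) (at r)" using assms(1) by (auto simp: o_def)
 from has_derivative_unique[OF this has_derivative_const] show ?thesis using y by metis
 qed
 have "tc (dr F) k x = 0" for k
 proof -
 have "tc (dr F) k x = tc (%y. 0) k x" by (rule tc_cong[OF S]) (rule d0)
 also have "... = 0"
 proof -
 have "(pdv (0, 1) ^^ k) (%y::'x \<times> real. 0) = (%y. 0)" by (induction k) auto
 thus ?thesis by (simp add: tc_def)
 qed
 finally show ?thesis .
 qed
 thus ?thesis using Suc by (simp add: tc_dr')
qed

lemma tc_const: "tc (%y. c) n x = (if n = 0 then c else 0)" using tc_x[of "%x. c" "%y. c" UNIV x n] by simp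

lemma tc_cmult:
 assumes S: "open S" "(x, 0) : S" and F: "regS F S"
 shows "tc (%y. c * F y) n x = c * tc F n x"
proof -
 have "tc (%y. c * F y) n x = (\<Sum>i=0..n. tc (%y. c) i x * tc F (n - i) x)" by (rule tc_mult[OF S]) (use F in auto)
 also have "... = (\<Sum>i=0..n. if i = 0 then c * tc F n x else 0)" by (rule sum.cong) (auto simp: tc_const)
 finally show ?thesis by simp
qed

lemma tc_diff:
 assumes S: "open S" "(x, 0) : S" and F: "regS F S" "regS G S"
 shows "tc (%y. F y - G y) n x = tc F n x - tc G n x" using tc_add[OF S F(1) reg_minus[OF S(1) F(2)], of n] tc_cmult[OF S F(2), of "- 1" n] by simp

lemma tc_sum:
 assumes S: "open S" "(x, 0) : S" and F: "!!i. i : I ==> regS (F i) S" and "finite I"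
 shows "tc (%y. SUM i:I. F i y) n x = (SUM i:I. tc (F i) n x)" using assms(4) F
proof (induction I rule: finite_induct)
 case empty show ?case by (simp add: tc_const)
next
 case (insert i I)
 have "tc (%y. F i y + (SUM i:I. F i y)) n x = tc (F i) n x + tc (%y. SUM i:I. F i y) n x"
 by (rule tc_add[OF S]) (use insert S in "auto intro: reg_sum")
 thus ?case using insert by simp
qed

lemma snd_smooth: "open S ==> regular_on k (%y. of_real (snd y)) (S :: ('x::euclidean_space \<times> real) set)"
 using reg_coord[OF _ Basis_dr, of S k] by (simp add: inner_prod_def)

lemma tc_snd: "tc (%y. of_real (snd y)) n x = (if n = 1 then 1 else 0)"
proof (cases n)
 case (Suc m)
 have "dr (%y. of_real (snd y)) = (%y::'a \<times> real. 1)"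
 proof
 fix y :: "'a \<times> real"
 have "((%y. complex_of_real (snd y)) has_derivative (%h. of_real (snd h))) (at y)" by (auto intro!: derivative_eq_intros)
 from pdvI[OF this, of "(0, 1)"] show "dr (%y. of_real (snd y)) y = 1" by simp
 qed
 thus ?thesis using Suc by (simp add: tc_dr' tc_const)
qed simp

lemma tc_rho_mult:
 assumes S: "open S" "(x, 0) : S" and F: "regS F S"
 shows "tc (%y. of_real (snd y) * F y) n x = (if n = 0 then 0 else tc F (n - 1) x)"
proof -
 have "tc (%y. of_real (snd y) * F y) n x = (\<Sum>i=0..n. tc (%y. of_real (snd y)) i x * tc F (n - i) x)"
 by (rule tc_mult[OF S snd_smooth[OF S(1)] F])
 also have "... = (\<Sum>i=0..n. if i = 1 then tc F (n - 1) x else 0)" by (rule sum.cong) (auto simp: tc_snd)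
 finally show ?thesis by auto
qed

lemma slice:
 assumes S: "open S" "(x, r) : S" and F: "F differentiable (at (x, r))" and b: "b : Basis"
 shows "pdv b (%x. F (x, r)) x = pdv (b, 0) F (x, r)"
 and "((%s. F (x, s)) has_vector_derivative dr F (x, r)) (at r)"
 and "(%x. F (x, r)) differentiable (at x)"
proof -
 have "((%x. (x, r)) has_derivative (%h. (h, 0))) (at x)" by (auto intro!: derivative_eq_intros)
 from diff_chain_at[OF this differentiable_D[OF F]]
 have D: "((%x. F (x, r)) has_derivative (%h. pdv (h, 0) F (x, r))) (at x)" by (simp add: o_def)
 from pdvI[OF D] show "pdv b (%x. F (x, r)) x = pdv (b, 0) F (x, r)" .
 show "(%x. F (x, r)) differentiable (at x)" using D by (auto simp: differentiable_def)
 have "((%s. (x, s)) has_derivative (%h. (0, h))) (at r)" by (auto intro!: derivative_eq_intros)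
 from diff_chain_at[OF this differentiable_D[OF F]]
 have "((%s. F (x, s)) has_derivative (%h. pdv (0, h) F (x, r))) (at r)" by (simp add: o_def)
 moreover have "(%h. pdv (0, h) F (x, r)) = (%h. h *\<^sub>R dr F (x, r))"
 proof
 fix h :: real
 have "h *\<^sub>R ((0::'a), 1::real) = (0, h)" by simp
 thus "pdv (0, h) F (x, r) = h *\<^sub>R dr F (x, r)" using linear_scale[OF has_derivative_linear[OF differentiable_D[OF F]], of h "(0, 1)"] by metis
 qed
 ultimately show "((%s. F (x, s)) has_vector_derivative dr F (x, r)) (at r)" by (simp only: has_vector_derivative_def)
qed

lemma slice_smooth:
 fixes F :: "'x::euclidean_space \<times> real => complex"
 assumes S: "open S" and F: "regS F S" and O: "open O'" "!!x. x : O' ==> (x, r) : S"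
 shows "regS (%x. F (x, r)) O'"
proof (rule sm_comp[OF O(1) S O(2) F])
 fix b :: "'x \<times> real" assume "b : Basis"
 then consider b' where "b' : Basis" "b = (b', 0)" | "b = (0, 1)" by (auto simp: Basis_prod_def)
 thus "regS (%x. of_real ((x, r) \<bullet> b)) O'" by cases (use O reg_coord in auto)
qed auto

lemma tc_dx:
 assumes S: "open S" "(x, 0) : S" and F: "regS F S" and b: "b : Basis"
 shows "tc (pdv (b, 0) F) n x = pdv b (tc F n) x"
proof -
 have "y : S ==> (pdv (0, 1) ^^ n) (pdv (b, 0) F) y = pdv (b, 0) ((pdv (0, 1) ^^ n) F) y" for y
 proof (induction n arbitrary: y)
 case (Suc n)
 have "(pdv (0, 1) ^^ Suc n) (pdv (b, 0) F) y = dr (pdv (b, 0) ((pdv (0, 1) ^^ n) F)) y" using pdv_cong[OF S(1) Suc(2) Suc(1)] by simp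
 also have "... = pdv (b, 0) (dr ((pdv (0, 1) ^^ n) F)) y"
 by (rule pdv_commute[OF S(1) Suc(2) dr_iter_smooth[OF S(1) F] Basis_dr Basis_dx[OF b]])
 finally show ?case by simp
 qed simp
 hence "tc (pdv (b, 0) F) n x = pdv (b, 0) ((pdv (0, 1) ^^ n) F) (x, 0) / fact n" using S by (simp add: tc_def)
 also have "... = pdv b (%x. ((pdv (0, 1) ^^ n) F) (x, 0)) x * (1 / fact n)"
 using slice(1)[OF S reg_differentiable[OF S(1) dr_iter_smooth[OF S(1) F] S(2)] b] by simp
 also have "... = pdv b (tc F n) x"
 proof -
 have "(%x. ((pdv (0, 1) ^^ n) F) (x, 0)) differentiable (at x)"
 by (rule slice(3)[OF S reg_differentiable[OF S(1) dr_iter_smooth[OF S(1) F] S(2)] b])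
 from pdv_cmult[OF this, of b "1 / fact n"] show ?thesis by (simp add: tc_def[abs_def])
 qed
 finally show ?thesis .
qed

text \<open>Integrates one order in the boundary variable: an error \<open>e * r ^ n\<close> in the
  derivative becomes \<open>e * r ^ Suc n\<close> in the function, by the mean value inequality on
  \<open>[0, r]\<close>.\<close>

lemma slice_bound:
 assumes S: "open S" and F: "regS F S" and seg: "!!s. 0 <= s ==> s <= r ==> (x, s) : S" and r: "r >= 0"
 and B: "!!s. 0 < s ==> s < r ==> norm (dr F (x, s) - of_nat (Suc n) * c * of_real (s ^ n)) <= e * r ^ n"
 shows "norm (F (x, r) - F (x, 0) - c * of_real (r ^ Suc n)) <= e * r ^ Suc n"
proof (cases "r = 0")
 case False
 hence r: "r > 0" using r by simp
 define h where "h = (%s. F (x, s) - c * of_real (s ^ Suc n))"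
 have der: "(h has_vector_derivative (dr F (x, s) - of_nat (Suc n) * c * of_real (s ^ n))) (at s)"
 if "0 <= s" "s <= r" for s
 proof -
 have "((%s. complex_of_real (s ^ Suc n)) has_vector_derivative of_real (real (Suc n) * s ^ n)) (at s)"
 by (intro has_vector_derivative_of_real) (auto intro!: derivative_eq_intros simp del: power_Suc)
 from has_vector_derivative_mult_right[OF this, of c]
 show ?thesis unfolding h_def
 using slice(2)[OF S seg[OF that] reg_differentiable[OF S F seg[OF that]], of "SOME b. b : Basis"] some_in_eq[of Basis]
 by (intro has_vector_derivative_eq_rhs[OF has_vector_derivative_diff]) (auto simp: mult_ac)
 qed
 have cont: "continuous_on {0..r} h" by (intro continuous_at_imp_continuous_on ballI has_vector_derivative_continuous[OF der]) auto
 obtain s where s: "s : {0<..<r}" "norm (h r - h 0) <= norm (r - 0) * norm (dr F (x, s) - of_nat (Suc n) * c * of_real (s ^ n))"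
 proof -
 have "EX s:{0<..<r}. norm (h r - h 0) <= norm ((r - 0) *\<^sub>R (dr F (x, s) - of_nat (Suc n) * c * of_real (s ^ n)))"
 by (rule mvt_general[OF r cont]) (use der in "auto simp: has_vector_derivative_def")
 thus ?thesis using that by auto
 qed
 hence "norm (h r - h 0) <= r * (e * r ^ n)" using B[of s] by (auto elim!: order_trans)
 thus ?thesis by (simp add: h_def mult_ac diff_diff_add add.commute)
qed simp

text \<open>L'Hospital's rule as an induction: the limit for \<open>dr F\<close> at order
  \<open>n\<close> is integrated by \<open>slice_bound\<close>.\<close>

lemma tc_limit:
 assumes S: "open S" "(x, 0) : S"
 shows "regS F S ==> (!!j. j < n ==> tc F j x = 0) ==>
 ((%r. F (x, r) / of_real (r ^ n)) \<longlongrightarrow> tc F n x) (at_right 0)"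
proof (induction n arbitrary: F)
 case 0
 have "isCont F (x, 0)" using differentiable_imp_continuous_within[OF reg_differentiable[OF S(1) 0(1) S(2)]] by simp
 moreover have "((%r. (x, r)) \<longlongrightarrow> (x, 0)) (at_right (0::real))" by (intro tendsto_intros)
 ultimately have "((%r. F (x, r)) \<longlongrightarrow> F (x, 0)) (at_right 0)" by (rule isCont_tendsto_compose)
 thus ?case by simp
next
 case (Suc n)
 have z: "tc (dr F) j x = 0" if "j < n" for j using Suc(3)[of "Suc j"] that by (simp add: tc_dr)
 have sd: "regS (dr F) S" using Suc(2) reg_pdv Basis_dr S by auto
 define c where "c = tc F (Suc n) x"
 have lim: "((%r. dr F (x, r) / of_real (r ^ n)) \<longlongrightarrow> of_nat (Suc n) * c) (at_right 0)"
 using Suc(1)[OF sd z] by (simp add: tc_dr c_def)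
 have F0: "F (x, 0) = 0" using Suc(3)[of 0] by simp
 obtain d0 where d0: "d0 > 0" "!!s. \<bar>s\<bar> < d0 ==> (x, s) : S"
 proof -
 obtain e where e: "e > 0" "ball (x, 0) e <= S" using S by (meson open_contains_ball)
 thus ?thesis using that[of e] by (force simp: dist_prod_def)
 qed
 show ?case
 proof (rule tendstoI)
 fix e :: real assume e: "e > 0"
 from tendstoD[OF lim, of "e / 2"] e obtain d where d: "d > 0"
 "!!s. 0 < s ==> s < d ==> dist (dr F (x, s) / of_real (s ^ n)) (of_nat (Suc n) * c) < e / 2" by (auto simp: eventually_at_right_field)
 have "dist (F (x, r) / of_real (r ^ Suc n)) c < e" if r: "0 < r" "r < min d d0" for r
 proof -
 have "norm (F (x, r) - F (x, 0) - c * of_real (r ^ Suc n)) <= (e / 2) * r ^ Suc n"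
 proof (rule slice_bound[OF S(1) Suc(2)])
 fix s :: real assume s: "0 < s" "s < r"
 have "dr F (x, s) - of_nat (Suc n) * c * of_real (s ^ n) = (dr F (x, s) / of_real (s ^ n) - of_nat (Suc n) * c) * of_real (s ^ n)"
 using s by (simp add: field_simps)
 also have "norm ... <= e / 2 * s ^ n" using d(2)[of s] s r by (simp add: norm_mult norm_power dist_norm mult_right_mono del: of_nat_Suc)
 also have "... <= e / 2 * r ^ n" using s e by (intro mult_left_mono power_mono) auto
 finally show "norm (dr F (x, s) - of_nat (Suc n) * c * of_real (s ^ n)) <= e / 2 * r ^ n" .
 qed (use r d0 in auto)
 hence "norm (F (x, r) - c * of_real (r ^ Suc n)) <= e / 2 * r ^ Suc n" using F0 by simp
 moreover have "F (x, r) / of_real (r ^ Suc n) - c = (F (x, r) - c * of_real (r ^ Suc n)) / of_real (r ^ Suc n)" using r by (simp add: field_simps)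
 ultimately have "dist (F (x, r) / of_real (r ^ Suc n)) c <= e / 2"
 using r unfolding dist_norm by (simp add: norm_divide norm_mult norm_power divide_simps)
 thus ?thesis using e by simp
 qed
 thus "\<forall>\<^sub>F r in at_right 0. dist (F (x, r) / of_real (r ^ Suc n)) (tc F (Suc n) x) < e"
 using d(1) d0(1) by (auto simp: eventually_at_right_field c_def intro!: exI[of _ "min d d0"])
 qed
qed

text \<open>Turns an estimate for positive \<open>r\<close> into vanishing of two-sided Taylor
  coefficients. The order conditions of a formal solution, which see only the interior, reach the
  coefficients in this way.\<close>

lemma tc_vanish:
 assumes S: "open S" "(x, 0) : S" and F: "regS F S"
 and B: "e > 0" "!!r. 0 < r ==> r < e ==> norm (F (x, r)) <= C * r ^ m"
 shows "j < m ==> tc F j x = 0"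
proof (induction j rule: less_induct)
 case (less j)
 have "((%r. F (x, r) / of_real (r ^ j)) \<longlongrightarrow> tc F j x) (at_right 0)" using less by (intro tc_limit[OF S F]) auto
 moreover have "((%r. F (x, r) / of_real (r ^ j)) \<longlongrightarrow> 0) (at_right 0)"
 proof (rule Lim_null_comparison)
 have "norm (F (x, r) / of_real (r ^ j)) <= \<bar>C\<bar> * r" if r: "0 < r" "r < min e 1" for r
 proof -
 have "norm (F (x, r)) <= \<bar>C\<bar> * r ^ m" using B(2)[of r] r by (simp add: order_trans)
 also have "... <= \<bar>C\<bar> * r ^ Suc j" using r less(2) by (intro mult_left_mono power_decreasing) auto
 finally show ?thesis using r by (simp add: norm_divide norm_power divide_simps)
 qed
 thus "\<forall>\<^sub>F r in at_right 0. norm (F (x, r) / of_real (r ^ j)) <= \<bar>C\<bar> * r"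
 using B(1) by (auto simp: eventually_at_right_field intro!: exI[of _ "min e 1"])
 show "((%r. \<bar>C\<bar> * r) \<longlongrightarrow> 0) (at_right 0)" by (rule tendsto_eq_intros | simp)+
 qed
 ultimately show ?case using tendsto_unique[OF trivial_limit_at_right_real] by blast
qed

text \<open>The iterated one-sided derivatives agree with those of the extension on the whole
  interval \<open>[0, e)\<close>, not only at 0; the induction needs this stronger form.\<close>

lemma taylor_coeff_tc:
 assumes S: "open S" "e > 0" "!!s. 0 <= s ==> s < e ==> (x, s) : S" and F: "regS F S"
 and f: "!!s. 0 <= s ==> s < e ==> f s = F (x, s)"
 shows "taylor_coeff f n = tc F n x"
proof -
 let ?D = "%h r. vector_derivative h (at r within {0::real..})"
 have "ALL s. 0 <= s & s < e --> (?D ^^ n) f s = (pdv (0, 1) ^^ n) F (x, s)"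
 proof (induction n)
 case (Suc n)
 show ?case
 proof (intro allI impI)
 fix s assume s: "0 <= s & s < e"
 let ?G = "(pdv (0, 1) ^^ n) F"
 have "((%s. ?G (x, s)) has_vector_derivative dr ?G (x, s)) (at s)"
 using slice(2)[OF S(1) S(3) reg_differentiable[OF S(1) dr_iter_smooth[OF S(1) F] S(3)], of s "SOME b. b : Basis"] s some_in_eq[of Basis]
 by auto
 hence "((%s. ?G (x, s)) has_vector_derivative dr ?G (x, s)) (at s within {0..})" by (rule has_vector_derivative_at_within)
 hence "((?D ^^ n) f has_vector_derivative dr ?G (x, s)) (at s within {0..})" by (rule has_vector_derivative_transform_within[where d = "e - s"])
 (use s Suc in "auto simp: dist_real_def")
 hence "?D ((?D ^^ n) f) s = dr ?G (x, s)"
 proof (rule vector_derivative_within[rotated])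
 have "at_right s <= at s within {0..}" using s by (intro at_le) auto
 thus "at s within {0..} ~= bot" using trivial_limit_at_right_real[of s] by (metis bot.extremum_uniqueI)
 qed
 thus "(?D ^^ Suc n) f s = (pdv (0, 1) ^^ Suc n) F (x, s)" by simp
 qed
 qed (use f in auto)
 thus ?thesis using S(2) by (simp add: taylor_coeff_def tc_def)
qed

section \<open>The linearised curvature of the model metric\<close>

lemma sum_idx: "(SUM I:UNIV. f I) = f Xinf + f X0 + f X1 + (f X1bar :: 'c::comm_monoid_add)" by (simp add: UNIV_idx add.assoc)

text \<open>The complex hyperbolic metric, its inverse and the bracket relations of its frame.\<close>

fun g0 :: "complex i2" where
 "g0 Xinf Xinf = 4" | "g0 X0 X0 = 1" | "g0 X1 X1bar = 1" | "g0 X1bar X1 = 1" | "g0 _ _ = 0"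

fun gi0 :: "complex i2" where
 "gi0 Xinf Xinf = 1 / 4" | "gi0 X0 X0 = 1" | "gi0 X1 X1bar = 1" | "gi0 X1bar X1 = 1" | "gi0 _ _ = 0"

fun C0 :: "complex i3" where
 "C0 Xinf X0 X0 = 2" | "C0 X0 Xinf X0 = - 2" | "C0 Xinf X1 X1 = 1" | "C0 X1 Xinf X1 = - 1"
| "C0 Xinf X1bar X1bar = 1" | "C0 X1bar Xinf X1bar = - 1" | "C0 X1 X1bar X0 = - \<i>" | "C0 X1bar X1 X0 = \<i>"
| "C0 _ _ _ = 0"

text \<open>The frame vectors acting on \<open>rho ^ m\<close> to leading order: the one along
  \<open>rho\<close> multiplies by \<open>m\<close>, while the others carry positive powers of
  \<open>rho\<close> and shift into higher orders.\<close>

fun einf :: "complex => idx => complex" where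
 "einf m Xinf = m" | "einf m _ = 0"

text \<open>First variations along \<open>g0 + rho\<^sup>m k\<close>: a suffix \<open>0\<close> is the value at \<open>rho = 0\<close>, a suffix \<open>1\<close> the
 coefficient of \<open>rho\<^sup>m\<close> up to terms that do not involve \<open>k\<close>.\<close>

definition L0 :: "complex i3" where
 "L0 I J L = 1/2 * (SUM M:UNIV. C0 I J M * g0 M L - C0 J L M * g0 M I - C0 I L M * g0 M J)"

definition L1 :: "complex => complex i2 => complex i3" where
 "L1 m k I J L = 1/2 * (einf m I * k J L + einf m J * k I L - einf m L * k I J
 + (SUM M:UNIV. C0 I J M * k M L - C0 J L M * k M I - C0 I L M * k M J))"

definition gi1 :: "complex i2 => complex i2" where
 "gi1 k I J = - (SUM A:UNIV. SUM B:UNIV. gi0 I A * k A B * gi0 B J)"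

definition G0 :: "complex i3" where
 "G0 I J K = (SUM L:UNIV. L0 I J L * gi0 L K)"

definition G1 :: "complex => complex i2 => complex i3" where
 "G1 m k I J K = (SUM L:UNIV. L0 I J L * gi1 k L K + L1 m k I J L * gi0 L K)"

definition R0 :: "complex i4" where
 "R0 I J K L = (SUM N:UNIV. G0 L I N * G0 K N J - G0 K I N * G0 L N J)
 - (SUM N:UNIV. (G0 K L N - G0 L K N) * G0 N I J)"

definition R1 :: "complex => complex i2 => complex i4" where
 "R1 m k I J K L = einf m K * G1 m k L I J - einf m L * G1 m k K I J
 + (SUM N:UNIV. (G0 L I N * G1 m k K N J + G1 m k L I N * G0 K N J) - (G0 K I N * G1 m k L N J + G1 m k K I N * G0 L N J))
 - (SUM N:UNIV. (G0 K L N - G0 L K N) * G1 m k N I J + (G1 m k K L N - G1 m k L K N) * G0 N I J)"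

definition Ric0 :: "complex i2" where
 "Ric0 I J = (SUM K:UNIV. R0 J K K I)"

definition Ric1 :: "complex => complex i2 => complex i2" where
 "Ric1 m k I J = (SUM K:UNIV. R1 m k J K K I)"

text \<open>The Weyl tensor of an Einstein metric with \<open>P = - g / 4\<close>.\<close>

definition W0 :: "complex i4" where
 "W0 I J K L = (SUM N:UNIV. g0 J N * R0 I N K L) - 1/2 * (g0 I K * g0 J L - g0 J K * g0 I L)"

definition W1 :: "complex => complex i2 => complex i4" where
 "W1 m k I J K L = (SUM N:UNIV. g0 J N * R1 m k I N K L + k J N * R0 I N K L)
 - 1/2 * ((g0 I K * k J L + k I K * g0 J L) - (g0 J K * k I L + k J K * g0 I L))"

text \<open>First variation of the square root of \<open>- det g\<close>. At the model the root is
  2, so the variation is the trace of \<open>k\<close>, which for normal \<open>k\<close> is this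
  expression.\<close>

definition S1 :: "complex i2 => complex" where
 "S1 k = k X0 X0 + 2 * k X1 X1bar"

text \<open>The product rule for \<open>s * h * h * W\<close>, where \<open>s\<close> is the root of
  \<open>- det g\<close> with value 2 at the model; the duality operator varies together with the
  curvature.\<close>

definition Wm1 :: "complex => complex i2 => complex i4" where
 "Wm1 m k I J K L = 1/2 * (W1 m k I J K L - 1/2 * (SUM A:UNIV. SUM B:UNIV. SUM P:UNIV. SUM Q:UNIV.
 \<i> * alt_symbol K L A B * (2 * gi0 A P * gi0 B Q * W1 m k I J P Q
 + (2 * gi0 A P * gi1 k B Q + (2 * gi1 k A P + S1 k * gi0 A P) * gi0 B Q) * W0 I J P Q)))"

lemma G0_tab [simp]:
 "G0 Xinf Xinf Xinf = 0"
 "G0 Xinf Xinf X0 = 0"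
 "G0 Xinf Xinf X1 = 0"
 "G0 Xinf Xinf X1bar = 0"
 "G0 Xinf X0 Xinf = 0"
 "G0 Xinf X0 X0 = 0"
 "G0 Xinf X0 X1 = 0"
 "G0 Xinf X0 X1bar = 0"
 "G0 Xinf X1 Xinf = 0"
 "G0 Xinf X1 X0 = 0"
 "G0 Xinf X1 X1 = 0"
 "G0 Xinf X1 X1bar = 0"
 "G0 Xinf X1bar Xinf = 0"
 "G0 Xinf X1bar X0 = 0"
 "G0 Xinf X1bar X1 = 0"
 "G0 Xinf X1bar X1bar = 0"
 "G0 X0 Xinf Xinf = 0"
 "G0 X0 Xinf X0 = (- 2)"
 "G0 X0 Xinf X1 = 0"
 "G0 X0 Xinf X1bar = 0"
 "G0 X0 X0 Xinf = 1 / 2"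
 "G0 X0 X0 X0 = 0"
 "G0 X0 X0 X1 = 0"
 "G0 X0 X0 X1bar = 0"
 "G0 X0 X1 Xinf = 0"
 "G0 X0 X1 X0 = 0"
 "G0 X0 X1 X1 = (1 / 2) * \<i>"
 "G0 X0 X1 X1bar = 0"
 "G0 X0 X1bar Xinf = 0"
 "G0 X0 X1bar X0 = 0"
 "G0 X0 X1bar X1 = 0"
 "G0 X0 X1bar X1bar = (- (1/2 * \<i>))"
 "G0 X1 Xinf Xinf = 0"
 "G0 X1 Xinf X0 = 0"
 "G0 X1 Xinf X1 = (- 1)"
 "G0 X1 Xinf X1bar = 0"
 "G0 X1 X0 Xinf = 0"
 "G0 X1 X0 X0 = 0"
 "G0 X1 X0 X1 = (1 / 2) * \<i>"
 "G0 X1 X0 X1bar = 0"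
 "G0 X1 X1 Xinf = 0"
 "G0 X1 X1 X0 = 0"
 "G0 X1 X1 X1 = 0"
 "G0 X1 X1 X1bar = 0"
 "G0 X1 X1bar Xinf = 1 / 4"
 "G0 X1 X1bar X0 = (- (1/2 * \<i>))"
 "G0 X1 X1bar X1 = 0"
 "G0 X1 X1bar X1bar = 0"
 "G0 X1bar Xinf Xinf = 0"
 "G0 X1bar Xinf X0 = 0"
 "G0 X1bar Xinf X1 = 0"
 "G0 X1bar Xinf X1bar = (- 1)"
 "G0 X1bar X0 Xinf = 0"
 "G0 X1bar X0 X0 = 0"
 "G0 X1bar X0 X1 = 0"
 "G0 X1bar X0 X1bar = (- (1/2 * \<i>))"
 "G0 X1bar X1 Xinf = 1 / 4"
 "G0 X1bar X1 X0 = (1 / 2) * \<i>"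
 "G0 X1bar X1 X1 = 0"
 "G0 X1bar X1 X1bar = 0"
 "G0 X1bar X1bar Xinf = 0"
 "G0 X1bar X1bar X0 = 0"
 "G0 X1bar X1bar X1 = 0"
 "G0 X1bar X1bar X1bar = 0" by (simp_all add: G0_def L0_def sum_idx)

text \<open>The model solves the equation exactly, which is why the Einstein tensor has constant
  term 0 in \<open>P_Einstein\<close>.\<close>

lemma Einstein_model: "Ric0 I J + 3/2 * g0 I J = 0" by (cases I; cases J; simp add: Ric0_def R0_def sum_idx)

text \<open>Variations that leave the components with an index \<open>Xinf\<close> fixed, as the
  normal form demands.\<close>

definition normal_sym :: "complex i2 => bool" where
 "normal_sym k \<longleftrightarrow> (ALL I J. k I J = k J I) & (ALL I. k Xinf I = 0)"

lemma normal_symD: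
 assumes "normal_sym k"
 shows "k Xinf I = 0" "k I Xinf = 0" "k X1 X0 = k X0 X1" "k X1bar X0 = k X0 X1bar" "k X1bar X1 = k X1 X1bar"
 using assms unfolding normal_sym_def by metis+

lemma G1_tab:
 assumes "normal_sym k"
 shows "G1 m k Xinf Xinf Xinf = 0"
 "G1 m k Xinf Xinf X0 = 0"
 "G1 m k Xinf Xinf X1 = 0"
 "G1 m k Xinf Xinf X1bar = 0"
 "G1 m k Xinf X0 Xinf = 0"
 "G1 m k Xinf X0 X0 = (1 / 2 * m) * k X0 X0"
 "G1 m k Xinf X0 X1 = (1 / 2 * m + 1 / 2) * k X0 X1bar"
 "G1 m k Xinf X0 X1bar = (1 / 2 * m + 1 / 2) * k X0 X1"
 "G1 m k Xinf X1 Xinf = 0"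
 "G1 m k Xinf X1 X0 = (1 / 2 * m + (- 1 / 2)) * k X0 X1"
 "G1 m k Xinf X1 X1 = (1 / 2 * m) * k X1 X1bar"
 "G1 m k Xinf X1 X1bar = (1 / 2 * m) * k X1 X1"
 "G1 m k Xinf X1bar Xinf = 0"
 "G1 m k Xinf X1bar X0 = (1 / 2 * m + (- 1 / 2)) * k X0 X1bar"
 "G1 m k Xinf X1bar X1 = (1 / 2 * m) * k X1bar X1bar"
 "G1 m k Xinf X1bar X1bar = (1 / 2 * m) * k X1 X1bar"
 "G1 m k X0 Xinf Xinf = 0"
 "G1 m k X0 Xinf X0 = (1 / 2 * m) * k X0 X0"
 "G1 m k X0 Xinf X1 = (1 / 2 * m + 1 / 2) * k X0 X1bar"
 "G1 m k X0 Xinf X1bar = (1 / 2 * m + 1 / 2) * k X0 X1"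
 "G1 m k X0 X0 Xinf = ((- 1 / 8) * m + 1 / 2) * k X0 X0"
 "G1 m k X0 X0 X0 = 0"
 "G1 m k X0 X0 X1 = 0"
 "G1 m k X0 X0 X1bar = 0"
 "G1 m k X0 X1 Xinf = ((- 1 / 8) * m + 3 / 8) * k X0 X1"
 "G1 m k X0 X1 X0 = (- (1/2 * \<i>)) * k X0 X1"
 "G1 m k X0 X1 X1 = (1/2 * \<i>) * k X0 X0 + (- (1/2 * \<i>)) * k X1 X1bar"
 "G1 m k X0 X1 X1bar = (- (1/2 * \<i>)) * k X1 X1"
 "G1 m k X0 X1bar Xinf = ((- 1 / 8) * m + 3 / 8) * k X0 X1bar"
 "G1 m k X0 X1bar X0 = (1/2 * \<i>) * k X0 X1bar"
 "G1 m k X0 X1bar X1 = (1/2 * \<i>) * k X1bar X1bar"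
 "G1 m k X0 X1bar X1bar = (- (1/2 * \<i>)) * k X0 X0 + (1/2 * \<i>) * k X1 X1bar"
 "G1 m k X1 Xinf Xinf = 0"
 "G1 m k X1 Xinf X0 = (1 / 2 * m + (- 1 / 2)) * k X0 X1"
 "G1 m k X1 Xinf X1 = (1 / 2 * m) * k X1 X1bar"
 "G1 m k X1 Xinf X1bar = (1 / 2 * m) * k X1 X1"
 "G1 m k X1 X0 Xinf = ((- 1 / 8) * m + 3 / 8) * k X0 X1"
 "G1 m k X1 X0 X0 = (- (1/2 * \<i>)) * k X0 X1"
 "G1 m k X1 X0 X1 = (1/2 * \<i>) * k X0 X0 + (- (1/2 * \<i>)) * k X1 X1bar"
 "G1 m k X1 X0 X1bar = (- (1/2 * \<i>)) * k X1 X1"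
 "G1 m k X1 X1 Xinf = ((- 1 / 8) * m + 1 / 4) * k X1 X1"
 "G1 m k X1 X1 X0 = 0"
 "G1 m k X1 X1 X1 = (\<i>) * k X0 X1"
 "G1 m k X1 X1 X1bar = 0"
 "G1 m k X1 X1bar Xinf = ((- 1 / 8) * m + 1 / 4) * k X1 X1bar"
 "G1 m k X1 X1bar X0 = 0"
 "G1 m k X1 X1bar X1 = (1/2 * \<i>) * k X0 X1bar"
 "G1 m k X1 X1bar X1bar = (- (1/2 * \<i>)) * k X0 X1"
 "G1 m k X1bar Xinf Xinf = 0"
 "G1 m k X1bar Xinf X0 = (1 / 2 * m + (- 1 / 2)) * k X0 X1bar"
 "G1 m k X1bar Xinf X1 = (1 / 2 * m) * k X1bar X1bar"
 "G1 m k X1bar Xinf X1bar = (1 / 2 * m) * k X1 X1bar"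
 "G1 m k X1bar X0 Xinf = ((- 1 / 8) * m + 3 / 8) * k X0 X1bar"
 "G1 m k X1bar X0 X0 = (1/2 * \<i>) * k X0 X1bar"
 "G1 m k X1bar X0 X1 = (1/2 * \<i>) * k X1bar X1bar"
 "G1 m k X1bar X0 X1bar = (- (1/2 * \<i>)) * k X0 X0 + (1/2 * \<i>) * k X1 X1bar"
 "G1 m k X1bar X1 Xinf = ((- 1 / 8) * m + 1 / 4) * k X1 X1bar"
 "G1 m k X1bar X1 X0 = 0"
 "G1 m k X1bar X1 X1 = (1/2 * \<i>) * k X0 X1bar"
 "G1 m k X1bar X1 X1bar = (- (1/2 * \<i>)) * k X0 X1"
 "G1 m k X1bar X1bar Xinf = ((- 1 / 8) * m + 1 / 4) * k X1bar X1bar"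
 "G1 m k X1bar X1bar X0 = 0"
 "G1 m k X1bar X1bar X1 = 0"
 "G1 m k X1bar X1bar X1bar = ((- (\<i>))) * k X0 X1bar" by (simp_all add: G1_def L0_def L1_def gi1_def sum_idx normal_symD[OF assms] algebra_simps)

text \<open>The indicial matrix decouples. On \<open>k X1 X1\<close> it is a scalar with roots 0 and
  4. On \<open>k X0 X1\<close> the tangential component has the root 5, but the component with index
  \<open>Xinf\<close> has no positive root. On \<open>k X0 X0\<close> and \<open>k X1 X1bar\<close>
  there is a 2 by 2 block of determinant \<open>q * (q + 2)\<close> with
  \<open>q = - m * (m - 6) / 8\<close>, hence with roots 0, 6, 8 and -2.\<close>

lemma Ric1_tab:
 assumes "normal_sym k"
 shows "Ric1 m k Xinf Xinf + 3/2 * k Xinf Xinf = - (m * (m - 4) / 2 * k X0 X0) - m * (m - 2) * k X1 X1bar"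
 and "Ric1 m k Xinf X1 + 3/2 * k Xinf X1 = - (\<i> * (m + 1) / 2 * k X0 X1)"
 and "Ric1 m k Xinf X1bar + 3/2 * k Xinf X1bar = \<i> * (m + 1) / 2 * k X0 X1bar"
 and "Ric1 m k X0 X0 + 3/2 * k X0 X0 = (1/2 - m * (m - 6) / 8) * k X0 X0 + (m - 2) / 2 * k X1 X1bar"
 and "Ric1 m k X1 X1bar + 3/2 * k X1 X1bar = (m - 4) / 8 * k X0 X0 + (1 - m * (m - 6) / 8) * k X1 X1bar"
 and "Ric1 m k X0 X1 + 3/2 * k X0 X1 = - ((m - 5) * (m + 1) / 8 * k X0 X1)"
 and "Ric1 m k X0 X1bar + 3/2 * k X0 X1bar = - ((m - 5) * (m + 1) / 8 * k X0 X1bar)"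
 and "Ric1 m k X1 X1 + 3/2 * k X1 X1 = - (m * (m - 4) / 8 * k X1 X1)"
 and "Ric1 m k X1bar X1bar + 3/2 * k X1bar X1bar = - (m * (m - 4) / 8 * k X1bar X1bar)"
 by (simp_all add: Ric1_def R1_def sum_idx G1_tab[OF assms] normal_symD[OF assms] field_simps power2_eq_square)

section \<open>Determinants and the linearised anti-self-dual Weyl tensor\<close>

lemma det_idx:
 "det (A :: 'a::comm_ring_1 ^ idx ^ idx) =
 A $ Xinf $ Xinf * (A $ X0 $ X0 * (A $ X1 $ X1 * A $ X1bar $ X1bar - A $ X1 $ X1bar * A $ X1bar $ X1)
 - A $ X0 $ X1 * (A $ X1 $ X0 * A $ X1bar $ X1bar - A $ X1 $ X1bar * A $ X1bar $ X0)
 + A $ X0 $ X1bar * (A $ X1 $ X0 * A $ X1bar $ X1 - A $ X1 $ X1 * A $ X1bar $ X0))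
 - A $ Xinf $ X0 * (A $ X0 $ Xinf * (A $ X1 $ X1 * A $ X1bar $ X1bar - A $ X1 $ X1bar * A $ X1bar $ X1)
 - A $ X0 $ X1 * (A $ X1 $ Xinf * A $ X1bar $ X1bar - A $ X1 $ X1bar * A $ X1bar $ Xinf)
 + A $ X0 $ X1bar * (A $ X1 $ Xinf * A $ X1bar $ X1 - A $ X1 $ X1 * A $ X1bar $ Xinf))
 + A $ Xinf $ X1 * (A $ X0 $ Xinf * (A $ X1 $ X0 * A $ X1bar $ X1bar - A $ X1 $ X1bar * A $ X1bar $ X0)
 - A $ X0 $ X0 * (A $ X1 $ Xinf * A $ X1bar $ X1bar - A $ X1 $ X1bar * A $ X1bar $ Xinf)
 + A $ X0 $ X1bar * (A $ X1 $ Xinf * A $ X1bar $ X0 - A $ X1 $ X0 * A $ X1bar $ Xinf))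
 - A $ Xinf $ X1bar * (A $ X0 $ Xinf * (A $ X1 $ X0 * A $ X1bar $ X1 - A $ X1 $ X1 * A $ X1bar $ X0)
 - A $ X0 $ X0 * (A $ X1 $ Xinf * A $ X1bar $ X1 - A $ X1 $ X1 * A $ X1bar $ Xinf)
 + A $ X0 $ X1 * (A $ X1 $ Xinf * A $ X1bar $ X0 - A $ X1 $ X0 * A $ X1bar $ Xinf))"
proof -
 have f1: "finite {X0, X1, X1bar}" "Xinf ~: {X0, X1, X1bar}"
 and f2: "finite {X1, X1bar}" "X0 ~: {X1, X1bar}"
 and f3: "finite {X1bar}" "X1 ~: {X1bar}" by auto
 show ?thesis unfolding det_def UNIV_idx unfolding sum_over_permutations_insert[OF f1] unfolding sum_over_permutations_insert[OF f2]
 unfolding sum_over_permutations_insert[OF f3]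
 by (simp add: sign_swap_id permutation_swap_id sign_compose permutation_compose sign_id swap_id_eq algebra_simps)
qed

lemma alt_inf1: "alt_symbol Xinf X1 A B = (if A = X0 & B = X1bar then 1 else if A = X1bar & B = X0 then - 1 else 0)"
 by (cases A; cases B; simp add: alt_symbol_def det_idx)

lemma alt_inf0: "alt_symbol Xinf X0 A B = (if A = X1 & B = X1bar then - 1 else if A = X1bar & B = X1 then 1 else 0)"
 by (cases A; cases B; simp add: alt_symbol_def det_idx)

lemma gi1_tab:
 assumes "normal_sym k"
 shows "gi1 k Xinf I = 0" "gi1 k I Xinf = 0" "gi1 k X0 X0 = - k X0 X0" "gi1 k X0 X1 = - k X0 X1bar"
 "gi1 k X1 X0 = - k X0 X1bar" "gi1 k X0 X1bar = - k X0 X1" "gi1 k X1bar X0 = - k X0 X1"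
 "gi1 k X1 X1 = - k X1bar X1bar" "gi1 k X1 X1bar = - k X1 X1bar" "gi1 k X1bar X1 = - k X1 X1bar"
 "gi1 k X1bar X1bar = - k X1 X1" by (cases I; simp add: gi1_def sum_idx normal_symD[OF assms])+

text \<open>The two components that resolve resonances. At \<open>m = 4\<close> the first one is
  \<open>k X1 X1\<close> itself. At \<open>m = 6\<close> the second is independent of the three
  Einstein components on \<open>k X0 X0\<close> and \<open>k X1 X1bar\<close>, which are
  proportional there.\<close>

lemma Wm1_tab:
 assumes "normal_sym k"
 shows "Wm1 m k Xinf X1 Xinf X1 = m * (m - 3) / 4 * k X1 X1"
 and "Wm1 m k Xinf X0 Xinf X0 = (m\<^sup>2 - 2 * m - 2) / 4 * k X0 X0 - (m - 2) / 2 * k X1 X1bar"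
proof -
 \<comment> \<open>With the alternating symbol pulled to the front, two terms of the sum over
   \<open>A\<close> and \<open>B\<close> are left; only then are the curvature tables
   expanded.\<close>
 have a: "(SUM A:UNIV. SUM B:UNIV. alt_symbol Xinf X1 A B * f A B) = f X0 X1bar - f X1bar X0"
 "(SUM A:UNIV. SUM B:UNIV. alt_symbol Xinf X0 A B * f A B) = f X1bar X1 - f X1 X1bar" for f :: "complex i2"
 by (simp_all add: sum_idx alt_inf1 alt_inf0)
 have w: "Wm1 m k I J K L = 1/2 * (W1 m k I J K L - \<i> / 2 * (SUM A:UNIV. SUM B:UNIV. alt_symbol K L A B * (SUM P:UNIV. SUM Q:UNIV.
 (2 * gi0 A P * gi0 B Q * W1 m k I J P Q
 + (2 * gi0 A P * gi1 k B Q + (2 * gi1 k A P + S1 k * gi0 A P) * gi0 B Q) * W0 I J P Q))))" for I J K L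
 by (simp add: Wm1_def sum_distrib_left mult_ac)
 show "Wm1 m k Xinf X1 Xinf X1 = m * (m - 3) / 4 * k X1 X1" unfolding w a
 by (simp add: sum_idx gi1_tab[OF assms] S1_def W0_def W1_def R0_def R1_def G1_tab[OF assms] normal_symD[OF assms] field_simps power2_eq_square)
 show "Wm1 m k Xinf X0 Xinf X0 = (m\<^sup>2 - 2 * m - 2) / 4 * k X0 X0 - (m - 2) / 2 * k X1 X1bar" unfolding w a
 by (simp add: sum_idx gi1_tab[OF assms] S1_def W0_def W1_def R0_def R1_def G1_tab[OF assms] normal_symD[OF assms] field_simps power2_eq_square)
qed

section \<open>Curvature of a formal metric\<close>

type_synonym 'x ser = "nat => 'x => complex"

definition smul :: "'x ser => 'x ser => 'x ser" where
 "smul f g n x = (\<Sum>i=0..n. f i x * g (n - i) x)"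

text \<open>Here \<open>E\<close> is the action of the frame on series and \<open>C\<close> the
  series of its structure functions. From here on the curvature is built algebraically from
  coefficients, so that no convergence is presupposed.\<close>

definition Lo :: "(idx => 'x ser => 'x ser) => 'x ser i3 => 'x ser i2 =>
 'x ser i3" where
 "Lo E C g I J L = (%n x. 1/2 * (E I (g J L) n x + E J (g I L) n x - E L (g I J) n x
 + (SUM M:UNIV. smul (C I J M) (g M L) n x - smul (C J L M) (g M I) n x - smul (C I L M) (g M J) n x)))"

definition Ga :: "(idx => 'x ser => 'x ser) => 'x ser i3 => 'x ser i2 =>
 'x ser i2 => 'x ser i3" where
 "Ga E C g h I J K = (%n x. SUM L:UNIV. smul (Lo E C g I J L) (h L K) n x)"

definition Rm :: "(idx => 'x ser => 'x ser) => 'x ser i3 =>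
 'x ser i4" where
 "Rm E G I J K L = (%n x. E K (G L I J) n x - E L (G K I J) n x
 + (SUM N:UNIV. smul (G L I N) (G K N J) n x - smul (G K I N) (G L N J) n x)
 - (SUM N:UNIV. smul (%n x. G K L N n x - G L K N n x) (G N I J) n x))"

definition Rc :: "(idx => 'x ser => 'x ser) => 'x ser i3 => 'x ser i2" where
 "Rc E G I J = (%n x. SUM K:UNIV. Rm E G J K K I n x)"

text \<open>The Schouten tensor is replaced by \<open>- g / 4\<close>, its value for an Einstein
  metric with \<open>Ric = - 3/2 g\<close>. For formal solutions this is the Weyl tensor, and no
  trace has to be linearised.\<close>

definition We :: "(idx => 'x ser => 'x ser) => 'x ser i3 => 'x ser i2 =>
 'x ser i4" where
 "We E G g I J K L = (%n x. (SUM N:UNIV. smul (g J N) (Rm E G I N K L) n x)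
 - 1/2 * (smul (g I K) (g J L) n x - smul (g J K) (g I L) n x))"

definition Wmin :: "(idx => 'x ser => 'x ser) => 'x ser i3 => 'x ser i2 =>
 'x ser i2 => 'x ser => 'x ser i4" where
 "Wmin E G g h s I J K L = (%n x. 1/2 * (We E G g I J K L n x
 - 1/2 * (SUM A:UNIV. SUM B:UNIV. SUM P:UNIV. SUM Q:UNIV.
 (\<i> * alt_symbol K L A B) * smul (smul (smul s (h A P)) (h B Q)) (We E G g I J P Q) n x)))"

text \<open>\<open>P l f a b\<close>: the series \<open>f\<close> has the constant term \<open>a\<close> and, modulo a class of negligible
 series, the principal part \<open>b\<close>; \<open>l\<close> counts the derivatives that may still be taken. The two
 instances neglect series with real analytic coefficients, and series that are small in norm.\<close>

locale dual_calc =
 fixes Om :: "'x set" and P :: "nat => 'x ser => complex => 'x ser => bool" and E :: "idx => 'x ser => 'x ser"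
 assumes P_cong: "P l f a b ==> (!!n x. x : Om ==> f n x = f' n x) ==> a = a' ==>
 (!!n x. x : Om ==> b n x = b' n x) ==> P l f' a' b'"
 and P_low: "P (Suc l) f a b ==> P l f a b"
 and P_const: "P l (%n x. if n = 0 then c else 0) c (%n x. 0)"
 and P_add: "P l f a b ==> P l f' a' b' ==> P l (%n x. f n x + f' n x) (a + a') (%n x. b n x + b' n x)"
 and P_mult: "P l f a b ==> P l f' a' b' ==> P l (smul f f') (a * a') (%n x. a * b' n x + b n x * a')"
 and P_E: "P (Suc l) f a b ==> P l (E I f) 0 (%n x. einf (of_nat n) I * b n x)"
begin

lemma P_cmult: "P l f a b ==> P l (%n x. c * f n x) (c * a) (%n x. c * b n x)"
proof (rule P_cong[OF P_mult[OF P_const[of l c]]])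
 fix n x
 have "smul (%n x. if n = 0 then c else 0) f n x = (\<Sum>i=0..n. if i = 0 then c * f n x else 0)" unfolding smul_def by (rule sum.cong) auto
 thus "smul (%n x. if n = 0 then c else 0) f n x = c * f n x" by simp
qed auto

lemma P_eq: "P l f a b ==> a = a' ==> (!!n x. b n x = b' n x) ==> P l f a' b'" by (erule P_cong) simp_all

lemma P_diff:
 assumes "P l f a b" "P l f' a' b'"
 shows "P l (%n x. f n x - f' n x) (a - a') (%n x. b n x - b' n x)" by (rule P_cong[OF P_add[OF assms(1) P_cmult[OF assms(2), of "- 1"]]]) auto

lemma P_sum:
 assumes "!!I. P l (f I) (a I) (b I)"
 shows "P l (%n x. SUM I:(UNIV :: idx set). f I n x) (SUM I:UNIV. a I) (%n x. SUM I:UNIV. b I n x)"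
 unfolding sum_idx by (intro P_add assms)

lemmas P_rules = P_cmult P_diff P_add P_sum P_mult

context
 fixes g h :: "'x ser i2" and C :: "'x ser i3"
 and k :: "nat => 'x => complex i2"
 assumes g: "!!I J. P 2 (g I J) (g0 I J) (%n x. k n x I J)"
 and h: "!!I J. P 2 (h I J) (gi0 I J) (%n x. gi1 (k n x) I J)"
 and C: "!!I J K. P 2 (C I J K) (C0 I J K) (%n x. 0)"
begin

text \<open>Metric, inverse and structure functions enter at level 2, the connection at level 1 and
  the curvature at level 0, one level for each derivative.\<close>

lemma down: "P 2 f a b ==> P 1 f a b" "P 1 f a b ==> P 0 f a b" "P 2 f a b ==> P 0 f a b"
 using P_low[of 1 f a b] P_low[of 0 f a b] by (simp_all add: numeral_2_eq_2)

lemma P_E1: "P 2 f a b ==> P 1 (E I f) 0 (%n x. einf (of_nat n) I * b n x)"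
 and P_E0: "P 1 f a b ==> P 0 (E I f) 0 (%n x. einf (of_nat n) I * b n x)" using P_E[of 1 f a b I] P_E[of 0 f a b I] by (simp_all add: numeral_2_eq_2)

lemma P_Lo: "P 1 (Lo E C g I J L) (L0 I J L) (%n x. L1 (of_nat n) (k n x) I J L)" unfolding Lo_def
 by (rule P_eq, (rule P_rules P_E1 g down(1)[OF g] down(1)[OF C])+)
 (simp_all only: L0_def L1_def mult_zero_left add_0_right diff_0_right add_0_left)

lemma P_Ga: "P 1 (Ga E C g h I J K) (G0 I J K) (%n x. G1 (of_nat n) (k n x) I J K)" unfolding Ga_def
 by (rule P_eq, (rule P_rules P_Lo down(1)[OF h])+)
 (simp_all only: G0_def G1_def)

lemma P_Rm: "P 0 (Rm E (Ga E C g h) I J K L) (R0 I J K L) (%n x. R1 (of_nat n) (k n x) I J K L)" unfolding Rm_def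
 by (rule P_eq, (rule P_rules P_E0 P_Ga down(2)[OF P_Ga])+)
 (simp_all only: R0_def R1_def diff_self add_0_left)

lemma P_Rc: "P 0 (Rc E (Ga E C g h) I J) (Ric0 I J) (%n x. Ric1 (of_nat n) (k n x) I J)" unfolding Rc_def
 by (rule P_eq, (rule P_rules P_Rm)+) (simp_all only: Ric0_def Ric1_def)

lemma P_Einstein: "P 0 (%n x. Rc E (Ga E C g h) I J n x + 3/2 * g I J n x) 0
 (%n x. Ric1 (of_nat n) (k n x) I J + 3/2 * k n x I J)" by (rule P_eq, (rule P_rules P_Rc down(3)[OF g])+) (simp_all only: Einstein_model)

lemma P_We: "P 0 (We E (Ga E C g h) g I J K L) (W0 I J K L) (%n x. W1 (of_nat n) (k n x) I J K L)" unfolding We_def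
 by (rule P_eq, (rule P_rules P_Rm down(3)[OF g])+) (simp_all only: W0_def W1_def)

text \<open>Only the first order part is evaluated later, so the constant term is left
  existential.\<close>

lemma P_Wmin:
 assumes s: "P 0 s 2 (%n x. S1 (k n x))"
 shows "EX a. P 0 (Wmin E (Ga E C g h) g h s I J K L) a (%n x. Wm1 (of_nat n) (k n x) I J K L)"
proof -
 have "P 0 (Wmin E (Ga E C g h) g h s I J K L) (1/2 * (W0 I J K L - 1/2 * (SUM A:UNIV. SUM B:UNIV. SUM P:UNIV. SUM Q:UNIV.
 (\<i> * alt_symbol K L A B) * (2 * gi0 A P * gi0 B Q * W0 I J P Q)))) (%n x. Wm1 (of_nat n) (k n x) I J K L)" unfolding Wmin_def
 by (rule P_eq, (rule P_rules P_We down(3)[OF h] s)+) (simp_all only: Wm1_def)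
 thus ?thesis by blast
qed

end

end

section \<open>Formal Einstein metrics have real analytic coefficients\<close>

definition Vf :: "('x => 'x::euclidean_space => complex) => ('x => complex) => 'x => complex" where
 "Vf z f x = (SUM b:Basis. z b x * pdv b f x)"

fun wt :: "idx => nat" where
 "wt Xinf = 0" | "wt X0 = 2" | "wt X1 = 1" | "wt X1bar = 1"

text \<open>The Theta-frame acting on coefficients: the vector along \<open>rho\<close> multiplies
  by the order, the others differentiate along the boundary and raise the order by
  \<open>wt I\<close>.\<close>

definition Eop :: "(idx => 'x => 'x::euclidean_space => complex) => idx => 'x ser => 'x ser" where
 "Eop z I f n x = (if I = Xinf then of_nat n * f n x
 else if n < wt I then 0 else Vf (z I) (f (n - wt I)) x)"

text \<open>The determinant of a metric in normal form with reversed sign; the factor 4 is the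
  component \<open>Xinf Xinf\<close>, and the symmetry of \<open>g\<close> is built in.\<close>

definition dets :: "'x ser i2 => 'x ser" where
 "dets g = (%n x. (- 4) * (smul (g X0 X0) (%n x. smul (g X1 X1) (g X1bar X1bar) n x - smul (g X1 X1bar) (g X1 X1bar) n x) n x
 - smul (g X0 X1) (%n x. smul (g X0 X1) (g X1bar X1bar) n x - smul (g X1 X1bar) (g X0 X1bar) n x) n x
 + smul (g X0 X1bar) (%n x. smul (g X0 X1) (g X1 X1bar) n x - smul (g X1 X1) (g X0 X1bar) n x) n x))"

lemma wt_pos: "I ~= Xinf ==> wt I > 0" by (cases I) auto

lemma einf_simps [simp]: "I ~= Xinf ==> einf m I = 0" by (cases I) auto

lemma gi0_g0: "(SUM J:UNIV. gi0 I J * g0 J K) = (if I = K then 1 else 0)" by (cases I; cases K; simp add: sum_idx)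

text \<open>A metric as formal series over the open set \<open>Om\<close>. The structure functions
  are polynomials of degree 2 in the boundary variable, since brackets of the Theta-frame leave at
  most two surplus powers of it.\<close>

locale formal_metric =
 fixes Om :: "'x::euclidean_space set" and z :: "idx => 'x => 'x => complex"
 and C :: "'x ser i3" and g h :: "'x ser i2"
 assumes Om: "open Om"
 and z: "!!I b. b : Basis ==> I ~= Xinf ==> anl (z I b) Om"
 and C: "!!I J K n. anl (C I J K n) Om" "!!I J K x. x : Om ==> C I J K 0 x = C0 I J K"
 "!!I J K n x. x : Om ==> n > 2 ==> C I J K n x = 0"
 and g_sym: "!!I J n x. x : Om ==> g I J n x = g J I n x"
 and g_0: "!!I J x. x : Om ==> g I J 0 x = g0 I J"
 and g_inf: "!!I n x. x : Om ==> n > 0 ==> g Xinf I n x = 0"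
 and gh: "!!I K n x. x : Om ==> (SUM J:UNIV. smul (g I J) (h J K) n x) = (if n = 0 & I = K then 1 else 0)"
begin

lemma an_cong: "anl f Om ==> (!!x. x : Om ==> f x = f' x) ==> anl f' Om" using reg_cong[OF Om, of f f' Analytic] by (simp add: regular_on.simps)

lemma an_c: "anl (%x. c) Om" using reg_const[of Analytic c Om] unfolding regular_on.simps .

lemma an_rules0:
 "anl f Om ==> anl f' Om ==> anl (%x. f x + f' x) Om"
 "anl f Om ==> anl f' Om ==> anl (%x. f x - f' x) Om"
 "anl f Om ==> anl f' Om ==> anl (%x. f x * f' x) Om"
 "anl f Om ==> anl (%x. - f x) Om"
 "anl f Om ==> anl (%x. c * f x) Om"
 "anl f Om ==> anl (%x. f x / c) Om"
 "anl f Om ==> anl (%x. cnj (f x)) Om" using reg_add[OF Om, of Analytic f f'] reg_diff[OF Om, of Analytic f f']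
 reg_mult[OF Om, of Analytic f f'] reg_minus[OF Om, of Analytic f] reg_cmult[OF Om, of Analytic f c]
 reg_cmult[OF Om, of Analytic f "1 / c"] reg_cnj[OF Om, of Analytic f] by (simp_all add: regular_on.simps)

lemmas an_rules = an_c an_rules0

lemma an_sum: "(!!i. i : I ==> anl (f i) Om) ==> anl (%x. SUM i:I. f i x) Om"
 by (induction I rule: infinite_finite_induct) (auto intro: an_rules)

lemma an_Vf: "I ~= Xinf ==> anl f Om ==> anl (Vf (z I) f) Om" unfolding Vf_def[abs_def] by (intro an_sum an_rules z an_deriv)

lemma an_smul: "(!!i. i <= n ==> anl (f i) Om) ==> (!!i. i <= n ==> anl (f' i) Om) ==>
 anl (smul f f' n) Om" unfolding smul_def[abs_def] by (intro an_sum an_rules) auto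

lemma smul_Suc:
 assumes "n > 0"
 shows "smul f f' n x = f 0 x * f' n x + f n x * f' 0 x + (SUM i:{0<..<n}. f i x * f' (n - i) x)"
proof -
 have "{0..n} = insert 0 (insert n {0<..<n})" by auto
 thus ?thesis using assms by (simp add: smul_def)
qed

lemma h_0: "x : Om ==> h I K 0 x = gi0 I K"
proof -
 assume x: "x : Om"
 have *: "(SUM J:UNIV. g0 L J * h J K 0 x) = (if L = K then 1 else 0)" for L using gh[OF x, of L K 0] by (simp add: smul_def g_0[OF x])
 have "h I K 0 x = (SUM J:UNIV. (if I = J then 1 else 0) * h J K 0 x)" by (cases I) (simp_all add: sum_idx)
 also have "... = (SUM L:UNIV. gi0 I L * (SUM J:UNIV. g0 L J * h J K 0 x))" unfolding gi0_g0[symmetric] by (simp add: sum_idx)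
 also have "... = gi0 I K" unfolding * by (cases I; cases K) (simp_all add: sum_idx)
 finally show ?thesis .
qed

text \<open>Solves for the inverse series order by order: \<open>gi0\<close> inverts the constant
  term, and the remaining products involve \<open>h\<close> at lower orders only.\<close>

lemma h_rec:
 assumes x: "x : Om" and n: "n > 0"
 shows "h I K n x = - (SUM L:UNIV. gi0 I L * (SUM J:UNIV. SUM i:{0<..n}. g L J i x * h J K (n - i) x))"
proof -
 have "{0..n} = insert 0 {0<..n}" by auto
 hence sp: "smul f f' n x = f 0 x * f' n x + (SUM i:{0<..n}. f i x * f' (n - i) x)" for f f' :: "'x ser" by (simp add: smul_def)
 have *: "(SUM J:UNIV. g0 L J * h J K n x) = - (SUM J:UNIV. SUM i:{0<..n}. g L J i x * h J K (n - i) x)" for L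
 using gh[OF x, of L K n] n by (simp add: sp g_0[OF x] sum.distrib add_eq_0_iff2)
 have "h I K n x = (SUM J:UNIV. (if I = J then 1 else 0) * h J K n x)" by (cases I) (simp_all add: sum_idx)
 also have "... = (SUM L:UNIV. gi0 I L * (SUM J:UNIV. g0 L J * h J K n x))" unfolding gi0_g0[symmetric] by (simp add: sum_idx)
 also have "... = - (SUM L:UNIV. gi0 I L * (SUM J:UNIV. SUM i:{0<..n}. g L J i x * h J K (n - i) x))"
 unfolding * by (simp add: sum_negf)
 finally show ?thesis .
qed

lemma h_analytic:
 assumes "!!I J i. i <= n ==> anl (g I J i) Om"
 shows "anl (h I K n) Om" using assms
proof (induction n arbitrary: I K rule: less_induct)
 case (less n)
 show ?case
 proof (cases "n = 0")
 case True
 show ?thesis unfolding True by (rule an_cong[OF an_rules(1)[of "gi0 I K"]]) (use h_0 in auto)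
 next
 case False
 have "anl (%x. - (SUM L:UNIV. gi0 I L * (SUM J:UNIV. SUM i:{0<..n}. g L J i x * h J K (n - i) x))) Om"
 by (intro an_rules an_sum) (use less in auto)
 thus ?thesis by (rule an_cong) (use h_rec False in auto)
 qed
qed

text \<open>The components with an index \<open>Xinf\<close> vanish at positive orders anyway;
  setting them to 0 at order 0 as well makes \<open>normal_sym\<close> hold for every
  \<open>n\<close>.\<close>

definition kk :: "nat => 'x => complex i2" where
 "kk n x I J = (if I = Xinf \<or> J = Xinf then 0 else g I J n x)"

lemma normal_kk: "x : Om ==> normal_sym (kk n x)" unfolding normal_sym_def kk_def using g_sym by auto

end

text \<open>The data at the resonances are stated as the induction consumes them: at order 4 a
  vanishing coefficient, at order 6 a coefficient known to be analytic, which covers every value of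
  \<open>lam\<close>.\<close>

locale formal_einstein = formal_metric +
 fixes s :: "'a ser"
 assumes s: "!!n x. x : Om ==> smul s s n x = dets g n x" "!!x. x : Om ==> s 0 x = 2"
 and g_cnj: "!!n x. x : Om ==> g X1bar X1bar n x = cnj (g X1 X1 n x)" "!!n x. x : Om ==> g X0 X1bar n x = cnj (g X0 X1 n x)"
 and Ein: "!!I J n x. x : Om ==> Rc (Eop z) (Ga (Eop z) C g h) I J n x + 3/2 * g I J n x = 0"
 and W4: "!!x. x : Om ==> Wmin (Eop z) (Ga (Eop z) C g h) g h s Xinf X1 Xinf X1 4 x = 0"
 and W6: "anl (Wmin (Eop z) (Ga (Eop z) C g h) g h s Xinf X0 Xinf X0 6) Om"
begin

text \<open>Everything below order \<open>m\<close> is known to be analytic, so only the coefficient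
  of order \<open>m\<close> is tracked, modulo analytic functions.\<close>

definition P1 :: "nat => nat => 'a ser => complex => 'a ser => bool" where
 "P1 m l f a b \<longleftrightarrow> (ALL j<m. anl (f j) Om) & (ALL x:Om. f 0 x = a) \<and>
 anl (%x. f m x - b m x) Om"

text \<open>In a product the mixed terms have orders strictly between 0 and \<open>m\<close> and are
  analytic. A tangential frame vector reaches order \<open>m\<close> only from lower orders, so it
  contributes nothing to the principal part.\<close>

lemma dual_P1:
 assumes m: "m > 0"
 shows "dual_calc Om (P1 m) (Eop z)"
proof
 fix l f a b f' a' b'
 assume P: "P1 m l f a b" and eq: "!!n x. x : Om ==> f n x = f' n x" "a = a'" "!!n x. x : Om ==> b n x = b' n x"
 have "anl (f' j) Om" if "j < m" for j using P that an_cong[of "f j" "f' j"] eq by (auto simp: P1_def)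
 moreover have "anl (%x. f' m x - b' m x) Om" using P an_cong[of "%x. f m x - b m x" "%x. f' m x - b' m x"] eq by (auto simp: P1_def)
 ultimately show "P1 m l f' a' b'" using P eq by (auto simp: P1_def)
next
 fix l f a b assume "P1 m (Suc l) f a b" thus "P1 m l f a b" by (simp add: P1_def)
next
 fix l c show "P1 m l (%n x. if n = 0 then c else 0) c (%n x. 0)" using an_rules(1) by (auto simp: P1_def)
next
 fix l f a b f' a' b' assume P: "P1 m l f a b" "P1 m l f' a' b'"
 have "anl (%x. (f m x - b m x) + (f' m x - b' m x)) Om" by (rule an_rules(2)) (use P in "auto simp: P1_def")
 hence "anl (%x. f m x + f' m x - (b m x + b' m x)) Om" by (rule an_cong) simp
 moreover have "anl (%x. f j x + f' j x) Om" if "j < m" for j by (rule an_rules(2)) (use P that in "auto simp: P1_def")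
 ultimately show "P1 m l (%n x. f n x + f' n x) (a + a') (%n x. b n x + b' n x)" using P by (simp add: P1_def)
next
 fix l f a b f' a' b' assume P: "P1 m l f a b" and P': "P1 m l f' a' b'"
 have "anl (smul f f' j) Om" if "j < m" for j by (rule an_smul) (use P P' that in "auto simp: P1_def")
 moreover have "anl (%x. smul f f' m x - (a * b' m x + b m x * a')) Om"
 proof -
 have "anl (%x. a * (f' m x - b' m x) + a' * (f m x - b m x) + (SUM i:{0<..<m}. f i x * f' (m - i) x)) Om"
 by (rule an_rules(2)[OF an_rules(2)[OF an_rules(6) an_rules(6)] an_sum[OF an_rules(4)]])
 (use P P' in "auto simp: P1_def")
 thus ?thesis by (rule an_cong) (use P P' m in "auto simp: P1_def smul_Suc algebra_simps")
 qed
 ultimately show "P1 m l (smul f f') (a * a') (%n x. a * b' n x + b n x * a')" using P P' by (auto simp: P1_def smul_def)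
next
 fix l f a b I assume P: "P1 m (Suc l) f a b"
 have low: "anl (f j) Om" if "j < m" for j using P that by (simp add: P1_def)
 have lt: "anl (Eop z I f j) Om" if "j < m \<or> (j = m & I ~= Xinf)" for j
 proof (cases "I = Xinf")
 case True
 thus ?thesis using that low by (auto simp: Eop_def[abs_def] intro: an_rules)
 next
 case False
 hence "j - wt I < m" using that m wt_pos[of I] by auto
 hence "anl (Vf (z I) (f (j - wt I))) Om" by (intro an_Vf False low)
 thus ?thesis using False by (cases "j < wt I") (auto simp: Eop_def[abs_def] intro: an_c)
 qed
 have "anl (%x. Eop z I f m x - einf (of_nat m) I * b m x) Om"
 proof (cases "I = Xinf")
 case True
 have "anl (%x. of_nat m * (f m x - b m x)) Om" using P by (intro an_rules(6)) (auto simp: P1_def)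
 thus ?thesis using True by (simp add: Eop_def algebra_simps)
 next
 case False
 thus ?thesis using lt[of m] by simp
 qed
 thus "P1 m l (Eop z I f) 0 (%n x. einf (of_nat n) I * b n x)" using lt wt_pos[of I] by (auto simp: P1_def Eop_def)
qed

lemma g_analytic: "anl (g I J m) Om"
proof (induction m arbitrary: I J rule: less_induct)
 case (less m)
 show ?case
 proof (cases "m = 0")
 case True
 show ?thesis unfolding True by (rule an_cong[OF an_rules(1)[of "g0 I J"]]) (use g_0 in auto)
 next
 case False
 hence m: "m > 0" by simp
 interpret dual_calc Om "P1 m" "Eop z" by (rule dual_P1[OF m])
 have Pg: "P1 m 2 (g I J) (g0 I J) (%n x. kk n x I J)" for I J
 proof -
 have "anl (%x. g I J m x - kk m x I J) Om"
 proof (rule an_cong[OF an_rules(1)[of 0]])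
 fix x assume "x : Om"
 thus "0 = g I J m x - kk m x I J" using g_inf[of x m I] g_inf[of x m J] g_sym[of x I Xinf m] m by (auto simp: kk_def)
 qed
 thus ?thesis using less g_0 by (auto simp: P1_def)
 qed
 have PC: "P1 m 2 (C I J K) (C0 I J K) (%n x. 0)" for I J K using C(1,2) by (auto simp: P1_def)
 have Ph: "P1 m 2 (h I K) (gi0 I K) (%n x. gi1 (kk n x) I K)" for I K
 proof -
 have hl: "anl (h I K j) Om" if "j < m" for I K j by (rule h_analytic) (use less that in auto)
 define d where "d L J x = g L J m x - kk m x L J" for L J x
 have "anl (d L J) Om" for L J using Pg[of L J] by (simp add: P1_def d_def[abs_def])
 hence "anl (%x. - (SUM L:UNIV. gi0 I L * (SUM J:UNIV. (SUM i:{0<..<m}. g L J i x * h J K (m - i) x)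
 + d L J x * gi0 J K))) Om" by (intro an_rules an_sum less hl) auto
 hence "anl (%x. h I K m x - gi1 (kk m x) I K) Om"
 proof (rule an_cong)
 fix x assume x: "x : Om"
 have sp: "{0<..m} = insert m {0<..<m}" using m by auto
 have hK: "h I K m x = - (SUM L:UNIV. gi0 I L * (SUM J:UNIV. (SUM i:{0<..<m}. g L J i x * h J K (m - i) x) + g L J m x * gi0 J K))"
 unfolding h_rec[OF x m] sp by (simp add: h_0[OF x] add.commute)
 show "- (SUM L:UNIV. gi0 I L * (SUM J:UNIV. (SUM i:{0<..<m}. g L J i x * h J K (m - i) x)
 + d L J x * gi0 J K)) = h I K m x - gi1 (kk m x) I K" unfolding hK by (simp add: gi1_def d_def sum_idx algebra_simps)
 qed
 thus ?thesis using hl h_0 by (auto simp: P1_def)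
 qed
 have Ps: "P1 m 0 s 2 (%n x. S1 (kk n x))"
 proof -
 note g' = P_low[OF P_low[OF Pg[unfolded numeral_2_eq_2]]]
 have d: "P1 m 0 (dets g) 4 (%n x. 4 * S1 (kk n x))" unfolding dets_def by (rule P_eq, (rule P_rules g')+) (auto simp: S1_def)
 have step: "anl (%x. (dets g n x - (SUM i:{0<..<n}. s i x * s (n - i) x) - v x) / 4) Om"
 if "!!i. i < n ==> anl (s i) Om" "anl (%x. dets g n x - v x) Om" for n v
 proof -
 have "anl (%x. (dets g n x - v x - (SUM i:{0<..<n}. s i x * s (n - i) x)) / 4) Om" by (intro an_rules an_sum that) auto
 thus ?thesis by (simp add: algebra_simps)
 qed
 \<comment> \<open>The order \<open>n\<close> part of \<open>s * s\<close> contains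
   \<open>s n\<close> twice, each time with the constant term 2, hence the division by 4.\<close>
 have eq: "s n x = (dets g n x - (SUM i:{0<..<n}. s i x * s (n - i) x)) / 4" if "x : Om" "n > 0" for n x
 proof -
 have "4 * s n x = dets g n x - (SUM i:{0<..<n}. s i x * s (n - i) x)"
 using s(1)[OF that(1), of n] smul_Suc[OF that(2), of s s x] s(2)[OF that(1)] by (simp add: eq_diff_eq)
 thus ?thesis by (metis nonzero_mult_div_cancel_left zero_neq_numeral)
 qed
 have sl: "j < m ==> anl (s j) Om" for j
 proof (induction j rule: less_induct)
 case (less j)
 show ?case
 proof (cases "j = 0")
 case True
 show ?thesis unfolding True by (rule an_cong[OF an_rules(1)[of 2]]) (use s in auto)
 next
 case False
 have "anl (%x. (dets g j x - (SUM i:{0<..<j}. s i x * s (j - i) x) - 0) / 4) Om" by (rule step) (use less d in "auto simp: P1_def")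
 thus ?thesis by (rule an_cong) (use eq False in auto)
 qed
 qed
 have "anl (%x. (dets g m x - (SUM i:{0<..<m}. s i x * s (m - i) x) - 4 * S1 (kk m x)) / 4) Om"
 by (rule step) (use sl d in "auto simp: P1_def")
 hence "anl (%x. s m x - S1 (kk m x)) Om" by (rule an_cong) (use eq m in auto)
 thus ?thesis using sl s(2) by (auto simp: P1_def)
 qed
 let ?m = "of_nat m :: complex"
 have E: "anl (%x. Ric1 ?m (kk m x) I J + 3/2 * kk m x I J) Om" for I J
 proof -
 have "anl (%x. - (Rc (Eop z) (Ga (Eop z) C g h) I J m x + 3/2 * g I J m x - (Ric1 ?m (kk m x) I J + 3/2 * kk m x I J))) Om"
 using P_Einstein[OF Pg Ph PC, of I J] by (intro an_rules(5)) (simp add: P1_def)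
 thus ?thesis by (rule an_cong) (use Ein in auto)
 qed
 have W: "anl (%x. Wmin (Eop z) (Ga (Eop z) C g h) g h s I J K L m x - Wm1 ?m (kk m x) I J K L) Om" for I J K L
 using P_Wmin[OF Pg Ph PC Ps, of I J K L] by (auto simp: P1_def)
 \<comment> \<open>The component \<open>Xinf X1\<close> has the factor \<open>m + 1\<close>, without
   positive root, whereas the factor of \<open>X0 X1\<close> vanishes at
   \<open>m = 5\<close>.\<close>
 have A01: "anl (g X0 X1 m) Om"
 proof -
 have "anl (%x. (Ric1 ?m (kk m x) Xinf X1 + 3/2 * kk m x Xinf X1) / - (\<i> * (?m + 1) / 2)) Om" by (intro an_rules(7) E)
 moreover have "?m + 1 ~= 0" using of_nat_neq_0[of m, where 'a = complex] by (simp add: add.commute)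
 ultimately show ?thesis by (elim an_cong) (simp only: Ric1_tab(2)[OF normal_kk], simp add: kk_def)
 qed
 have A11: "anl (g X1 X1 m) Om"
 proof (cases "m = 4")
 case True
 have "anl (%x. - (Wmin (Eop z) (Ga (Eop z) C g h) g h s Xinf X1 Xinf X1 m x - Wm1 ?m (kk m x) Xinf X1 Xinf X1)) Om" by (intro an_rules(5) W)
 thus ?thesis by (rule an_cong) (use W4 True in "simp add: Wm1_tab(1)[OF normal_kk], simp add: kk_def")
 next
 case False
 have "?m ~= 0" "?m - 4 ~= 0" using False m of_nat_eq_iff[of m 4, where 'a = complex] by auto
 moreover have "anl (%x. (Ric1 ?m (kk m x) X1 X1 + 3/2 * kk m x X1 X1) / - (?m * (?m - 4) / 8)) Om" by (intro an_rules(7) E)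
 ultimately show ?thesis by (elim an_cong) (simp only: Ric1_tab(8)[OF normal_kk], simp add: kk_def)
 qed
 define A where "A = (%x. (1/2 - ?m * (?m - 6) / 8) * g X0 X0 m x + (?m - 2) / 2 * g X1 X1bar m x)"
 define B where "B = (%x. (?m - 4) / 8 * g X0 X0 m x + (1 - ?m * (?m - 6) / 8) * g X1 X1bar m x)"
 define D where "D = (%x. - (?m * (?m - 4) / 2 * g X0 X0 m x) - ?m * (?m - 2) * g X1 X1bar m x)"
 have an_A: "anl A Om" by (rule an_cong[OF E[of X0 X0]], simp only: Ric1_tab(4)[OF normal_kk], simp add: kk_def A_def)
 have an_B: "anl B Om" by (rule an_cong[OF E[of X1 X1bar]], simp only: Ric1_tab(5)[OF normal_kk], simp add: kk_def B_def)
 have an_D: "anl D Om" by (rule an_cong[OF E[of Xinf Xinf]], simp only: Ric1_tab(1)[OF normal_kk], simp add: kk_def D_def)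
 \<comment> \<open>At \<open>m = 6\<close> the expressions \<open>A\<close>, \<open>B\<close> and
   \<open>D\<close> are proportional, and \<open>F\<close> is the missing equation. At
   \<open>m = 8\<close> still \<open>B\<close> is a multiple of \<open>A\<close>, but
   \<open>D\<close> is independent. The linear combinations below solve these 2 by 2
   systems.\<close>
 have "anl (g X0 X0 m) Om & anl (g X1 X1bar m) Om"
 proof (cases "m = 6")
 case True
 define F where "F = (%x. 11 / 2 * g X0 X0 m x - 2 * g X1 X1bar m x)"
 have "anl (%x. Wmin (Eop z) (Ga (Eop z) C g h) g h s Xinf X0 Xinf X0 m x
 - (Wmin (Eop z) (Ga (Eop z) C g h) g h s Xinf X0 Xinf X0 m x - Wm1 ?m (kk m x) Xinf X0 Xinf X0)) Om"
 by (rule an_rules(3)[OF _ W]) (use True W6 in simp)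
 hence an_F: "anl F Om" by (rule an_cong, simp add: Wm1_tab(2)[OF normal_kk], simp add: kk_def F_def True)
 have "anl (%x. (2 * B x + F x) / 6) Om" "anl (%x. (22 * B x - F x) / 24) Om" by (intro an_rules an_B an_F)+
 thus ?thesis by (auto simp: B_def F_def True)
 next
 case n6: False
 show ?thesis
 proof (cases "m = 8")
 case True
 have "anl (%x. - (16 * A x + D x) / 40) Om" "anl (%x. (32 * A x - 3 * D x) / 240) Om" by (intro an_rules an_A an_D)+
 thus ?thesis by (auto simp: A_def D_def True)
 next
 case False
 \<comment> \<open>With this \<open>q\<close> the determinant of the block is
   \<open>q * (q + 2)\<close>, which for positive \<open>m\<close> vanishes only at 6 and 8.\<close>
 define q where "q = - ?m * (?m - 6) / 8"
 have nz: "q ~= 0" "q + 2 ~= 0"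
 proof -
 have "?m ~= 6" "?m ~= 8" "?m ~= 0" "?m + 2 ~= 0"
 using n6 False m of_nat_eq_iff[of m 6, where 'a = complex] of_nat_eq_iff[of m 8, where 'a = complex]
 of_nat_neq_0[of "Suc m", where 'a = complex] by (auto simp: add.commute)
 moreover have "q + 2 = - (?m - 8) * (?m + 2) / 8" by (simp add: q_def field_simps)
 ultimately show "q ~= 0" "q + 2 ~= 0" by (auto simp: q_def)
 qed
 have AB: "A x = (1/2 + q) * g X0 X0 m x + (?m - 2) / 2 * g X1 X1bar m x"
 "B x = (?m - 4) / 8 * g X0 X0 m x + (1 + q) * g X1 X1bar m x" for x by (simp_all add: A_def B_def q_def)
 have det: "(1/2 + q) * (1 + q) - (?m - 2) / 2 * ((?m - 4) / 8) = q * (q + 2)" by (simp add: q_def field_simps)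
 have "anl (%x. ((1 + q) * A x - (?m - 2) / 2 * B x) / (q * (q + 2))) Om"
 "anl (%x. ((1/2 + q) * B x - (?m - 4) / 8 * A x) / (q * (q + 2))) Om" by (intro an_rules an_A an_B)+
 moreover have "((1 + q) * A x - (?m - 2) / 2 * B x) = q * (q + 2) * g X0 X0 m x"
 "((1/2 + q) * B x - (?m - 4) / 8 * A x) = q * (q + 2) * g X1 X1bar m x" for x
 proof -
 have cr: "d * (a * u + b * v) - b * (c * u + d * v) = (a * d - b * c) * u"
 "a * (c * u + d * v) - c * (a * u + b * v) = (a * d - b * c) * v" for a b c d u v :: complex by (simp_all add: algebra_simps)
 show "((1 + q) * A x - (?m - 2) / 2 * B x) = q * (q + 2) * g X0 X0 m x"
 "((1/2 + q) * B x - (?m - 4) / 8 * A x) = q * (q + 2) * g X1 X1bar m x" unfolding AB cr det by simp_all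
 qed
 ultimately show ?thesis using nz by simp
 qed
 qed
 note A2 = conjunct1[OF this] conjunct2[OF this]
 have A0b: "anl (g X0 X1bar m) Om" by (rule an_cong[OF an_rules(8)[OF A01]]) (simp add: g_cnj)
 have Abb: "anl (g X1bar X1bar m) Om" by (rule an_cong[OF an_rules(8)[OF A11]]) (simp add: g_cnj)
 have Ainf: "anl (g Xinf J m) Om" for J by (rule an_cong[OF an_rules(1)[of 0]]) (use g_inf m in auto)
 have sym: "anl (g J I m) Om ==> anl (g I J m) Om" for I J by (erule an_cong) (use g_sym in auto)
 show ?thesis by (cases I; cases J) (use Ainf A01 A0b A11 Abb A2 sym in blast)+
 qed
qed

end

section \<open>Weighted norms of Taylor coefficients\<close>

text \<open>With the weight \<open>s\<^bsup>|al|\<^esup> / binom (|al| + m) m\<close> on the coefficient of order \<open>m\<close> in \<open>rho\<close>, a derivative along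
 the boundary costs exactly the factor \<open>m + 1\<close> that the Fuchsian operator gains.\<close>

locale norms =
 fixes x0 :: "'x::euclidean_space" and s :: real
 assumes s: "s > 0"
begin

definition w :: "('x => nat) => nat => real" where
 "w al m = s ^ mdeg al / real ((mdeg al + m) choose m)"

text \<open>A relation rather than a norm function, since \<open>infsum\<close> says nothing without
  summability. The order \<open>m\<close> selects the weight; the radius \<open>t\<close> of the
  representation is arbitrary and may be much smaller than \<open>s\<close>.\<close>

definition NB :: "nat => ('x => complex) => real => bool" where
 "NB m f K \<longleftrightarrow> (EX c t. hps f x0 c t & (%al. norm (c al) * w al m) summable_on MI \<and>
 (infsum (%al. norm (c al) * w al m) MI) <= K)"

lemma w_pos: "w al m > 0" using s by (simp add: w_def)

lemma w_le: "w al m <= s ^ mdeg al"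
proof -
 have "real ((mdeg al + m) choose m) >= 1" using zero_less_binomial[of m "mdeg al + m"] by linarith
 thus ?thesis using s unfolding w_def by (simp add: divide_le_eq)
qed

lemma NB_I: "hps f x0 c t ==> (%al. norm (c al) * w al m) summable_on MI ==>
 (infsum (%al. norm (c al) * w al m) MI) <= K ==> NB m f K" by (auto simp: NB_def)

lemma NB_nonneg: "NB m f K ==> K >= 0"
proof -
 assume "NB m f K"
 then obtain c :: "('x => nat) => complex" where "(infsum (%al. norm (c al) * w al m) MI) <= K" by (auto simp: NB_def)
 moreover have "(infsum (%al. norm (c al) * w al m) MI) >= 0" by (rule infsum_nonneg) (use w_pos in "auto simp: less_imp_le")
 ultimately show ?thesis by linarith
qed

lemma NB_mono: "NB m f K ==> K <= K' ==> NB m f K'" unfolding NB_def by (meson order_trans)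

lemma NB_cong:
 assumes "NB m f K" "open S" "x0 : S" "!!x. x : S ==> f x = f' x"
 shows "NB m f' K"
proof -
 obtain c t where c: "hps f x0 c t" "(%al. norm (c al) * w al m) summable_on MI"
 "(infsum (%al. norm (c al) * w al m) MI) <= K" using assms(1) by (auto simp: NB_def)
 obtain t' where "hps f x0 c t'" "pd x0 t' <= S" using hps_in_open[OF c(1) assms(2,3)] by blast
 hence "hps f' x0 c t'" using hps_cong assms(4) by blast
 thus ?thesis using c by (auto simp: NB_def)
qed

text \<open>Since the weights never exceed \<open>s ^ mdeg al\<close>, a function with radius at
  least \<open>s\<close> is bounded uniformly in all orders \<open>m\<close>. The given data enter
  the estimates this way.\<close>

lemma NB_hps:
 assumes f: "hps f x0 c t" and le: "s <= t"
 shows "NB m f (wn c t)"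
proof (rule NB_I[OF f])
 have le': "norm (c al) * w al m <= norm (c al) * t ^ mdeg al" for al by (intro mult_left_mono order_trans[OF w_le] power_mono le) (use s in auto)
 show *: "(%al. norm (c al) * w al m) summable_on MI"
 by (rule summable_on_comparison_test[OF asumD[OF hps_asum[OF f]]]) (use le' w_pos in "auto simp: less_imp_le")
 show "(infsum (%al. norm (c al) * w al m) MI) <= wn c t" unfolding wn_def by (intro infsum_mono * asumD[OF hps_asum[OF f]] le')
qed

lemma NB_const: "NB m (%x. c) (norm c)"
proof (rule NB_I[OF hps_const[of 1 c]])
 have "((%al::'x => nat. norm (if al = mzero then c else 0) * w al m) has_sum norm c) MI"
 by (rule has_sum_finite_neutralI[of "{mzero}"]) (auto simp: w_def)
 thus "(%al::'x => nat. norm (if al = mzero then c else 0) * w al m) summable_on MI"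
 "(infsum (%al. norm (if al = mzero then c else 0) * w al m) MI) <= norm c" by (auto simp: infsumI has_sum_imp_summable)
qed simp

lemma NB_add:
 assumes "NB m f K" "NB m f' K'"
 shows "NB m (%x. f x + f' x) (K + K')"
proof -
 obtain c t where c: "hps f x0 c t" "(%al. norm (c al) * w al m) summable_on MI"
 "(infsum (%al. norm (c al) * w al m) MI) <= K" using assms(1) by (auto simp: NB_def)
 obtain d t' where d: "hps f' x0 d t'" "(%al. norm (d al) * w al m) summable_on MI"
 "(infsum (%al. norm (d al) * w al m) MI) <= K'" using assms(2) by (auto simp: NB_def)
 have h: "hps (%x. f x + f' x) x0 (%al. c al + d al) (min t t')"
 by (rule hps_add) (use c d hps_pos[OF c(1)] hps_pos[OF d(1)] in "auto intro: hps_shrink")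
 have le: "norm (c al + d al) * w al m <= norm (c al) * w al m + norm (d al) * w al m" for al
 using w_pos[of al m] norm_triangle_ineq[of "c al" "d al"] by (metis distrib_right mult_right_mono less_imp_le)
 have sm: "(%al. norm (c al + d al) * w al m) summable_on MI"
 by (rule summable_on_comparison_test[OF summable_on_add[OF c(2) d(2)]]) (use le w_pos in "auto simp: less_imp_le")
 have "(infsum (%al. norm (c al + d al) * w al m) MI) <= (infsum (%al. norm (c al) * w al m + norm (d al) * w al m) MI)"
 by (intro infsum_mono sm summable_on_add c d le)
 also have "... <= K + K'" using c d by (simp add: infsum_add)
 finally show ?thesis by (rule NB_I[OF h sm])
qed

text \<open>Submultiplicativity of the weights reduces to a single term of Vandermonde's identity:
  the product of \<open>a + m choose m\<close> and \<open>b + n choose n\<close> is at most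
  \<open>a + b + m + n choose m + n\<close>.\<close>

lemma conv_weight:
 fixes c d :: "('x => nat) => complex"
 assumes m: "M = m + n"
 shows "ga : MI ==> norm (conv c d ga) * w ga M \<le>
 conv (%al. norm (c al) * w al m) (%al. norm (d al) * w al n) ga"
proof -
 assume ga: "ga : MI"
 have w: "w ga M <= w al m * w (msub ga al) n" if al: "al : mbelow ga" for al
 proof -
 define a b where "a = mdeg al" and "b = mdeg (msub ga al)"
 have dg: "mdeg ga = a + b" using madd_msub[OF al ga] mdeg_madd by (metis a_def b_def)
 have "((a + m) choose m) * ((b + n) choose n) <= ((a + m) + (b + n)) choose (m + n)"
 proof -
 have "((a + m) + (b + n)) choose (m + n) = (SUM k<=m + n. ((a + m) choose k) * ((b + n) choose (m + n - k)))" by (rule vandermonde[symmetric])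
 also have "... >= ((a + m) choose m) * ((b + n) choose (m + n - m))" by (rule member_le_sum) auto
 finally show ?thesis by simp
 qed
 hence "((a + m) choose m) * ((b + n) choose n) <= (a + b + M) choose M" by (simp add: m add_ac)
 hence bin: "real ((a + m) choose m) * real ((b + n) choose n) <= real ((a + b + M) choose M)" by (metis of_nat_le_iff of_nat_mult)
 have "w ga M = s ^ (a + b) / real ((a + b + M) choose M)" by (simp add: w_def dg)
 also have "... <= s ^ (a + b) / (real ((a + m) choose m) * real ((b + n) choose n))" using s bin by (intro divide_left_mono) auto
 also have "... = w al m * w (msub ga al) n" by (simp add: w_def power_add flip: a_def b_def)
 finally show ?thesis .
 qed
 have "norm (conv c d ga) * w ga M <= (SUM al:mbelow ga. norm (c al * d (msub ga al))) * w ga M"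
 unfolding conv_def using w_pos[of ga M] by (intro mult_right_mono norm_sum) auto
 also have "... = (SUM al:mbelow ga. (norm (c al) * norm (d (msub ga al))) * w ga M)" by (simp add: sum_distrib_right norm_mult)
 also have "... <= (SUM al:mbelow ga. (norm (c al) * norm (d (msub ga al))) * (w al m * w (msub ga al) n))"
 by (intro sum_mono mult_left_mono w) auto
 also have "... = conv (%al. norm (c al) * w al m) (%al. norm (d al) * w al n) ga" unfolding conv_def by (simp add: mult_ac)
 finally show ?thesis .
qed

lemma NB_mult:
 assumes "NB m f K" "NB n f' K'"
 shows "NB (m + n) (%x. f x * f' x) (K * K')"
proof -
 obtain c t where c: "hps f x0 c t" "(%al. norm (c al) * w al m) summable_on MI"
 "(infsum (%al. norm (c al) * w al m) MI) <= K" using assms(1) by (auto simp: NB_def)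
 obtain d t' where d: "hps f' x0 d t'" "(%al. norm (d al) * w al n) summable_on MI"
 "(infsum (%al. norm (d al) * w al n) MI) <= K'" using assms(2) by (auto simp: NB_def)
 have h: "hps (%x. f x * f' x) x0 (conv c d) (min t t')" by (rule hps_mult) (use c d hps_pos[OF c(1)] hps_pos[OF d(1)] in "auto intro: hps_shrink")
 let ?a = "%al. norm (c al) * w al m" and ?b = "%al. norm (d al) * w al n"
 have nn: "norm (?a al) = ?a al" "norm (?b al) = ?b al" for al using w_pos[of al m] w_pos[of al n] by simp_all
 have hs: "(conv ?a ?b has_sum (infsum ?a MI * infsum ?b MI)) MI" by (rule conv_has_sum) (use c d nn in auto)
 have sm: "(%ga. norm (conv c d ga) * w ga (m + n)) summable_on MI" by (rule summable_on_comparison_test[OF has_sum_imp_summable[OF hs]])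
 (use conv_weight[OF refl] w_pos in "auto simp: less_imp_le")
 have "(infsum (%ga. norm (conv c d ga) * w ga (m + n)) MI) <= infsum ?a MI * infsum ?b MI"
 by (rule has_sum_mono[OF has_sum_infsum[OF sm] hs conv_weight[OF refl]])
 also have "... <= K * K'" by (intro mult_mono c d NB_nonneg[OF assms(1)] infsum_nonneg) (use w_pos in "auto simp: less_imp_le")
 finally show ?thesis by (rule NB_I[OF h sm])
qed

lemma NB_cmult: "NB m f K ==> NB m (%x. c * f x) (norm c * K)" using NB_mult[OF NB_const[of 0 c], of m f K] by simp

lemma NB_sum: "finite I ==> (!!i. i : I ==> NB m (f i) (K i)) ==> NB m (%x. SUM i:I. f i x) (SUM i:I. K i)"
proof (induction I rule: finite_induct)
 case empty
 show ?case using NB_const[of m 0] by simp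
qed (auto intro: NB_add)

text \<open>The quotient of \<open>a + 1\<close> by \<open>a + m + 1 choose m + 1\<close> equals
  that of \<open>m + 1\<close> by \<open>a + m + 1 choose m\<close>. This trades the factor from
  differentiating a monomial of degree \<open>a + 1\<close> for one that depends on the order
  alone.\<close>

lemma NB_pdv:
 assumes "NB m f K" and b: "b : Basis"
 shows "NB (Suc m) (pdv b f) (real (Suc m) / s * K)"
proof -
 obtain c t where c: "hps f x0 c t" "(%al. norm (c al) * w al m) summable_on MI"
 "(infsum (%al. norm (c al) * w al m) MI) <= K" using assms(1) by (auto simp: NB_def)
 have h: "hps (pdv b f) x0 (dcoef b c) (t / 2)" unfolding pdv_def[abs_def] by (rule hps_deriv[OF c(1) b])
 let ?i = "%al. madd al (munit b)" and ?F = "%al. norm (c al) * w al m"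
 have le: "norm (dcoef b c al) * w al (Suc m) <= real (Suc m) / s * ?F (?i al)" for al
 proof -
 define a where "a = mdeg al"
 have ab: "al b <= a" unfolding mdeg_def a_def using b by (intro member_le_sum) auto
 have "Suc m * ((Suc a + m) choose Suc m) = Suc a * ((Suc a + m) choose m)" by (metis Suc_times_binomial_add add.commute nat_arith.suc1)
 hence bin: "real (Suc m) * real ((a + Suc m) choose Suc m) = real (Suc a) * real ((Suc a + m) choose m)"
 by (metis of_nat_mult add_Suc add_Suc_right)
 have p: "real ((a + Suc m) choose Suc m) > 0" "real ((Suc a + m) choose m) > 0" by (simp_all del: binomial_Suc_Suc)
 have eq: "real (Suc a) * w al (Suc m) = real (Suc m) / s * w (?i al) m"
 proof -
 have "real (Suc a) / real ((a + Suc m) choose Suc m) = real (Suc m) / real ((Suc a + m) choose m)"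
 using bin by (simp add: field_simps del: binomial_Suc_Suc)
 hence "real (Suc a) * s ^ a / real ((a + Suc m) choose Suc m) = real (Suc m) * s ^ a / real ((Suc a + m) choose m)"
 by (metis mult.commute times_divide_eq_right)
 thus ?thesis using s b by (simp add: w_def a_def)
 qed
 have "norm (dcoef b c al) * w al (Suc m) = norm (c (?i al)) * (real (Suc (al b)) * w al (Suc m))"
 by (simp add: dcoef_def norm_mult flip: of_nat_Suc)
 also have "... <= norm (c (?i al)) * (real (Suc a) * w al (Suc m))" using ab w_pos[of al "Suc m"] by (intro mult_left_mono) auto
 also have "... = real (Suc m) / s * ?F (?i al)" unfolding eq by simp
 finally show ?thesis .
 qed
 have inj: "inj_on ?i MI" by (rule inj_onI) (metis madd_comm msub_madd)
 have sub: "?i ` MI <= MI" by auto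
 have s1: "?F summable_on ?i ` MI" by (rule summable_on_subset_banach[OF c(2) sub])
 hence s2: "(%al. ?F (?i al)) summable_on MI" using summable_on_reindex[OF inj, of ?F] by (simp add: o_def)
 have sm: "(%al. norm (dcoef b c al) * w al (Suc m)) summable_on MI"
 by (rule summable_on_comparison_test[OF summable_on_cmult_right[OF s2] le]) (use w_pos in "auto simp: less_imp_le")
 have "(infsum (%al. norm (dcoef b c al) * w al (Suc m)) MI) <= (infsum (%al. real (Suc m) / s * ?F (?i al)) MI)"
 by (intro infsum_mono sm summable_on_cmult_right s2 le)
 also have "... = real (Suc m) / s * (infsum (%al. ?F (?i al)) MI)" by (rule infsum_cmult_right')
 also have "... <= real (Suc m) / s * K"
 proof (rule mult_left_mono)
 have "(infsum (%al. ?F (?i al)) MI) = infsum ?F (?i ` MI)" using infsum_reindex[OF inj, of ?F] by (simp add: o_def)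
 also have "... <= infsum ?F MI" by (rule infsum_mono2[OF s1 c(2) sub]) (use w_pos in "auto simp: less_imp_le")
 also have "... <= K" by (rule c(3))
 finally show "(infsum (%al. ?F (?i al)) MI) <= K" .
 qed (use s in auto)
 finally have "(infsum (%al. norm (dcoef b c al) * w al (Suc m)) MI) <= real (Suc m) / s * K" .
 thus ?thesis by (rule NB_I[OF h sm])
qed

text \<open>Lets a constant be subtracted before differentiating, as the estimates control
  deviations from the model.\<close>

lemma NB_pdv_const:
 assumes "NB m (%x. f x - a) K" and b: "b : Basis"
 shows "NB (Suc m) (pdv b f) (real (Suc m) / s * K)"
proof -
 obtain c t where c: "hps (%x. f x - a) x0 c t" using assms(1) by (auto simp: NB_def)
 show ?thesis
 proof (rule NB_cong[OF NB_pdv[OF assms] open_pd pd_centre[OF hps_pos[OF c]]])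
 fix y assume "y : pd x0 t"
 hence "(%x. f x - a) differentiable (at y)" using hps_has_derivative hps_recentre'[OF c] unfolding differentiable_def by blast
 from pdv_add[OF this differentiable_const, of b a] show "pdv b (%x. f x - a) y = pdv b f y" by simp
 qed
qed

lemma NB_weaken: "NB m f K ==> NB (m + n) f K" using NB_mult[of m f K n "%x. 1" 1] NB_const[of n 1] by simp

end

section \<open>Convergence of formal Einstein metrics\<close>

locale norms_open = norms +
 fixes Om :: "'a set"
 assumes Om: "open Om" "x0 : Om"
begin

section \<open>Weighted norms of truncated series in the boundary variable\<close>

lemma NB_cong_Om: "NB m f K ==> (!!x. x : Om ==> f x = f' x) ==> NB m f' K" using NB_cong[OF _ Om] by metis

abbreviation "swt R l n \<equiv> R ^ n * real (n + 1) ^ l"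

text \<open>The sum stops below order \<open>M\<close>, so the statement makes sense before
  convergence is known. The power \<open>l\<close> of \<open>n + 1\<close> counts the derivatives
  that the estimate can still afford, and a small \<open>R\<close> makes positive orders
  small.\<close>

definition SB :: "real => nat => nat => 'a ser => real => bool" where
 "SB R l M f K \<longleftrightarrow> (EX ka. (ALL n<M. NB n (f n) (ka n)) & (SUM n<M. swt R l n * ka n) <= K)"

lemma SB_I: "(!!n. n < M ==> NB n (f n) (ka n)) ==> (SUM n<M. swt R l n * ka n) <= K ==> SB R l M f K" by (auto simp: SB_def)

lemma SB_mono: "SB R l M f K ==> K <= K' ==> SB R l M f K'" unfolding SB_def by (meson order_trans)

lemma SB_cong: "SB R l M f K ==> (!!n x. n < M ==> x : Om ==> f n x = f' n x) ==> SB R l M f' K" unfolding SB_def using NB_cong_Om by meson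

lemma SB_nonneg: "SB R l M f K ==> R >= 0 ==> K >= 0"
proof -
 assume "SB R l M f K" "R >= 0"
 then obtain ka where k: "ALL n<M. NB n (f n) (ka n)" "(SUM n<M. swt R l n * ka n) <= K" unfolding SB_def by blast
 have "(SUM n<M. swt R l n * ka n) >= 0" using k(1) NB_nonneg \<open>R >= 0\<close> by (intro sum_nonneg) auto
 thus ?thesis using k(2) by linarith
qed

lemma SB_add:
 assumes "SB R l M f K" "SB R l M f' K'"
 shows "SB R l M (%n x. f n x + f' n x) (K + K')"
proof -
 obtain ka ka' where "ALL n<M. NB n (f n) (ka n)" "(SUM n<M. swt R l n * ka n) <= K"
 "ALL n<M. NB n (f' n) (ka' n)" "(SUM n<M. swt R l n * ka' n) <= K'" using assms unfolding SB_def by blast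
 thus ?thesis by (intro SB_I[where ka = "%n. ka n + ka' n"] NB_add) (auto simp: distrib_left sum.distrib)
qed

lemma SB_cmult:
 assumes "SB R l M f K"
 shows "SB R l M (%n x. c * f n x) (norm c * K)"
proof -
 obtain ka where k: "ALL n<M. NB n (f n) (ka n)" "(SUM n<M. swt R l n * ka n) <= K" using assms unfolding SB_def by blast
 have "(SUM n<M. swt R l n * (norm c * ka n)) = norm c * (SUM n<M. swt R l n * ka n)" by (simp add: sum_distrib_left mult_ac)
 also have "... <= norm c * K" using k(2) by (rule mult_left_mono) auto
 finally show ?thesis using k(1) by (intro SB_I[where ka = "%n. norm c * ka n"] NB_cmult) auto
qed

lemma SB_zero: "(!!n x. n < M ==> x : Om ==> f n x = 0) ==> SB R l M f 0"
proof -
 assume z: "!!n x. n < M ==> x : Om ==> f n x = 0"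
 have "NB n (f n) 0" if "n < M" for n by (rule NB_cong_Om[OF NB_const[of n 0, simplified]]) (use z that in auto)
 thus ?thesis by (intro SB_I[where ka = "%_. 0"]) auto
qed

lemma SB_sum:
 assumes "!!I. SB R l M (f I) (K I)"
 shows "SB R l M (%n x. SUM I:(UNIV :: idx set). f I n x) (SUM I:UNIV. K I)" unfolding sum_idx by (intro SB_add assms)

lemma SB_low:
 assumes "SB R (Suc l) M f K" "R >= 0"
 shows "SB R l M f K"
proof -
 obtain ka where k: "ALL n<M. NB n (f n) (ka n)" "(SUM n<M. swt R (Suc l) n * ka n) <= K" using assms unfolding SB_def by blast
 have "(SUM n<M. swt R l n * ka n) <= (SUM n<M. swt R (Suc l) n * ka n)"
 using k(1) NB_nonneg assms(2) by (intro sum_mono mult_right_mono mult_left_mono power_increasing) auto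
 thus ?thesis using k by (intro SB_I[where ka = ka]) auto
qed

text \<open>Submultiplicative because \<open>n + 1 <= (i + 1) * (n - i + 1)\<close>. The factors may
  be known to different orders \<open>A\<close> and \<open>B\<close>, as long as the products that
  reach beyond them vanish below \<open>M\<close>.\<close>

lemma SB_mult_gen:
 assumes f: "SB R l A f K" and f': "SB R l B f' K'" and R: "R >= 0"
 and z: "!!n i x. n < M ==> i <= n ==> ~ (i < A & n - i < B) ==> x : Om ==> f i x = 0 \<or> f' (n - i) x = 0"
 shows "SB R l M (smul f f') (K * K')"
proof -
 obtain ka ka' where k: "!!n. n < A ==> NB n (f n) (ka n)" "(SUM n<A. swt R l n * ka n) <= K"
 and k': "!!n. n < B ==> NB n (f' n) (ka' n)" "(SUM n<B. swt R l n * ka' n) <= K'" using f f' unfolding SB_def by blast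
 define I where "I n = {i. i <= n & i < A & n - i < B}" for n
 have fI: "finite (I n)" for n unfolding I_def by simp
 define q where "q i j = (swt R l i * ka i) * (swt R l j * ka' j)" for i j
 show ?thesis
 proof (rule SB_I[where ka = "%n. SUM i:I n. ka i * ka' (n - i)"])
 fix n assume n: "n < M"
 have "NB n (%x. SUM i:I n. f i x * f' (n - i) x) (SUM i:I n. ka i * ka' (n - i))"
 proof (rule NB_sum[OF fI])
 fix i assume "i : I n"
 hence i: "i <= n" "i < A" "n - i < B" by (auto simp: I_def)
 show "NB n (%x. f i x * f' (n - i) x) (ka i * ka' (n - i))" using NB_mult[OF k(1)[OF i(2)] k'(1)[OF i(3)]] i(1) by simp
 qed
 thus "NB n (smul f f' n) (SUM i:I n. ka i * ka' (n - i))"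
 proof (rule NB_cong_Om)
 fix x assume x: "x : Om"
 show "(SUM i:I n. f i x * f' (n - i) x) = smul f f' n x" unfolding smul_def
 by (rule sum.mono_neutral_left) (use z[OF n _ _ x] in "force simp: I_def")+
 qed
 next
 have nn: "q i j >= 0" if "i < A" "j < B" for i j unfolding q_def using NB_nonneg[OF k(1)[OF that(1)]] NB_nonneg[OF k'(1)[OF that(2)]] R by simp
 have "(SUM n<M. swt R l n * (SUM i:I n. ka i * ka' (n - i))) <= (SUM n<M. SUM i:I n. q i (n - i))" unfolding sum_distrib_left
 proof (intro sum_mono)
 fix n i assume "i : I n"
 hence i: "i <= n" "i < A" "n - i < B" by (auto simp: I_def)
 have p: "ka i * ka' (n - i) >= 0" using NB_nonneg[OF k(1)[OF i(2)]] NB_nonneg[OF k'(1)[OF i(3)]] by simp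
 have "real (n + 1) <= real (i + 1) * real (n - i + 1)"
 proof -
 obtain j where "n = i + j" using i(1) le_Suc_ex by blast
 thus ?thesis by (simp add: algebra_simps)
 qed
 hence "real (n + 1) ^ l <= (real (i + 1) * real (n - i + 1)) ^ l" by (intro power_mono) auto
 moreover have "R ^ n = R ^ i * R ^ (n - i)" using i(1) by (simp flip: power_add)
 ultimately have "swt R l n <= R ^ i * R ^ (n - i) * (real (i + 1) * real (n - i + 1)) ^ l" using R by (simp add: mult_left_mono)
 from mult_right_mono[OF this p] show "swt R l n * (ka i * ka' (n - i)) <= q i (n - i)" by (simp add: q_def power_mult_distrib mult_ac)
 qed
 also have "... = (SUM p:Sigma {..<M} I. q (snd p) (fst p - snd p))" by (subst sum.Sigma) (auto simp: fI case_prod_unfold)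
 also have "... = (SUM p:(%p. (snd p, fst p - snd p)) ` Sigma {..<M} I. q (fst p) (snd p))"
 by (subst sum.reindex) (auto simp: inj_on_def I_def)
 also have "... <= (SUM p:{..<A} \<times> {..<B}. q (fst p) (snd p))" by (rule sum_mono2) (auto simp: I_def nn)
 also have "... = (SUM i<A. swt R l i * ka i) * (SUM j<B. swt R l j * ka' j)"
 unfolding sum_product by (subst sum.cartesian_product) (simp add: q_def case_prod_unfold)
 also have "... <= K * K'" by (intro mult_mono k k' SB_nonneg[OF f R] sum_nonneg mult_nonneg_nonneg NB_nonneg[OF k'(1)]) (use R in auto)
 finally show "(SUM n<M. swt R l n * (SUM i:I n. ka i * ka' (n - i))) <= K * K'" .
 qed
qed

text \<open>If the first factor has no constant term, the second may be known to one order less;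
  this drives the induction for the inverse metric.\<close>

lemma SB_mult_half:
 assumes "SB R l M f K" "SB R l M' f' K'" "R >= 0" "M <= Suc M'" "!!x. x : Om ==> f 0 x = 0"
 shows "SB R l M (smul f f') (K * K')"
proof (rule SB_mult_gen[OF assms(1-3)])
 fix n i x assume "n < M" "i <= n" "~ (i < M & n - i < M')" and x: "x : Om"
 hence "i = 0" using assms(4) by linarith
 thus "f i x = 0 \<or> f' (n - i) x = 0" using assms(5)[OF x] by simp
qed

text \<open>Without constant terms both indices in a product of order \<open>n\<close> are below
  \<open>n\<close>, so bounds below \<open>M\<close> yield one below \<open>Suc M\<close>. The
  induction in \<open>coefficient_bound\<close> lives on this gain of one order.\<close>

lemma SB_mult_strict:
 assumes "SB R l M f K" "SB R l M f' K'" "R >= 0" "!!x. x : Om ==> f 0 x = 0" "!!x. x : Om ==> f' 0 x = 0"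
 shows "SB R l (Suc M) (smul f f') (K * K')"
proof (rule SB_mult_gen[OF assms(1-3)])
 fix n i x assume "n < Suc M" "i <= n" "~ (i < M & n - i < M)" and x: "x : Om"
 hence "i = 0 \<or> n - i = 0" by linarith
 thus "f i x = 0 \<or> f' (n - i) x = 0" using assms(4,5)[OF x] by auto
qed

lemma SB_delta: "R >= 0 ==> SB R l M (%n x. if n = 0 then c else 0) (norm c)"
proof -
 assume R: "R >= 0"
 have "(SUM n<M. swt R l n * (if n = 0 then norm c else 0)) <= norm c" by (auto simp: if_distrib cong: if_cong)
 moreover have "NB n (%x. if n = 0 then c else 0) (if n = 0 then norm c else 0)" for n using NB_const[of n c] NB_const[of n 0] by auto
 ultimately show ?thesis by (intro SB_I[where ka = "%n. if n = 0 then norm c else 0"])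
qed

text \<open>The order is raised by at least one, which gives the factor \<open>R\<close> and one
  more known order; the price \<open>n + 1\<close> is one power counted by \<open>l\<close>. The
  factor 3 bounds the ratio of \<open>j + d + 1\<close> to \<open>j + 1\<close> for shifts
  \<open>d <= 2\<close>.\<close>

lemma SB_Vf:
 assumes f: "SB R (Suc l) M (%n x. f n x - (if n = 0 then a else 0)) K"
 and z: "!!b. b : Basis ==> NB 0 (z b) A" and R: "0 <= R" "R <= 1" and d: "d = 1 \<or> d = 2"
 shows "SB R l (Suc M) (%n. if n < d then (%x. 0) else Vf z (f (n - d))) (R * (3 ^ Suc l * real DIM('a) * A / s) * K)"
proof -
 obtain ka where k: "!!n. n < M ==> NB n (%x. f n x - (if n = 0 then a else 0)) (ka n)"
 "(SUM n<M. swt R (Suc l) n * ka n) <= K" using f unfolding SB_def by blast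
 have A: "A >= 0" using NB_nonneg z nonempty_Basis by blast
 define D where "D = real DIM('a) * A / s"
 have D: "D >= 0" using A s by (simp add: D_def)
 have V: "NB (n + d) (Vf z (f n)) (real (n + 1) * D * ka n)" if "n < M" for n
 proof -
 have p: "NB (Suc n) (pdv b (f n)) (real (Suc n) / s * ka n)" if "b : Basis" for b by (rule NB_pdv_const[OF k(1)[OF \<open>n < M\<close>] that])
 have "NB (0 + Suc n) (%x. SUM b:Basis. z b x * pdv b (f n) x) (SUM b:(Basis::'a set). A * (real (Suc n) / s * ka n))"
 by (intro NB_sum NB_mult z p) auto
 moreover have "(SUM b:(Basis::'a set). A * (real (Suc n) / s * ka n)) = real (n + 1) * D * ka n" by (simp add: D_def)
 ultimately have "NB (Suc n) (Vf z (f n)) (real (n + 1) * D * ka n)" by (simp add: Vf_def[abs_def])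
 from NB_weaken[OF this, of "d - 1"] show ?thesis using d by auto
 qed
 show ?thesis
 proof (rule SB_I[where ka = "%n. if n < d then 0 else real (n - d + 1) * D * ka (n - d)"])
 fix n assume n: "n < Suc M"
 show "NB n (if n < d then %x. 0 else Vf z (f (n - d))) (if n < d then 0 else real (n - d + 1) * D * ka (n - d))"
 proof (cases "n < d")
 case True thus ?thesis using NB_const[of n 0] by simp
 next
 case False
 hence "n - d < M" "n - d + d = n" using n d by auto
 thus ?thesis using V[of "n - d"] by simp
 qed
 next
 have "(SUM n<Suc M. swt R l n * (if n < d then 0 else real (n - d + 1) * D * ka (n - d)))
 = (SUM n:{d..<Suc M}. swt R l n * (real (n - d + 1) * D * ka (n - d)))" by (rule sum.mono_neutral_cong_right) auto
 also have "... = (SUM j:{0..<Suc M - d}. R ^ (j + d) * real (j + d + 1) ^ l * (real (j + 1) * D * ka j))"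
 by (rule sum.reindex_bij_witness[of _ "%j. j + d" "%n. n - d"]) auto
 also have "... <= (SUM j:{0..<Suc M - d}. R * 3 ^ Suc l * D * (swt R (Suc l) j * ka j))"
 proof (rule sum_mono)
 fix j assume "j : {0..<Suc M - d}"
 hence j: "j < M" using d by auto
 have kj: "ka j >= 0" by (rule NB_nonneg[OF k(1)[OF j]])
 have "R ^ (j + d) <= R ^ (j + 1)" using R d by (intro power_decreasing) auto
 moreover have "real (j + d + 1) ^ l <= (3 * real (j + 1)) ^ l" using d by (intro power_mono) auto
 ultimately have "R ^ (j + d) * real (j + d + 1) ^ l * (real (j + 1) * D * ka j)
 <= R ^ (j + 1) * (3 * real (j + 1)) ^ l * (real (j + 1) * D * ka j)" using R D kj by (intro mult_mono) auto
 also have "... <= 3 * (R ^ (j + 1) * (3 * real (j + 1)) ^ l * (real (j + 1) * D * ka j))" using R D kj by simp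
 also have "... = R * 3 ^ Suc l * D * (swt R (Suc l) j * ka j)"
 unfolding power_mult_distrib by (simp only: power_Suc power_add mult_ac power_one_right)
 finally show "R ^ (j + d) * real (j + d + 1) ^ l * (real (j + 1) * D * ka j) <= R * 3 ^ Suc l * D * (swt R (Suc l) j * ka j)" .
 qed
 also have "... = R * 3 ^ Suc l * D * (SUM j:{0..<Suc M - d}. swt R (Suc l) j * ka j)" by (simp add: sum_distrib_left)
 also have "... <= R * 3 ^ Suc l * D * (SUM j<M. swt R (Suc l) j * ka j)"
 using R D d by (intro mult_left_mono sum_mono2) (auto intro!: mult_nonneg_nonneg NB_nonneg[OF k(1)])
 also have "... <= R * 3 ^ Suc l * D * K" using R D by (intro mult_left_mono k) auto
 finally show "(SUM n<Suc M. swt R l n * (if n < d then 0 else real (n - d + 1) * D * ka (n - d)))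
 <= R * (3 ^ Suc l * real DIM('a) * A / s) * K" by (simp add: D_def)
 qed
qed

lemma SB_theta:
 assumes "SB R (Suc l) M f K" "R >= 0"
 shows "SB R l M (%n x. of_nat n * f n x) K"
proof -
 obtain ka where k: "ALL n<M. NB n (f n) (ka n)" "(SUM n<M. swt R (Suc l) n * ka n) <= K" using assms unfolding SB_def by blast
 have "(SUM n<M. swt R l n * (real n * ka n)) <= (SUM n<M. swt R (Suc l) n * ka n)"
 proof (rule sum_mono)
 fix n assume "n : {..<M}"
 hence "ka n >= 0" using k(1) NB_nonneg by auto
 hence "swt R l n * (real n * ka n) <= swt R l n * (real (n + 1) * ka n)" using assms(2) by (intro mult_left_mono mult_right_mono) auto
 thus "swt R l n * (real n * ka n) <= swt R (Suc l) n * ka n" by (simp add: mult_ac)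
 qed
 moreover have "NB n (%x. of_nat n * f n x) (real n * ka n)" if "n < M" for n using NB_cmult[of n "f n" "ka n" "of_nat n"] k(1) that by simp
 ultimately show ?thesis using k(2) by (intro SB_I[where ka = "%n. real n * ka n"]) auto
qed

end

text \<open>Order 9 is the first one beyond all resonances. Orders below 9 are given data bounded by
  \<open>A\<close>; the equations are inverted only from 9 on.\<close>

locale convergence = formal_metric Om z C g h + norms_open x0 s Om
 for Om :: "'x::euclidean_space set" and z C g h x0 s +
 fixes A :: real
 assumes Ein: "!!I J n x. x : Om ==> Rc (Eop z) (Ga (Eop z) C g h) I J n x + 3/2 * g I J n x = 0"
 and zA: "!!I b. b : Basis ==> I ~= Xinf ==> NB 0 (z I b) A"
 and CA: "!!I J K n. n <= 2 ==> NB n (C I J K n) A"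
 and gA: "!!I J n. n < 9 ==> NB n (g I J n) A"
begin

section \<open>The contraction estimate for the tail\<close>

definition v :: "'x ser i2" where
 "v I J n x = (if n < 9 \<or> I = Xinf \<or> J = Xinf then 0 else g I J n x)"

definition vk :: "nat => 'x => complex i2" where
 "vk n x = (%I J. v I J n x)"

text \<open>Bootstrap hypothesis: the tail below order \<open>M\<close> has size \<open>ep\<close>.
  An error is absorbed once it is smaller than \<open>ep\<close> by the factor \<open>ta\<close>;
  \<open>R <= ep * ta\<close> achieves this for the data and for tangential derivatives,
  \<open>ep <= ta\<close> for quadratic terms.\<close>

definition hyp :: "nat => real => real => real => bool" where
 "hyp M ep ta R \<longleftrightarrow> 0 < R & R <= ep * ta & 0 < ep & ep <= ta & ta <= 1 & (ALL I J. SB R 2 M (v I J) ep)"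

definition rest :: "'x ser => complex => 'x ser => 'x ser" where
 "rest f a b n x = f n x - (if n = 0 then a else 0) - b n x"

text \<open>The principal part is known below \<open>M\<close>, the remainder even below
  \<open>Suc M\<close> and smaller by the factor \<open>ta\<close>. Neither \<open>K\<close> nor
  \<open>de\<close> may depend on \<open>M\<close>, \<open>ep\<close>, \<open>ta\<close> or
  \<open>R\<close>, otherwise the induction on \<open>M\<close> would not close.\<close>

definition dominated :: "nat => 'x ser => complex => 'x ser => real => real => bool" where
 "dominated l f a b K de \<longleftrightarrow> K >= 0 & de > 0 & (ALL M ep ta R. hyp M ep ta R --> ta <= de -->
 SB R l M b (K * ep) & SB R l (Suc M) (rest f a b) (K * (ep * ta)))"

definition P2 :: "nat => 'x ser => complex => 'x ser => bool" where
 "P2 l f a b \<longleftrightarrow> (ALL x:Om. f 0 x = a) & (ALL x:Om. b 0 x = 0) & (EX K de. dominated l f a b K de)"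

lemma hypD:
 assumes "hyp M ep ta R"
 shows "0 < R" "R <= ep * ta" "0 < ep" "ep <= ta" "ta <= 1" "0 < ta" "ep <= 1" "R <= 1" "R >= 0" "ep * ta <= ep" "ep * ep <= ep * ta"
 "SB R 2 M (v I J) ep"
proof -
 show *: "0 < R" "R <= ep * ta" "0 < ep" "ep <= ta" "ta <= 1" "SB R 2 M (v I J) ep" using assms by (auto simp: hyp_def)
 thus "0 < ta" "ep <= 1" "R >= 0" by auto
 show "ep * ta <= ep" "ep * ep <= ep * ta" using * by auto
 with * show "R <= 1" by linarith
qed

lemma P2_I:
 assumes "!!x. x : Om ==> f 0 x = a" "!!x. x : Om ==> b 0 x = 0" "K >= 0" "de > 0"
 "!!M ep ta R. hyp M ep ta R ==> ta <= de ==> SB R l M b (K * ep)"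
 "!!M ep ta R. hyp M ep ta R ==> ta <= de ==> SB R l (Suc M) (rest f a b) (K * (ep * ta))"
 shows "P2 l f a b" using assms unfolding P2_def dominated_def by blast

lemma dominatedD:
 assumes "dominated l f a b K de"
 shows "K >= 0" "de > 0" "hyp M ep ta R ==> ta <= de ==> SB R l M b (K * ep)"
 "hyp M ep ta R ==> ta <= de ==> SB R l (Suc M) (rest f a b) (K * (ep * ta))" using assms by (auto simp: dominated_def)

lemma P2_D: "P2 l f a b ==> EX K de. dominated l f a b K de" by (simp add: P2_def)

lemma P2_0: "P2 l f a b ==> x : Om ==> f 0 x = a" "P2 l f a b ==> x : Om ==> b 0 x = 0" by (auto simp: P2_def)

lemma SB_less: "SB R l (Suc M) f K ==> R >= 0 ==> SB R l M f K"
proof -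
 assume "SB R l (Suc M) f K" and R: "R >= 0"
 then obtain ka where k: "ALL n<Suc M. NB n (f n) (ka n)" "(SUM n<Suc M. swt R l n * ka n) <= K" unfolding SB_def by blast
 have "swt R l M * ka M >= 0" using k(1) NB_nonneg R by auto
 thus ?thesis using k by (intro SB_I[where ka = ka]) auto
qed

lemma SB_var:
 assumes h: "hyp M ep ta R" and b: "SB R l M b (K * ep)" and r: "SB R l (Suc M) (rest f a b) (K * (ep * ta))" and K: "K >= 0"
 shows "SB R l M (%n x. f n x - (if n = 0 then a else 0)) (2 * K * ep)"
proof -
 have "SB R l M (%n x. b n x + rest f a b n x) (K * ep + K * (ep * ta))" by (rule SB_add[OF b SB_less[OF r]]) (use hypD[OF h] in auto)
 hence "SB R l M (%n x. f n x - (if n = 0 then a else 0)) (K * ep + K * (ep * ta))" by (simp add: rest_def)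
 thus ?thesis by (rule SB_mono) (use mult_left_mono[OF hypD(10)[OF h] K] in simp)
qed

text \<open>Splits a product at the constant terms into two linear contributions and a product of
  deviations, to which \<open>SB_mult_strict\<close> applies.\<close>

lemma smul_expand:
 "smul f f' n x = a * (f' n x - (if n = 0 then a' else 0)) + a' * (f n x - (if n = 0 then a else 0))
 + smul (%n x. f n x - (if n = 0 then a else 0)) (%n x. f' n x - (if n = 0 then a' else 0)) n x
 + (if n = 0 then a * a' else 0)"
proof (cases "n = 0")
 case True
 thus ?thesis by (simp add: smul_def algebra_simps)
next
 case False
 hence "(SUM i:{0<..<n}. (f i x - (if i = 0 then a else 0)) * (f' (n - i) x - (if n - i = 0 then a' else 0)))
 = (SUM i:{0<..<n}. f i x * f' (n - i) x)" by simp
 thus ?thesis using False by (simp add: smul_Suc algebra_simps)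
qed

text \<open>Two mechanisms make remainders small. A product of two deviations has size
  \<open>ep * ep <= ep * ta\<close> and is known to one order more; a tangential derivative brings
  \<open>R * ep <= ep * ta\<close> together with a shift of the order.\<close>

lemma dual_P2: "dual_calc Om P2 (Eop z)"
proof
 fix l f a b f' a' b'
 assume P: "P2 l f a b" and eq: "!!n x. x : Om ==> f n x = f' n x" "a = a'" "!!n x. x : Om ==> b n x = b' n x"
 obtain K de where "dominated l f a b K de" using P2_D[OF P] by blast
 note K = dominatedD[OF this]
 show "P2 l f' a' b'"
 proof (rule P2_I[OF _ _ K(1,2)])
 show "f' 0 x = a'" "b' 0 x = 0" if "x : Om" for x using P2_0[OF P that] eq that by auto
 fix M ep ta R assume h: "hyp M ep ta R" "ta <= de"
 show "SB R l M b' (K * ep)" by (rule SB_cong[OF K(3)[OF h]]) (rule eq)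
 show "SB R l (Suc M) (rest f' a' b') (K * (ep * ta))" by (rule SB_cong[OF K(4)[OF h]]) (simp add: rest_def eq)
 qed
next
 fix l f a b assume P: "P2 (Suc l) f a b"
 obtain K de where "dominated (Suc l) f a b K de" using P2_D[OF P] by blast
 note K = dominatedD[OF this]
 show "P2 l f a b"
 proof (rule P2_I[OF _ _ K(1,2)])
 fix M ep ta R assume h: "hyp M ep ta R" "ta <= de"
 show "SB R l M b (K * ep)" by (rule SB_low[OF K(3)[OF h] hypD(9)[OF h(1)]])
 show "SB R l (Suc M) (rest f a b) (K * (ep * ta))" by (rule SB_low[OF K(4)[OF h] hypD(9)[OF h(1)]])
 qed (use P2_0[OF P] in auto)
next
 fix l c show "P2 l (%n x. if n = 0 then c else 0) c (%n x. 0)" by (rule P2_I[of _ _ _ 0 1]) (auto intro!: SB_zero simp: rest_def)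
next
 fix l f a b f' a' b' assume P: "P2 l f a b" and P': "P2 l f' a' b'"
 obtain K de where "dominated l f a b K de" using P2_D[OF P] by blast
 note K = dominatedD[OF this]
 obtain K' de' where "dominated l f' a' b' K' de'" using P2_D[OF P'] by blast
 note K' = dominatedD[OF this]
 show "P2 l (%n x. f n x + f' n x) (a + a') (%n x. b n x + b' n x)"
 proof (rule P2_I[of _ _ _ "K + K'" "min de de'"])
 fix M ep ta R assume h: "hyp M ep ta R" "ta <= min de de'"
 show "SB R l M (%n x. b n x + b' n x) ((K + K') * ep)" using SB_add[OF K(3)[OF h(1)] K'(3)[OF h(1)]] h(2) by (simp add: distrib_right)
 have "SB R l (Suc M) (%n x. rest f a b n x + rest f' a' b' n x) ((K + K') * (ep * ta))"
 using SB_add[OF K(4)[OF h(1)] K'(4)[OF h(1)]] h(2) by (simp add: distrib_right)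
 thus "SB R l (Suc M) (rest (%n x. f n x + f' n x) (a + a') (%n x. b n x + b' n x)) ((K + K') * (ep * ta))" by (rule SB_cong) (auto simp: rest_def)
 qed (use K K' P2_0[OF P] P2_0[OF P'] in auto)
next
 fix l f a b f' a' b' assume P: "P2 l f a b" and P': "P2 l f' a' b'"
 obtain K de where "dominated l f a b K de" using P2_D[OF P] by blast
 note K = dominatedD[OF this]
 obtain K' de' where "dominated l f' a' b' K' de'" using P2_D[OF P'] by blast
 note K' = dominatedD[OF this]
 define L where "L = norm a * K' + norm a' * K + 4 * K * K'"
 show "P2 l (smul f f') (a * a') (%n x. a * b' n x + b n x * a')"
 proof (rule P2_I[of _ _ _ L "min de de'"])
 fix M ep ta R assume h: "hyp M ep ta R" "ta <= min de de'"
 note H = hypD[OF h(1)]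
 have "SB R l M (%n x. a * b' n x + a' * b n x) (norm a * (K' * ep) + norm a' * (K * ep))"
 using h(2) by (intro SB_add SB_cmult K(3)[OF h(1)] K'(3)[OF h(1)]) auto
 thus "SB R l M (%n x. a * b' n x + b n x * a') (L * ep)" using H K(1) K'(1) by (elim SB_mono[OF SB_cong]) (auto simp: L_def algebra_simps)
 let ?u = "%n x. f n x - (if n = 0 then a else 0)" and ?u' = "%n x. f' n x - (if n = 0 then a' else 0)"
 have u: "SB R l M ?u (2 * K * ep)" "SB R l M ?u' (2 * K' * ep)"
 using SB_var[OF h(1) K(3)[OF h(1)] K(4)[OF h(1)] K(1)] SB_var[OF h(1) K'(3)[OF h(1)] K'(4)[OF h(1)] K'(1)] h(2) by auto
 have uu: "SB R l (Suc M) (smul ?u ?u') ((2 * K * ep) * (2 * K' * ep))" by (rule SB_mult_strict[OF u H(9)]) (use P2_0[OF P] P2_0[OF P'] in auto)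
 have "SB R l (Suc M) (%n x. (a * rest f' a' b' n x + a' * rest f a b n x) + smul ?u ?u' n x)
 ((norm a * (K' * (ep * ta)) + norm a' * (K * (ep * ta))) + (2 * K * ep) * (2 * K' * ep))"
 using h(2) by (intro SB_add SB_cmult uu K(4)[OF h(1)] K'(4)[OF h(1)]) auto
 hence "SB R l (Suc M) (rest (smul f f') (a * a') (%n x. a * b' n x + b n x * a'))
 ((norm a * (K' * (ep * ta)) + norm a' * (K * (ep * ta))) + (2 * K * ep) * (2 * K' * ep))"
 by (rule SB_cong) (simp only: rest_def smul_expand[of f f' _ _ a a'], simp add: algebra_simps)
 thus "SB R l (Suc M) (rest (smul f f') (a * a') (%n x. a * b' n x + b n x * a')) (L * (ep * ta))"
 proof (rule SB_mono)
 have "(2 * K * ep) * (2 * K' * ep) = 4 * K * K' * (ep * ep)" by simp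
 also have "... <= 4 * K * K' * (ep * ta)" using K(1) K'(1) by (intro mult_left_mono[OF H(11)]) auto
 finally show "norm a * (K' * (ep * ta)) + norm a' * (K * (ep * ta)) + (2 * K * ep) * (2 * K' * ep) <= L * (ep * ta)"
 by (simp add: L_def algebra_simps)
 qed
 qed (use K K' P2_0[OF P] P2_0[OF P'] in "auto simp: smul_def L_def")
next
 fix l f a b I assume P: "P2 (Suc l) f a b"
 obtain K de where "dominated (Suc l) f a b K de" using P2_D[OF P] by blast
 note K = dominatedD[OF this]
 show "P2 l (Eop z I f) 0 (%n x. einf (of_nat n) I * b n x)"
 proof (cases "I = Xinf")
 case True
 show ?thesis
 proof (rule P2_I[OF _ _ K(1,2)])
 fix M ep ta R assume h: "hyp M ep ta R" "ta <= de"
 show "SB R l M (%n x. einf (of_nat n) I * b n x) (K * ep)" using SB_theta[OF K(3)[OF h] hypD(9)[OF h(1)]] True by simp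
 show "SB R l (Suc M) (rest (Eop z I f) 0 (%n x. einf (of_nat n) I * b n x)) (K * (ep * ta))"
 by (rule SB_cong[OF SB_theta[OF K(4)[OF h] hypD(9)[OF h(1)]]]) (auto simp: rest_def True Eop_def algebra_simps)
 qed (use True P2_0[OF P] in "auto simp: Eop_def")
 next
 case False
 define Q where "Q = 3 ^ Suc l * real DIM('x) * A / s"
 have A: "A >= 0" using NB_nonneg zA nonempty_Basis by blast
 have Q: "Q >= 0" using A s by (simp add: Q_def)
 show ?thesis
 proof (rule P2_I[of _ _ _ "2 * Q * K", OF _ _ _ K(2)])
 fix M ep ta R assume h: "hyp M ep ta R" "ta <= de"
 note H = hypD[OF h(1)]
 show "SB R l M (%n x. einf (of_nat n) I * b n x) (2 * Q * K * ep)" by (rule SB_mono[OF SB_zero]) (use False Q K H in auto)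
 have "wt I = 1 \<or> wt I = 2" using False by (cases I) auto
 from SB_Vf[OF SB_var[OF h(1) K(3)[OF h] K(4)[OF h] K(1)] zA H(9,8) this] False
 have "SB R l (Suc M) (%n. if n < wt I then %x. 0 else Vf (z I) (f (n - wt I))) (R * Q * (2 * K * ep))" by (simp add: Q_def)
 hence "SB R l (Suc M) (rest (Eop z I f) 0 (%n x. einf (of_nat n) I * b n x)) (R * Q * (2 * K * ep))"
 by (rule SB_cong) (auto simp: rest_def Eop_def False)
 thus "SB R l (Suc M) (rest (Eop z I f) 0 (%n x. einf (of_nat n) I * b n x)) (2 * Q * K * (ep * ta))"
 proof (rule SB_mono)
 have "R * ep <= (ep * ta) * 1" using H by auto
 from mult_left_mono[OF this, of "2 * Q * K"] show "R * Q * (2 * K * ep) <= 2 * Q * K * (ep * ta)" using Q K by (simp add: mult_ac)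
 qed
 qed (use False Q K P2_0[OF P] wt_pos[of I] in "auto simp: Eop_def")
 qed
qed

lemma A_nonneg: "A >= 0" using NB_nonneg[OF gA[of 0]] by simp

text \<open>The coefficients of order 1 to 8 are not small, but their weights contain
  \<open>R ^ n <= R <= ep * ta\<close>, so they belong to the remainder. The constant 900 stands for
  at most 9 orders, each with \<open>(n + 1) ^ 2 <= 100\<close>.\<close>

lemma low_coeffs:
 assumes f0: "!!x. x : Om ==> f 0 x = a" and b: "!!n x. x : Om ==> n < 9 ==> b n x = 0"
 and fb: "!!n x. x : Om ==> n >= 9 ==> f n x = b n x" and fA: "!!n. n < 9 ==> NB n (f n) A"
 and bv: "!!M ep ta R. hyp M ep ta R ==> SB R 2 M b ep"
 and h: "hyp M ep ta R"
 shows "SB R 2 M b ((900 * A + 1) * ep)" "SB R 2 (Suc M) (rest f a b) ((900 * A + 1) * (ep * ta))"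
proof -
 note H = hypD[OF h]
 have "ep * 1 <= ep * (900 * A + 1)" using H A_nonneg by auto
 thus "SB R 2 M b ((900 * A + 1) * ep)" by (intro SB_mono[OF bv[OF h]]) (simp add: mult.commute)
 define ka where "ka n = (if 0 < n & n < 9 then A else 0)" for n :: nat
 show "SB R 2 (Suc M) (rest f a b) ((900 * A + 1) * (ep * ta))"
 proof (rule SB_I[where ka = ka])
 fix n
 show "NB n (rest f a b n) (ka n)"
 proof (cases "0 < n & n < 9")
 case True
 have "NB n (rest f a b n) A" by (rule NB_cong_Om[OF fA[of n]]) (use True b in "auto simp: rest_def")
 thus ?thesis using True by (simp add: ka_def)
 next
 case False
 have "NB n (rest f a b n) 0" by (rule NB_cong_Om[OF NB_const[of n 0, simplified]]) (use False f0 b fb in "auto simp: rest_def")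
 moreover have "ka n = 0" using False by (auto simp: ka_def)
 ultimately show ?thesis by simp
 qed
 next
 have "(SUM n<Suc M. swt R 2 n * ka n) = (SUM n:{0<..<9} Int {..<Suc M}. swt R 2 n * A)"
 by (rule sum.mono_neutral_cong_right) (auto simp: ka_def)
 also have "... <= (SUM n:{0<..<9} Int {..<Suc M}. R * 100 * A)"
 proof (rule sum_mono)
 fix n assume n: "n : {0<..<9} Int {..<Suc M}"
 have "R ^ n <= R ^ 1" using n H by (intro power_decreasing) auto
 moreover have "real (n + 1) ^ 2 <= 10 ^ 2" using n by (intro power_mono) auto
 ultimately have "swt R 2 n <= R * 100" using H by (intro mult_mono) auto
 thus "swt R 2 n * A <= R * 100 * A" using A_nonneg by (rule mult_right_mono)
 qed
 also have "... = real (card ({0<..<9} Int {..<Suc M})) * (R * 100 * A)" by simp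
 also have "... <= 9 * (R * 100 * A)"
 proof (rule mult_right_mono)
 have "card ({0<..<9} Int {..<Suc M}) <= card {0<..<9::nat}" by (rule card_mono) auto
 thus "real (card ({0<..<9} Int {..<Suc M})) <= 9" by simp
 qed (use H A_nonneg in auto)
 also have "... = 900 * A * R" by simp
 also have "... <= (900 * A + 1) * (ep * ta)" using H A_nonneg mult_left_mono[OF H(2), of "900 * A"] by (simp add: distrib_right)
 finally show "(SUM n<Suc M. swt R 2 n * ka n) <= (900 * A + 1) * (ep * ta)" .
 qed
qed

lemma P2_low_coeffs:
 assumes "!!x. x : Om ==> f 0 x = a" "!!n x. x : Om ==> n < 9 ==> b n x = 0"
 "!!n x. x : Om ==> n >= 9 ==> f n x = b n x" "!!n. n < 9 ==> NB n (f n) A"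
 "!!M ep ta R. hyp M ep ta R ==> SB R 2 M b ep"
 shows "P2 2 f a b" by (rule P2_I[of _ _ _ "900 * A + 1" 1]) (use A_nonneg assms low_coeffs[OF assms] in auto)

lemma g_split:
 "!!x. x : Om ==> g I J 0 x = g0 I J" "!!n x. x : Om ==> n < 9 ==> vk n x I J = 0"
 "!!n x. x : Om ==> n >= 9 ==> g I J n x = vk n x I J" "!!n. n < 9 ==> NB n (g I J n) A"
 "!!M ep ta R. hyp M ep ta R ==> SB R 2 M (%n x. vk n x I J) ep"
proof -
 fix n :: nat and x assume "x : Om" "n >= 9"
 thus "g I J n x = vk n x I J" using g_inf[of x n I] g_inf[of x n J] g_sym[of x I Xinf n] by (auto simp: vk_def v_def)
qed (use g_0 gA hypD(12) in "auto simp: vk_def v_def[abs_def]")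

lemma P2_g: "P2 2 (g I J) (g0 I J) (%n x. vk n x I J)" by (rule P2_low_coeffs[OF g_split])

lemma P2_C: "P2 2 (C I J K) (C0 I J K) (%n x. 0)"
proof (rule P2_low_coeffs)
 fix n assume "n < (9::nat)"
 show "NB n (C I J K n) A"
 proof (cases "n <= 2")
 case False
 hence "NB n (C I J K n) 0" by (intro NB_cong_Om[OF NB_const[of n 0, simplified]]) (auto simp: C(3))
 thus ?thesis using NB_mono A_nonneg by blast
 qed (rule CA)
next
 fix M ep ta R assume "hyp M ep ta R"
 thus "SB R 2 M (%n x. 0) ep" using hypD(3) by (intro SB_mono[OF SB_zero]) (auto simp: less_imp_le)
qed (use C in auto)

section \<open>Estimates for the inverse metric\<close>

definition u :: "'x ser i2" where
 "u L J n x = g L J n x - (if n = 0 then g0 L J else 0)"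

abbreviation "K1 \<equiv> 900 * A + 1"

lemma u_0: "x : Om ==> u L J 0 x = 0" by (simp add: u_def g_0)

lemma SB_u:
 assumes h: "hyp M ep ta R"
 shows "SB R 2 M (u L J) (2 * K1 * ep)" using SB_var[OF h low_coeffs[OF g_split h]] A_nonneg unfolding u_def[abs_def] by simp

lemma smul_delta: "smul f (%n x. if n = 0 then c else 0) n x = f n x * c"
proof -
 have "smul f (%n x. if n = 0 then c else 0) n x = (\<Sum>i=0..n. if i = n then f n x * c else 0)" unfolding smul_def by (rule sum.cong) auto
 thus ?thesis by simp
qed

lemma smul_add_right: "smul f (%n x. p n x + q n x) n x = smul f p n x + smul f q n x" by (simp add: smul_def distrib_left sum.distrib)

text \<open>The inverse as a fixed point \<open>h = gi0 - gi0 * u * h\<close>. As \<open>u\<close>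
  has no constant term, the right-hand side uses \<open>h\<close> at lower orders only.\<close>

lemma h_fix:
 assumes x: "x : Om"
 shows "h I K n x = (if n = 0 then gi0 I K else 0) + (- 1) * (SUM L:UNIV. gi0 I L * (SUM J:UNIV. smul (u L J) (h J K) n x))"
proof (cases "n = 0")
 case True
 thus ?thesis using x by (simp add: smul_def u_0 h_0)
next
 case False
 have "smul (u L J) (h J K) n x = (SUM i:{0<..n}. g L J i x * h J K (n - i) x)" for L J
 proof -
 have "{0..n} = insert 0 {0<..n}" by auto
 thus ?thesis by (auto simp: smul_def u_def g_0[OF x])
 qed
 thus ?thesis using h_rec[OF x, of n I K] False by simp
qed

lemma norm_gi0: "norm (gi0 I J) <= 1" by (cases I; cases J) auto

lemma card_idx [simp]: "CARD(idx) = 4" by (simp add: UNIV_idx)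

lemma SB_dsum:
 fixes f :: "'x ser i2"
 assumes "!!L J. SB R l M (f L J) K" "K >= 0"
 shows "SB R l M (%n x. (- 1) * (SUM L:UNIV. gi0 I L * (SUM J:UNIV. f L J n x))) (16 * K)"
proof (rule SB_mono)
 have "SB R l M (%n x. SUM J:UNIV. f L J n x) (SUM J:(UNIV :: idx set). K)" for L
 by (rule SB_sum[of R l M "%J. f L J" "%_. K"]) (rule assms(1))
 hence "SB R l M (%n x. SUM L:UNIV. gi0 I L * (SUM J:UNIV. f L J n x)) (SUM L:UNIV. norm (gi0 I L) * (SUM J:(UNIV :: idx set). K))"
 by (intro SB_sum[of R l M "%L n x. gi0 I L * (SUM J:UNIV. f L J n x)"] SB_cmult)
 thus "SB R l M (%n x. (- 1) * (SUM L:UNIV. gi0 I L * (SUM J:UNIV. f L J n x)))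
 (norm (- 1 :: complex) * (SUM L:UNIV. norm (gi0 I L) * (SUM J:(UNIV :: idx set). K)))" by (rule SB_cmult)
 have "(SUM L:UNIV. norm (gi0 I L) * (SUM J:(UNIV :: idx set). K)) <= (SUM L:(UNIV :: idx set). 1 * (4 * K))"
 using norm_gi0 assms(2) by (intro sum_mono mult_mono) auto
 thus "norm (- 1 :: complex) * (SUM L:UNIV. norm (gi0 I L) * (SUM J:(UNIV :: idx set). K)) <= 16 * K" by simp
qed

lemma SB_trunc: "SB R l M f K ==> N <= M ==> R >= 0 ==> SB R l N f K"
proof -
 assume "SB R l M f K" and *: "N <= M" "R >= 0"
 then obtain ka where k: "ALL n<M. NB n (f n) (ka n)" "(SUM n<M. swt R l n * ka n) <= K" unfolding SB_def by blast
 have "(SUM n<N. swt R l n * ka n) <= (SUM n<M. swt R l n * ka n)" using k(1) NB_nonneg * by (intro sum_mono2) auto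
 thus ?thesis using k * by (intro SB_I[where ka = ka]) auto
qed

text \<open>A Neumann series as an induction on the order of truncation. The constant 64 is 16
  terms, times 2 from \<open>SB_u\<close>, times the bound 2 for \<open>h\<close>; the smallness of
  \<open>ta\<close> makes the correction at most 1, so the bound 2 reproduces itself.\<close>

lemma h_bounds:
 assumes hy: "hyp M ep ta R" and small: "ta <= 1 / (64 * K1)"
 shows "SB R 2 M (h I K) 2" "SB R 2 M (%n x. h I K n x - (if n = 0 then gi0 I K else 0)) (64 * K1 * ep)"
proof -
 note H = hypD[OF hy]
 have K1: "K1 > 0" using A_nonneg by linarith
 have e: "64 * K1 * ep <= 1" using mult_left_mono[OF order_trans[OF H(4) small], of "64 * K1"] K1 by simp
 have st: "SB R 2 (Suc N) (%n x. (- 1) * (SUM L:UNIV. gi0 I L * (SUM J:UNIV. smul (u L J) (h J K) n x))) (64 * K1 * ep)"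
 if "Suc N <= M" "!!J. SB R 2 N (h J K) 2" for N I K
 proof -
 have "SB R 2 (Suc N) (smul (u L J) (h J K)) (2 * K1 * ep * 2)" for L J
 by (rule SB_mult_half[OF SB_trunc[OF SB_u[OF hy] that(1) H(9)] that(2) H(9)]) (use u_0 in auto)
 thus ?thesis by (rule SB_mono[OF SB_dsum[of R 2 "Suc N" "%L J. smul (u L J) (h J K)" "2 * K1 * ep * 2" I]]) (use K1 H(3) in auto)
 qed
 have hN: "SB R 2 N (h I K) 2" if "N <= M" for N I K using that
 proof (induction N arbitrary: I K)
 case 0
 show ?case by (rule SB_mono[OF SB_zero]) auto
 next
 case (Suc N)
 have "SB R 2 (Suc N) (h I K) (norm (gi0 I K) + 64 * K1 * ep)"
 by (rule SB_cong[OF SB_add[OF SB_delta[OF H(9), of 2 _ "gi0 I K"] st[where I = I and K = K, OF Suc(2)]]])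
 (use Suc h_fix[symmetric] in auto)
 thus ?case by (rule SB_mono) (use norm_gi0[of I K] e in linarith)
 qed
 thus "SB R 2 M (h I K) 2" by simp
 show "SB R 2 M (%n x. h I K n x - (if n = 0 then gi0 I K else 0)) (64 * K1 * ep)"
 proof (cases M)
 case 0
 show ?thesis by (rule SB_mono[OF SB_zero]) (use 0 K1 H in auto)
 next
 case (Suc N)
 have "SB R 2 (Suc N) (%n x. (- 1) * (SUM L:UNIV. gi0 I L * (SUM J:UNIV. smul (u L J) (h J K) n x))) (64 * K1 * ep)"
 by (rule st) (use Suc hN in auto)
 thus ?thesis unfolding Suc by (rule SB_cong) (simp add: h_fix)
 qed
qed

lemma g_rest: "hyp M ep ta R ==> SB R 2 (Suc M) (rest (g L J) (g0 L J) (%n x. vk n x L J)) (K1 * (ep * ta))" by (rule low_coeffs(2)[OF g_split])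

text \<open>In the fixed point equation the leading term \<open>gi0\<close> of \<open>h\<close>
  produces \<open>gi1\<close>. What is left is the remainder of \<open>g\<close> and the product of
  \<open>u\<close> with the deviation of \<open>h\<close>, which is quadratic; 128 is the product of
  the factors 2 and 64 in their bounds.\<close>

lemma P2_h: "P2 2 (h I K) (gi0 I K) (%n x. gi1 (vk n x) I K)"
proof (rule P2_I[of _ _ _ "16 * (K1 + 128 * K1 * K1)" "1 / (64 * K1)"])
 have K1: "K1 > 0" using A_nonneg by linarith
 show "16 * (K1 + 128 * K1 * K1) >= 0" "1 / (64 * K1) > 0" using K1 by auto
 fix M ep ta R assume hy: "hyp M ep ta R" and small: "ta <= 1 / (64 * K1)"
 note H = hypD[OF hy]
 have gi: "gi1 k I K = (- 1) * (SUM L:UNIV. gi0 I L * (SUM J:UNIV. gi0 J K * k L J))" for k :: "complex i2"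
 by (simp add: gi1_def sum_idx algebra_simps)
 have "SB R 2 M (%n x. gi0 J K * vk n x L J) (1 * ep)" for L J
 by (rule SB_mono[OF SB_cmult[OF g_split(5)[OF hy]]]) (use norm_gi0[of J K] H in "intro mult_right_mono, auto")
 hence "SB R 2 M (%n x. gi1 (vk n x) I K) (16 * ep)" using SB_dsum[of R 2 M "%L J n x. gi0 J K * vk n x L J" "1 * ep" I] H unfolding gi by simp
 thus "SB R 2 M (%n x. gi1 (vk n x) I K) (16 * (K1 + 128 * K1 * K1) * ep)"
 proof (rule SB_mono)
 have "K1 >= 1" "K1 * K1 >= 0" using A_nonneg by auto
 hence "1 <= K1 + 128 * K1 * K1" by simp
 from mult_right_mono[OF this, of ep] show "16 * ep <= 16 * (K1 + 128 * K1 * K1) * ep" using H by simp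
 qed
 let ?z = "%L J n x. gi0 J K * rest (g L J) (g0 L J) (%n x. vk n x L J) n x" and ?B = "1 * (K1 * (ep * ta)) + (2 * K1 * ep) * (64 * K1 * ep)"
 let ?y = "%J n x. h J K n x - (if n = 0 then gi0 J K else 0)"
 have "SB R 2 (Suc M) (%n x. ?z L J n x + smul (u L J) (?y J) n x)
 (?B)" for L J
 proof (rule SB_add)
 show "SB R 2 (Suc M) (?z L J) (1 * (K1 * (ep * ta)))"
 by (rule SB_mono[OF SB_cmult[OF g_rest[OF hy]]])
 (use norm_gi0[of J K] H K1 in "intro mult_right_mono, auto")
 show "SB R 2 (Suc M) (smul (u L J) (?y J)) ((2 * K1 * ep) * (64 * K1 * ep))"
 by (rule SB_mult_strict[OF SB_u[OF hy] h_bounds(2)[OF hy small] H(9)]) (use u_0 h_0 in auto)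
 qed
 hence "SB R 2 (Suc M) (%n x. (- 1) * (SUM L:UNIV. gi0 I L * (SUM J:UNIV.
 ?z L J n x + smul (u L J) (?y J) n x)))
 (16 * (?B))" by (rule SB_dsum) (use K1 H in simp)
 hence "SB R 2 (Suc M) (rest (h I K) (gi0 I K) (%n x. gi1 (vk n x) I K))
 (16 * (?B))"
 proof (rule SB_cong)
 fix n x assume x: "x : Om"
 have sp: "smul (u L J) (h J K) n x = ?z L J n x
 + gi0 J K * vk n x L J + smul (u L J) (?y J) n x" for L J
 proof -
 have "smul (u L J) (h J K) n x = smul (u L J) (%n x. (if n = 0 then gi0 J K else 0) + ?y J n x) n x" by simp
 also have "... = u L J n x * gi0 J K + smul (u L J) (?y J) n x" unfolding smul_add_right smul_delta ..
 finally show ?thesis by (simp add: rest_def u_def algebra_simps)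
 qed
 show "(- 1) * (SUM L:UNIV. gi0 I L * (SUM J:UNIV.
 ?z L J n x + smul (u L J) (?y J) n x))
 = rest (h I K) (gi0 I K) (%n x. gi1 (vk n x) I K) n x" unfolding rest_def[of "h I K"] h_fix[OF x, of I K] sp gi
 by (simp add: sum.distrib distrib_left)
 qed
 thus "SB R 2 (Suc M) (rest (h I K) (gi0 I K) (%n x. gi1 (vk n x) I K)) (16 * (K1 + 128 * K1 * K1) * (ep * ta))"
 proof (rule SB_mono)
 have "(2 * K1 * ep) * (64 * K1 * ep) = 128 * K1 * K1 * (ep * ep)" by (simp add: algebra_simps)
 also have "... <= 128 * K1 * K1 * (ep * ta)" using K1 by (intro mult_left_mono[OF H(11)]) auto
 finally have *: "(2 * K1 * ep) * (64 * K1 * ep) <= 128 * K1 * K1 * (ep * ta)" .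
 show "16 * (?B) <= 16 * (K1 + 128 * K1 * K1) * (ep * ta)"
 using * by (simp only: distrib_left distrib_right)
 qed
next
 fix x assume "x : Om"
 thus "h I K 0 x = gi0 I K" "gi1 (vk 0 x) I K = 0" using h_0 by (simp_all add: gi1_def vk_def v_def)
qed

section \<open>The linear equations for the tail and their inversion\<close>

definition lin :: "'x ser i2" where
 "lin I J n x = Ric1 (of_nat n) (vk n x) I J + 3/2 * vk n x I J"

lemma normal_vk: "x : Om ==> normal_sym (vk n x)" unfolding normal_sym_def vk_def v_def using g_sym by auto

text \<open>The Einstein tensor vanishes, so its principal part \<open>lin\<close> is minus its
  remainder and inherits the smallness and the extra order. Sum and minimum over the finitely many
  components make the constants uniform.\<close>

lemma lin_small:
 obtains K de where "K >= 0" "de > 0"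
 "!!M ep ta R I J. hyp M ep ta R ==> ta <= de ==> SB R 0 (Suc M) (lin I J) (K * (ep * ta))"
proof -
 interpret dual_calc Om P2 "Eop z" by (rule dual_P2)
 have "EX K de. K >= 0 & de > 0 & (ALL M ep ta R. hyp M ep ta R --> ta <= de --> SB R 0 (Suc M) (lin I J) (K * (ep * ta)))" for I J
 proof -
 obtain K de where "dominated 0 (%n x. Rc (Eop z) (Ga (Eop z) C g h) I J n x + 3/2 * g I J n x) 0
 (%n x. Ric1 (of_nat n) (vk n x) I J + 3/2 * vk n x I J) K de" using P2_D[OF P_Einstein[OF P2_g P2_h P2_C, of I J]] by blast
 note K = dominatedD[OF this]
 have "SB R 0 (Suc M) (lin I J) (K * (ep * ta))" if "hyp M ep ta R" "ta <= de" for M ep ta R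
 proof -
 have "SB R 0 (Suc M) (lin I J) (norm (- 1 :: complex) * (K * (ep * ta)))"
 by (rule SB_cong[OF SB_cmult[OF K(4)[OF that], of "- 1"]]) (simp only: rest_def lin_def Ein, simp)
 thus ?thesis by simp
 qed
 thus ?thesis using K(1,2) by blast
 qed
 then obtain Kf def where f: "!!I J. Kf I J >= (0::real)" "!!I J. def I J > (0::real)"
 "!!I J M ep ta R. hyp M ep ta R ==> ta <= def I J ==> SB R 0 (Suc M) (lin I J) (Kf I J * (ep * ta))" by metis
 define K where "K = (SUM p:(UNIV :: (idx \<times> idx) set). Kf (fst p) (snd p))"
 define de where "de = Min (range (%p. def (fst p) (snd p)))"
 have Kle: "Kf I J <= K" for I J unfolding K_def using member_le_sum[of "(I, J)" UNIV "%p. Kf (fst p) (snd p)"] f(1) by simp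
 have dle: "de <= def I J" for I J unfolding de_def by (rule Min_le) (auto intro: image_eqI[of _ _ "(I, J)"])
 have "de > 0" unfolding de_def using f(2) by auto
 moreover have "K >= 0" unfolding K_def using f(1) by (intro sum_nonneg)
 moreover have "SB R 0 (Suc M) (lin I J) (K * (ep * ta))" if h: "hyp M ep ta R" "ta <= de" for M ep ta R I J
 proof (rule SB_mono[OF f(3)[OF h(1)]])
 show "ta <= def I J" using h(2) dle order_trans by blast
 show "Kf I J * (ep * ta) <= K * (ep * ta)" using hypD(3,6)[OF h(1)] by (intro mult_right_mono Kle) auto
 qed
 ultimately show ?thesis using that by blast
qed

text \<open>Multipliers of size \<open>1 / n^2\<close> restore the two powers of
  \<open>n + 1\<close> that the second order operator has used up.\<close>

lemma SB_scale:
 assumes f: "SB R 0 M f K" and eq: "!!n x. x : Om ==> f' n x = of_real (c n) * f n x"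
 and c: "!!n. \<bar>c n\<bar> * real (n + 1) ^ 2 <= D" and R: "R >= 0"
 shows "SB R 2 M f' (D * K)"
proof -
 obtain ka where k: "ALL n<M. NB n (f n) (ka n)" "(SUM n<M. swt R 0 n * ka n) <= K" using f unfolding SB_def by blast
 have D: "D >= 0" using c[of 0] by auto
 show ?thesis
 proof (rule SB_I[where ka = "%n. \<bar>c n\<bar> * ka n"])
 fix n assume "n < M"
 hence "NB n (%x. of_real (c n) * f n x) (norm (of_real (c n) :: complex) * ka n)" using k(1) by (intro NB_cmult) auto
 thus "NB n (f' n) (\<bar>c n\<bar> * ka n)" by (simp add: NB_cong_Om eq)
 next
 have "(SUM n<M. swt R 2 n * (\<bar>c n\<bar> * ka n)) <= (SUM n<M. D * (R ^ n * ka n))"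
 proof (rule sum_mono)
 fix n assume "n : {..<M}"
 hence "R ^ n * ka n >= 0" using k(1) NB_nonneg R by auto
 from mult_right_mono[OF c[of n] this]
 show "swt R 2 n * (\<bar>c n\<bar> * ka n) <= D * (R ^ n * ka n)" by (simp add: mult_ac)
 qed
 also have "... <= D * K" using k(2) D unfolding sum_distrib_left[symmetric] by (intro mult_left_mono) auto
 finally show "(SUM n<M. swt R 2 n * (\<bar>c n\<bar> * ka n)) <= D * K" .
 qed
qed

text \<open>The inverse of the indicial matrix decays like \<open>1 / n\<^sup>2\<close> beyond the last resonance \<open>n = 8\<close>.\<close>

definition c11 :: "nat => real" where
 "c11 n = (if n < 9 then 0 else - 8 / (real n * (real n - 4)))"

definition c01 :: "nat => real" where
 "c01 n = (if n < 9 then 0 else - 8 / ((real n - 5) * (real n + 1)))"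

definition cD :: "nat => real" where
 "cD n = real n * (real n - 6) * (real n - 8) * (real n + 2)"

definition cc :: "nat => nat => real" where
 "cc i n = (if n < 9 then 0 else
 (if i = 0 then 64 - 8 * real n * (real n - 6) else if i = 1 then - 32 * (real n - 2)
 else if i = 2 then 32 - 8 * real n * (real n - 6) else - 8 * (real n - 4)) / cD n)"

text \<open>Substituting \<open>n = j + 9\<close> with \<open>j >= 0\<close> turns every estimate
  into a comparison of polynomials in \<open>j\<close>; 400 is a crude common bound.\<close>

lemma c_bounds:
 "\<bar>c11 n\<bar> * real (n + 1) ^ 2 <= 400" "\<bar>c01 n\<bar> * real (n + 1) ^ 2 <= 400" "\<bar>cc i n\<bar> * real (n + 1) ^ 2 <= 400"
proof -
 have "\<bar>c11 n\<bar> * real (n + 1) ^ 2 <= 400 & \<bar>c01 n\<bar> * real (n + 1) ^ 2 <= 400 & \<bar>cc i n\<bar> * real (n + 1) ^ 2 <= 400"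
 proof (cases "n < 9")
 case True
 thus ?thesis by (simp add: c11_def c01_def cc_def)
 next
 case False
 define j where "j = real n - 9"
 have j: "j >= 0" and n: "real n = j + 9" using False by (auto simp: j_def)
 have pw: "0 <= j" "0 <= j^2" "0 <= j^3" "0 <= j^4" using j by auto
 have "\<bar>c11 n\<bar> = 8 / ((j + 9) * (j + 5))" using False j by (simp add: c11_def n)
 moreover have "8 * (j + 10)^2 <= 400 * ((j + 9) * (j + 5))" using pw by (simp add: algebra_simps power2_eq_square)
 ultimately have 1: "\<bar>c11 n\<bar> * real (n + 1) ^ 2 <= 400" using j by (simp add: n divide_le_eq add.commute)
 have "\<bar>c01 n\<bar> = 8 / ((j + 4) * (j + 10))" using False j by (simp add: c01_def n add.commute)
 moreover have "8 * (j + 10)^2 <= 400 * ((j + 4) * (j + 10))" using pw by (simp add: power2_eq_square)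
 ultimately have 2: "\<bar>c01 n\<bar> * real (n + 1) ^ 2 <= 400" using j by (simp add: n divide_le_eq add.commute)
 have D: "cD n = (j + 9) * (j + 3) * (j + 1) * (j + 11)" by (simp add: cD_def n algebra_simps)
 have Dp: "cD n > 0" unfolding D using j by auto
 have bd: "b * (j + 10)^2 <= 400 * cD n" if "0 <= b" "b <= 8 * ((j + 9) * (j + 3)) + 32 * (j + 7)" for b
 proof -
 have "b * (j + 10)^2 <= (8 * ((j + 9) * (j + 3)) + 32 * (j + 7)) * (j + 10)^2" using that(2) by (rule mult_right_mono) auto
 also have "... <= 400 * cD n" unfolding D using pw by (simp add: algebra_simps power2_eq_square)
 finally show ?thesis .
 qed
 define b where "b = (if i = 0 then 64 - 8 * real n * (real n - 6) else if i = 1 then - 32 * (real n - 2)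
 else if i = 2 then 32 - 8 * real n * (real n - 6) else - 8 * (real n - 4))"
 have "\<bar>b\<bar> <= 8 * ((j + 9) * (j + 3)) + 32 * (j + 7)" using pw by (auto simp: b_def n abs_le_iff algebra_simps)
 from bd[OF _ this] have "\<bar>b\<bar> * (j + 10)^2 <= 400 * cD n" by simp
 moreover have "\<bar>cc i n\<bar> = \<bar>b\<bar> / cD n" using False Dp by (simp add: cc_def b_def)
 ultimately have 3: "\<bar>cc i n\<bar> * real (n + 1) ^ 2 <= 400" using Dp by (simp add: n divide_le_eq add.commute)
 show ?thesis using 1 2 3 by simp
 qed
 thus "\<bar>c11 n\<bar> * real (n + 1) ^ 2 <= 400" "\<bar>c01 n\<bar> * real (n + 1) ^ 2 <= 400" "\<bar>cc i n\<bar> * real (n + 1) ^ 2 <= 400"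
 by auto
qed

text \<open>Cramer's rule for the block on \<open>X0 X0\<close> and \<open>X1 X1bar\<close>, whose
  determinant is \<open>cD n / 64\<close>; the coefficients \<open>cc\<close> contain the cleared
  factor 64. Below order 9 both sides vanish.\<close>

lemma v_solve:
 assumes x: "x : Om"
 shows "v X1 X1 n x = of_real (c11 n) * lin X1 X1 n x" "v X1bar X1bar n x = of_real (c11 n) * lin X1bar X1bar n x"
 "v X0 X1 n x = of_real (c01 n) * lin X0 X1 n x" "v X0 X1bar n x = of_real (c01 n) * lin X0 X1bar n x"
 "v X0 X0 n x = of_real (cc 0 n) * lin X0 X0 n x + of_real (cc 1 n) * lin X1 X1bar n x"
 "v X1 X1bar n x = of_real (cc 2 n) * lin X1 X1bar n x + of_real (cc 3 n) * lin X0 X0 n x"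
proof -
 let ?m = "of_nat n :: complex"
 have small: "v I J n x = 0" if "n < 9" for I J using that by (simp add: v_def)
 have rn: "complex_of_real (real n) = ?m" by simp
 have m: "?m ~= of_nat k" if "~ n < 9" "k < 9" for k using that by (metis of_nat_eq_iff)
 have m': "?m ~= 0" "?m - 4 ~= 0" "?m - 5 ~= 0" "?m - 6 ~= 0" "?m - 8 ~= 0" "?m + 1 ~= 0" "?m + 2 ~= 0" if "~ n < 9"
 using m[OF that, of 0] m[OF that, of 4] m[OF that, of 5] m[OF that, of 6] m[OF that, of 8]
 of_nat_neq_0[of n, where 'a = complex] of_nat_neq_0[of "Suc n", where 'a = complex] by (auto simp: add.commute)
 note L = lin_def Ric1_tab[OF normal_vk[OF x]]
 show "v X1 X1 n x = of_real (c11 n) * lin X1 X1 n x" "v X1bar X1bar n x = of_real (c11 n) * lin X1bar X1bar n x"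
 unfolding L using small m' by (cases "n < 9"; simp add: c11_def vk_def)+
 show "v X0 X1 n x = of_real (c01 n) * lin X0 X1 n x" "v X0 X1bar n x = of_real (c01 n) * lin X0 X1bar n x"
 unfolding L using small m' by (cases "n < 9"; simp add: c01_def vk_def)+
 have "v X0 X0 n x = of_real (cc 0 n) * lin X0 X0 n x + of_real (cc 1 n) * lin X1 X1bar n x
 & v X1 X1bar n x = of_real (cc 2 n) * lin X1 X1bar n x + of_real (cc 3 n) * lin X0 X0 n x"
 proof (cases "n < 9")
 case True
 thus ?thesis using small by (simp add: cc_def)
 next
 case False
 define Dc where "Dc = ?m * (?m - 6) * (?m - 8) * (?m + 2)"
 have Dn: "Dc ~= 0" using m'[OF False] by (simp add: Dc_def)
 have Dr: "complex_of_real (cD n) = Dc" by (simp add: cD_def Dc_def)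
 define q where "q = - ?m * (?m - 6) / 8"
 have A: "lin X0 X0 n x = (1/2 + q) * v X0 X0 n x + (?m - 2) / 2 * v X1 X1bar n x"
 and B: "lin X1 X1bar n x = (?m - 4) / 8 * v X0 X0 n x + (1 + q) * v X1 X1bar n x" unfolding L by (simp_all add: vk_def q_def)
 have det: "(1/2 + q) * (1 + q) - (?m - 2) / 2 * ((?m - 4) / 8) = Dc / 64" by (simp add: q_def Dc_def field_simps)
 have cr: "d * (a * r + b * t) - b * (c * r + d * t) = (a * d - b * c) * r"
 "a * (c * r + d * t) - c * (a * r + b * t) = (a * d - b * c) * t" for a b c d r t :: complex by (simp_all add: algebra_simps)
 have s1: "(1 + q) * lin X0 X0 n x - (?m - 2) / 2 * lin X1 X1bar n x = Dc / 64 * v X0 X0 n x"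
 and s2: "(1/2 + q) * lin X1 X1bar n x - (?m - 4) / 8 * lin X0 X0 n x = Dc / 64 * v X1 X1bar n x" unfolding A B cr det by simp_all
 have e: "of_real (cc 0 n) = 64 * (1 + q) / Dc" "of_real (cc 1 n) = - 64 * ((?m - 2) / 2) / Dc"
 "of_real (cc 2 n) = 64 * (1/2 + q) / Dc" "of_real (cc 3 n) = - 64 * ((?m - 4) / 8) / Dc"
 using False Dn by (simp_all add: cc_def Dr q_def field_simps)
 have comb: "64 * a / Dc * X + - 64 * b / Dc * Y = 64 / Dc * (a * X - b * Y)" for a b X Y by (simp add: right_diff_distrib mult.assoc)
 show ?thesis unfolding e comb s1 s2 using Dn by simp
 qed
 thus "v X0 X0 n x = of_real (cc 0 n) * lin X0 X0 n x + of_real (cc 1 n) * lin X1 X1bar n x"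
 "v X1 X1bar n x = of_real (cc 2 n) * lin X1 X1bar n x + of_real (cc 3 n) * lin X0 X0 n x" by auto
qed

lemma v_bound:
 assumes "!!I J. SB R 0 M (lin I J) K" and R: "R >= 0"
 shows "SB R 2 M (v I J) (800 * K)"
proof -
 have K: "K >= 0" by (rule SB_nonneg[OF assms])
 have "!!f' n x c I J. (!!n x. x : Om ==> f' n x = of_real (c n) * lin I J n x) ==>
 (!!n. \<bar>c n\<bar> * real (n + 1) ^ 2 <= 400) ==> SB R 2 M f' (400 * K)" by (rule SB_scale[OF assms(1) _ _ R])
 note sc = this
 have two: "SB R 2 M f (800 * K)" if "SB R 2 M f (400 * K)" for f by (rule SB_mono[OF that]) (use K in auto)
 have s11: "SB R 2 M (v X1 X1) (800 * K)" by (rule two[OF sc[OF v_solve(1) c_bounds(1)]])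
 have sbb: "SB R 2 M (v X1bar X1bar) (800 * K)" by (rule two[OF sc[OF v_solve(2) c_bounds(1)]])
 have s01: "SB R 2 M (v X0 X1) (800 * K)" by (rule two[OF sc[OF v_solve(3) c_bounds(2)]])
 have s0b: "SB R 2 M (v X0 X1bar) (800 * K)" by (rule two[OF sc[OF v_solve(4) c_bounds(2)]])
 have a: "SB R 2 M (%n x. of_real (cc i n) * lin I J n x) (400 * K)" for i I J by (rule sc[OF refl c_bounds(3)])
 have s00: "SB R 2 M (v X0 X0) (800 * K)" using SB_cong[OF SB_add[OF a[of 0 X0 X0] a[of 1 X1 X1bar]], of "v X0 X0"] v_solve(5) by simp
 have s1b: "SB R 2 M (v X1 X1bar) (800 * K)" using SB_cong[OF SB_add[OF a[of 2 X1 X1bar] a[of 3 X0 X0]], of "v X1 X1bar"] v_solve(6) by simp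
 have sI: "SB R 2 M (v I J) (800 * K)" if "I = Xinf \<or> J = Xinf" for I J by (rule SB_mono[OF SB_zero]) (use that K in "auto simp: v_def")
 have sy: "SB R 2 M (v I J) (800 * K)" if "SB R 2 M (v J I) (800 * K)" for I J by (rule SB_cong[OF that]) (use g_sym in "auto simp: v_def")
 show ?thesis by (cases I; cases J) (use s11 sbb s01 s0b s00 s1b sI sy in blast)+
qed

text \<open>With \<open>ep = ta\<close> and \<open>R = ta * ta\<close> the equations return the
  bound \<open>800 * K * ta * ta\<close>, and \<open>ta\<close> is chosen so that this is at most
  \<open>ta\<close>. The hypothesis thus passes from \<open>M\<close> to \<open>Suc M\<close>, and
  the geometric bound is a single term of the bounded sum.\<close>

theorem coefficient_bound:
 "EX R>0. EX K. ALL n I J. NB n (g I J n) (K / R ^ n)"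
proof -
 obtain K de where K: "K >= 0" "de > 0"
 "!!M ep ta R I J. hyp M ep ta R ==> ta <= de ==> SB R 0 (Suc M) (lin I J) (K * (ep * ta))" by (rule lin_small) (erule that, assumption+)
 define ta where "ta = min 1 (min de (1 / (800 * K + 1)))"
 have ta: "0 < ta" "ta <= 1" "ta <= de" "ta <= 1 / (800 * K + 1)" using K by (auto simp: ta_def)
 have Kta: "800 * K * ta <= 1"
 proof -
 have "(800 * K + 1) * ta <= (800 * K + 1) * (1 / (800 * K + 1))" using ta(4) K(1) by (intro mult_left_mono) auto
 thus ?thesis using ta(1) K(1) by (simp add: distrib_right)
 qed
 define R where "R = ta * ta"
 have R: "0 < R" "R <= 1" using ta by (auto simp: R_def mult_le_one)
 have step: "SB R 2 M (v I J) ta" for M I J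
 proof (induction M arbitrary: I J)
 case 0
 show ?case by (rule SB_mono[OF SB_zero]) (use ta in auto)
 next
 case (Suc M)
 hence h: "hyp M ta ta R" using ta by (simp add: hyp_def R_def)
 have "SB R 2 (Suc M) (v I J) (800 * (K * (ta * ta)))" by (rule v_bound[OF K(3)[OF h ta(3)]]) (use R in auto)
 thus ?case by (rule SB_mono) (use mult_right_mono[OF Kta, of ta] ta in simp)
 qed
 have "NB n (g I J n) ((A + ta) / R ^ n)" for n I J
 proof (cases "n < 9")
 case True
 have "R ^ n <= 1" using R by (intro power_le_one) auto
 hence "A * R ^ n <= A + ta" using mult_left_le[of "R ^ n" A] A_nonneg ta by linarith
 thus ?thesis by (intro NB_mono[OF gA[OF True]]) (use R in "simp add: pos_le_divide_eq")
 next
 case False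
 obtain ka where k: "ALL i<Suc n. NB i (v I J i) (ka i)" "(SUM i<Suc n. swt R 2 i * ka i) <= ta"
 using step[of "Suc n" I J] unfolding SB_def by blast
 have nn: "ka i >= 0" if "i < Suc n" for i using k(1) NB_nonneg that by blast
 have "R ^ n * ka n <= swt R 2 n * ka n" using R nn[of n] by (intro mult_right_mono) auto
 also have "... <= (SUM i<Suc n. swt R 2 i * ka i)" by (rule member_le_sum) (use R nn in auto)
 finally have "R ^ n * ka n <= A + ta" using k(2) A_nonneg by linarith
 hence "ka n <= (A + ta) / R ^ n" using R by (simp add: pos_le_divide_eq mult.commute)
 moreover have "NB n (g I J n) (ka n)" by (rule NB_cong_Om[of n "v I J n"]) (use k(1) False g_split(3)[of _ n I J] in "auto simp: vk_def")
 ultimately show ?thesis by (rule NB_mono[rotated])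
 qed
 thus ?thesis using R(1) by blast
qed

end

subsection \<open>Joint convergence\<close>

text \<open>Splits a multi-index of the product space into the order in the boundary variable, its
  value at \<open>(0, 1)\<close>, and a multi-index along the boundary.\<close>

definition jointc :: "(nat => ('x::euclidean_space => nat) => complex) => ('x \<times> real => nat) => complex" where
 "jointc c be = c (be (0, 1)) (\<lambda>b\<in>Basis. be (b, 0))"

lemma Basis_prod_real: "(Basis :: ('x::euclidean_space \<times> real) set) = insert (0, 1) ((%b. (b, 0)) ` Basis)" by (auto simp: Basis_prod_def)

lemma joint_bij:
 "bij_betw (%be. (be (0, 1), \<lambda>b\<in>Basis. be (b, 0))) (MI :: ('x::euclidean_space \<times> real => nat) set) (UNIV \<times> MI)"
proof (rule bij_betw_byWitness[where f' = "%(n, al). \<lambda>b\<in>Basis. if b = (0, 1) then n else al (fst b)"])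
 show "ALL be:MI. (%(n, al). \<lambda>b\<in>Basis. if b = (0, 1) then n else al (fst b))
 (be (0, 1), \<lambda>b\<in>Basis. be (b, 0)) = (be :: 'x \<times> real => nat)" by (auto intro!: MI_eqI simp: Basis_prod_real) (auto simp: MI_def)
 show "ALL p:UNIV \<times> MI. (%be. (be (0, 1), \<lambda>b\<in>Basis. be (b, 0)))
 ((%(n, al). \<lambda>b\<in>(Basis :: ('x \<times> real) set). if b = (0, 1) then n else al (fst b)) p) = p"
 proof
 fix p :: "nat \<times> ('x => nat)" assume p: "p : UNIV \<times> MI"
 thus "(%be. (be (0, 1), \<lambda>b\<in>Basis. be (b, 0)))
 ((%(n, al). \<lambda>b\<in>(Basis :: ('x \<times> real) set). if b = (0, 1) then n else al (fst b)) p) = p"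
 by (auto intro!: MI_eqI simp: Basis_prod_real, auto simp: MI_def)
 qed
qed (auto simp: MI_def)

lemma joint_mdeg: "mdeg (be :: 'x::euclidean_space \<times> real => nat) = be (0, 1) + mdeg (\<lambda>b\<in>Basis. be (b, 0))"
 unfolding mdeg_def Basis_prod_real by (subst sum.insert) (auto simp: sum.reindex inj_on_def)

lemma joint_mon: "mon (y, r) (be :: 'x::euclidean_space \<times> real => nat) = r ^ be (0, 1) * mon y (\<lambda>b\<in>Basis. be (b, 0))"
 unfolding mon_def Basis_prod_real by (subst prod.insert) (auto simp: prod.reindex inj_on_def)

text \<open>Absolute convergence of the double series gives one power series in all variables
  jointly; regrouped by the boundary variable it is the given series of functions.\<close>

lemma hps_joint:
 fixes x0 :: "'x::euclidean_space"
 assumes t: "t > 0" and c: "!!n. asum (c n) t" and sm: "summable (%n. wn (c n) t * t ^ n)"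
 obtains G where "hps G (x0, 0::real) (jointc c) t"
 "!!y r. (y, r) : pd (x0, 0) t ==>
 (%n. (infsum (%al. c n al * of_real (mon (y - x0) al)) MI) * of_real r ^ n) sums G (y, r)"
proof -
 have S: "(%(n, al). norm (c n al) * t ^ mdeg al * t ^ n) summable_on UNIV \<times> MI"
 proof (rule summable_on_SigmaI)
 show "((%al. case (n, al) of (n, al) => norm (c n al) * t ^ mdeg al * t ^ n) has_sum wn (c n) t * t ^ n) MI" for n
 unfolding wn_def by (auto intro!: has_sum_cmult_left has_sum_infsum asumD c)
 show "(%n. wn (c n) t * t ^ n) summable_on UNIV"
 by (rule summable_nonneg_imp_summable_on[OF sm]) (intro mult_nonneg_nonneg wn_nonneg t zero_le_power less_imp_le)
 qed (use t in auto)
 have "(%be. norm (jointc c be) * t ^ mdeg be) summable_on (MI :: ('x \<times> real => nat) set)"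
 using summable_on_reindex_bij_betw[OF joint_bij, of "%(n, al). norm (c n al) * t ^ mdeg al * t ^ n"] S
 by (simp add: jointc_def joint_mdeg power_add mult_ac)
 hence as: "asum (jointc c :: ('x \<times> real => nat) => complex) t" by (simp add: asum_def)
 define G where "G p = (infsum (%be. jointc c be * of_real (mon (p - (x0, 0)) be)) MI)" for p :: "'x \<times> real"
 have ns: "(%be. norm (jointc c be * of_real (mon (p - (x0, 0)) be))) summable_on MI" if "p : pd (x0, 0) t" for p
 by (rule asum_at[OF as]) (use pd_le[OF that] in auto)
 have G: "((%be. jointc c be * of_real (mon (p - (x0, 0)) be)) has_sum G p) MI" if "p : pd (x0, 0) t" for p
 unfolding G_def by (rule norm_summable_has_sum[OF ns[OF that]])
 have h: "hps G (x0, 0) (jointc c) t" using t as G by (auto simp: hps_def)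
 moreover have "(%n. (infsum (%al. c n al * of_real (mon (y - x0) al)) MI) * of_real r ^ n) sums G (y, r)"
 if p: "(y, r) : pd (x0, 0) t" for y r
 proof -
 have "((%(n, al). c n al * of_real (mon (y - x0) al) * of_real r ^ n) has_sum G (y, r)) (UNIV \<times> MI)"
 using has_sum_reindex_bij_betw[OF joint_bij, of "%(n, al). c n al * of_real (mon (y - x0) al) * of_real r ^ n"] G[OF p]
 by (simp add: jointc_def joint_mon mult_ac)
 hence "((%n. (infsum (%al. c n al * of_real (mon (y - x0) al)) MI) * of_real r ^ n) has_sum G (y, r)) UNIV"
 proof (rule has_sum_SigmaD)
 fix n :: nat
 have "\<bar>(y - x0) \<bullet> b\<bar> <= t" if "b : Basis" for b using pd_le[OF p, of "(b, 0)"] that by (auto simp: Basis_prod_real)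
 hence "(%al. norm (c n al * of_real (mon (y - x0) al))) summable_on MI" by (intro asum_at[OF c])
 thus "((%al. case (n, al) of (n, al) => c n al * of_real (mon (y - x0) al) * of_real r ^ n) has_sum
 (infsum (%al. c n al * of_real (mon (y - x0) al)) MI) * of_real r ^ n) MI"
 by (auto intro!: has_sum_cmult_left norm_summable_has_sum)
 qed
 thus ?thesis by (rule has_sum_imp_sums)
 qed
 ultimately show ?thesis by (rule that)
qed

lemma hps_analytic_on_pd:
 assumes "hps f x c t" shows "anl f (pd x t)" unfolding anl_iff_hps using hps_recentre'[OF assms] by blast

text \<open>The binomial coefficient in the weight is at most \<open>2 ^ (mdeg al + m)\<close>.
  Halving the radius removes the part with \<open>mdeg al\<close>; the factor \<open>2 ^ m\<close>
  is left to the geometric series in the boundary variable.\<close>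

lemma (in norms) NB_asum:
 assumes f: "NB m f K" and t: "0 < t" "2 * t <= s"
 obtains c u where "hps f x0 c u" "asum c t" "wn c t <= 2 ^ m * K"
proof -
 obtain c u where c: "hps f x0 c u" "(%al. norm (c al) * w al m) summable_on MI"
 "(infsum (%al. norm (c al) * w al m) MI) <= K" using f by (auto simp: NB_def)
 have le: "norm (c al) * t ^ mdeg al <= 2 ^ m * (norm (c al) * w al m)" for al
 proof -
 have "real ((mdeg al + m) choose m) <= 2 ^ (mdeg al + m)"
 using binomial_le_pow2[of "mdeg al + m" m] by (metis of_nat_le_iff of_nat_numeral of_nat_power)
 hence "t ^ mdeg al * real ((mdeg al + m) choose m) <= t ^ mdeg al * 2 ^ (mdeg al + m)" using t by auto
 also have "... = 2 ^ m * (2 * t) ^ mdeg al" by (simp add: power_add)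
 also have "... <= 2 ^ m * s ^ mdeg al" using t by (intro mult_left_mono power_mono) auto
 finally have "t ^ mdeg al <= 2 ^ m * w al m" unfolding w_def by (simp add: pos_le_divide_eq)
 hence "norm (c al) * t ^ mdeg al <= norm (c al) * (2 ^ m * w al m)" by (rule mult_left_mono) simp
 thus ?thesis by (simp add: mult_ac)
 qed
 have as: "asum c t" unfolding asum_def by (rule summable_on_comparison_test[OF summable_on_cmult_right[OF c(2), of "2 ^ m"]]) (use le t in auto)
 have "wn c t <= (infsum (%al. 2 ^ m * (norm (c al) * w al m)) MI)" unfolding wn_def
 by (intro infsum_mono asumD as summable_on_cmult_right c le)
 also have "... <= 2 ^ m * K" using c by (simp add: infsum_cmult_right)
 finally show ?thesis using that c as by blast
qed

text \<open>The norms make every coefficient series converge on one common cube, but the series is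
  known to represent \<open>f n\<close> only on a cube that may shrink with \<open>n\<close>. The
  identity theorem extends the equality to the common cube.\<close>

lemma (in norms) joint_convergence:
 assumes f: "!!n. NB n (f n) (K / R ^ n)" and R: "R > 0"
 and an: "!!n. anl (f n) Om" and Om: "open Om" "x0 : Om"
 obtains W G where "open W" "(x0, 0::real) : W" "anl G W"
 "!!x r. (x, r) : W ==> x : Om & (%n. f n x * of_real r ^ n) sums G (x, r)"
proof -
 obtain e where e: "e > 0" "pd x0 e <= Om" using hps_in_open[OF hps_const[of 1 0 x0] Om] hps_pos by (metis zero_less_one)
 \<comment> \<open>\<open>4 * t <= R\<close> gives the ratio \<open>2 * t / R <= 1/2\<close> of the
   geometric series, and \<open>2 * t <= s\<close> is what \<open>NB_asum\<close> needs.\<close>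
 define t where "t = min e (min s R / 4)"
 have t: "t > 0" "2 * t <= s" "4 * t <= R" "t <= e" using e s R by (auto simp: t_def)
 have "ALL n. EX c u. hps (f n) x0 c u & asum c t & wn c t <= 2 ^ n * (K / R ^ n)" using NB_asum[OF f t(1,2)] by metis
 then obtain c u where c: "!!n. hps (f n) x0 (c n) (u n)" "!!n. asum (c n) t" "!!n. wn (c n) t <= 2 ^ n * (K / R ^ n)" by metis
 have K: "K >= 0" using NB_nonneg[OF f[of 0]] by simp
 have "summable (%n. wn (c n) t * t ^ n)"
 proof (rule summable_comparison_test')
 show "summable (%n. K * (1/2) ^ n)" by simp
 fix n :: nat
 have "wn (c n) t * t ^ n <= 2 ^ n * (K / R ^ n) * t ^ n" using t c(3) by (intro mult_right_mono) auto
 also have "... = K * (2 * t / R) ^ n" by (simp add: power_divide)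
 also have "... <= K * (1/2) ^ n" using K t by (intro mult_left_mono power_mono) auto
 finally show "norm (wn (c n) t * t ^ n) <= K * (1/2) ^ n" using wn_nonneg[OF t(1), of "c n"] t by simp
 qed
 from hps_joint[OF t(1) c(2) this, of x0] obtain G where G: "hps G (x0, 0::real) (jointc c) t"
 "!!y r. (y, r) : pd (x0, 0) t ==>
 (%n. (infsum (%al. c n al * of_real (mon (y - x0) al)) MI) * of_real r ^ n) sums G (y, r)" by blast
 define F where "F n y = (infsum (%al. c n al * of_real (mon (y - x0) al)) MI)" for n y
 have F: "hps (F n) x0 (c n) t" for n unfolding hps_def F_def using t c(2) pd_le by (auto intro!: norm_summable_has_sum asum_at[OF c(2)])
 have Ff: "F n y = f n y" if y: "y : pd x0 t" for n y
 proof (rule analytic_identity[where S = "pd x0 t" and U = "pd x0 (min t (u n))"])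
 have un: "u n > 0" using hps_pos c(1) by blast
 show "x0 : pd x0 (min t (u n))" using t un by simp
 show "anl (f n) (pd x0 t)" using an pd_mono[OF t(4), of x0] e unfolding real_analytic_on_def by blast
 fix z assume "z : pd x0 (min t (u n))"
 hence z: "z : pd x0 t" "z : pd x0 (u n)" using pd_mono[of "min t (u n)" t] pd_mono[of "min t (u n)" "u n"] by auto
 show "F n z = f n z" using hps_sum[OF F z(1)] hps_sum[OF c(1) z(2)] has_sum_unique by blast
 qed (use t y hps_analytic_on_pd[OF F] convex_connected[OF convex_pd] in auto)
 show ?thesis
 proof (rule that[of "pd (x0, 0) t" G])
 fix x and r :: real assume p: "(x, r) : pd (x0, 0) t"
 have "\<bar>(x - x0) \<bullet> b\<bar> < t" if "b : Basis" for b using p that unfolding pd_def by (auto simp: Basis_prod_real)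
 hence x: "x : pd x0 t" by (simp add: pd_def)
 show "x : Om & (%n. f n x * of_real r ^ n) sums G (x, r)" using G(2)[OF p] Ff[OF x] x pd_mono[OF t(4), of x0] e by (auto simp: F_def)
 qed (use t hps_analytic_on_pd[OF G(1)] in auto)
qed
lemma analytic_common_radius:
 assumes "finite F" "!!f. f : F ==> anl f Om" "x0 : Om"
 shows "EX s>0. EX A. ALL f:F. EX c t. hps f x0 c t & s <= t & wn c t <= A" using assms(1,2)
proof (induction F rule: finite_induct)
 case empty thus ?case by (auto intro: exI[of _ 1])
next
 case (insert f F)
 obtain s A where s: "s > 0" "ALL f:F. EX c t. hps f x0 c t & s <= t & wn c t <= A" using insert by auto
 obtain c t where c: "hps f x0 c t" using insert(4)[of f] assms(3) unfolding anl_iff_hps by auto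
 have "EX c t'. hps f' x0 c t' & min s t <= t' & wn c t' <= max A (wn c t)" if "f' : F" for f'
 using s(2) that by (meson max.coboundedI1 min.coboundedI1)
 moreover have "EX c' t'. hps f x0 c' t' & min s t <= t' & wn c' t' <= max A (wn c t)"
 using c by (meson max.cobounded2 min.cobounded2)
 moreover have "EX c t'. hps f' x0 c t' & min s t <= t' & wn c t' <= max A (wn c0 t)" if "f' : F" for f' c0
 using s(2) that by (meson max.coboundedI1 min.coboundedI1)
 ultimately show ?case using s(1) hps_pos[OF c] by (intro exI[of _ "min s t"] conjI exI[of _ "max A (wn c t)"] ballI) auto
qed

lemma (in formal_einstein) converges:
 assumes x0: "x0 : Om"
 obtains W G where "open W" "(x0, 0::real) : W" "!!I J. anl (G I J) W"
 "!!x r I J. (x, r) : W ==> x : Om & (%n. g I J n x * of_real r ^ n) sums G I J (x, r)"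
proof -
 \<comment> \<open>Only finitely many functions enter the estimates as data, so one radius and one
   bound \<open>A\<close> serve for all of them.\<close>
 define F where "F = (%(I, b). z I b) ` ((- {Xinf}) \<times> Basis) Un (%(I, J, K, n). C I J K n) ` (UNIV \<times> UNIV \<times> UNIV \<times> {..2})
 Un (%(I, J, n). g I J n) ` (UNIV \<times> UNIV \<times> {..<9})"
 have inF: "b : Basis ==> I ~= Xinf ==> z I b : F" "n <= 2 ==> C I J K n : F" "n < 9 ==> g I J n : F" for I J K b n
 unfolding F_def by (((rule UnI1)+, rule image_eqI[of _ _ "(I, b)"]; simp), (rule UnI1, rule UnI2, rule image_eqI[of _ _ "(I, J, K, n)"]; simp), (rule UnI2, rule image_eqI[of _ _ "(I, J, n)"]; simp))
 have "finite F" unfolding F_def by (intro finite_UnI) auto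
 moreover have "anl f Om" if "f : F" for f using that unfolding F_def by (elim UnE imageE) (auto intro: z C(1) g_analytic)
 ultimately obtain s' A where s': "s' > 0" "!!f. f : F ==> EX c t. hps f x0 c t & s' <= t & wn c t <= A"
 using analytic_common_radius[OF _ _ x0] by metis
 interpret N: norms x0 s' by standard (rule s')
 have NB: "N.NB n f A" if "f : F" for n f using s'(2)[OF that] N.NB_hps N.NB_mono by blast
 interpret convergence Om z C g h x0 s' A
 proof
 show "Rc (Eop z) (Ga (Eop z) C g h) I J n x + 3/2 * g I J n x = 0" if "x : Om" for I J n x by (rule Ein[OF that])
 show "N.NB 0 (z I b) A" if "b : Basis" "I ~= Xinf" for I b by (rule NB[OF inF(1)[OF that]])
 show "N.NB n (C I J K n) A" if "n <= 2" for I J K n by (rule NB[OF inF(2)[OF that]])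
 show "N.NB n (g I J n) A" if "n < 9" for I J n by (rule NB[OF inF(3)[OF that]])
 qed (use Om x0 in auto)
 obtain R K where R: "R > 0" "!!n I J. N.NB n (g I J n) (K / R ^ n)" using coefficient_bound by blast
 define P where "P I J W G \<longleftrightarrow> open W & (x0, 0::real) : W & anl G W \<and>
 (ALL x r. (x, r) : W --> x : Om & (%n. g I J n x * of_real r ^ n) sums G (x, r))" for I J W G
 have "EX W G. P I J W G" for I J unfolding P_def by (rule N.joint_convergence[of "g I J" K R Om, OF R(2) R(1) g_analytic Om(1) x0]) blast
 then obtain W G where P: "!!I J. P I J (W I J) (G I J)" by metis
 note W = P[unfolded P_def]
 show ?thesis
 proof (rule that[of "\<Inter>I. \<Inter>J. W I J" G])
 show "anl (G I J) (\<Inter>I. \<Inter>J. W I J)" for I J using W[of I J] unfolding real_analytic_on_def by blast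
 show "open (\<Inter>I. \<Inter>J. W I J)" by (intro open_INT finite ballI) (use W in blast)
 show "x : Om & (%n. g I J n x * of_real r ^ n) sums G I J (x, r)" if "(x, r) : (\<Inter>I. \<Inter>J. W I J)" for x r I J
 using that W[of I J] by blast
 qed (use W in blast)
qed

section \<open>Calculus in a chart\<close>

lemma sum_axis: "(SUM b:(Basis :: r3 set). f b) = (SUM i:UNIV. f (axis i 1))"
proof -
 have B: "(Basis :: r3 set) = range (%i. axis i 1)" by (auto simp: Basis_vec_def)
 have "inj (%i::3. axis i (1::real))" by (auto simp: inj_on_def axis_eq_axis)
 thus ?thesis unfolding B by (simp add: sum.reindex)
qed

lemma axis_Basis [simp]: "axis i (1::real) : (Basis :: r3 set)" by simp

lemma BasisE3: "b : (Basis :: r3 set) ==> (!!i. b = axis i 1 ==> P) ==> P" by (auto simp: Basis_vec_def)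

lemma pdv_coord: "b' : Basis ==> b : Basis ==> pdv b' (%x. of_real (x \<bullet> b)) x = (if b = b' then 1 else 0)"
proof -
 assume b: "b' : Basis" "b : Basis"
 have "((%x. of_real (x \<bullet> b)) has_derivative (%h. complex_of_real (h \<bullet> b))) (at x)" by (auto intro!: derivative_eq_intros)
 from pdvI[OF this] show ?thesis using b by (simp add: inner_Basis)
qed

locale chart =
 fixes M :: "('a::{t2_space, second_countable_topology}) atlas" and V :: "'a set" and phi :: "'a => r3"
 assumes atlas: "analytic_atlas M" and chart: "(V, phi) : M"
begin

abbreviation "CT \<equiv> ctangent M"

abbreviation psi :: "r3 => 'a" where "psi \<equiv> inv_into V phi"

lemma atlasD:
 assumes "(V', phi') : M"
 shows "open V'" "open (phi' ` V')" "homeomorphism V' (phi' ` V') phi' (inv_into V' phi')"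
 "regA (%x. of_real (phi' (psi x) $ i)) (phi ` (V Int V'))"
 "regA (%x. of_real (phi (inv_into V' phi' x) $ i)) (phi' ` (V' Int V))"
proof -
 have a: "open U & open (phi ` U) & homeomorphism U (phi ` U) phi (inv_into U phi)" if "(U, phi) : M" for U phi
 using atlas that unfolding analytic_atlas_def by blast
 have b: "regA (%x. of_real (phi (inv_into V psi x) $ i)) (psi ` (U Int V))"
 if "(U, phi) : M" "(V, psi) : M" for U phi V psi i
 using atlas that unfolding analytic_atlas_def by (elim conjE) (drule (1) bspec, simp, drule (1) bspec, simp)
 show "open V'" "open (phi' ` V')" "homeomorphism V' (phi' ` V') phi' (inv_into V' phi')" using a[OF assms] by auto
 show "regA (%x. of_real (phi' (psi x) $ i)) (phi ` (V Int V'))" using b[OF assms chart] by (simp add: Int_commute)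
 show "regA (%x. of_real (phi (inv_into V' phi' x) $ i)) (phi' ` (V' Int V))" using b[OF chart assms] by (simp add: Int_commute)
qed

lemmas V_open = atlasD(1)[OF chart] and im_open = atlasD(2)[OF chart] and hom = atlasD(3)[OF chart]

lemma psiphi [simp]: "q : V ==> psi (phi q) = q" and phipsi [simp]: "x : phi ` V ==> phi (psi x) = x"
 and psi_in: "x : phi ` V ==> psi x : V" and phi_cont: "continuous_on V phi" and psi_cont: "continuous_on (phi ` V) psi"
 using hom unfolding homeomorphism_def by auto

lemma sub_open: "open U ==> U <= V ==> open (phi ` U)"
 using homeomorphism_imp_open_map[OF hom] im_open by (metis openin_open_eq openin_open_trans open_subset)

lemma pre_open: "open W ==> open {q : V. phi q : W}" using continuous_open_preimage[OF phi_cont V_open] by (simp add: Int_def)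

lemma pre_open2:
 assumes "open W" shows "open {(q, r). q : V & (phi q, r) : W}"
proof -
 have "continuous_on (V \<times> UNIV) (%p. (phi (fst p), snd p))" by (intro continuous_intros continuous_on_compose2[OF phi_cont]) auto
 note continuous_open_preimage[OF this open_Times[OF V_open open_UNIV] assms]
 moreover have "(V \<times> UNIV) Int (%p. (phi (fst p), snd p)) -` W = {(q, r). q : V & (phi q, r) : W}" by auto
 ultimately show ?thesis by simp
qed

lemma im_sub: "U <= V ==> x : phi ` U ==> x : phi ` V & psi x : U & phi (psi x) = x" by auto

lemma fun_chart: "regular_fun k M f U ==> U <= V ==> regular_on k (%x. f (psi x)) (phi ` U)"
 unfolding regular_fun_def using chart by (fastforce simp: o_def Int_absorb2)

text \<open>The regularity predicates quantify over the whole atlas, whereas all computations are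
  made in one chart.\<close>

lemma transition_smooth:
 assumes V': "(V', phi') : M" and U: "open U" "U <= V" and f: "regS (%x. f (psi x)) (phi ` U)"
 shows "regS (%y. f (inv_into V' phi' y)) (phi' ` (U Int V'))"
proof -
 interpret c': chart M V' phi' using atlas V' by unfold_locales
 have op: "open (phi' ` (U Int V'))" using c'.sub_open[of "U Int V'"] U c'.V_open by auto
 have *: "regS (%y. f (psi (phi (c'.psi y)))) (phi' ` (U Int V'))"
 proof (rule sm_comp[OF op sub_open[OF U] _ f])
 show "phi (c'.psi y) : phi ` U" if "y : phi' ` (U Int V')" for y using that by auto
 fix b :: "r3" assume "b : Basis"
 then obtain i where b: "b = axis i 1" by (rule BasisE3)
 have "open (phi' ` (V' Int V))" using c'.sub_open[of "V' Int V"] V_open c'.V_open by auto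
 note r = reg_smooth[OF this atlasD(5)[OF V', of i]]
 show "regS (%y. of_real (phi (c'.psi y) \<bullet> b)) (phi' ` (U Int V'))"
 unfolding b cart_eq_inner_axis[symmetric] by (rule reg_subset[OF r]) (use U in auto)
 qed
 show ?thesis by (rule reg_cong[OF op _ *]) (use U in auto)
qed

lemma smooth_fun_chart:
 assumes "open U" "U <= V" "regS (%x. f (psi x)) (phi ` U)"
 shows "regular_fun Smooth M f U" unfolding regular_fun_def using transition_smooth[OF _ assms] by (auto simp: o_def)

lemma reg_fun_subset: "regular_fun k M f U ==> U' <= U ==> regular_fun k M f U'" unfolding regular_fun_def by (fastforce elim: reg_subset)

lemma smooth_nearI: "open U ==> p : U ==> U <= V ==> regS (%x. f (psi x)) (phi ` U) ==> smooth_near M p f"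
 unfolding smooth_near_def using smooth_fun_chart by blast

lemma smooth_nearE:
 assumes "smooth_near M p f" "p : V"
 obtains U where "open U" "p : U" "U <= V" "regS (%x. f (psi x)) (phi ` U)"
proof -
 obtain U where U: "open U" "p : U" "regular_fun Smooth M f U" using assms by (auto simp: smooth_near_def)
 show ?thesis by (rule that[of "U Int V"]) (use U assms V_open in "auto intro!: fun_chart reg_fun_subset[OF U(3)]")
qed

definition co :: "r3 => 'a => complex" where
 "co b = (%q. of_real (phi q \<bullet> b))"

definition cv :: "r3 => 'a => 'a cvec" where
 "cv b p f = (if smooth_near M p f then pdv b (%x. f (psi x)) (phi p) else 0)"

lemma co_axis: "co (axis i 1) = (%q. of_real (phi q $ i))" by (simp add: co_def cart_eq_inner_axis)

lemma cv_axis: "cv (axis i 1) p = coord_vec M V phi i p" by (rule ext) (simp add: cv_def coord_vec_def pdv_def o_def)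

lemma co_smooth: "b : Basis ==> regular_on k (%x. co b (psi x)) (phi ` V)"
 by (rule reg_cong[OF im_open _ reg_coord[OF im_open]]) (auto simp: co_def)

lemma co_near: "p : V ==> b : Basis ==> smooth_near M p (co b)" by (rule smooth_nearI[OF V_open _ _ co_smooth]) auto

lemma cv_co: "p : V ==> b : Basis ==> b' : Basis ==> cv b p (co b') = (if b' = b then 1 else 0)"
proof -
 assume p: "p : V" and b: "b : Basis" "b' : Basis"
 have "pdv b (%x. co b' (psi x)) (phi p) = pdv b (%x. of_real (x \<bullet> b')) (phi p)" by (rule pdv_cong[OF im_open]) (use p in "auto simp: co_def")
 thus ?thesis using co_near[OF p b(2)] b by (simp add: cv_def pdv_coord)
qed

definition vec :: "(r3 => complex) => 'a => 'a cvec" where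
 "vec c p = (%f. SUM b:Basis. c b * cv b p f)"

lemma vec_tangent: "p : V ==> vec c p : CT p" unfolding ctangent_def vec_def using chart
 by (auto intro!: exI[of _ "\<chi> i. c (axis i 1)"] simp: sum_axis cv_axis)

lemma vec_co: "p : V ==> b : Basis ==> vec c p (co b) = c b" by (simp add: vec_def cv_co if_distrib cong: if_cong)

lemma coord_vec_change:
 assumes V': "(V', phi') : M" and p: "p : V" "p : V'"
 shows "coord_vec M V' phi' i p = vec (%b. coord_vec M V' phi' i p (co b)) p"
proof
 fix f
 interpret c': chart M V' phi' using atlas V' by unfold_locales
 show "coord_vec M V' phi' i p f = vec (%b. coord_vec M V' phi' i p (co b)) p f"
 proof (cases "smooth_near M p f")
 case True
 obtain U where U: "open U" "p : U" "U <= V" "regS (%x. f (psi x)) (phi ` U)" using smooth_nearE[OF True p(1)] by blast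
 have d: "(%x. f (psi x)) differentiable at (phi (c'.psi (phi' p)))" using reg_differentiable[OF sub_open[OF U(1,3)] U(4)] U(2) p by auto
 have d': "(%x. complex_of_real (phi (c'.psi x) \<bullet> b)) differentiable at (phi' p)" if "b : Basis" for b
 proof -
 obtain i where b: "b = axis i 1" using \<open>b : Basis\<close> by (rule BasisE3)
 have "open (phi' ` (V' Int V))" using c'.sub_open[of "V' Int V"] V_open c'.V_open by auto
 from reg_differentiable[OF this atlasD(5)[OF V', of i], of "phi' p"] show ?thesis using p by (simp add: b cart_eq_inner_axis)
 qed
 have op: "open (phi' ` (U Int V'))" using c'.sub_open[of "U Int V'"] U c'.V_open by auto
 have "coord_vec M V' phi' i p f = pdv (axis i 1) (%x. f (c'.psi x)) (phi' p)" using True by (simp add: coord_vec_def pdv_def o_def)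
 also have "... = pdv (axis i 1) (%x. f (psi (phi (c'.psi x)))) (phi' p)" by (rule pdv_cong[OF op]) (use U p in auto)
 also have "... = (SUM b:Basis. pdv b (%x. f (psi x)) (phi p) * pdv (axis i 1) (%x. of_real (phi (c'.psi x) \<bullet> b)) (phi' p))"
 by (subst pdv_comp(2)[where f = "%x. f (psi x)", OF d d']) (use p in auto)
 also have "... = vec (%b. coord_vec M V' phi' i p (co b)) p f" unfolding vec_def using True co_near[OF p(1)]
 by (intro sum.cong) (auto simp: coord_vec_def cv_def pdv_def o_def co_def mult.commute)
 finally show ?thesis .
 qed (simp add: coord_vec_def vec_def cv_def)
qed

text \<open>A tangent vector may be given in some other chart, yet its values on the coordinate
  functions of the fixed chart determine it. All later identities between vectors are checked on
  \<open>co\<close>.\<close>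

lemma tangent_expand:
 assumes p: "p : V" and X: "X : CT p"
 shows "X = vec (%b. X (co b)) p"
proof -
 obtain V' phi' c where V': "(V', phi') : M" "p : V'" and c: "X = (%f. SUM i:UNIV. c $ i * coord_vec M V' phi' i p f)"
 using X by (auto simp: ctangent_def)
 have "X f = vec (%b. X (co b)) p f" for f
 proof -
 have "X f = (SUM i:UNIV. c $ i * vec (%b. coord_vec M V' phi' i p (co b)) p f)" unfolding c using coord_vec_change[OF V'(1) p V'(2)] by metis
 also have "... = vec (%b. X (co b)) p f" unfolding vec_def c sum_distrib_right sum_distrib_left by (subst sum.swap) (simp add: mult.assoc)
 finally show ?thesis .
 qed
 thus ?thesis by blast
qed

lemma tangent_eqI:
 assumes "p : V" "X : CT p" "Y : CT p" "!!b. b : Basis ==> X (co b) = Y (co b)"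
 shows "X = Y" using tangent_expand[OF assms(1,2)] tangent_expand[OF assms(1,3)] assms(4) by (simp add: vec_def)

lemma lincomb_tangent:
 assumes p: "p : V" and X: "X : CT p" "Y : CT p"
 shows "lincomb a X b Y : CT p"
proof -
 have "lincomb a X b Y = vec (%i. a * X (co i) + b * Y (co i)) p" by (subst tangent_expand[OF p X(1)], subst tangent_expand[OF p X(2)])
 (simp add: lincomb_def vec_def sum_distrib_left sum.distrib distrib_right mult.assoc)
 thus ?thesis by (simp add: vec_tangent[OF p])
qed

lemma smooth_near_cnj: "p : V ==> smooth_near M p (%q. cnj (f q)) \<longleftrightarrow> smooth_near M p f"
proof -
 have "smooth_near M p (%q. cnj (f q))" if "p : V" "smooth_near M p f" for f
 proof -
 note h = smooth_nearE[OF that(2,1)]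
 obtain U where U: "open U" "p : U" "U <= V" "regS (%x. f (psi x)) (phi ` U)" using h by blast
 show ?thesis by (rule smooth_nearI[OF U(1-3) reg_cnj[OF sub_open[OF U(1,3)] U(4)]])
 qed
 from this[of f] this[of "%q. cnj (f q)"] show "p : V ==> ?thesis" by auto
qed

lemma cv_cnj: "p : V ==> b : Basis ==> cv b p (%q. cnj (f q)) = cnj (cv b p f)"
proof (cases "smooth_near M p f")
 case True
 assume p: "p : V" and b: "b : Basis"
 obtain U where U: "open U" "p : U" "U <= V" "regS (%x. f (psi x)) (phi ` U)" using smooth_nearE[OF True p] by blast
 have "(%x. f (psi x)) differentiable at (phi p)" using reg_differentiable[OF sub_open[OF U(1,3)] U(4)] U by auto
 thus ?thesis using p by (simp add: cv_def smooth_near_cnj pdv_cnj)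
qed (simp add: cv_def smooth_near_cnj)

lemma conj_tangent:
 assumes p: "p : V" and X: "X : CT p"
 shows "conj_vec X : CT p" "conj_vec X (co b) = cnj (X (co b))"
proof -
 have "conj_vec X = vec (%b. cnj (X (co b))) p" by (subst tangent_expand[OF p X]) (auto simp: conj_vec_def vec_def cv_cnj p)
 thus "conj_vec X : CT p" by (simp add: vec_tangent[OF p])
qed (simp add: conj_vec_def co_def)

lemma rtangent_iff:
 "p : V ==> X : rtangent M p \<longleftrightarrow> X : CT p & (ALL b:Basis. X (co b) : \<real>)"
 unfolding rtangent_def using conj_tangent tangent_eqI[of p "conj_vec X" X] by (auto simp: Reals_cnj_iff) metis

definition zc :: "('a => 'a cvec) => r3 => r3 => complex" where
 "zc X b x = X (psi x) (co b)"

lemma tangent_apply: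
 assumes U: "open U" "U <= V" "x : phi ` U" and X: "X (psi x) : CT (psi x)"
 and f: "regS (%x. f (psi x)) (phi ` U)"
 shows "X (psi x) f = Vf (zc X) (%x. f (psi x)) x"
proof -
 have x: "psi x : U" "phi (psi x) = x" using im_sub[OF U(2,3)] by auto
 have "smooth_near M (psi x) f" using smooth_nearI[OF U(1) x(1) U(2) f] .
 moreover have "X (psi x) f = vec (%b. X (psi x) (co b)) (psi x) f" by (rule fun_cong[OF tangent_expand[OF _ X]]) (use U in auto)
 ultimately show ?thesis by (simp add: Vf_def zc_def vec_def cv_def x)
qed

text \<open>Vector fields seen in the fixed chart alone. For smooth fields \<open>vfc_I\<close>
  leads back to \<open>vector_field\<close>, the form in which the Reeb field and the connection are
  tested.\<close>

definition vfc :: "regularity => 'a set => ('a => 'a cvec) => bool" where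
 "vfc k U X \<longleftrightarrow> (ALL p:U. X p : CT p) & (ALL b:Basis. regular_on k (zc X b) (phi ` U))"

lemma vfc_tangent: "vfc k U X ==> p : U ==> X p : CT p"
 and vfc_reg: "vfc k U X ==> b : Basis ==> regular_on k (zc X b) (phi ` U)" by (auto simp: vfc_def)

lemma vfc_D: "vector_field k M U X ==> U <= V ==> vfc k U X" unfolding vfc_def vector_field_def zc_def using chart fun_chart[of k _ U]
 by (fastforce elim!: BasisE3 simp: co_axis Int_absorb2)

lemma vfc_smooth: "open U ==> U <= V ==> vfc k U X ==> vfc Smooth U X" unfolding vfc_def using reg_smooth[OF sub_open] by blast

lemma vfc_subset: "vfc k U X ==> U' <= U ==> vfc k U' X"
 unfolding vfc_def using reg_subset[of k _ "phi ` U" "phi ` U'"] by (meson image_mono subset_iff)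

lemma reg_Vf:
 assumes "open S" "!!b. b : Basis ==> regular_on k (z b) S" "regular_on k f S"
 shows "regular_on k (Vf z f) S" unfolding Vf_def[abs_def] by (intro reg_sum reg_mult reg_pdv assms finite_Basis)

lemma vfc_apply:
 assumes U: "open U" "U <= V" and X: "vfc k U X" and f: "regular_on k (%x. f (psi x)) (phi ` U)"
 shows "x : phi ` U ==> X (psi x) f = Vf (zc X) (%x. f (psi x)) x"
 and "regular_on k (%x. X (psi x) f) (phi ` U)"
proof -
 note op = sub_open[OF U]
 show *: "X (psi x) f = Vf (zc X) (%x. f (psi x)) x" if "x : phi ` U" for x
 by (rule tangent_apply[where U = U and x = x and X = X and f = f, OF U that vfc_tangent[OF X] reg_smooth[OF op f]])
 (use im_sub[OF U(2) that] in auto)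
 show "regular_on k (%x. X (psi x) f) (phi ` U)" by (rule reg_cong[OF op _ reg_Vf[OF op vfc_reg[OF X] f]]) (use * in auto)
qed

lemma vfc_I:
 assumes U: "open U" "U <= V" and X: "vfc Smooth U X"
 shows "vector_field Smooth M U X" unfolding vector_field_def
proof (intro conjI ballI, goal_cases)
 case (1 p) thus ?case using X by (rule vfc_tangent[rotated])
next
 case (2 c)
 obtain V' phi' where c: "c = (V', phi')" by (cases c)
 have V': "(V', phi') : M" using 2 c by auto
 have o: "open (U Int V')" "U Int V' <= V" "open (V Int V')" using U atlasD(1)[OF V'] V_open by auto
 have r: "regS (%x. of_real (phi' (psi x) $ i)) (phi ` (U Int V'))" for i
 by (rule reg_subset[OF reg_smooth[OF sub_open atlasD(4)[OF V', of i]]]) (use o in auto)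
 have "regular_fun Smooth M (%p. X p (%q. of_real (phi' q $ i))) (U Int V')" for i
 by (rule smooth_fun_chart[OF o(1,2)], rule vfc_apply(2)[OF o(1,2) vfc_subset[OF X]]) (use r in auto)
 thus ?case by (simp add: c)
qed

lemma vec_vfc:
 assumes "U <= V" "open U" "!!b. b : Basis ==> regular_on k (c b) (phi ` U)"
 shows "vfc k U (%p. vec (%b. c b (phi p)) p)" unfolding vfc_def
proof (intro conjI ballI)
 fix b :: "r3" assume b: "b : Basis"
 show "regular_on k (zc (%p. vec (%b. c b (phi p)) p) b) (phi ` U)" by (rule reg_cong[OF sub_open[OF assms(2,1)] _ assms(3)[OF b]])
 (use assms b in "auto simp: zc_def vec_co ")
qed (use assms vec_tangent in auto)

lemma vfc_conj:
 assumes U: "open U" "U <= V" and X: "vfc k U X"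
 shows "vfc k U (%p. conj_vec (X p))" unfolding vfc_def
proof (intro conjI ballI)
 fix b :: "r3" assume b: "b : Basis"
 show "regular_on k (zc (%p. conj_vec (X p)) b) (phi ` U)" by (rule reg_cong[OF sub_open[OF U] _ reg_cnj[OF sub_open[OF U] vfc_reg[OF X b]]])
 (use U vfc_tangent[OF X] in "auto simp: zc_def conj_tangent ")
qed (use U vfc_tangent[OF X] conj_tangent in auto)

lemma zc_conj: "p : V ==> X p : CT p ==> zc (%p. conj_vec (X p)) b (phi p) = cnj (zc X b (phi p))" by (simp add: zc_def conj_tangent)

text \<open>The second order terms cancel by symmetry of mixed derivatives. The space is arbitrary
  because the identity is used along the boundary and also with the boundary variable added.\<close>

lemma Vf_commutator:
 fixes x :: "'e::euclidean_space"
 assumes S: "open S" "x : S" and z: "!!b. b : Basis ==> regS (z b) S" "!!b. b : Basis ==> regS (y b) S"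
 and f: "regS f S"
 shows "Vf z (Vf y f) x - Vf y (Vf z f) x = Vf (%b x. Vf z (y b) x - Vf y (z b) x) f x"
proof -
 define A where "A z y = (SUM b:Basis. Vf z (y b) x * pdv b f x)" for z y :: "'e => 'e => complex"
 define B where "B z y = (SUM a:Basis. SUM b:Basis. z a x * y b x * pdv a (pdv b f) x)" for z y :: "'e => 'e => complex"
 have e: "Vf z (Vf y f) x = A z y + B z y"
 if z: "!!b. b : Basis ==> regS (z b) S" and y: "!!b. b : Basis ==> regS (y b) S" for z y
 proof -
 have "pdv a (Vf y f) x = (SUM b:Basis. y b x * pdv a (pdv b f) x + pdv a (y b) x * pdv b f x)" if "a : Basis" for a
 unfolding Vf_def[abs_def] using reg_differentiable[OF S(1) y S(2)] reg_differentiable[OF S(1) reg_pdv[OF S(1) f] S(2)]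
 by (subst pdv_sum) (auto simp: pdv_mult)
 hence "Vf z (Vf y f) x = (SUM a:Basis. SUM b:Basis. z a x * (y b x * pdv a (pdv b f) x + pdv a (y b) x * pdv b f x))"
 unfolding Vf_def[of z] by (simp add: sum_distrib_left)
 also have "... = (SUM a:Basis. SUM b:Basis. z a x * y b x * pdv a (pdv b f) x) + (SUM a:Basis. SUM b:Basis. z a x * pdv a (y b) x * pdv b f x)"
 by (simp add: sum.distrib distrib_left mult.assoc)
 also have "(SUM a:Basis. SUM b:Basis. z a x * pdv a (y b) x * pdv b f x) = (SUM b:Basis. Vf z (y b) x * pdv b f x)"
 by (subst sum.swap) (simp add: Vf_def sum_distrib_right)
 finally show ?thesis by (simp add: A_def B_def)
 qed
 have e1: "Vf z (Vf y f) x = A z y + B z y" "Vf y (Vf z f) x = A y z + B y z" by (rule e; use z in blast)+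
 have "B y z = B z y" unfolding B_def by (subst sum.swap) (intro sum.cong refl, simp add: pdv_commute[OF S f] mult_ac)
 thus ?thesis unfolding e1 Vf_def[of "%b x. Vf z (y b) x - Vf y (z b) x"] by (simp add: sum_subtractf left_diff_distrib A_def)
qed

lemma lie_bracket_chart:
 assumes U: "open U" "U <= V" and X: "vfc Smooth U X" and Y: "vfc Smooth U Y" and p: "p : U"
 shows "lie_bracket M X Y p = vec (%b. Vf (zc X) (zc Y b) (phi p) - Vf (zc Y) (zc X b) (phi p)) p"
proof
 fix f
 note op = sub_open[OF U]
 show "lie_bracket M X Y p f = vec (%b. Vf (zc X) (zc Y b) (phi p) - Vf (zc Y) (zc X b) (phi p)) p f"
 proof (cases "smooth_near M p f")
 case True
 have pV: "p : V" using p U by auto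
 obtain U' where U': "open U'" "p : U'" "U' <= V" "regS (%x. f (psi x)) (phi ` U')" using smooth_nearE[OF True pV] by blast
 define B where "B = U Int U'"
 have B: "open B" "B <= V" "p : B" "phi p : phi ` B" using U U' p by (auto simp: B_def)
 note opB = sub_open[OF B(1,2)]
 have f: "regS (%x. f (psi x)) (phi ` B)" using U'(4) by (rule reg_subset) (auto simp: B_def)
 have XB: "vfc Smooth B X" "vfc Smooth B Y" using X Y vfc_subset by (auto simp: B_def)
 have a: "X' p (%q. Y' q f) = Vf (zc X') (Vf (zc Y') (%x. f (psi x))) (phi p)" if "vfc Smooth B X'" "vfc Smooth B Y'" for X' Y'
 proof -
 have "X' p (%q. Y' q f) = Vf (zc X') (%x. Y' (psi x) f) (phi p)"
 using vfc_apply(1)[OF B(1,2) that(1) vfc_apply(2)[OF B(1,2) that(2) f] B(4)] pV by simp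
 also have "... = Vf (zc X') (Vf (zc Y') (%x. f (psi x))) (phi p)"
 unfolding Vf_def[of "zc X'"] using pdv_cong[OF opB B(4) vfc_apply(1)[OF B(1,2) that(2) f]] by auto
 finally show ?thesis .
 qed
 show ?thesis by (simp add: lie_bracket_def a XB Vf_commutator[OF opB B(4) vfc_reg[OF XB(1)] vfc_reg[OF XB(2)] f])
 (simp add: Vf_def[of "%b x. Vf (zc X) (zc Y b) x - Vf (zc Y) (zc X b) x"] vec_def cv_def)
 qed (simp add: lie_bracket_def vec_def cv_def)
qed

section \<open>One-forms and exterior derivatives in a chart\<close>

definition lin :: "'a form => 'a set => bool" where
 "lin al U \<longleftrightarrow> (ALL p:U. ALL X:CT p. ALL Y:CT p. ALL a b. al p (lincomb a X b Y) = a * al p X + b * al p Y)"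

definition fc :: "'a form => r3 => r3 => complex" where
 "fc al b x = al (psi x) (cv b (psi x))"

definition ofc :: "regularity => 'a set => 'a form => bool" where
 "ofc k U al \<longleftrightarrow> lin al U & (ALL b:Basis. regular_on k (fc al b) (phi ` U))"

lemma cv_vec: "p : V ==> b : Basis ==> cv b p = vec (%b'. if b' = b then 1 else 0) p"
 by (simp add: vec_def if_distrib[of "%c. c * _"] cong: if_cong)

lemma cv_tangent: "p : V ==> b : Basis ==> cv b p : CT p" by (subst cv_vec) (auto intro: vec_tangent)

lemma lin_vec:
 assumes "lin al U" "p : U" "p : V"
 shows "al p (vec c p) = (SUM b:Basis. c b * al p (cv b p))"
proof -
 have z: "al p (vec (%b. 0) p) = 0"
 proof -
 have "lincomb 0 (vec (%b. 0) p) 0 (vec (%b. 0) p) = vec (%b. 0) p" by (auto simp: lincomb_def vec_def)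
 thus ?thesis using assms vec_tangent[of p "%b. 0"] unfolding lin_def by (metis add_0 mult_zero_left)
 qed
 have s: "al p (vec (%b. if b : B then c b else 0) p) = (SUM b:B. c b * al p (cv b p))" if "finite B" "B <= Basis" for B using that
 proof (induction B rule: finite_induct)
 case empty thus ?case using z by simp
 next
 case (insert b B)
 have "vec (%b'. if b' : insert b B then c b' else 0) p = lincomb (c b) (cv b p) 1 (vec (%b. if b : B then c b else 0) p)"
 using insert assms by (subst cv_vec)
 (auto simp: vec_def lincomb_def sum_distrib_left sum.distrib[symmetric] fun_eq_iff intro!: sum.cong)
 moreover have "cv b p : CT p" by (rule cv_tangent) (use insert assms in auto)
 ultimately show ?case using insert assms vec_tangent[of p] by (simp add: lin_def)
 qed
 have "vec (%b. if b : Basis then c b else 0) p = vec c p" by (auto simp: vec_def)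
 thus ?thesis using s[of Basis] by simp
qed

lemma lin_apply:
 "lin al U ==> p : U ==> p : V ==> X : CT p ==> al p X = (SUM b:Basis. X (co b) * al p (cv b p))"
 by (rule trans[OF arg_cong[OF tangent_expand] lin_vec])

lemma ofc_apply:
 assumes U: "U <= V" and al: "lin al U" and X: "vfc k U X" and x: "x : phi ` U"
 shows "al (psi x) (X (psi x)) = (SUM b:Basis. zc X b x * fc al b x)"
 using lin_apply[OF al _ _ vfc_tangent[OF X]] im_sub[OF U x] by (auto simp: fc_def zc_def)

lemma ofc_reg:
 assumes U: "open U" "U <= V" and al: "ofc k U al" and X: "vfc k U X"
 shows "regular_on k (%x. al (psi x) (X (psi x))) (phi ` U)"
proof (rule reg_cong[OF sub_open[OF U]])
 show "(SUM b:Basis. zc X b x * fc al b x) = al (psi x) (X (psi x))" if "x : phi ` U" for x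
 using ofc_apply[OF U(2) _ X that] al by (simp add: ofc_def)
 show "regular_on k (%x. SUM b:Basis. zc X b x * fc al b x) (phi ` U)"
 using al X by (intro reg_sum reg_mult sub_open U) (auto simp: ofc_def vfc_def)
qed

lemma ofc_D: "one_form k M U al ==> U <= V ==> ofc k U al" unfolding one_form_def ofc_def lin_def fc_def using chart fun_chart[of k _ U]
 by (fastforce elim!: BasisE3 simp: cv_axis Int_absorb2)

lemma ofc_smooth: "open U ==> U <= V ==> ofc k U al ==> ofc Smooth U al" unfolding ofc_def using reg_smooth[OF sub_open] by blast

lemma ofc_subset: "ofc k U al ==> U' <= U ==> ofc k U' al"
 unfolding ofc_def lin_def using reg_subset[of k _ "phi ` U" "phi ` U'"] by (meson image_mono subset_iff)

lemma ofc_I: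
 assumes U: "open U" "U <= V" and al: "ofc Smooth U al"
 shows "one_form Smooth M U al" unfolding one_form_def
proof (intro conjI, goal_cases)
 case 1 show ?case using al by (simp add: ofc_def lin_def)
next
 case 2
 have "regular_fun Smooth M (%p. al p (coord_vec M V' phi' i p)) (U Int V')" if V': "(V', phi') : M" for V' phi' i
 proof -
 interpret c': chart M V' phi' using atlas V' by unfold_locales
 have o: "open (U Int V')" "U Int V' <= V" "U Int V' <= V'" using U c'.V_open by auto
 have "c'.vfc Smooth (U Int V') (coord_vec M V' phi' i)" unfolding c'.vfc_def
 proof (intro conjI ballI)
 fix b :: "r3" assume b: "b : Basis"
 show "regS (c'.zc (coord_vec M V' phi' i) b) (phi' ` (U Int V'))"
 by (rule reg_cong[OF c'.sub_open[OF o(1,3)] _ reg_const[of Smooth "if b = axis i 1 then 1 else 0"]])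
 (use b in "auto simp: c'.zc_def c'.cv_axis[symmetric] c'.cv_co")
 qed (auto simp: c'.cv_axis[symmetric] intro: c'.cv_tangent)
 note c = vfc_D[OF c'.vfc_I[OF o(1,3) this] o(2)]
 have "regS (%x. al (psi x) (coord_vec M V' phi' i (psi x))) (phi ` (U Int V'))" by (rule ofc_reg[OF o(1,2) ofc_subset[OF al] c]) simp
 thus ?thesis by (rule smooth_fun_chart[OF o(1,2)])
 qed
 thus ?case by auto
qed

text \<open>The derivatives of the coefficients of \<open>X\<close> and \<open>Y\<close> cancel
  against the bracket, which leaves an expression tensorial in both fields.\<close>

lemma ext_d_chart:
 assumes U: "open U" "U <= V" and al: "ofc Smooth U al" and X: "vfc Smooth U X" and Y: "vfc Smooth U Y" and p: "p : U"
 shows "ext_d M al X Y p = (SUM a:Basis. SUM b:Basis.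
 (pdv a (fc al b) (phi p) - pdv b (fc al a) (phi p)) * zc X a (phi p) * zc Y b (phi p))"
proof -
 note op = sub_open[OF U]
 have pV: "p : V" and x: "phi p : phi ` U" using p U by auto
 have f: "!!b. b : Basis ==> fc al b differentiable at (phi p)" using al reg_differentiable[OF op _ x] by (auto simp: ofc_def)
 have d: "X p (%q. al q (Y q)) = (SUM a:Basis. SUM b:Basis. zc X a (phi p) * zc Y b (phi p) * pdv a (fc al b) (phi p))
 + (SUM b:Basis. Vf (zc X) (zc Y b) (phi p) * fc al b (phi p))" if X: "vfc Smooth U X" and Y: "vfc Smooth U Y" for X Y
 proof -
 have y: "!!b. b : Basis ==> zc Y b differentiable at (phi p)" using vfc_reg[OF Y] reg_differentiable[OF op _ x] by blast
 have "X p (%q. al q (Y q)) = Vf (zc X) (%x. al (psi x) (Y (psi x))) (phi p)" using vfc_apply(1)[OF U X ofc_reg[OF U al Y] x] pV by simp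
 also have "... = (SUM a:Basis. zc X a (phi p) * pdv a (%x. SUM b:Basis. zc Y b x * fc al b x) (phi p))"
 unfolding Vf_def using al by (intro sum.cong refl arg_cong2[of _ _ _ _ "(*)"] pdv_cong[OF op x])
 (rule ofc_apply[OF U(2) _ Y], auto simp: ofc_def)
 also have "... = (SUM a:Basis. zc X a (phi p) * (SUM b:Basis. zc Y b (phi p) * pdv a (fc al b) (phi p) + pdv a (zc Y b) (phi p) * fc al b (phi p)))"
 by (intro sum.cong refl) (subst pdv_sum, auto simp: pdv_mult f y)
 also have "... = (SUM a:Basis. SUM b:Basis. zc X a (phi p) * zc Y b (phi p) * pdv a (fc al b) (phi p))
 + (SUM a:Basis. SUM b:Basis. zc X a (phi p) * pdv a (zc Y b) (phi p) * fc al b (phi p))"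
 by (simp add: sum_distrib_left sum.distrib distrib_left mult.assoc)
 also have "(SUM a:Basis. SUM b:Basis. zc X a (phi p) * pdv a (zc Y b) (phi p) * fc al b (phi p)) =
 (SUM b:Basis. Vf (zc X) (zc Y b) (phi p) * fc al b (phi p))" by (subst sum.swap) (simp add: Vf_def sum_distrib_right)
 finally show ?thesis .
 qed
 have l: "al p (lie_bracket M X Y p) = (SUM b:Basis. (Vf (zc X) (zc Y b) (phi p) - Vf (zc Y) (zc X b) (phi p)) * fc al b (phi p))"
 unfolding lie_bracket_chart[OF U X Y p] using al p pV by (subst lin_vec) (auto simp: ofc_def fc_def)
 have sw: "(SUM a:Basis. SUM b:Basis. zc Y a (phi p) * zc X b (phi p) * pdv a (fc al b) (phi p)) =
 (SUM a:Basis. SUM b:Basis. zc X a (phi p) * zc Y b (phi p) * pdv b (fc al a) (phi p))" by (subst sum.swap) (simp add: mult_ac)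
 show ?thesis unfolding ext_d_def d[OF X Y] d[OF Y X] l sw by (simp add: left_diff_distrib right_diff_distrib sum_subtractf mult_ac)
qed

end

section \<open>Contact forms and adapted frames\<close>

definition dt :: "(3 => complex) => (3 => complex) => complex" where
 "dt u v = u 1 * v 1 + u 2 * v 2 + u 3 * v 3"

text \<open>In three dimensions a two-form is evaluated through the cross product of its arguments,
  so exterior derivatives become \<open>dt\<close> of a curl with \<open>crs\<close>, and linear
  independence is a nonzero triple product.\<close>

definition crs :: "(3 => complex) => (3 => complex) => 3 => complex" where
 "crs u v i = (if i = 1 then u 2 * v 3 - u 3 * v 2 else if i = 2 then u 3 * v 1 - u 1 * v 3 else u 1 * v 2 - u 2 * v 1)"

lemma crs_simps [simp]: "crs u v 1 = u 2 * v 3 - u 3 * v 2" "crs u v 2 = u 3 * v 1 - u 1 * v 3" "crs u v 3 = u 1 * v 2 - u 2 * v 1"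
 by (simp_all add: crs_def)

lemma dt_sum: "dt u v = (SUM i:UNIV. u i * v i)" by (simp add: dt_def sum_3)

text \<open>Two vectors annihilated by \<open>th\<close> have a cross product parallel to
  \<open>th\<close>: the 2 by 2 minors are combinations of \<open>dt th v\<close> and
  \<open>dt th w\<close>.\<close>

lemma crs_annihilator:
 assumes "dt th v = 0" "dt th w = 0"
 shows "crs v w k * th l = crs v w l * th k"
proof -
 have "crs v w 1 * th 2 - crs v w 2 * th 1 = w 3 * dt th v - v 3 * dt th w"
 "crs v w 2 * th 3 - crs v w 3 * th 2 = w 1 * dt th v - v 1 * dt th w"
 "crs v w 3 * th 1 - crs v w 1 * th 3 = w 2 * dt th v - v 2 * dt th w" by (simp_all add: dt_def algebra_simps)
 hence "crs v w 1 * th 2 = crs v w 2 * th 1" "crs v w 2 * th 3 = crs v w 3 * th 2" "crs v w 3 * th 1 = crs v w 1 * th 3" using assms by simp_all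
 thus ?thesis using exhaust_3[of k] exhaust_3[of l] by auto
qed

lemma dt_crs_nonzero:
 assumes "dt th v = 0" "dt th w = 0" "dt b (crs v w) ~= 0" "th k ~= 0"
 shows "dt th b ~= 0"
proof
 assume 0: "dt th b = 0"
 have "dt b (crs v w) * th k = b 1 * (crs v w 1 * th k) + b 2 * (crs v w 2 * th k) + b 3 * (crs v w 3 * th k)" by (simp add: dt_def algebra_simps)
 also have "... = crs v w k * dt th b" unfolding crs_annihilator[OF assms(1,2), of _ k] by (simp add: dt_def algebra_simps)
 finally have "dt b (crs v w) * th k = crs v w k * dt th b" .
 with 0 assms show False by simp
qed

lemma cramer3:
 "u i * dt t (crs v w) = dt u (crs v w) * t i + dt t (crs u w) * v i + dt t (crs v u) * w i"
 using exhaust_3[of i] by (auto simp: dt_def algebra_simps)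

lemma complex_real_parts: "a : \<real> ==> b : \<real> ==> c : \<real> ==> d : \<real> ==> a + \<i> * b = c + \<i> * d ==> a = c & b = d"
 by (auto elim!: Reals_cases simp: complex_eq_iff)

lemma dt_sum_rules [simp]:
 "dt th (%i. a * u i) = a * dt th u" "dt th (%i. u i + v i) = dt th u + dt th v" by (simp_all add: dt_def algebra_simps)

context chart
begin

definition ci :: "('a => 'a cvec) => r3 => 3 => complex" where
 "ci X x i = zc X (axis i 1) x"

definition fi :: "'a form => r3 => 3 => complex" where
 "fi al x i = fc al (axis i 1) x"

definition curl :: "'a form => r3 => 3 => complex" where
 "curl al x = (%i. let d = (%a b. pdv (axis a 1) (fc al (axis b 1)) x - pdv (axis b 1) (fc al (axis a 1)) x)
 in if i = 1 then d 2 3 else if i = 2 then d 3 1 else d 1 2)"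

lemma ext_d_curl:
 assumes "open U" "U <= V" "ofc Smooth U al" "vfc Smooth U X" "vfc Smooth U Y" "p : U"
 shows "ext_d M al X Y p = dt (curl al (phi p)) (crs (ci X (phi p)) (ci Y (phi p)))" unfolding ext_d_chart[OF assms] sum_axis
 by (simp add: sum_3 dt_def curl_def ci_def Let_def algebra_simps)

lemma apply_fi: "U <= V ==> lin al U ==> p : U ==> X p : CT p ==> al p (X p) = dt (fi al (phi p)) (ci X (phi p))"
 using lin_apply[of al U p "X p"] by (auto simp: sum_axis sum_3 dt_def fi_def fc_def ci_def zc_def mult.commute subset_iff)

lemma reg_ci: "vfc k U X ==> regular_on k (%x. ci X x i) (phi ` U)" unfolding ci_def by (rule vfc_reg) auto

lemma reg_fi: "ofc k U al ==> regular_on k (%x. fi al x i) (phi ` U)" unfolding fi_def ofc_def by auto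

lemma reg_curl: "open U ==> U <= V ==> ofc k U al ==> regular_on k (%x. curl al x i) (phi ` U)"
 unfolding curl_def ofc_def using exhaust_3[of i] by (auto intro!: reg_diff reg_pdv[unfolded pdv_def[abs_def], folded pdv_def] sub_open)

lemma reg_dt:
 "open S ==> (!!i. regular_on k (%x. u x i) S) ==> (!!i. regular_on k (%x. v x i) S) ==> regular_on k (%x. dt (u x) (v x)) S"
 unfolding dt_def by (intro reg_add reg_mult)

lemma reg_crs:
 "open S ==> (!!i. regular_on k (%x. u x i) S) ==> (!!i. regular_on k (%x. v x i) S) ==> regular_on k (%x. crs (u x) (v x) i) S"
 using exhaust_3[of i] by (auto intro!: reg_diff reg_mult)

lemma ext_d_reg:
 assumes U: "open U" "U <= V" and al: "ofc k U al" and X: "vfc k U X" "vfc k U Y"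
 shows "regular_on k (%x. ext_d M al X Y (psi x)) (phi ` U)"
proof (rule reg_cong[OF sub_open[OF U]])
 show "dt (curl al x) (crs (ci X x) (ci Y x)) = ext_d M al X Y (psi x)" if "x : phi ` U" for x
 using ext_d_curl[OF U ofc_smooth[OF U al] vfc_smooth[OF U X(1)] vfc_smooth[OF U X(2)]] im_sub[OF U(2) that] by simp
 show "regular_on k (%x. dt (curl al x) (crs (ci X x) (ci Y x))) (phi ` U)"
 by (intro reg_dt reg_crs reg_ci[OF X(1)] reg_ci[OF X(2)] reg_curl[OF U al] sub_open[OF U])
qed

lemma ci_eqI:
 assumes "p : V" "X p : CT p" "Y p : CT p" "!!i. ci X (phi p) i = ci Y (phi p) i"
 shows "X p = Y p" by (rule tangent_eqI[OF assms(1-3)], erule BasisE3) (use assms(1,4) in "simp add: ci_def zc_def")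

lemma ci_lincomb: "p : V ==> ci (%q. lincomb (a q) (X q) (b q) (Y q)) (phi p) i = a p * ci X (phi p) i + b p * ci Y (phi p) i"
 by (simp add: ci_def zc_def lincomb_def)

lemma real_parts:
 assumes p: "p : V" and r: "A : rtangent M p" "B : rtangent M p" "C : rtangent M p" "D : rtangent M p"
 and e: "lincomb 1 A \<i> B = lincomb 1 C \<i> D"
 shows "A = C" "B = D"
proof -
 have "A (co b) + \<i> * B (co b) = C (co b) + \<i> * D (co b)" for b using fun_cong[OF e, of "co b"] by (simp add: lincomb_def)
 moreover have "A (co b) : \<real>" "B (co b) : \<real>" "C (co b) : \<real>" "D (co b) : \<real>" if "b : Basis" for b
 using r that rtangent_iff[OF p] by auto
 ultimately have "A (co b) = C (co b)" "B (co b) = D (co b)" if "b : Basis" for b using that complex_real_parts by blast+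
 thus "A = C" "B = D" using tangent_eqI[OF p] r rtangent_iff[OF p] by blast+
qed

end

lemma atlas_chart:
 assumes "analytic_atlas M"
 obtains V phi where "chart M V phi" "p : V"
proof -
 have "p : (\<Union>(U, phi)\<in>M. U)" using assms by (auto simp: analytic_atlas_def)
 thus ?thesis using that assms by (auto simp: chart_def)
qed

lemma vf_lincomb:
 assumes M: "analytic_atlas M" and U: "open U" and X: "vector_field k M U X" "vector_field k M U Y"
 and f: "regular_fun k M f U" "regular_fun k M g U"
 shows "vector_field k M U (%q. lincomb (f q) (X q) (g q) (Y q))" unfolding vector_field_def
proof (intro conjI ballI, goal_cases)
 case (1 p)
 obtain V phi where "chart M V phi" "p : V" by (rule atlas_chart[OF M])
 thus ?case using 1 X chart.lincomb_tangent unfolding vector_field_def by blast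
next
 case (2 c)
 obtain V' phi' where c: "c = (V', phi')" by (cases c)
 have "regular_fun k M (%p. lincomb (f p) (X p) (g p) (Y p) (%q. of_real (phi' q $ i))) (U Int V')" for i unfolding regular_fun_def
 proof (clarify)
 fix W ka assume W: "(W, ka) : M"
 interpret w: chart M W ka using M W by unfold_locales
 interpret v: chart M V' phi' using M 2 c by unfold_locales auto
 have o: "open (ka ` (U Int V' Int W))" by (rule w.sub_open) (use U w.V_open v.V_open in auto)
 have "regular_on k (f' \<circ> w.psi) (ka ` (U Int V' Int W))" if "regular_fun k M f' U \<or> regular_fun k M f' (U Int V')" for f'
 using that w.reg_fun_subset[of k f' U "U Int V'"] W unfolding regular_fun_def by fastforce
 note r = this
 have "regular_fun k M (%p. X p (%q. of_real (phi' q $ i))) (U Int V')" "regular_fun k M (%p. Y p (%q. of_real (phi' q $ i))) (U Int V')"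
 using X 2 c unfolding vector_field_def by fast+
 note r2 = this
 show "regular_on k ((%p. lincomb (f p) (X p) (g p) (Y p) (%q. of_real (phi' q $ i))) \<circ> w.psi) (ka ` (U Int V' Int W))"
 proof -
 have e: "(%p. lincomb (f p) (X p) (g p) (Y p) (%q. of_real (phi' q $ i))) \<circ> w.psi = (%x. (f \<circ> w.psi) x * ((%p. X p (%q. of_real (phi' q $ i))) \<circ> w.psi) x
 + (g \<circ> w.psi) x * ((%p. Y p (%q. of_real (phi' q $ i))) \<circ> w.psi) x)" by (simp add: lincomb_def o_def)
 show ?thesis unfolding e by (intro reg_add reg_mult o r) (use f r2 in auto)
 qed
 qed
 thus ?case by (simp add: c)
qed

lemma (in chart) vf_subset:
 assumes X: "vector_field k M U X" and U': "U' <= U"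
 shows "vector_field k M U' X" unfolding vector_field_def
proof (intro conjI ballI, goal_cases)
 case (1 p) thus ?case using X U' unfolding vector_field_def by blast
next
 case (2 c)
 obtain V' phi' where c: "c = (V', phi')" by (cases c)
 have "regular_fun k M (%p. X p (%q. of_real (phi' q $ i))) (U Int V')" for i using X 2 c unfolding vector_field_def by fast
 hence "regular_fun k M (%p. X p (%q. of_real (phi' q $ i))) (U' Int V')" for i by (rule reg_fun_subset) (use U' in auto)
 thus ?case by (simp add: c)
qed

locale cr = chart M V phi for M :: "('a::{t2_space, second_countable_topology}) atlas" and V phi +
 fixes H J tht
 assumes cr: "cr_structure M H J" and ct: "contact_form Analytic M H J tht"
begin

abbreviation "lev \<equiv> levi_form M tht"

lemmas cr1 = spec[OF conjunct1[OF conjunct2[OF cr[unfolded cr_structure_def]]]]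
 and cr2 = spec[OF conjunct2[OF conjunct2[OF cr[unfolded cr_structure_def]]]]

lemmas ct1 = conjunct1[OF ct[unfolded contact_form_def]]
 and ct2 = conjunct1[OF conjunct2[OF ct[unfolded contact_form_def]]]
 and ct3 = conjunct1[OF conjunct2[OF conjunct2[OF ct[unfolded contact_form_def]]]]
 and ct4 = conjunct2[OF conjunct2[OF conjunct2[OF ct[unfolded contact_form_def]]]]

lemma H_lincomb: "X : H p ==> Y : H p ==> lincomb (of_real a) X (of_real b) Y : H p"
proof -
 assume X: "X : H p" "Y : H p"
 have l: "lincomb (of_real a) (lincomb (of_real a1) X (of_real b1) Y) (of_real b) (lincomb (of_real a2) X (of_real b2) Y)
 = lincomb (of_real (a * a1 + b * a2)) X (of_real (a * b1 + b * b2)) Y" for a b a1 a2 b1 b2 :: real and X Y :: "'a cvec"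
 by (auto simp: lincomb_def algebra_simps)
 obtain X0 Y0 where "H p = {lincomb (of_real a) X0 (of_real b) Y0 | a b :: real. True}" using cr2[of p] by blast
 moreover obtain a1 b1 a2 b2 where "X = lincomb (of_real a1) X0 (of_real b1) Y0" "Y = lincomb (of_real a2) X0 (of_real b2) Y0"
 using X calculation by blast
 ultimately show ?thesis using l[of a a1 X0 b1 Y0 b a2 b2] by blast
qed

lemma H_real: "X : H p ==> X : rtangent M p" and J_H: "X : H p ==> J p X : H p"
 and J_J: "X : H p ==> J p (J p X) = lincomb (- 1) X 0 X"
 and J_lin: "X : H p ==> Y : H p ==>
 J p (lincomb (of_real a) X (of_real b) Y) = lincomb (of_real a) (J p X) (of_real b) (J p Y)"
 and H_theta: "X : H p ==> tht p X = 0" using conjunct1[OF conjunct2[OF cr1], of p] conjunct1[OF conjunct2[OF conjunct2[OF cr1]], of p]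
 conjunct2[OF conjunct2[OF conjunct2[OF cr1]], of p] ct3 by blast+

lemma tht_form: "one_form Analytic M UNIV tht" and tht_real: "X : rtangent M p ==> tht p X : \<real>"
 and H_eq: "H p = {X : rtangent M p. tht p X = 0}"
 and levi_pos: "open U ==> vector_field Smooth M U Z ==> (!!p. p : U ==> Z p : T10 H J p) ==> p : U ==> Z p ~= zero_vec ==>
 lev Z Z p : \<real> & Re (lev Z Z p) > 0" using ct1 ct2 ct3 ct4 by blast+

lemma tht_ofc: "U <= V ==> ofc Analytic U tht"
proof -
 have "one_form Analytic M V tht" using tht_form unfolding one_form_def by auto
 (metis (mono_tags, lifting) Int_lower2 case_prodD reg_fun_subset)
 from ofc_D[OF this] show "U <= V ==> ?thesis" using ofc_subset by blast
qed

lemma tht_lin: "U <= V ==> lin tht U" using tht_ofc by (simp add: ofc_def)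

lemma tht_lincomb: "p : V ==> X : CT p ==> Y : CT p ==> tht p (lincomb a X b Y) = a * tht p X + b * tht p Y"
 using tht_lin[of V] by (simp add: lin_def)

lemma H_ct: "X : H p ==> X : CT p" using H_real by (auto simp: rtangent_def)

lemma lincomb_00: "lincomb 0 X 0 Y = zero_vec" by (simp add: lincomb_def zero_vec_def)

text \<open>Comparing real parts in \<open>JX + iJY = iX - Y\<close> gives \<open>Y = - JX\<close>,
  so the fibre consists of the vectors \<open>X - iJX\<close>.\<close>

lemma T10E:
 assumes p: "p : V" and Z: "Z : T10 H J p"
 obtains X where "X : H p" "Z = lincomb 1 X (- \<i>) (J p X)"
proof -
 obtain X Y where X: "X : H p" "Y : H p" "Z = lincomb 1 X \<i> Y" "lincomb 1 (J p X) \<i> (J p Y) = lincomb \<i> X (- 1) Y"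
 using Z by (auto simp: T10_def)
 have Y': "lincomb (- 1) Y 0 Y : H p" using H_lincomb[OF X(2,2), of "- 1" 0] by simp
 have "lincomb 1 (J p X) \<i> (J p Y) = lincomb 1 (lincomb (- 1) Y 0 Y) \<i> X" unfolding X(4) by (auto simp: lincomb_def)
 hence "J p X = lincomb (- 1) Y 0 Y" by (rule real_parts(1)[OF p, rotated -1]) (use X Y' J_H H_real in auto)
 hence "Z = lincomb 1 X (- \<i>) (J p X)" using X by (auto simp: lincomb_def)
 thus ?thesis using that X by blast
qed

lemma T10I:
 assumes p: "p : V" and X: "X : H p" shows "lincomb 1 X (- \<i>) (J p X) : T10 H J p"
proof -
 have Y: "lincomb (- 1) (J p X) 0 (J p X) : H p" using H_lincomb[OF J_H[OF X] J_H[OF X], of "- 1" 0] by simp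
 have "J p (lincomb (- 1) (J p X) 0 (J p X)) = lincomb (- 1) (J p (J p X)) 0 (J p (J p X))" using J_lin[OF J_H[OF X] J_H[OF X], of "- 1" 0] by simp
 hence "lincomb 1 (J p X) \<i> (J p (lincomb (- 1) (J p X) 0 (J p X))) = lincomb \<i> X (- 1) (lincomb (- 1) (J p X) 0 (J p X))"
 unfolding J_J[OF X] by (auto simp: lincomb_def)
 moreover have "lincomb 1 X (- \<i>) (J p X) = lincomb 1 X \<i> (lincomb (- 1) (J p X) 0 (J p X))" by (auto simp: lincomb_def)
 ultimately show ?thesis using X Y unfolding T10_def by blast
qed

lemma T10_ct: "p : V ==> Z : T10 H J p ==> Z : CT p" unfolding T10_def by (blast intro: lincomb_tangent H_ct)

lemma T10_theta: "p : V ==> Z : T10 H J p ==> tht p Z = 0" by (auto simp: T10_def tht_lincomb H_ct H_theta)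

lemma T10_lincomb:
 assumes p: "p : V" and Z: "Z : T10 H J p" "W : T10 H J p"
 shows "lincomb a Z b W : T10 H J p"
proof -
 obtain X where X: "X : H p" "Z = lincomb 1 X (- \<i>) (J p X)" using T10E[OF p Z(1)] .
 obtain Y where Y: "Y : H p" "W = lincomb 1 Y (- \<i>) (J p Y)" using T10E[OF p Z(2)] .
 define X1 where "X1 = lincomb (of_real (Re a)) X (of_real (Im a)) (J p X)"
 define Y1 where "Y1 = lincomb (of_real (Re b)) Y (of_real (Im b)) (J p Y)"
 have 1: "X1 : H p" "Y1 : H p" unfolding X1_def Y1_def by (intro H_lincomb X Y J_H)+
 define U where "U = lincomb (of_real 1) X1 (of_real 1) Y1"
 have U: "U : H p" "J p U = lincomb (of_real 1) (J p X1) (of_real 1) (J p Y1)" unfolding U_def by (rule H_lincomb[OF 1], rule J_lin[OF 1])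
 have j: "J p X1 = lincomb (of_real (Re a)) (J p X) (of_real (Im a)) (lincomb (- 1) X 0 X)"
 "J p Y1 = lincomb (of_real (Re b)) (J p Y) (of_real (Im b)) (lincomb (- 1) Y 0 Y)"
 unfolding X1_def Y1_def J_J[OF X(1), symmetric] J_J[OF Y(1), symmetric] by (intro J_lin X Y J_H)+
 have "lincomb a Z b W = lincomb 1 U (- \<i>) (J p U)" unfolding U(2) j X(2) Y(2)
 by (subst (1 2) complex_eq) (auto simp: U_def X1_def Y1_def lincomb_def algebra_simps complex_eq_iff)
 thus ?thesis using T10I[OF p U(1)] by simp
qed

text \<open>If \<open>X - iJX\<close> and its conjugate \<open>X + iJX\<close> are both of type
  (1,0), then \<open>JX = - JX\<close>, so \<open>JX = 0\<close>, and applying \<open>J\<close> once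
  more gives \<open>X = 0\<close>.\<close>

lemma T10_conj:
 assumes p: "p : V" and Z: "Z : T10 H J p" "conj_vec Z : T10 H J p" shows "Z = zero_vec"
proof -
 obtain X where X: "X : H p" "Z = lincomb 1 X (- \<i>) (J p X)" using T10E[OF p Z(1)] .
 obtain Y where Y: "Y : H p" "conj_vec Z = lincomb 1 Y (- \<i>) (J p Y)" using T10E[OF p Z(2)] .
 have r: "conj_vec X = X" "conj_vec (J p X) = J p X" using X H_real J_H by (auto simp: rtangent_def)
 have "conj_vec Z = lincomb 1 X \<i> (J p X)"
 proof
 fix f
 have "cnj (X (%p. cnj (f p))) = X f" "cnj (J p X (%p. cnj (f p))) = J p X f"
 using fun_cong[OF r(1), of f] fun_cong[OF r(2), of f] by (simp_all add: conj_vec_def)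
 thus "conj_vec Z f = lincomb 1 X \<i> (J p X) f" by (simp add: X(2) conj_vec_def lincomb_def)
 qed
 also have "lincomb 1 Y (- \<i>) (J p Y) = lincomb 1 Y \<i> (lincomb (- 1) (J p Y) 0 (J p Y))" by (auto simp: lincomb_def)
 moreover have JY: "lincomb (- 1) (J p Y) 0 (J p Y) : H p" using H_lincomb[OF J_H[OF Y(1)] J_H[OF Y(1)], of "- 1" 0] by simp
 ultimately have e: "lincomb 1 X \<i> (J p X) = lincomb 1 Y \<i> (lincomb (- 1) (J p Y) 0 (J p Y))" using Y(2) by simp
 have XY: "X = Y" "J p X = lincomb (- 1) (J p Y) 0 (J p Y)" by (rule real_parts[OF p _ _ _ _ e]; use X Y JY J_H H_real in blast)+
 have JX: "J p X f = 0" for f using fun_cong[OF XY(2), of f] by (simp add: lincomb_def XY(1)[symmetric])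
 have "J p (J p X) = zero_vec"
 proof -
 have "J p X = lincomb (of_real 0) X (of_real 0) X" using JX by (auto simp: lincomb_def)
 hence "J p (J p X) = lincomb (of_real 0) (J p X) (of_real 0) (J p X)" using J_lin[OF X(1) X(1), of 0 0] by simp
 thus ?thesis by (simp add: lincomb_00)
 qed
 hence "X f = 0" for f using fun_cong[OF J_J[OF X(1)], of f] by (simp add: lincomb_def zero_vec_def)
 thus ?thesis using JX by (auto simp: X(2) lincomb_def zero_vec_def)
qed

lemma frame_exists:
 assumes p: "p : V"
 obtains U Z where "open U" "p : U" "U <= V" "admissible_frame M H J U Z"
proof -
 obtain U X Y where U: "open U" "p : U" "vector_field Analytic M U X"
 and HU: "!!q. q : U ==> H q = {lincomb (of_real a) (X q) (of_real b) (Y q) | a b :: real. True}"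
 and ind: "!!q a b. q : U ==> lincomb (of_real a) (X q) (of_real b) (Y q) = zero_vec ==> a = (0::real) & b = (0::real)"
 and JX: "vector_field Analytic M U (%q. J q (X q))" using cr2[of p] by blast
 have at: "analytic_atlas M" by (rule atlas)
 have XH: "X q : H q" if "q : U" for q
 proof -
 have "X q = lincomb (of_real 1) (X q) (of_real 0) (Y q)" by (auto simp: lincomb_def)
 thus ?thesis using HU[OF that] by blast
 qed
 define Z where "Z q = lincomb 1 (X q) (- \<i>) (J q (X q))" for q
 have "vector_field Analytic M U Z" unfolding Z_def[abs_def] by (rule vf_lincomb[OF at U(1,3) JX]) (auto simp: regular_fun_def)
 hence ZV: "vector_field Analytic M (U Int V) Z" by (rule vf_subset) simp
 have "Z q : T10 H J q & Z q ~= zero_vec" if q: "q : U" "q : V" for q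
 proof
 show "Z q : T10 H J q" unfolding Z_def by (rule T10I[OF q(2) XH[OF q(1)]])
 show "Z q ~= zero_vec"
 proof
 assume "Z q = zero_vec"
 hence "lincomb 1 (X q) \<i> (lincomb (- 1) (J q (X q)) 0 (J q (X q))) = lincomb 1 (lincomb 0 (X q) 0 (X q)) \<i> (lincomb 0 (X q) 0 (X q))"
 by (auto simp: Z_def lincomb_def zero_vec_def)
 hence "X q = lincomb 0 (X q) 0 (X q)"
 using real_parts(1)[OF q(2)] XH[OF q(1)] J_H H_real H_lincomb[of _ q _ "- 1" 0] H_lincomb[of _ q _ 0 0] by (metis of_real_0 of_real_1 of_real_minus)
 from fun_cong[OF this] have "lincomb (of_real 1) (X q) (of_real 0) (Y q) = zero_vec" by (simp add: lincomb_def zero_vec_def)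
 thus False using ind[OF q(1), of 1 0] by simp
 qed
 qed
 hence "admissible_frame M H J (U Int V) Z" using ZV U V_open by (auto simp: admissible_frame_def)
 thus ?thesis using that[of "U Int V" Z] U p V_open by auto
qed

end

context chart
begin

definition vec3 :: "(3 => complex) => 'a => 'a cvec" where
 "vec3 u p = vec (%b. SUM i:UNIV. u i * of_real (b \<bullet> axis i 1)) p"

lemma vec3_tangent: "p : V ==> vec3 u p : CT p" by (simp add: vec3_def vec_tangent)

lemma axis_sum: "(SUM i:UNIV. u i * complex_of_real (axis j 1 \<bullet> axis i (1::real))) = u (j::3)"
 by (simp add: inner_axis_axis if_distrib[of "%c. _ * complex_of_real c"] cong: if_cong)

lemma vec3_ci: "p : V ==> ci (%q. vec3 (u q) q) (phi p) i = u p i" by (simp add: ci_def zc_def vec3_def vec_co axis_sum)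

lemma vec3_vfc:
 assumes U: "open U" "U <= V" and u: "!!i. regular_on k (%x. u x i) (phi ` U)"
 shows "vfc k U (%q. vec3 (u (phi q)) q)" unfolding vec3_def
 by (rule vec_vfc[OF U(2,1), of k "%b x. SUM i:UNIV. u x i * of_real (b \<bullet> axis i 1)"])
 (intro reg_sum reg_mult u reg_const sub_open[OF U] finite)

lemma lin_vec3:
 assumes "lin al U" "p : U" "p : V"
 shows "al p (vec3 u p) = dt (fi al (phi p)) u" unfolding vec3_def lin_vec[OF assms] sum_axis axis_sum using assms(3)
 by (simp add: dt_sum fi_def fc_def mult.commute)

end

context cr
begin

text \<open>If \<open>tht\<close> vanished at \<open>p\<close>, the three coordinate vectors would
  all lie in \<open>H p\<close>, which is spanned by two vectors.\<close>

lemma tht_nonzero: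
 assumes p: "p : V" obtains k where "fi tht (phi p) k ~= 0"
proof -
 have False if 0: "!!k. fi tht (phi p) k = 0"
 proof -
 obtain X Y where H: "H p = {lincomb (of_real a) X (of_real b) Y | a b :: real. True}" using cr2[of p] by blast
 have "EX a b. ALL j. a * X (co (axis j 1)) + b * Y (co (axis j 1)) = (if j = i then 1 else 0)" for i
 proof -
 define e where "e = vec3 (%j. if j = i then 1 else 0) p"
 have ec: "e (co (axis j 1)) = (if j = i then 1 else 0)" for j
 using vec3_ci[OF p, of "%_ j. if j = i then 1 else 0" j] p by (simp add: ci_def zc_def e_def)
 have "e : CT p" unfolding e_def by (rule vec3_tangent[OF p])
 hence "e : rtangent M p" unfolding rtangent_iff[OF p] using ec by (auto elim!: BasisE3)
 moreover have "tht p e = 0" unfolding e_def lin_vec3[OF tht_lin[OF order_refl] p p] by (simp add: dt_def 0)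
 ultimately have "e : H p" by (simp add: H_eq)
 then obtain a b :: real where e: "e = lincomb (of_real a) X (of_real b) Y" unfolding H by blast
 have "of_real a * X (co (axis j 1)) + of_real b * Y (co (axis j 1)) = (if j = i then 1 else 0)" for j
 using ec[of j] unfolding e by (simp add: lincomb_def)
 thus ?thesis by blast
 qed
 then obtain a b where ab: "!!i j. a i * X (co (axis j 1)) + b i * Y (co (axis j 1)) = (if j = i then 1 else (0::complex))" by metis
 define x where "x j = X (co (axis j 1))" for j
 define y where "y j = Y (co (axis j 1))" for j
 have ab: "a i * x j + b i * y j = (if j = i then 1 else 0)" for i j using ab by (simp add: x_def y_def)
 \<comment> \<open>Multiplicativity of 2 by 2 minors. The product matrix is the 3 by 3 identity: its
   diagonal minors show that certain minors of both factors are nonzero, while their product is an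
   off-diagonal minor and hence 0.\<close>
 have c: "(a i * b j - a j * b i) * (x k * y l - x l * y k)
 = (a i * x k + b i * y k) * (a j * x l + b j * y l) - (a i * x l + b i * y l) * (a j * x k + b j * y k)" for i j k l by (simp add: algebra_simps)
 show False using c[of 1 2 2 3] c[of 1 2 1 2] c[of 2 3 2 3] by (auto simp: ab)
 qed
 thus ?thesis using that by blast
qed

definition nn :: "r3 => complex" where
 "nn x = dt (fi tht x) (curl tht x)"

lemma tht_apply: "p : V ==> X p : CT p ==> tht p (X p) = dt (fi tht (phi p)) (ci X (phi p))"
 by (rule apply_fi[OF order_refl tht_lin[OF order_refl]])

lemma levi_chart:
 assumes U: "open U" "U <= V" and Z: "vfc Smooth U Z" and p: "p : U"
 shows "lev Z Z p = - \<i> * dt (curl tht (phi p)) (crs (ci Z (phi p)) (ci (%q. conj_vec (Z q)) (phi p)))" unfolding levi_form_def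
 by (subst ext_d_curl[OF U ofc_smooth[OF U tht_ofc[OF U(2)]] Z vfc_conj[OF U Z] p]) simp

lemma frame_D:
 assumes "admissible_frame M H J U Z" "U <= V"
 shows "open U" "vfc Analytic U Z" "vfc Smooth U Z" "p : U ==> Z p : T10 H J p" "p : U ==> Z p ~= zero_vec"
 "p : U ==> Z p : CT p" "p : U ==> tht p (Z p) = 0" "p : U ==> tht p (conj_vec (Z p)) = 0"
proof -
 show o: "open U" and v: "vfc Analytic U Z" and *: "p : U ==> Z p : T10 H J p" "p : U ==> Z p ~= zero_vec"
 using assms vfc_D by (auto simp: admissible_frame_def)
 show "vfc Smooth U Z" by (rule vfc_smooth[OF o assms(2) v])
 show t: "p : U ==> Z p : CT p" "p : U ==> tht p (Z p) = 0" using * T10_ct T10_theta assms(2) by auto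
 assume p: "p : U"
 hence pV: "p : V" using assms by auto
 obtain X where X: "X : H p" "Z p = lincomb 1 X (- \<i>) (J p X)" using T10E[OF pV *(1)[OF p]] .
 have "conj_vec X = X" "conj_vec (J p X) = J p X" using X H_real J_H by (auto simp: rtangent_def)
 hence "conj_vec (Z p) = lincomb 1 X \<i> (J p X)" by (auto simp: X(2) conj_vec_def lincomb_def fun_eq_iff)
 thus "tht p (conj_vec (Z p)) = 0" using X J_H by (simp add: tht_lincomb[OF pV] H_ct H_theta)
qed

lemma levi_pos':
 assumes "admissible_frame M H J U Z" "U <= V" "p : U"
 shows "lev Z Z p = of_real (Re (lev Z Z p))" "Re (lev Z Z p) > 0"
 using levi_pos[OF frame_D(1)[OF assms(1,2)] vfc_I[OF frame_D(1)[OF assms(1,2)] assms(2) frame_D(3)[OF assms(1,2)]]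
 frame_D(4)[OF assms(1,2)] assms(3) frame_D(5)[OF assms]] by auto

lemma nn_nonzero: "x : phi ` V ==> nn x ~= 0"
proof -
 assume "x : phi ` V"
 then obtain p where p: "p : V" and x: "x = phi p" by auto
 obtain U Z where U: "open U" "p : U" "U <= V" and Z: "admissible_frame M H J U Z" using frame_exists[OF p] .
 note F = frame_D[OF Z U(3)]
 obtain k where k: "fi tht (phi p) k ~= 0" using tht_nonzero[OF p] .
 have c: "conj_vec (Z p) : CT p" using conj_tangent(1)[OF p F(6)[OF U(2)]] .
 show ?thesis unfolding nn_def x
 proof (rule dt_crs_nonzero[where k = k and th = "fi tht (phi p)" and v = "ci Z (phi p)" and w = "ci (%q. conj_vec (Z q)) (phi p)"])
 show "dt (fi tht (phi p)) (ci Z (phi p)) = 0" using F(6,7) U(2) tht_apply[OF p, of Z] by simp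
 show "dt (fi tht (phi p)) (ci (%q. conj_vec (Z q)) (phi p)) = 0" using F(8)[OF U(2)] tht_apply[OF p, of "%q. conj_vec (Z q)"] c by simp
 show "dt (curl tht (phi p)) (crs (ci Z (phi p)) (ci (%q. conj_vec (Z q)) (phi p))) ~= 0"
 using levi_pos'(2)[OF Z U(3,2)] levi_chart[OF F(1) U(3) F(3) U(2)] by auto
 qed (rule k)
qed

text \<open>The kernel of \<open>d tht\<close> is spanned by the curl of \<open>tht\<close>, and
  dividing by \<open>nn\<close>, the coefficient of \<open>tht\<close> wedge \<open>d tht\<close>,
  normalises it. The formula makes the Reeb field visibly analytic.\<close>

definition Tv :: "'a => 'a cvec" where
 "Tv p = vec3 (%i. curl tht (phi p) i / nn (phi p)) p"

lemma Tv_ci: "p : V ==> ci Tv (phi p) i = curl tht (phi p) i / nn (phi p)"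
 using vec3_ci[of p "%p i. curl tht (phi p) i / nn (phi p)"] by (simp add: Tv_def[abs_def])

lemma Tv_vfc: "vfc Analytic V Tv" unfolding Tv_def[abs_def]
proof (rule vec3_vfc[OF V_open order_refl, of _ "%x i. curl tht x i / nn x"])
 fix i
 note o = tht_ofc[OF order_refl]
 show "regA (%x. curl tht x i / nn x) (phi ` V)" using nn_nonzero unfolding nn_def
 by (intro reg_divide reg_dt reg_curl[OF V_open order_refl o] reg_fi[OF o] im_open)
qed

lemma Tv_tangent: "p : V ==> Tv p : CT p" by (simp add: Tv_def vec3_tangent)

lemma Tv_tht: "p : V ==> tht p (Tv p) = 1"
 using nn_nonzero[of "phi p"] unfolding Tv_def by (subst lin_vec3[OF tht_lin[OF order_refl]]) (auto simp: dt_def nn_def add_divide_distrib[symmetric])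

lemma fi_real: "x : phi ` V ==> b : Basis ==> cnj (fc tht b x) = fc tht b x"
proof -
 assume x: "x : phi ` V" and b: "b : Basis"
 have "cv b (psi x) : rtangent M (psi x)"
 unfolding rtangent_iff[OF psi_in[OF x]] using cv_tangent[OF psi_in[OF x] b] cv_co[OF psi_in[OF x] b] by auto
 thus ?thesis using tht_real by (auto simp: fc_def Reals_cnj_iff)
qed

lemma curl_real: "x : phi ` V ==> cnj (curl tht x i) = curl tht x i"
proof -
 assume x: "x : phi ` V"
 have "cnj (pdv a (fc tht b) x) = pdv a (fc tht b) x" if b: "b : Basis" for a b
 proof -
 have "fc tht b differentiable at x" using tht_ofc[OF order_refl] reg_differentiable[OF im_open _ x] b by (auto simp: ofc_def)
 from pdv_cnj[OF this, of a] show ?thesis using pdv_cong[OF im_open x, of "%x. cnj (fc tht b x)" "fc tht b" a] fi_real b by simp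
 qed
 thus ?thesis by (auto simp: curl_def)
qed

lemma Tv_real: assumes p: "p : V" shows "Tv p : rtangent M p"
proof -
 have x: "phi p : phi ` V" using p by auto
 have "cnj (nn (phi p)) = nn (phi p)" using x by (simp add: nn_def dt_def curl_real fi_def fi_real)
 hence "ci Tv (phi p) i : \<real>" for i unfolding Tv_ci[OF p] Reals_cnj_iff using curl_real[OF x] by simp
 thus ?thesis unfolding rtangent_iff[OF p] using Tv_tangent[OF p] p by (auto simp: ci_def zc_def elim!: BasisE3)
qed

lemma Tv_ext_d:
 assumes U: "open U" "U <= V" and X: "vfc Smooth U X" and p: "p : U"
 shows "ext_d M tht Tv X p = 0"
proof -
 have pV: "p : V" using U p by auto
 have T: "vfc Smooth U Tv" by (rule vfc_subset[OF vfc_smooth[OF V_open order_refl Tv_vfc] U(2)])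
 have "dt b (crs (%i. b i / n) x) = 0" for b x n by (simp add: dt_def algebra_simps)
 thus ?thesis using Tv_ci[OF pV] unfolding ext_d_curl[OF U ofc_smooth[OF U tht_ofc[OF U(2)]] T X p] by presburger
qed

text \<open>Testing with constant coordinate fields shows that \<open>T p\<close> is parallel to the
  curl, and \<open>tht p (T p) = 1\<close> fixes the factor.\<close>

lemma Tv_unique:
 assumes U: "open U" "U <= V" and T: "vfc Smooth U T" and p: "p : U" and 1: "tht p (T p) = 1"
 and e: "!!X. vfc Smooth U X ==> ext_d M tht T X p = 0"
 shows "T p = Tv p"
proof (rule ci_eqI)
 show pV: "p : V" using U p by auto
 show Tp: "T p : CT p" using vfc_tangent[OF T p] .
 fix i
 let ?b = "curl tht (phi p)" and ?t = "ci T (phi p)" and ?th = "fi tht (phi p)"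
 have "dt ?b (crs ?t (%i. if i = k then 1 else 0)) = 0" for k
 proof -
 define X where "X q = vec3 (%i. if i = k then 1 else 0) q" for q
 have X: "vfc Smooth U X" unfolding X_def[abs_def] by (rule vec3_vfc[OF U, of _ "%_ i. if i = k then 1 else 0"]) simp
 have "ci X (phi p) = (%i. if i = k then 1 else 0)" unfolding X_def[abs_def] using vec3_ci[OF pV, of "%_ i. if i = k then 1 else 0"] by auto
 thus ?thesis using e[OF X] ext_d_curl[OF U ofc_smooth[OF U tht_ofc[OF U(2)]] T X p] by simp
 qed
 from this[of 1] this[of 2] this[of 3]
 have c: "?b 2 * ?t 3 = ?b 3 * ?t 2" "?b 1 * ?t 3 = ?b 3 * ?t 1" "?b 1 * ?t 2 = ?b 2 * ?t 1" by (simp_all add: dt_def)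
 hence s: "?b i * ?t j = ?b j * ?t i" for i j using exhaust_3[of i] exhaust_3[of j] by auto
 have "?b i * dt ?th ?t = ?th 1 * (?b i * ?t 1) + ?th 2 * (?b i * ?t 2) + ?th 3 * (?b i * ?t 3)" by (simp add: dt_def algebra_simps)
 also have "... = nn (phi p) * ?t i" unfolding s[of i 1] s[of i 2] s[of i 3] by (simp add: nn_def dt_def algebra_simps)
 finally have "?b i * dt ?th ?t = nn (phi p) * ?t i" .
 moreover have "dt ?th ?t = 1" using 1 tht_apply[OF pV, of T] Tp by simp
 ultimately show "?t i = ci Tv (phi p) i" unfolding Tv_ci[OF pV] using nn_nonzero[of "phi p"] pV by simp
qed (use U p Tv_tangent in auto)

lemma Tv_charts:
 assumes "(V', phi') : M" "p : V" "p : V'" shows "cr.Tv M V' phi' tht p = Tv p"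
proof -
 interpret c': cr M V' phi' H J tht using atlas assms cr ct by unfold_locales
 have o: "open (V Int V')" "V Int V' <= V" "V Int V' <= V'" using V_open c'.V_open by auto
 have "c'.vfc Smooth (V Int V') c'.Tv" by (rule c'.vfc_subset[OF c'.vfc_smooth[OF c'.V_open order_refl c'.Tv_vfc] o(3)])
 note T = vfc_D[OF c'.vfc_I[OF o(1,3) this] o(2)]
 show ?thesis
 proof (rule Tv_unique[OF o(1,2) T])
 fix X assume "vfc Smooth (V Int V') X"
 from c'.vfc_D[OF vfc_I[OF o(1,2) this] o(3)] show "ext_d M tht c'.Tv X p = 0" by (rule c'.Tv_ext_d[OF o(1,3)]) (use assms in auto)
 qed (use assms c'.Tv_tht in auto)
qed

text \<open>The Reeb field is defined globally, so the local formulas are glued before uniqueness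
  applies: \<open>TG\<close> picks some chart at every point, and by \<open>Tv_charts\<close> the
  choice does not matter.\<close>

lemma reeb: "p : V ==> reeb_field M tht p = Tv p"
proof -
 define TG where "TG q = (let c = SOME (W, ka). (W, ka) : M & q : W in cr.Tv M (fst c) (snd c) tht q)" for q
 have TG: "TG q = cr.Tv M W ka tht q" if W: "(W, ka) : M" "q : W" for q W ka
 proof -
 interpret c: cr M W ka H J tht using atlas cr ct W by unfold_locales
 have "case (SOME (W, ka). (W, ka) : M & q : W) of (W, ka) => (W, ka) : M & q : W"
 by (rule someI[of _ "(W, ka)"]) (use W in auto)
 thus ?thesis using c.Tv_charts[of _ _ q] W(2) unfolding TG_def by auto
 qed
 define P where "P T \<longleftrightarrow> vector_field Smooth M UNIV T & (ALL p. T p : rtangent M p & tht p (T p) = 1) \<and>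
 (ALL U X. open U & vector_field Smooth M U X --> (ALL p:U. ext_d M tht T X p = 0))" for T
 have ext_cong: "ext_d M tht TG X q = ext_d M tht (cr.Tv M W ka tht) X q" if W: "(W, ka) : M" "q : W"
 and O: "open O'" "q : O'" and X: "vector_field Smooth M O' X" for q W ka X O'
 proof -
 interpret c: cr M W ka H J tht using atlas cr ct W by unfold_locales
 have o: "open (O' Int W)" "O' Int W <= W" "q : O' Int W" using O W c.V_open by auto
 have T: "c.vfc Smooth (O' Int W) c.Tv" by (rule c.vfc_subset[OF c.vfc_smooth[OF c.V_open order_refl c.Tv_vfc] o(2)])
 hence T': "c.vfc Smooth (O' Int W) TG" unfolding c.vfc_def c.zc_def using TG[OF W(1)]
 by (auto elim!: reg_cong[OF c.sub_open[OF o(1,2)], rotated])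
 have X': "c.vfc Smooth (O' Int W) X" by (rule c.vfc_D[OF c.vf_subset[OF X] o(2)]) auto
 have "c.ci TG (ka q) = c.ci c.Tv (ka q)" using TG[OF W] W(2) by (auto simp: c.ci_def c.zc_def)
 thus ?thesis unfolding c.ext_d_curl[OF o(1,2) c.ofc_smooth[OF o(1,2) c.tht_ofc[OF o(2)]] T' X' o(3)]
 c.ext_d_curl[OF o(1,2) c.ofc_smooth[OF o(1,2) c.tht_ofc[OF o(2)]] T X' o(3)] by simp
 qed
 have PTG: "P TG" unfolding P_def
 proof (intro conjI allI impI ballI)
 fix q
 obtain W ka where W: "chart M W ka" "q : W" by (rule atlas_chart[OF atlas])
 interpret c: cr M W ka H J tht using cr ct W by (simp add: cr_def cr_axioms_def)
 show "TG q : rtangent M q" "tht q (TG q) = 1" using TG[OF c.chart W(2)] c.Tv_real c.Tv_tht W(2) by auto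
 next
 fix O' X q assume O: "open O' & vector_field Smooth M O' X" "q : O'"
 obtain W ka where W: "chart M W ka" "q : W" by (rule atlas_chart[OF atlas])
 interpret c: cr M W ka H J tht using cr ct W by (simp add: cr_def cr_axioms_def)
 have o: "open (O' Int W)" "O' Int W <= W" "q : O' Int W" using O W c.V_open by auto
 have "c.vfc Smooth (O' Int W) X" by (rule c.vfc_D[OF c.vf_subset o(2)]) (use O in auto)
 from c.Tv_ext_d[OF o(1,2) this o(3)] show "ext_d M tht TG X q = 0" using ext_cong[OF c.chart W(2)] O by auto
 next
 show "vector_field Smooth M UNIV TG" unfolding vector_field_def
 proof (intro conjI ballI, goal_cases)
 case (1 q)
 obtain W ka where W: "chart M W ka" "q : W" by (rule atlas_chart[OF atlas])
 interpret c: cr M W ka H J tht using cr ct W by (simp add: cr_def cr_axioms_def)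
 show ?case using TG[OF c.chart W(2)] c.Tv_tangent W(2) by auto
 next
 case (2 c)
 obtain W ka where c: "c = (W, ka)" by (cases c)
 interpret c: cr M W ka H J tht using atlas cr ct 2 c by unfold_locales auto
 have "regular_fun Smooth M (%p. TG p (%q. of_real (ka q $ i))) W" for i
 proof (rule c.smooth_fun_chart[OF c.V_open order_refl])
 show "regS (%x. TG (c.psi x) (%q. of_real (ka q $ i))) (ka ` W)"
 by (rule reg_cong[OF c.im_open _ c.vfc_reg[OF c.vfc_smooth[OF c.V_open order_refl c.Tv_vfc], of "axis i 1"]])
 (use TG[OF c.chart] in "auto simp: c.zc_def c.co_axis")
 qed
 thus ?case by (simp add: c)
 qed
 qed
 moreover have "T = TG" if T: "P T" for T
 proof
 fix q
 obtain W ka where W: "chart M W ka" "q : W" by (rule atlas_chart[OF atlas])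
 interpret c: cr M W ka H J tht using cr ct W by (simp add: cr_def cr_axioms_def)
 have v: "c.vfc Smooth W T" by (rule c.vfc_D[OF c.vf_subset order_refl]) (use T in "auto simp: P_def")
 have "ext_d M tht T X q = 0" if "c.vfc Smooth W X" for X using T c.vfc_I[OF c.V_open order_refl that] c.V_open W(2) unfolding P_def by blast
 from c.Tv_unique[OF c.V_open order_refl v W(2) _ this] have "T q = c.Tv q" using T by (simp add: P_def)
 thus "T q = TG q" using TG[OF c.chart W(2)] by simp
 qed
 ultimately have "reeb_field M tht = TG" unfolding reeb_field_def P_def[symmetric] by (rule the_equality)
 thus "p : V ==> ?thesis" using TG[OF chart] by simp
qed

end

lemma (in cr) levi_chart':
 assumes U: "open U" "U <= V" and Z: "vfc Smooth U Z" and p: "p : U"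
 shows "lev Z Z p = - \<i> * dt (curl tht (phi p)) (crs (ci Z (phi p)) (%i. cnj (ci Z (phi p) i)))"
proof -
 have "ci (%q. conj_vec (Z q)) (phi p) = (%i. cnj (ci Z (phi p) i))"
 by (rule ext) (use zc_conj[of p Z] vfc_tangent[OF Z p] U p in "auto simp: ci_def")
 thus ?thesis using levi_chart[OF assms] by simp
qed

text \<open>Dividing by the square root of the Levi form keeps the frame analytic by
  \<open>reg_rsqrt\<close>. With unit Levi form the metric and the structure functions have constant
  leading terms.\<close>

lemma (in cr) unit_frame_exists:
 assumes p: "p : V"
 obtains U Z where "open U" "p : U" "U <= V" "admissible_frame M H J U Z" "!!q. q : U ==> lev Z Z q = 1"
proof -
 obtain U Y where U: "open U" "p : U" "U <= V" and Y: "admissible_frame M H J U Y" using frame_exists[OF p] .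
 note F = frame_D[OF Y U(3)] and lv = levi_pos'[OF Y U(3)]
 define f :: "'a => complex" where "f q = of_real (1 / sqrt (Re (lev Y Y q)))" for q
 define Z where "Z q = lincomb (f q) (Y q) 0 (Y q)" for q
 have f: "regular_fun Analytic M f U" unfolding regular_fun_def
 proof clarify
 fix W ka assume W: "(W, ka) : M"
 interpret c: cr M W ka H J tht using atlas cr ct W by unfold_locales
 have o: "open (U Int W)" "U Int W <= W" using U c.V_open by auto
 have Y': "c.vfc Analytic (U Int W) Y" by (rule c.vfc_D[OF c.vf_subset o(2)]) (use Y in "auto simp: admissible_frame_def")
 have "regA (%x. of_real (1 / sqrt (Re (lev Y Y (c.psi x))))) (ka ` (U Int W))"
 proof (rule reg_rsqrt[OF c.sub_open[OF o]])
 show "regA (%x. lev Y Y (c.psi x)) (ka ` (U Int W))" unfolding levi_form_def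
 by (intro reg_cmult c.ext_d_reg c.sub_open o c.tht_ofc Y' c.vfc_conj)
 qed (use lv in auto)
 thus "regA (f \<circ> c.psi) (ka ` (U Int W))" by (simp add: f_def[abs_def] o_def)
 qed
 have fn: "f q ~= 0" if "q : U" for q using lv(2)[OF that] by (simp add: f_def)
 have "admissible_frame M H J U Z" unfolding admissible_frame_def
 proof (intro conjI ballI)
 show "vector_field Analytic M U Z" unfolding Z_def[abs_def]
 by (rule vf_lincomb[OF atlas U(1) _ _ f]) (use Y in "auto simp: admissible_frame_def regular_fun_def ")
 fix q assume q: "q : U"
 show "Z q : T10 H J q" unfolding Z_def by (rule T10_lincomb) (use U q F(4) in auto)
 show "Z q ~= zero_vec" using F(5)[OF q] fn[OF q] by (auto simp: Z_def zero_vec_def lincomb_def fun_eq_iff)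
 qed (rule U)
 moreover have "lev Z Z q = 1" if q: "q : U" for q
 proof -
 have qV: "q : V" using q U by auto
 have "dt c (crs (%i. k * z i) (%i. cnj k * cnj (z i))) = (k * cnj k) * dt c (crs z (%i. cnj (z i)))" for c k z by (simp add: dt_def algebra_simps)
 note * = this
 have "ci Z (phi q) = (%i. f q * ci Y (phi q) i)" unfolding Z_def[abs_def] by (rule ext) (simp add: ci_lincomb[OF qV])
 hence "lev Z Z q = (f q * cnj (f q)) * lev Y Y q"
 using levi_chart'[OF U(1,3) frame_D(3)[OF calculation U(3)] q] levi_chart'[OF U(1,3) F(3) q] by (simp add: *)
 moreover have "f q * cnj (f q) * lev Y Y q = 1"
 proof -
 define r where "r = Re (lev Y Y q)"
 have r: "r > 0" "lev Y Y q = of_real r" using lv[OF q] by (simp_all add: r_def)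
 have "f q * cnj (f q) * lev Y Y q = of_real (1 / sqrt r * (1 / sqrt r) * r)" unfolding r(2) of_real_mult by (simp add: f_def r_def)
 thus ?thesis using r(1) by simp
 qed
 ultimately show ?thesis by simp
 qed
 ultimately show ?thesis using that U by blast
qed

lemma dt_crs_self [simp]: "dt t (crs t w) = 0" "dt t (crs w t) = 0" "dt t (crs w w) = 0" by (simp_all add: dt_def algebra_simps)

lemma dt_crs_swap: "dt t (crs w z) = - dt t (crs z w)" by (simp add: dt_def algebra_simps)

lemma dt_crs_expand:
 "dt c (crs (%i. x0 * t i + x1 * z i + x2 * w i) (%i. y0 * t i + y1 * z i + y2 * w i)) =
 (x0 * y1 - x1 * y0) * dt c (crs t z) + (x0 * y2 - x2 * y0) * dt c (crs t w) + (x1 * y2 - x2 * y1) * dt c (crs z w)"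
 by (simp add: dt_def algebra_simps)

lemma cnj_dt: "cnj (dt u v) = dt (%i. cnj (u i)) (%i. cnj (v i))" by (simp add: dt_def)

lemma cnj_dt_crs: "cnj (dt u (crs v w)) = dt (%i. cnj (u i)) (crs (%i. cnj (v i)) (%i. cnj (w i)))" by (simp add: dt_def)

locale frame = cr M V phi H Jc tht for M :: "('a::{t2_space, second_countable_topology}) atlas" and V phi H Jc tht +
 fixes U Z
 assumes UV: "U <= V" and adm: "admissible_frame M H Jc U Z" and levi1: "!!q. q : U ==> lev Z Z q = 1"
begin

abbreviation "TF \<equiv> theta_fiber M"
abbreviation "cf \<equiv> coframe1 M tht Z"
abbreviation "fdr \<equiv> frame_deriv M tht Z"
abbreviation "T \<equiv> reeb_field M tht"
abbreviation "W \<equiv> %q. conj_vec (Z q)"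
abbreviation "Om \<equiv> phi ` U"
abbreviation "t \<equiv> ci T"
abbreviation "z \<equiv> ci Z"
abbreviation "w \<equiv> ci W"
abbreviation "th \<equiv> fi tht"

lemmas F = frame_D[OF adm UV]
lemma U: "open U" "U <= V" using F(1) UV by auto
lemmas op = sub_open[OF U]
lemma UV': "p : U ==> p : V" using UV by auto

lemma T_Tv: "p : V ==> T p = Tv p" by (rule reeb)

lemma T_vfc: "vfc Analytic U T" using vfc_subset[OF Tv_vfc UV] unfolding vfc_def zc_def by (auto simp: T_Tv UV' elim!: reg_cong[OF op, rotated])

lemma W_vfc: "vfc Analytic U W" by (rule vfc_conj[OF U F(2)])

lemmas vA = T_vfc F(2) W_vfc
lemmas vS = vA[THEN vfc_smooth[OF U]]
lemma t_ct: "p : U ==> T p : CT p" "p : U ==> Z p : CT p" "p : U ==> W p : CT p"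
 using vA vfc_tangent by blast+

lemma t_eq: "x : Om ==> t x i = curl tht x i / nn x" using Tv_ci im_sub[OF UV] T_Tv by (fastforce simp: ci_def zc_def)

lemma w_eq: "x : Om ==> w x i = cnj (z x i)" using zc_conj[of "psi x" Z] F(6) by (auto simp: ci_def UV')

lemma t_real: "x : Om ==> cnj (t x i) = t x i"
proof -
 assume "x : Om"
 hence p: "psi x : V" using UV' by auto
 thus ?thesis using Tv_real[OF p] T_Tv[OF p] rtangent_iff[OF p, of "T (psi x)"] by (simp add: ci_def zc_def Reals_cnj_iff)
qed

lemma cnj_tzw: "x : Om ==> (%i. cnj (t x i)) = t x" "x : Om ==> (%i. cnj (z x i)) = w x" "x : Om ==> (%i. cnj (w x i)) = z x"
 using w_eq t_real by auto

lemma th_t: "x : Om ==> dt (th x) (t x) = 1" and th_z: "x : Om ==> dt (th x) (z x) = 0" and th_w: "x : Om ==> dt (th x) (w x) = 0"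
 using tht_apply[of "psi x" T] tht_apply[of "psi x" Z] tht_apply[of "psi x" W] t_ct[of "psi x"] F(7,8)[of "psi x"] Tv_tht[of "psi x"]
 by (auto simp: UV' T_Tv)

text \<open>Coefficients with respect to \<open>z\<close> and \<open>w\<close> are found by Cramer's
  rule with this determinant; the coefficient of \<open>t\<close> is the value of
  \<open>tht\<close>.\<close>

definition DD :: "r3 => complex" where "DD x = dt (t x) (crs (z x) (w x))"
definition c1 :: "r3 => (3 => complex) => complex" where "c1 x u = dt (t x) (crs u (w x)) / DD x"
definition cb :: "r3 => (3 => complex) => complex" where "cb x u = dt (t x) (crs (z x) u) / DD x"

lemma curl_zw: "x : Om ==> dt (curl tht x) (crs (z x) (w x)) = \<i>"
 using levi_chart[OF U F(3), of "psi x"] levi1[of "psi x"] im_sub[OF UV, of x] by (auto simp: complex_eq_iff)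

lemma DD: assumes x: "x : Om" shows "DD x ~= 0" "cnj (DD x) = - DD x"
proof -
 have "DD x = dt (curl tht x) (crs (z x) (w x)) / nn x" unfolding DD_def dt_def using t_eq[OF x] by (simp add: add_divide_distrib)
 thus "DD x ~= 0" using nn_nonzero[of x] x UV by (auto simp: curl_zw)
 show "cnj (DD x) = - DD x" unfolding DD_def cnj_dt_crs cnj_tzw[OF x] by (rule dt_crs_swap)
qed

lemma c_basis [simp]: "c1 x (t x) = 0" "cb x (t x) = 0" "cb x (z x) = 0" "c1 x (w x) = 0"
 "x : Om ==> c1 x (z x) = 1" "x : Om ==> cb x (w x) = 1" using DD(1)[of x] by (auto simp: c1_def cb_def DD_def[symmetric])

lemma c_add: "c1 x (%i. u i + v i) = c1 x u + c1 x v" "cb x (%i. u i + v i) = cb x u + cb x v"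
 "c1 x (%i. k * u i) = k * c1 x u" "cb x (%i. k * u i) = k * cb x u"
 by (simp_all add: c1_def cb_def dt_def add_divide_distrib[symmetric] algebra_simps)

lemma decomp: "x : Om ==> u i = dt (th x) u * t x i + c1 x u * z x i + cb x u * w x i"
proof -
 assume x: "x : Om"
 define c0 where "c0 = dt u (crs (z x) (w x)) / DD x"
 have *: "u i = c0 * t x i + c1 x u * z x i + cb x u * w x i" for i
 using cramer3[of u i "t x" "z x" "w x"] DD(1)[OF x] by (simp add: c0_def c1_def cb_def DD_def[symmetric] field_simps)
 have "u = (%i. c0 * t x i + c1 x u * z x i + cb x u * w x i)" using * by blast
 hence "dt (th x) u = dt (th x) (%i. c0 * t x i + c1 x u * z x i + cb x u * w x i)" by simp
 hence "c0 = dt (th x) u" using th_t[OF x] th_z[OF x] th_w[OF x] by simp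
 with * show ?thesis by simp
qed

lemma c_cnj: assumes x: "x : Om" shows "c1 x (%i. cnj (u i)) = cnj (cb x u)" "cb x (%i. cnj (u i)) = cnj (c1 x u)"
 unfolding c1_def cb_def complex_cnj_divide cnj_dt_crs DD(2)[OF x] cnj_tzw[OF x] by (subst dt_crs_swap, simp del: crs_simps)+

lemma th_cnj: "x : Om ==> dt (th x) (%i. cnj (u i)) = cnj (dt (th x) u)"
proof -
 assume "x : Om"
 hence "(%i. cnj (th x i)) = th x" using UV by (intro ext) (auto simp: fi_def fi_real)
 thus ?thesis by (simp add: cnj_dt)
qed

lemma reg_tzw: "regA (%x. t x i) Om" "regA (%x. z x i) Om" "regA (%x. w x i) Om" using reg_ci vA by blast+

lemma reg_c:
 assumes "!!i. regA (%x. u x i) Om"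
 shows "regA (%x. c1 x (u x)) Om" "regA (%x. cb x (u x)) Om" "regA (%x. dt (th x) (u x)) Om" unfolding c1_def cb_def using DD(1)
 by (intro reg_divide reg_dt reg_crs op reg_tzw assms reg_fi tht_ofc UV; simp add: DD_def)+

definition br :: "('a => 'a cvec) => ('a => 'a cvec) => r3 => 3 => complex" where
 "br X Y x i = Vf (zc X) (zc Y (axis i 1)) x - Vf (zc Y) (zc X (axis i 1)) x"

lemma reg_br: "vfc k U X ==> vfc k U Y ==> regular_on k (%x. br X Y x i) Om" unfolding br_def by (intro reg_diff reg_Vf op vfc_reg) auto

lemma lie_br:
 assumes "vfc Smooth U X" "vfc Smooth U Y" "p : U" shows "lie_bracket M X Y p = vec3 (br X Y (phi p)) p"
 unfolding lie_bracket_chart[OF U assms] vec3_def by (rule ext) (simp add: vec_def sum_axis axis_sum br_def)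

lemma tangent_const:
 assumes X: "vfc Smooth U X" and p: "p : U" and c: "!!q. q : U ==> f q = c"
 shows "X p f = 0"
proof -
 have x: "phi p : Om" "psi (phi p) = p" using p UV' by auto
 have r: "regS (%x. f (psi x)) Om" by (rule reg_cong[OF op _ reg_const[of _ c]]) (use c im_sub[OF UV] in auto)
 have "pdv b (%x. f (psi x)) (phi p) = pdv b (%x. c) (phi p)" for b by (rule pdv_cong[OF op x(1)]) (use c im_sub[OF UV] in auto)
 thus ?thesis using vfc_apply(1)[OF U X r x(1)] x(2) by (simp add: Vf_def)
qed

text \<open>On fields where the form takes constant values only the bracket term of the exterior
  derivative survives, so structure equations and brackets are interchangeable.\<close>

lemma ext_d_br:
 assumes \<alpha>: "ofc Smooth U \<alpha>" and X: "vfc Smooth U X" and Y: "vfc Smooth U Y" and p: "p : U"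
 and c: "!!q. q : U ==> \<alpha> q (X q) = c" "!!q. q : U ==> \<alpha> q (Y q) = d"
 shows "dt (fi \<alpha> (phi p)) (br X Y (phi p)) = - ext_d M \<alpha> X Y p"
proof -
 have "\<alpha> p (lie_bracket M X Y p) = dt (fi \<alpha> (phi p)) (br X Y (phi p))"
 unfolding lie_br[OF X Y p] using \<alpha> p UV' by (intro lin_vec3) (auto simp: ofc_def)
 thus ?thesis
 unfolding ext_d_def using tangent_const[OF X p, of "%q. \<alpha> q (Y q)" d] tangent_const[OF Y p, of "%q. \<alpha> q (X q)" c] c by simp
qed

text \<open>\<open>a\<close>, \<open>al\<close> and \<open>be\<close> are the structure functions of
  the unitary frame. The form \<open>tht\<close> fixes the components of the brackets along
  \<open>T\<close>, and conjugation gives the others.\<close>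

definition a :: "r3 => complex" where "a x = c1 x (br Z W x)"
definition al :: "r3 => complex" where "al x = c1 x (br T Z x)"
definition be :: "r3 => complex" where "be x = cb x (br T Z x)"

lemma reg_str: "regA a Om" "regA al Om" "regA be Om" unfolding a_def[abs_def] al_def[abs_def] be_def[abs_def] by (intro reg_c reg_br vA)+

lemma br_cnj:
 assumes x: "x : Om" and X: "vfc Smooth U X" "vfc Smooth U Y" "vfc Smooth U X'" "vfc Smooth U Y'"
 and c: "!!x b. x : Om ==> b : Basis ==> zc X' b x = cnj (zc X b x)" "!!x b. x : Om ==> b : Basis ==> zc Y' b x = cnj (zc Y b x)"
 shows "br X' Y' x = (%i. cnj (br X Y x i))"
proof -
 have "Vf (zc X') (zc Y' b) x = cnj (Vf (zc X) (zc Y b) x)" if b: "b : Basis" and Y: "vfc Smooth U Y"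
 and c: "!!x b. x : Om ==> b : Basis ==> zc X' b x = cnj (zc X b x)" "!!x b. x : Om ==> b : Basis ==> zc Y' b x = cnj (zc Y b x)" for X Y X' Y' b
 proof -
 have "pdv b' (zc Y' b) x = cnj (pdv b' (zc Y b) x)" for b' using pdv_cong[OF op x, of "zc Y' b" "%x. cnj (zc Y b x)" b'] c(2)[OF _ b]
 pdv_cnj[OF reg_differentiable[OF op vfc_reg[OF Y b] x], of b'] by simp
 thus ?thesis by (simp add: Vf_def c(1)[OF x])
 qed
 note * = this
 show ?thesis unfolding br_def using *[OF axis_Basis X(2) c] *[OF axis_Basis X(1) c(2,1)] by simp
qed

lemma zc_cnj: "x : Om ==> b : Basis ==> zc W b x = cnj (zc Z b x)" "x : Om ==> b : Basis ==> zc Z b x = cnj (zc W b x)"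
 "x : Om ==> b : Basis ==> zc T b x = cnj (zc T b x)" using w_eq[of x] t_real[of x] by (auto elim!: BasisE3 simp: ci_def)

lemma br_swap: "br Y X x i = - br X Y x i" by (simp add: br_def)

lemma br_eq:
 assumes x: "x : Om"
 shows "br Z W x i = - \<i> * t x i + a x * z x i - cnj (a x) * w x i"
 "br T Z x i = al x * z x i + be x * w x i"
 "br T W x i = cnj (be x) * z x i + cnj (al x) * w x i"
proof -
 obtain p where p: "p : U" "x = phi p" using x by auto
 have thtS: "ofc Smooth U tht" by (rule ofc_smooth[OF U tht_ofc[OF UV]])
 have 1: "tht q (T q) = 1" if "q : U" for q using Tv_tht UV'[OF that] T_Tv by auto
 have "dt (th x) (br Z W x) = - ext_d M tht Z W p" unfolding p(2) by (rule ext_d_br[OF thtS vS(2,3) p(1), of 0 0]) (use F in auto)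
 also have "ext_d M tht Z W p = \<i>" using levi1[OF p(1)] by (auto simp: levi_form_def complex_eq_iff)
 finally have c0: "dt (th x) (br Z W x) = - \<i>" .
 have "ext_d M tht T Z p = dt (curl tht x) (crs (t x) (z x))" unfolding p(2) by (rule ext_d_curl[OF U thtS vS(1,2) p(1)])
 also have "... = 0" using t_eq[OF x] UV by (auto simp: dt_def field_simps)
 finally have "dt (th x) (br T Z x) = 0" using ext_d_br[OF thtS vS(1,2) p(1), of 1 0] 1 F(7) p(2) by simp
 thus TZ: "br T Z x i = al x * z x i + be x * w x i" for i using decomp[OF x, of "br T Z x" i] by (simp add: al_def be_def)
 have "cb x (br Z W x) = - cnj (a x)"
 proof -
 have "br W Z x = (%i. cnj (br Z W x i))" by (rule br_cnj[OF x vS(2,3,3,2)]) (use zc_cnj in auto)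
 hence "cnj (cb x (br Z W x)) = c1 x (br W Z x)" using c_cnj[OF x] by simp
 also have "br W Z x = (%i. (- 1) * br Z W x i)" by (subst br_swap, simp)
 finally have "cnj (cb x (br Z W x)) = - a x" unfolding c_add a_def by simp
 thus ?thesis by (metis complex_cnj_cnj complex_cnj_minus)
 qed
 thus "br Z W x i = - \<i> * t x i + a x * z x i - cnj (a x) * w x i" using decomp[OF x, of "br Z W x" i] c0 by (simp add: a_def)
 have "br T W x = (%i. cnj (br T Z x i))" by (rule br_cnj[OF x vS(1,2,1,3)]) (use zc_cnj in auto)
 thus "br T W x i = cnj (be x) * z x i + cnj (al x) * w x i" using TZ w_eq[OF x] by simp
qed

end

section \<open>The Tanaka--Webster connection of a unitary frame\<close>

context frame
begin

lemma dt_lin3: "dt u (%i. k * t' i + m * z' i + n * w' i) = k * dt u t' + m * dt u z' + n * dt u w'" by simp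

text \<open>The Lie derivative of \<open>d tht\<close> along the Reeb field vanishes because \<open>curl tht\<close> is divergence free.\<close>

lemma al_imaginary:
 assumes x: "x : Om" shows "al x + cnj (al x) = 0"
proof -
 have r: "regA (%y. curl tht y i) Om" for i by (rule reg_curl[OF U tht_ofc[OF UV]])
 have d: "(%y. curl tht y i) differentiable (at x)" "(%y. t y i) differentiable (at x)"
 "(%y. z y i) differentiable (at x)" "(%y. w y i) differentiable (at x)" for i by (rule reg_differentiable[OF op _ x], rule r reg_tzw)+
 have d0: "nn differentiable (at x)" unfolding nn_def[abs_def] using reg_differentiable[OF op reg_dt[OF op reg_fi[OF tht_ofc[OF UV]] r] x] .
 have vf: "Vf u (%y. f y + g y) x = Vf u f x + Vf u g x" "Vf u (%y. f y - g y) x = Vf u f x - Vf u g x"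
 "Vf u (%y. f y * g y) x = f x * Vf u g x + Vf u f x * g x"
 if "f differentiable (at x)" "g differentiable (at x)" for f g u
 using that by (simp_all add: Vf_def pdv_add pdv_diff pdv_mult sum.distrib sum_subtractf sum_distrib_left sum_distrib_right algebra_simps)
 let ?b = "curl tht x" and ?D = "%X v i. Vf (zc X) (%y. v y i) x"
 define B where "B j i = pdv (axis j 1) (%y. curl tht y i) x" for i j
 have DB: "?D X (curl tht) i = (SUM j:UNIV. ci X x j * B j i)" for X i by (simp add: Vf_def sum_axis ci_def B_def)
 have "Vf (zc T) (%y. dt (curl tht y) (crs (z y) (w y))) x = 0" unfolding Vf_def using pdv_cong[OF op x, of _ "%_. \<i>"] curl_zw by simp
 hence 1: "dt (?D T (curl tht)) (crs (z x) (w x)) + dt ?b (crs (?D T z) (w x)) + dt ?b (crs (z x) (?D T w)) = 0"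
 by (simp add: dt_def vf d algebra_simps)
 have bt: "curl tht y i = nn y * t y i" if "y : Om" for y i using t_eq[OF that] nn_nonzero[of y] that UV by auto
 have Db: "?D X (curl tht) i = nn x * ?D X t i + Vf (zc X) nn x * t x i" for X i
 proof -
 have "?D X (curl tht) i = Vf (zc X) (%y. nn y * t y i) x" unfolding Vf_def using pdv_cong[OF op x bt] by simp
 thus ?thesis by (simp add: vf d d0)
 qed
 have Dz: "?D T z i = ?D Z t i + al x * z x i + be x * w x i"
 "?D T w i = ?D W t i + cnj (be x) * z x i + cnj (al x) * w x i" for i using br_eq(2,3)[OF x, of i] by (simp_all add: br_def ci_def algebra_simps)
 \<comment> \<open>Applying a linear map to each slot of a triple product in turn gives its trace
   times the product. The map is the derivative of the curl, whose trace is the divergence of a curl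
   and hence 0.\<close>
 have tr: "dt (%i. SUM j:UNIV. ?b j * B j i) (crs (z x) (w x)) + dt ?b (crs (%i. SUM j:UNIV. z x j * B j i) (w x))
 + dt ?b (crs (z x) (%i. SUM j:UNIV. w x j * B j i)) = (B 1 1 + B 2 2 + B 3 3) * dt ?b (crs (z x) (w x))"
 by (simp add: dt_def sum_3 algebra_simps)
 have fr: "regA (fc tht b) Om" if "b : Basis" for b using tht_ofc[OF UV] that by (auto simp: ofc_def)
 note dp = reg_differentiable[OF op reg_pdv[OF op fr] x]
 have "B 1 1 + B 2 2 + B 3 3 = 0"
 using pdv_commute[OF op x fr, of "axis 3 1" "axis 1 1" "axis 2 1"] pdv_commute[OF op x fr, of "axis 2 1" "axis 1 1" "axis 3 1"]
 pdv_commute[OF op x fr, of "axis 1 1" "axis 2 1" "axis 3 1"] by (simp add: B_def curl_def Let_def pdv_diff dp)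
 with tr have "dt (%i. nn x * ?D T (curl tht) i) (crs (z x) (w x)) + dt ?b (crs (?D Z (curl tht)) (w x))
 + dt ?b (crs (z x) (?D W (curl tht))) = 0" unfolding DB by (simp add: bt[OF x] sum_distrib_left mult.assoc)
 hence "nn x * (dt (?D T (curl tht)) (crs (z x) (w x)) + dt ?b (crs (?D Z t) (w x)) + dt ?b (crs (z x) (?D W t))) = 0"
 unfolding Db by (simp add: bt[OF x] dt_def algebra_simps)
 hence "dt (?D T (curl tht)) (crs (z x) (w x)) + dt ?b (crs (?D Z t) (w x)) + dt ?b (crs (z x) (?D W t)) = 0" using nn_nonzero[of x] x UV by auto
 moreover have "dt ?b (crs (?D T z) (w x)) + dt ?b (crs (z x) (?D T w)) =
 dt ?b (crs (?D Z t) (w x)) + dt ?b (crs (z x) (?D W t)) + (al x + cnj (al x)) * dt ?b (crs (z x) (w x))"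
 unfolding Dz by (simp add: dt_def algebra_simps)
 ultimately have "(al x + cnj (al x)) * \<i> = 0" using 1 unfolding curl_zw[OF x] by algebra
 thus ?thesis by simp
qed

definition c0p :: "'a => 'a cvec => complex" where "c0p p X = dt (th (phi p)) (%i. X (co (axis i 1)))"
definition c1p :: "'a => 'a cvec => complex" where "c1p p X = c1 (phi p) (%i. X (co (axis i 1)))"
definition cbp :: "'a => 'a cvec => complex" where "cbp p X = cb (phi p) (%i. X (co (axis i 1)))"

lemma coords: "p : U ==> (%i. T p (co (axis i 1))) = t (phi p)" "p : U ==> (%i. Z p (co (axis i 1))) = z (phi p)"
 "p : U ==> (%i. W p (co (axis i 1))) = w (phi p)" "p : U ==> (%i. X p (co (axis i 1))) = ci X (phi p)"
 by (rule ext, simp add: ci_def zc_def UV')+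

lemma cp_basis [simp]:
 assumes p: "p : U"
 shows "c0p p (T p) = 1" "c0p p (Z p) = 0" "c0p p (W p) = 0" "c1p p (T p) = 0" "c1p p (Z p) = 1" "c1p p (W p) = 0"
 "cbp p (T p) = 0" "cbp p (Z p) = 0" "cbp p (W p) = 1" unfolding c0p_def c1p_def cbp_def coords[OF p] using p by (simp_all add: th_t th_z th_w)

lemma cp_decomp:
 assumes p: "p : U" and X: "X : CT p"
 shows "X = (%f. c0p p X * T p f + c1p p X * Z p f + cbp p X * W p f)"
proof -
 have "X = lincomb 1 (lincomb (c0p p X) (T p) (c1p p X) (Z p)) (cbp p X) (W p)"
 proof (rule tangent_eqI[OF UV'[OF p] X])
 show "lincomb 1 (lincomb (c0p p X) (T p) (c1p p X) (Z p)) (cbp p X) (W p) : CT p" using t_ct p by (intro lincomb_tangent UV')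
 fix b :: "r3" assume "b : Basis"
 then obtain i where b: "b = axis i 1" by (rule BasisE3)
 show "X (co b) = lincomb 1 (lincomb (c0p p X) (T p) (c1p p X) (Z p)) (cbp p X) (W p) (co b)"
 using decomp[of "phi p" "%i. X (co (axis i 1))" i] p fun_cong[OF coords(1)[OF p], of i] fun_cong[OF coords(2)[OF p], of i] fun_cong[OF coords(3)[OF p], of i]
 by (simp add: lincomb_def b c0p_def c1p_def cbp_def)
 qed
 thus ?thesis by (simp add: lincomb_def)
qed

lemma cp_lincomb: "c0p p (lincomb k X m Y) = k * c0p p X + m * c0p p Y" "c1p p (lincomb k X m Y) = k * c1p p X + m * c1p p Y"
 "cbp p (lincomb k X m Y) = k * cbp p X + m * cbp p Y" unfolding c0p_def c1p_def cbp_def lincomb_def by (simp_all add: c_add)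

lemma cp_conj:
 assumes p: "p : U" and X: "X : CT p"
 shows "c0p p (conj_vec X) = cnj (c0p p X)" "c1p p (conj_vec X) = cnj (cbp p X)" "cbp p (conj_vec X) = cnj (c1p p X)"
 unfolding c0p_def c1p_def cbp_def conj_tangent(2)[OF UV'[OF p] X] using p by (simp_all add: c_cnj th_cnj)

lemma tht_c0p: "p : U ==> X : CT p ==> tht p X = c0p p X"
 using tht_apply[of p "%_. X"] by (simp add: c0p_def ci_def[abs_def] zc_def UV')

lemma coframe1_eq:
 assumes p: "p : U" and X: "X : CT p"
 shows "cf p X = c1p p X" unfolding coframe1_def
proof (rule the_equality)
 show "EX k m. X = (%f. k * T p f + c1p p X * Z p f + m * W p f)" using cp_decomp[OF p X] by blast
 fix c assume "EX k m. X = (%f. k * T p f + c * Z p f + m * W p f)"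
 then obtain k m where "X = lincomb 1 (lincomb k (T p) c (Z p)) m (W p)" by (auto simp: lincomb_def)
 thus "c = c1p p X" using p by (simp add: cp_lincomb)
qed

lemma c_ofc:
 assumes l: "!!p X. p : U ==> X : CT p ==> \<alpha> p X = k0 (phi p) * c0p p X + k1 (phi p) * c1p p X + k2 (phi p) * cbp p X"
 and r: "regA k0 Om" "regA k1 Om" "regA k2 Om"
 shows "ofc Analytic U \<alpha>" unfolding ofc_def
proof (intro conjI ballI)
 show "lin \<alpha> U" unfolding lin_def by (intro ballI allI) (use l lincomb_tangent UV' in "auto simp: cp_lincomb algebra_simps")
 fix b :: "r3" assume "b : Basis"
 then obtain j where b: "b = axis j 1" by (rule BasisE3)
 have e: "(%i. cv b (psi x) (co (axis i 1))) = (%i. if i = j then 1 else 0)" if "x : Om" for x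
 using cv_co[of "psi x" b] im_sub[OF UV that] by (auto simp: b axis_eq_axis)
 show "regA (fc \<alpha> b) Om"
 proof (rule reg_cong[OF op])
 show "k0 x * dt (th x) (%i. if i = j then 1 else 0) + k1 x * c1 x (%i. if i = j then 1 else 0) + k2 x * cb x (%i. if i = j then 1 else 0) = fc \<alpha> b x"
 if "x : Om" for x using e[OF that] im_sub[OF UV that] l[of "psi x" "cv b (psi x)"] cv_tangent[of "psi x" b] UV'
 by (simp add: fc_def c0p_def c1p_def cbp_def b)
 show "regA (%x. k0 x * dt (th x) (%i. if i = j then 1 else 0) + k1 x * c1 x (%i. if i = j then 1 else 0) + k2 x * cb x (%i. if i = j then 1 else 0)) Om"
 by (intro reg_add reg_mult op r reg_c reg_const)
 qed
qed

text \<open>The connection form read off from the brackets of the frame; with unit Levi form,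
  compatibility with the metric means that it is purely imaginary.\<close>

definition om0 :: "'a form" where
 "om0 p X = al (phi p) * c0p p X + cnj (a (phi p)) * c1p p X - a (phi p) * cbp p X"

lemma om0_ofc: "ofc Analytic U om0" by (rule c_ofc[of _ al "%x. cnj (a x)" "%x. - a x"]) (auto simp: om0_def intro!: reg_str reg_cnj reg_minus op)

lemma coframe_ofc: "ofc Analytic U cf" by (rule c_ofc[of _ "%x. 0" "%x. 1" "%x. 0"]) (auto simp: coframe1_eq)

lemma ext_d_vec:
 assumes \<alpha>: "lin \<alpha> U" and X: "vfc Smooth U X" "vfc Smooth U Y" and p: "p : U"
 shows "\<alpha> p (lie_bracket M X Y p) = dt (fi \<alpha> (phi p)) (br X Y (phi p))"
 unfolding lie_br[OF X p] using \<alpha> p UV' by (intro lin_vec3)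

lemma fi_frame: "p : U ==> lin \<alpha> U ==> dt (fi \<alpha> (phi p)) (t (phi p)) = \<alpha> p (T p)" "p : U ==> lin \<alpha> U ==> dt (fi \<alpha> (phi p)) (z (phi p)) = \<alpha> p (Z p)"
 "p : U ==> lin \<alpha> U ==> dt (fi \<alpha> (phi p)) (w (phi p)) = \<alpha> p (W p)"
 using apply_fi[OF UV, of \<alpha> p T] apply_fi[OF UV, of \<alpha> p Z] apply_fi[OF UV, of \<alpha> p W] t_ct[of p] by auto

lemma lin_br:
 assumes p: "p : U" and \<alpha>: "lin \<alpha> U"
 shows "dt (fi \<alpha> (phi p)) (br Z W (phi p)) = - \<i> * \<alpha> p (T p) + a (phi p) * \<alpha> p (Z p) - cnj (a (phi p)) * \<alpha> p (W p)"
 "dt (fi \<alpha> (phi p)) (br T Z (phi p)) = al (phi p) * \<alpha> p (Z p) + be (phi p) * \<alpha> p (W p)"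
 "dt (fi \<alpha> (phi p)) (br T W (phi p)) = cnj (be (phi p)) * \<alpha> p (Z p) + cnj (al (phi p)) * \<alpha> p (W p)"
proof -
 have x: "phi p : Om" using p by auto
 have "br Z W (phi p) = (%i. - \<i> * t (phi p) i + a (phi p) * z (phi p) i + - cnj (a (phi p)) * w (phi p) i)"
 "br T Z (phi p) = (%i. 0 * t (phi p) i + al (phi p) * z (phi p) i + be (phi p) * w (phi p) i)"
 "br T W (phi p) = (%i. 0 * t (phi p) i + cnj (be (phi p)) * z (phi p) i + cnj (al (phi p)) * w (phi p) i)" using br_eq[OF x] by auto
 thus "dt (fi \<alpha> (phi p)) (br Z W (phi p)) = - \<i> * \<alpha> p (T p) + a (phi p) * \<alpha> p (Z p) - cnj (a (phi p)) * \<alpha> p (W p)"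
 "dt (fi \<alpha> (phi p)) (br T Z (phi p)) = al (phi p) * \<alpha> p (Z p) + be (phi p) * \<alpha> p (W p)"
 "dt (fi \<alpha> (phi p)) (br T W (phi p)) = cnj (be (phi p)) * \<alpha> p (Z p) + cnj (al (phi p)) * \<alpha> p (W p)"
 by (simp_all only: dt_lin3 fi_frame[OF p \<alpha>]) simp_all
qed

lemma d_coframe:
 assumes p: "p : U"
 shows "ext_d M cf Z W p = - a (phi p)" "ext_d M cf T Z p = - al (phi p)"
 "ext_d M cf T W p = - cnj (be (phi p))"
proof -
 have o: "ofc Smooth U cf" by (rule ofc_smooth[OF U coframe_ofc])
 have l: "lin cf U" using o by (simp add: ofc_def)
 have v: "cf q (T q) = 0" "cf q (Z q) = 1" "cf q (W q) = 0" if "q : U" for q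
 using that t_ct by (simp_all add: coframe1_eq)
 show "ext_d M cf Z W p = - a (phi p)" "ext_d M cf T Z p = - al (phi p)"
 "ext_d M cf T W p = - cnj (be (phi p))"
 proof -
 have "dt (fi cf (phi p)) (br Z W (phi p)) = - ext_d M cf Z W p"
 "dt (fi cf (phi p)) (br T Z (phi p)) = - ext_d M cf T Z p"
 "dt (fi cf (phi p)) (br T W (phi p)) = - ext_d M cf T W p"
 by (rule ext_d_br[OF o _ _ p]; (rule v, assumption | rule vS v))+
 note * = this[unfolded lin_br[OF p l] v[OF p]]
 show "ext_d M cf Z W p = - a (phi p)" "ext_d M cf T Z p = - al (phi p)"
 "ext_d M cf T W p = - cnj (be (phi p))" using * by simp_all
 qed
qed

lemma tw_exists: "tanaka_webster M tht Z U om0 (%p. - cnj (be (phi p)))" unfolding tanaka_webster_def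
proof (intro conjI allI impI ballI)
 show "one_form Smooth M U om0" by (rule ofc_I[OF U ofc_smooth[OF U om0_ofc]])
 show "regular_fun Smooth M (%p. - cnj (be (phi p))) U"
 by (rule smooth_fun_chart[OF U], rule reg_cong[OF op _ reg_smooth[OF op reg_minus[OF op reg_cnj[OF op reg_str(3)]]]])
 (use im_sub[OF UV] in auto)
 fix X Y p assume XY: "vector_field Smooth M U X & vector_field Smooth M U Y" and p: "p : U"
 have v: "vfc Smooth U X" "vfc Smooth U Y" using XY vfc_D UV by auto
 have t: "X p : CT p" "Y p : CT p" using v p vfc_tangent by auto
 have x: "phi p : Om" using p by auto
 have ct': "conj_vec X : CT p" if "X : CT p" for X using conj_tangent[OF UV'[OF p] that] by simp
 have o: "ofc Smooth U cf" by (rule ofc_smooth[OF U coframe_ofc])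
 have e: "ci X (phi p) = (%i. c0p p (X p) * t (phi p) i + c1p p (X p) * z (phi p) i + cbp p (X p) * w (phi p) i)" for X
 unfolding c0p_def c1p_def cbp_def coords(4)[OF p] by (rule ext) (rule decomp[OF x])
 note dc = d_coframe[OF p, unfolded ext_d_curl[OF U o vS(2,3) p] ext_d_curl[OF U o vS(1,2) p] ext_d_curl[OF U o vS(1,3) p]]
 have "conj_form cf p X = cbp p X" if "X : CT p" for X
 using p that ct'[OF that] by (simp add: conj_form_def coframe1_eq cp_conj)
 thus "ext_d M cf X Y p = wedge cf om0 p (X p) (Y p) +
 - cnj (be (phi p)) * wedge tht (conj_form cf) p (X p) (Y p)" unfolding ext_d_curl[OF U o v p] e[of X] e[of Y] dt_crs_expand dc
 using t p by (simp add: wedge_def coframe1_eq tht_c0p om0_def algebra_simps)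
next
 fix X p assume X: "vector_field Smooth M U X" and p: "p : U"
 have v: "vfc Smooth U X" using X vfc_D UV by auto
 have t: "X p : CT p" using v p vfc_tangent by auto
 have "X p (lev Z Z) = 0" by (rule tangent_const[OF v p levi1])
 moreover have "om0 p (X p) + conj_form om0 p (X p) = (al (phi p) + cnj (al (phi p))) * c0p p (X p)"
 using p t by (simp add: conj_form_def om0_def cp_conj algebra_simps)
 ultimately show "X p (lev Z Z) = (om0 p (X p) + conj_form om0 p (X p)) * lev Z Z p" using al_imaginary[of "phi p"] p by simp
qed

text \<open>\<open>tw_form\<close> and \<open>tw_torsion\<close> are chosen by \<open>SOME\<close>;
  uniqueness of the values on the frame makes these choices computable.\<close>

lemma tw_unique:
 assumes tw: "tanaka_webster M tht Z U om ta" and p: "p : U"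
 shows "om p (T p) = al (phi p)" "om p (Z p) = cnj (a (phi p))" "om p (W p) = - a (phi p)" "ta p = - cnj (be (phi p))"
proof -
 have vf: "vector_field Smooth M U T" "vector_field Smooth M U Z" "vector_field Smooth M U W" by (intro vfc_I U vS)+
 have v: "cf p (T p) = 0" "cf p (Z p) = 1" "cf p (W p) = 0" using p t_ct by (simp_all add: coframe1_eq)
 have cv: "conj_form cf p (T p) = 0" "conj_form cf p (Z p) = 0" "conj_form cf p (W p) = 1"
 using p t_ct conj_tangent(1)[OF UV'[OF p]] by (simp_all add: conj_form_def coframe1_eq cp_conj)
 have th: "tht p (T p) = 1" "tht p (Z p) = 0" "tht p (W p) = 0" using p t_ct by (simp_all add: tht_c0p)
 have e: "ext_d M cf X Y p = wedge cf om p (X p) (Y p) + ta p * wedge tht (conj_form cf) p (X p) (Y p)"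
 if "vector_field Smooth M U X" "vector_field Smooth M U Y" for X Y using tw that p unfolding tanaka_webster_def by blast
 show "om p (T p) = al (phi p)" "ta p = - cnj (be (phi p))" and w: "om p (W p) = - a (phi p)"
 using e[OF vf(1,2)] e[OF vf(2,3)] e[OF vf(1,3)] unfolding d_coframe[OF p] wedge_def v cv th by simp_all
 have "Z p (lev Z Z) = (om p (Z p) + conj_form om p (Z p)) * lev Z Z p" using tw vf p unfolding tanaka_webster_def by blast
 hence "om p (Z p) + cnj (om p (W p)) = 0" using tangent_const[OF vS(2) p levi1] levi1[OF p] by (simp add: conj_form_def)
 thus "om p (Z p) = cnj (a (phi p))" using w by simp
qed

abbreviation "TW \<equiv> tw_form M tht Z U"

lemma TW_ex: "EX ta. tanaka_webster M tht Z U TW ta" unfolding tw_form_def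
 by (rule someI_ex[of "%om. EX ta. tanaka_webster M tht Z U om ta"]) (use tw_exists in blast)

lemma TW: assumes p: "p : U" shows "TW p (T p) = al (phi p)" "TW p (Z p) = cnj (a (phi p))" "TW p (W p) = - a (phi p)"
 "tw_torsion M tht Z U p = - be (phi p)" "conj_form TW p (Z p) = - cnj (a (phi p))" "conj_form TW p (W p) = a (phi p)"
proof -
 show *: "TW p (T p) = al (phi p)" "TW p (Z p) = cnj (a (phi p))" "TW p (W p) = - a (phi p)" using TW_ex tw_unique[OF _ p] by blast+
 have "EX om. tanaka_webster M tht Z U om (SOME ta. EX om. tanaka_webster M tht Z U om ta)"
 by (rule someI_ex[of "%ta. EX om. tanaka_webster M tht Z U om ta"]) (use tw_exists in blast)
 then obtain om where "tanaka_webster M tht Z U om (SOME ta. EX om. tanaka_webster M tht Z U om ta)" ..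
 from tw_unique(4)[OF this p] show "tw_torsion M tht Z U p = - be (phi p)" unfolding tw_torsion_def levi1[OF p] by simp
 have "conj_vec (W p) = Z p" by (auto simp: conj_vec_def)
 thus "conj_form TW p (Z p) = - cnj (a (phi p))" "conj_form TW p (W p) = a (phi p)" using * by (simp_all add: conj_form_def)
qed

definition AN :: "('a => complex) => bool" where
 "AN f \<longleftrightarrow> regA (%x. f (psi x)) Om"

lemma AN_cong: "AN f ==> (!!p. p : U ==> f p = g p) ==> AN g" unfolding AN_def by (rule reg_cong[OF op]) (use im_sub[OF UV] in auto)

lemma AN_rules: "AN f ==> AN g ==> AN (%p. f p + g p)" "AN f ==> AN g ==> AN (%p. f p - g p)"
 "AN f ==> AN g ==> AN (%p. f p * g p)" "AN (%p. k)" "AN f ==> AN (%p. cnj (f p))"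
 "AN (%p. a (phi p))" "AN (%p. al (phi p))" "AN (%p. be (phi p))"
proof -
 have "AN (%p. k (phi p))" if "regA k Om" for k unfolding AN_def by (rule reg_cong[OF op _ that]) (use im_sub[OF UV] in auto)
 thus "AN (%p. a (phi p))" "AN (%p. al (phi p))" "AN (%p. be (phi p))" using reg_str by blast+
qed (auto simp: AN_def intro: reg_add reg_diff reg_mult reg_cnj op)

lemma AN_minus: "AN f ==> AN (%p. - f p)" using AN_rules(3)[OF AN_rules(4)[of "- 1"], of f] by simp

lemma AN_deriv: "AN f ==> AN (%p. T p f)" "AN f ==> AN (%p. Z p f)" "AN f ==> AN (%p. W p f)"
 unfolding AN_def by (rule vfc_apply(2)[OF U]; use vA in blast)+

lemma AN_tw_deriv:
 assumes "AN f" shows "AN (tw_deriv M tht Z U m n Z f)" "AN (tw_deriv M tht Z U m n W f)" "AN (tw_deriv M tht Z U m 0 T f)"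
proof -
 have "AN (%p. Z p f - (of_nat m * cnj (a (phi p)) + of_nat n * - cnj (a (phi p))) * f p)"
 "AN (%p. W p f - (of_nat m * - a (phi p) + of_nat n * a (phi p)) * f p)"
 "AN (%p. T p f - (of_nat m * al (phi p)) * f p)" by (intro AN_rules AN_minus AN_deriv assms)+
 note d = this
 show "AN (tw_deriv M tht Z U m n Z f)" "AN (tw_deriv M tht Z U m n W f)" "AN (tw_deriv M tht Z U m 0 T f)"
 by (rule AN_cong[OF d(1)], simp add: tw_deriv_def TW, rule AN_cong[OF d(2)], simp add: tw_deriv_def TW,
 rule AN_cong[OF d(3)], simp add: tw_deriv_def TW)
qed

text \<open>All ingredients are polynomials in the structure functions and their derivatives along
  the frame. The definition provides a merely smooth connection form, so its values on the frame are
  replaced by \<open>al\<close> and \<open>a\<close> before differentiating.\<close>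

lemma AN_obstruction: "AN (obstruction M tht Z U)"
proof -
 have S: "AN (tw_scal M tht Z U)"
 proof (rule AN_cong)
 show "AN (%p. Z p (%p. - a (phi p)) - W p (%p. cnj (a (phi p))) - (- \<i> * al (phi p) + a (phi p) * cnj (a (phi p)) - cnj (a (phi p)) * - a (phi p)))"
 by (intro AN_rules AN_minus AN_deriv)
 fix p assume p: "p : U"
 obtain ta where tw: "tanaka_webster M tht Z U TW ta" using TW_ex by blast
 have o: "ofc Smooth U TW" using tw ofc_D UV unfolding tanaka_webster_def by blast
 have l: "lin TW U" using o by (simp add: ofc_def)
 have c: "X p f = X p g" if "vfc Smooth U X" "!!q. q : U ==> f q = g q" "regS (%x. f (psi x)) Om" for X f g
 proof -
 have x: "phi p : Om" "psi (phi p) = p" using p UV' by auto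
 have g: "regS (%x. g (psi x)) Om" by (rule reg_cong[OF op _ that(3)]) (use that(2) im_sub[OF UV] in auto)
 have "pdv b (%x. f (psi x)) (phi p) = pdv b (%x. g (psi x)) (phi p)" for b by (rule pdv_cong[OF op x(1)]) (use that(2) im_sub[OF UV] in auto)
 thus ?thesis using vfc_apply(1)[OF U that(1) that(3) x(1)] vfc_apply(1)[OF U that(1) g x(1)] x(2) by (simp add: Vf_def)
 qed
 have "Z p (%q. TW q (W q)) = Z p (%p. - a (phi p))" by (rule c[OF vS(2) _ ofc_reg[OF U o vS(3)]]) (simp add: TW)
 moreover have "W p (%q. TW q (Z q)) = W p (%p. cnj (a (phi p)))" by (rule c[OF vS(3) _ ofc_reg[OF U o vS(2)]]) (simp add: TW)
 ultimately show "Z p (%p. - a (phi p)) - W p (%p. cnj (a (phi p))) - (- \<i> * al (phi p) + a (phi p) * cnj (a (phi p)) - cnj (a (phi p)) * - a (phi p)) = tw_scal M tht Z U p"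
 using p by (simp add: tw_scal_def levi1 ext_d_def ext_d_vec[OF l vS(2,3) p] lin_br[OF p l] TW)
 qed
 have A: "AN (tw_torsion M tht Z U)" by (rule AN_cong[OF AN_minus[OF AN_rules(8)]]) (simp add: TW)
 have Q: "AN (cartan_tensor M tht Z U)"
 proof (rule AN_cong)
 show "AN (%p. 1/6 * tw_deriv M tht Z U 1 0 Z (tw_deriv M tht Z U 0 0 Z (tw_scal M tht Z U)) p + \<i>/2 * tw_scal M tht Z U p * tw_torsion M tht Z U p
 - tw_deriv M tht Z U 2 0 T (tw_torsion M tht Z U) p - 2 * \<i> / 3 * tw_deriv M tht Z U 2 1 Z (tw_deriv M tht Z U 2 0 W (tw_torsion M tht Z U)) p)"
 by (intro AN_rules AN_tw_deriv S A)
 qed (simp add: cartan_tensor_def Let_def levi1)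
 show ?thesis
 proof (rule AN_cong)
 show "AN (%p. tw_deriv M tht Z U 2 1 W (tw_deriv M tht Z U 2 0 W (cartan_tensor M tht Z U)) p
 - \<i> * cnj (tw_torsion M tht Z U p) * cartan_tensor M tht Z U p)" by (intro AN_rules AN_tw_deriv Q A)
 qed (simp add: obstruction_def Let_def levi1)
qed

end

section \<open>The Levi-Civita connection in a theta frame\<close>

definition kz :: "complex i3 => complex i3 => complex i2 =>
 complex i3" where
 "kz D C G I J L = 1/2 * (D I J L + D J I L - D L I J
 + (SUM M:UNIV. C I J M * G M L - C J L M * G M I - C I L M * G M J))"

lemma sum_delta_idx: "(SUM K:UNIV. f K * (if K = L then 1 else 0)) = (f (L::idx) :: complex)"
 "(SUM K:UNIV. f K * (if L = K then 1 else 0)) = (f (L::idx) :: complex)" by (simp_all add: if_distrib cong: if_cong)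

text \<open>Stated as an equivalence, it shows both that a connection exists and that the choice in
  \<open>LC\<close> is determined.\<close>

lemma koszul:
 fixes \<Gamma> :: "complex i3"
 assumes G: "!!I J. G I J = G J I" and GH: "!!I K. (SUM J:UNIV. G I J * H J K) = (if I = K then 1 else 0)"
 and HG: "!!I K. (SUM J:UNIV. H I J * G J K) = (if I = K then 1 else 0)"
 and C: "!!I J K. C I J K = - C J I K" and D: "!!I J K. D K I J = D K J I"
 shows "(ALL I J K. \<Gamma> I J K - \<Gamma> J I K = C I J K) & (ALL I J K. D K I J = (SUM L:UNIV. \<Gamma> K I L * G L J + \<Gamma> K J L * G I L)) \<longleftrightarrow>
 (ALL I J K. \<Gamma> I J K = (SUM L:UNIV. kz D C G I J L * H L K))"
proof -
 define c where "c I J L = (SUM M:UNIV. C I J M * G M L)" for I J L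
 have kz: "kz D C G I J L = 1/2 * (D I J L + D J I L - D L I J + (c I J L - c J L I - c I L J))" for I J L by (simp add: kz_def c_def sum_subtractf)
 have c_anti: "c I J L = - c J I L" for I J L unfolding c_def by (subst C) (simp add: sum_negf)
 have inv: "(SUM L:UNIV. (SUM K:UNIV. f K * G K L) * H L K') = f K'" "(SUM L:UNIV. (SUM K:UNIV. f K * H K L) * G L K') = f K'" for f K'
 proof -
 have "(SUM L:UNIV. (SUM K:UNIV. f K * A K L) * B L K') = f K'"
 if "!!I K. (SUM J:UNIV. A I J * B J K) = (if I = K then 1 else 0)" for A B :: "complex i2"
 proof -
 have "(SUM L:UNIV. (SUM K:UNIV. f K * A K L) * B L K') = (SUM K:UNIV. f K * (SUM L:UNIV. A K L * B L K'))"
 unfolding sum_distrib_left sum_distrib_right by (subst sum.swap) (simp add: mult.assoc)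
 thus ?thesis by (simp add: that sum_delta_idx)
 qed
 thus "(SUM L:UNIV. (SUM K:UNIV. f K * G K L) * H L K') = f K'" "(SUM L:UNIV. (SUM K:UNIV. f K * H K L) * G L K') = f K'"
 using GH HG by blast+
 qed
 define B where "B I J L = (SUM K:UNIV. \<Gamma> I J K * G K L)" for I J L
 have DB: "(SUM L:UNIV. \<Gamma> K I L * G L J + \<Gamma> K J L * G I L) = B K I J + B K J I" for I J K
 unfolding B_def by (simp add: sum.distrib G[of I])
 show ?thesis
 proof (intro iffI conjI allI; (elim conjE)?)
 fix I J K
 assume t: "ALL I J K. \<Gamma> I J K - \<Gamma> J I K = C I J K" and m: "ALL I J K. D K I J = (SUM L:UNIV. \<Gamma> K I L * G L J + \<Gamma> K J L * G I L)"
 have cB: "c I J L = B I J L - B J I L" for I J L unfolding c_def B_def using t by (simp add: sum_subtractf[symmetric] left_diff_distrib[symmetric])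
 have "kz D C G I J L = B I J L" for L unfolding kz m[rule_format, unfolded DB] cB by simp
 thus "\<Gamma> I J K = (SUM L:UNIV. kz D C G I J L * H L K)" using inv(1)[of "\<Gamma> I J" K] by (simp add: B_def)
 next
 fix I J K
 assume g: "ALL I J K. \<Gamma> I J K = (SUM L:UNIV. kz D C G I J L * H L K)"
 have B: "B I J L = kz D C G I J L" for I J L unfolding B_def using g inv(2)[of "kz D C G I J" L] by simp
 show "D K I J = (SUM L:UNIV. \<Gamma> K I L * G L J + \<Gamma> K J L * G I L)"
 unfolding DB B kz using D[of K I J] D[of I K J] D[of J K I] c_anti[of I J K] c_anti[of K J I] c_anti[of K I J]
 c_anti[of J I K] by (simp add: field_simps)
 have "kz D C G I J L - kz D C G J I L = c I J L" for L unfolding kz using D[of L I J] c_anti[of I J L] by (simp add: field_simps)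
 hence "(SUM L:UNIV. kz D C G I J L * H L K) - (SUM L:UNIV. kz D C G J I L * H L K) = (SUM L:UNIV. c I J L * H L K)"
 by (simp add: sum_subtractf[symmetric] left_diff_distrib[symmetric])
 thus "\<Gamma> I J K - \<Gamma> J I K = C I J K" using g inv(1)[of "C I J" K] by (simp add: c_def)
 qed
qed

text \<open>The extension across the boundary may be given in another chart and is transported by
  the smooth transition map.\<close>

lemma (in chart) bfun_chart:
 assumes F: "regular_bfun Smooth M F N" and p: "(p, r) : N" "p : V"
 obtains S G where "open S" "(phi p, r) : S" "!!x r. (x, r) : S ==> x : phi ` V" "regS G S"
 "!!x r. (x, r) : S ==> (psi x, r) : N ==> F (psi x, r) = G (x, r)"
proof -
 obtain V' phi' W G where V': "(V', phi') : M" "p : V'" and W: "open W" "(phi' p, r) : W" "regS G W"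
 "!!q r. q : V' ==> (phi' q, r) : W ==> (q, r) : N ==> F (q, r) = G (phi' q, r)" using F p(1) unfolding regular_bfun_def by fast
 interpret c': chart M V' phi' using atlas V' by unfold_locales
 define S where "S = {(x, r). x : phi ` (V Int V') & (phi' (psi x), r) : W}"
 have oV: "open (phi ` (V Int V'))" using sub_open[of "V Int V'"] V_open c'.V_open by auto
 have tr: "regS (%x. of_real (phi' (psi x) $ i)) (phi ` (V Int V'))" for i by (rule reg_smooth[OF oV atlasD(4)[OF V'(1)]])
 have cont: "continuous_on (phi ` (V Int V')) (%x. phi' (psi x))"
 by (rule continuous_on_compose2[OF c'.phi_cont continuous_on_subset[OF psi_cont]]) auto
 have "continuous_on (phi ` (V Int V') \<times> UNIV) (%y. (phi' (psi (fst y)), snd y))"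
 by (intro continuous_intros continuous_on_compose2[OF cont]) auto
 note continuous_open_preimage[OF this open_Times[OF oV open_UNIV] W(1)]
 moreover have "(phi ` (V Int V') \<times> UNIV) Int (%y. (phi' (psi (fst y)), snd y)) -` W = S" by (auto simp: S_def)
 ultimately have oS: "open S" by simp
 show ?thesis
 proof (rule that[OF oS])
 show "regS (%y. G (phi' (psi (fst y)), snd y)) S"
 proof (rule sm_comp[OF oS W(1) _ W(3)])
 fix b :: "r3 \<times> real" assume "b : Basis"
 then consider i where "b = (axis i 1, 0)" | "b = (0, 1)" by (auto simp: Basis_prod_def elim!: BasisE3)
 thus "regS (%y. of_real ((phi' (psi (fst y)), snd y) \<bullet> b)) S"
 proof cases
 case 1
 have "regS (%y. of_real (phi' (psi (fst y)) $ i)) S"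
 proof (rule sm_comp[OF oS oV _ tr])
 fix b :: "r3" assume b: "b : Basis"
 show "regS (%y. of_real (fst y \<bullet> b)) S" using reg_coord[OF oS Basis_dx[OF b], of Smooth] by (simp add: inner_prod_def)
 qed (auto simp: S_def)
 thus ?thesis by (simp add: 1 cart_eq_inner_axis)
 qed (simp add: snd_smooth[OF oS])
 qed (auto simp: S_def)
 qed (use W V' p in "auto simp: S_def")
qed

context frame
begin

definition zz :: "idx => r3 => r3 => complex" where
 "zz I b x = (case I of Xinf => 0 | X0 => zc T b x | X1 => zc Z b x | X1bar => zc W b x)"

text \<open>The Theta-frame acting on functions in the chart. It also applies to extensions across
  \<open>rho = 0\<close>, where Taylor coefficients are taken.\<close>

definition eo :: "idx => (r3 \<times> real => complex) => r3 \<times> real => complex" where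
 "eo I F y = (if I = Xinf then of_real (snd y) * dr F y
 else of_real (snd y) ^ wt I * (SUM b:Basis. zz I b (fst y) * pdv (b, 0) F y))"

lemma zz_an: "I ~= Xinf ==> b : Basis ==> regA (zz I b) Om" using vA by (cases I) (auto simp: zz_def[abs_def] intro: vfc_reg)

definition dom :: "(r3 \<times> real) set => bool" where
 "dom S \<longleftrightarrow> open S & (ALL y:S. fst y : Om)"

lemma domD: "dom S ==> open S" "dom S ==> y : S ==> fst y : Om" by (auto simp: dom_def)

lemma reg_fst:
 assumes S: "dom S" and f: "regular_on k f Om" shows "regS (%y. f (fst y)) S"
proof (rule sm_comp[OF domD(1)[OF S] op domD(2)[OF S] reg_smooth[OF op f]])
 fix b :: "r3" assume b: "b : Basis"
 show "regS (%y. of_real (fst y \<bullet> b)) S" using reg_coord[OF domD(1)[OF S] Basis_dx[OF b], of Smooth] by (simp add: inner_prod_def)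
qed

lemma zz_fst: "dom S ==> I ~= Xinf ==> b : Basis ==> regS (%y. zz I b (fst y)) S" using reg_fst zz_an by blast

lemma reg_eo: "dom S ==> regS F S ==> regS (eo I F) S" unfolding eo_def
 by (cases "I = Xinf") (auto intro!: reg_mult reg_sum reg_power snd_smooth reg_pdv Basis_dr Basis_dx zz_fst dest: domD)

definition sl :: "(r3 \<times> real) set => real => r3 set" where
 "sl S r = {x. (x, r) : S}"

lemma sl_open: "open S ==> open (sl S r)"
proof -
 have "sl S r = (%x. (x, r)) -` S" by (auto simp: sl_def)
 moreover assume "open S"
 ultimately show ?thesis by (auto intro!: continuous_intros)
qed

lemma sl_smooth: "open S ==> regS F S ==> regS (%x. F (x, r)) (sl S r)" by (rule slice_smooth[OF _ _ sl_open]) (auto simp: sl_def)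

lemma eo_Vf:
 assumes S: "open S" "(x, r) : S" and F: "regS F S" and I: "I ~= Xinf"
 shows "eo I F (x, r) = of_real r ^ wt I * Vf (zz I) (%x. F (x, r)) x"
 unfolding eo_def Vf_def using I slice(1)[OF S reg_differentiable[OF S(1) F S(2)]] by simp

lemma frame_deriv_eo:
 assumes S: "dom S" "(x, r) : S" and F: "!!x r. (x, r) : S ==> F (psi x, r) = G (x, r)" and G: "regS G S"
 shows "fdr I F (psi x, r) = eo I G (x, r)"
proof -
 note oS = domD(1)[OF S(1)]
 define U' where "U' = {q : U. phi q : sl S r}"
 have slO: "sl S r <= Om" using domD(2)[OF S(1)] by (auto simp: sl_def)
 have im: "phi ` U' = sl S r" using slO unfolding U'_def by blast
 have "U' = U Int {q : V. phi q : sl S r}" using UV by (auto simp: U'_def)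
 hence U': "open U'" "U' <= V" "phi ` U' = sl S r" using pre_open[OF sl_open[OF oS]] U im by auto
 have xs: "x : phi ` U'" using S by (auto simp: U' sl_def)
 hence xU: "psi x : U" using im_sub[OF UV] slO U' by auto
 have r: "regS (%x. F (psi x, r)) (phi ` U')"
 by (rule reg_cong[OF sub_open[OF U'(1,2)] _ sl_smooth[OF oS G, of r, folded U'(3)]]) (use F in "auto simp: U' sl_def")
 have c: "Vf z (%x. F (psi x, r)) x = Vf z (%x. G (x, r)) x" for z :: "r3 => r3 => complex"
 unfolding Vf_def using pdv_cong[OF sl_open[OF oS], of x r "%x. F (psi x, r)" "%x. G (x, r)"] F S(2) by (auto simp: sl_def)
 have X: "X (psi x) (%q. F (q, r)) = Vf (zc X) (%x. G (x, r)) x" if "X (psi x) : CT (psi x)" for X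
 using tangent_apply[where f = "%q. F (q, r)" and X = X and x = x, OF U'(1,2) xs that r] c by simp
 show ?thesis
 proof (cases "I = Xinf")
 case True
 have "(%s. (x, s)) -` S = {s. (x, s) : S}" by auto
 moreover have "open ((%s. (x, s)) -` S)" by (intro oS continuous_intros)
 ultimately have o: "open {s. (x, s) : S}" by simp
 have "((%s. F (psi x, s)) has_vector_derivative dr G (x, r)) (at r)"
 by (rule has_vector_derivative_transform_within_open[OF slice(2)[OF oS S(2) reg_differentiable[OF oS G S(2)] axis_Basis] o])
 (use S F in auto)
 thus ?thesis by (simp add: True eo_def vector_derivative_at)
 next
 case False
 show ?thesis unfolding eo_Vf[OF oS S(2) G False]
 using False X[of T, OF t_ct(1)[OF xU]] X[of Z, OF t_ct(2)[OF xU]] X[of W, OF t_ct(3)[OF xU]] by (cases I) (auto simp: zz_def[abs_def])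
 qed
qed

text \<open>The terms of the brackets beyond the constant \<open>C0\<close>: the bracket of
  \<open>rho * Z\<close> with its conjugate leaves one surplus power of \<open>rho\<close>, that of
  \<open>rho^2 * T\<close> with \<open>rho * Z\<close> or its conjugate leaves two.\<close>

definition Ch :: "idx => idx => idx => nat => r3 => complex" where
 "Ch I J K n x = (if (I, J, K, n) = (X1, X1bar, X1, 1) then a x else if (I, J, K, n) = (X1, X1bar, X1bar, 1) then - cnj (a x)
 else if (I, J, K, n) = (X0, X1, X1, 2) then al x else if (I, J, K, n) = (X0, X1, X1bar, 2) then be x
 else if (I, J, K, n) = (X0, X1bar, X1, 2) then cnj (be x) else if (I, J, K, n) = (X0, X1bar, X1bar, 2) then cnj (al x) else 0)"

definition Cs :: "idx => idx => idx => nat => r3 => complex" where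
 "Cs I J K n x = (if n = 0 then C0 I J K else Ch I J K n x - Ch J I K n x)"

definition CF :: "idx => idx => idx => r3 \<times> real => complex" where
 "CF I J K y = Cs I J K 0 (fst y) + of_real (snd y) * Cs I J K 1 (fst y) + of_real (snd y) * (of_real (snd y) * Cs I J K 2 (fst y))"

lemma C0_anti: "C0 I J K = - C0 J I K" by (cases I; cases J; cases K; simp)

lemma CF_anti: "CF I J K y = - CF J I K y" unfolding CF_def Cs_def by (subst C0_anti) (simp add: algebra_simps)

lemma reg_if: "regular_on k f S ==> regular_on k g S ==> regular_on k (%x. if P then f x else g x) S" by (cases P) auto

lemma Cs_an: "regA (Cs I J K n) Om"
proof -
 have "regA (Ch I J K n) Om" for I J unfolding Ch_def[abs_def] by (intro reg_if reg_minus reg_cnj reg_str reg_const op)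
 thus ?thesis unfolding Cs_def[abs_def] by (cases "n = 0") (auto intro!: reg_diff op)
qed

lemma eo_mono:
 assumes g: "g differentiable (at x)"
 shows "eo I (%y. of_real (snd y) ^ n * g (fst y)) (x, r) =
 (if I = Xinf then of_nat n * of_real r ^ n * g x else of_real r ^ wt I * (of_real r ^ n * Vf (zz I) g x))"
proof -
 have "((%y. g (fst y)) has_derivative (%h. pdv (fst h) g x)) (at (x, r))"
 using has_derivative_compose[OF has_derivative_fst[OF has_derivative_ident], of g "%h. pdv h g x" "(x, r)"] differentiable_D[OF g] by simp
 hence d: "((%y. of_real (snd y) ^ n * g (fst y)) has_derivative
 (%h. of_real r ^ n * pdv (fst h) g x + of_nat n * (of_real (snd h) * of_real r ^ (n - 1)) * g x)) (at (x, r))"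
 by (auto intro!: derivative_eq_intros)
 have 0: "pdv 0 g x = 0" using differentiable_D_Basis[OF g, of 0] by simp
 show ?thesis unfolding eo_def pdvI[OF d] by (cases n) (simp_all add: 0 Vf_def sum_distrib_left mult_ac)
qed

text \<open>Both sides are first order operators, so it suffices to compare their coefficients;
  \<open>key\<close> does this for each coordinate, reducing to the brackets along the
  boundary.\<close>

lemma bracket:
 assumes S: "dom S" "y : S" and F: "regS F S"
 shows "eo I (eo J F) y - eo J (eo I F) y = (SUM K:UNIV. CF I J K y * eo K F y)"
proof -
 note oS = domD(1)[OF S(1)]
 obtain x r where y: "y = (x, r)" by (cases y)
 have x: "x : Om" using domD(2)[OF S] by (simp add: y)
 define E where "E I B y = (if I = Xinf then if B = (0, 1) then of_real (snd y) else 0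
 else if B = (0, 1) then 0 else of_real (snd y) ^ wt I * zz I (fst B) (fst y))" for I and B y :: "r3 \<times> real"
 have ev: "eo I F = Vf (E I) F" for I F
 proof -
 have "(SUM B:Basis. f B) = f (0, 1) + (SUM b:Basis. f (b, 0))" for f :: "r3 \<times> real => complex"
 unfolding Basis_prod_real by (subst sum.insert) (auto simp: sum.reindex inj_on_def)
 thus ?thesis by (auto simp: eo_def Vf_def E_def sum_distrib_left mult.assoc)
 qed
 have Er: "regS (E I B) S" if "B : Basis" for I B using that unfolding E_def[abs_def] Basis_prod_real
 by (cases "I = Xinf") (auto intro!: reg_mult reg_power snd_smooth zz_fst S oS)
 have key: "eo I (E J B) y - eo J (E I B) y = (SUM K:UNIV. CF I J K y * E K B y)" if Bb: "B : Basis" for I J B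
 proof (cases "B = (0, 1)")
 case True
 have "eo I (E J B) y = (if I = Xinf & J = Xinf then of_real r else 0)" for I J
 using eo_mono[of "%_. 1" x I 1 r] by (cases "J = Xinf") (simp_all add: E_def[abs_def] True y Vf_def, simp_all add: eo_def)
 thus ?thesis by (cases I; cases J) (simp_all add: sum_idx E_def True CF_def Cs_def Ch_def)
 next
 case False
 then obtain i where B: "B = (axis i 1, 0)" using Bb unfolding Basis_prod_real by (auto elim: BasisE3)
 have e: "eo I (E J B) y = (if J = Xinf then 0 else if I = Xinf then of_nat (wt J) * of_real r ^ wt J * zz J (axis i 1) x
 else of_real r ^ wt I * (of_real r ^ wt J * Vf (zz I) (zz J (axis i 1)) x))" for I J
 proof (cases "J = Xinf")
 case False
 have "zz J (axis i 1) differentiable (at x)" by (rule reg_differentiable[OF op zz_an[OF False] x]) simp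
 from eo_mono[OF this, of I "wt J" r] show ?thesis using False by (simp add: E_def[abs_def] B y)
 qed (simp add: E_def[abs_def] B eo_def)
 note b = br_eq[OF x, of i, unfolded br_def diff_eq_eq]
 show ?thesis unfolding e by (cases I; cases J)
 (simp_all add: b sum_idx E_def B CF_def Cs_def Ch_def y zz_def[abs_def] ci_def power2_eq_square algebra_simps)
 qed
 have "eo I (eo J F) y - eo J (eo I F) y = Vf (%B y. Vf (E I) (E J B) y - Vf (E J) (E I B) y) F y"
 unfolding ev by (rule Vf_commutator[OF oS S(2) Er Er F])
 also have "... = (SUM B:Basis. SUM K:UNIV. CF I J K y * E K B y * pdv B F y)"
 using key unfolding Vf_def[of "%B y. Vf (E I) (E J B) y - Vf (E J) (E I B) y"] ev by (simp add: sum_distrib_right)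
 also have "... = (SUM K:UNIV. CF I J K y * eo K F y)" unfolding ev Vf_def by (subst sum.swap) (simp add: sum_distrib_left mult.assoc)
 finally show ?thesis .
qed

end

text \<open>In normal form four components determine the metric; conjugates are inserted where the
  reality of a fibre metric forces them.\<close>

definition nf :: "complex => complex => complex => complex => complex i2" where
 "nf a b c d I J = (case I of Xinf => (if J = Xinf then 4 else 0)
 | X0 => (case J of Xinf => 0 | X0 => a | X1 => b | X1bar => cnj b)
 | X1 => (case J of Xinf => 0 | X0 => b | X1 => c | X1bar => d)
 | X1bar => (case J of Xinf => 0 | X0 => cnj b | X1 => d | X1bar => cnj c))"

lemma nf_sym: "nf a b c d I J = nf a b c d J I" by (cases I; cases J; simp add: nf_def)

lemma conj_lincomb: "conj_vec (lincomb a X b Y) = lincomb (cnj a) (conj_vec X) (cnj b) (conj_vec Y)"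
 "conj_vec (conj_vec X) = X" by (auto simp: conj_vec_def lincomb_def)

context frame
begin

lemma dom_Int: "dom S ==> open S' ==> dom (S Int S')" by (auto simp: dom_def)

lemma dom_UNIV: "dom (Om \<times> UNIV)" by (auto simp: dom_def intro: open_Times op)

lemma bfun_germ:
 assumes F: "regular_bfun Smooth M F N" and p: "(p, r) : N" "p : U"
 obtains S G where "dom S" "(phi p, r) : S" "regS G S"
 "!!x r. (x, r) : S ==> (psi x, r) : N ==> F (psi x, r) = G (x, r)"
proof -
 obtain S G where S: "open S" "(phi p, r) : S" "regS G S"
 "!!x r. (x, r) : S ==> (psi x, r) : N ==> F (psi x, r) = G (x, r)" using bfun_chart[OF F p(1) UV'[OF p(2)]] by metis
 show ?thesis by (rule that[of _ G, OF dom_Int[OF dom_UNIV S(1)]]) (use S p in "auto elim: reg_subset")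
qed

lemma open_germ:
 assumes F: "EX N. open N & (p, r) : N & regular_bfun Smooth M F N" and p: "p : U"
 obtains S G where "dom S" "(phi p, r) : S" "regS G S" "!!x r. (x, r) : S ==> F (psi x, r) = G (x, r)"
proof -
 obtain N where N: "open N" "(p, r) : N" "regular_bfun Smooth M F N" using F by blast
 obtain S G where S: "dom S" "(phi p, r) : S" "regS G S"
 "!!x r. (x, r) : S ==> (psi x, r) : N ==> F (psi x, r) = G (x, r)" using bfun_germ[OF N(3,2) p] by metis
 have "continuous_on (Om \<times> UNIV) (%y. (psi (fst y), snd y))" using UV by (intro continuous_intros continuous_on_compose2[OF psi_cont]) auto
 from continuous_open_preimage[OF this open_Times[OF op open_UNIV] N(1)]
 have "dom (S Int (Om \<times> UNIV Int (%y. (psi (fst y), snd y)) -` N))" by (rule dom_Int[OF S(1)])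
 thus ?thesis by (rule that[of _ G]) (use S N p UV' in "auto elim: reg_subset")
qed

text \<open>Torsion is tested on all functions, but the boundary variable and the coordinates of the
  chart already recover every coefficient, since \<open>r > 0\<close> and the frame is
  independent.\<close>

lemma fd_torsion:
 fixes ga :: "complex i3"
 assumes p: "p : U" and r: "r > 0"
 shows "(ALL I J F. (EX N. open N & (p, r) : N & regular_bfun Smooth M F N) -->
 (SUM K:UNIV. (ga I J K - ga J I K) * fdr K F (p, r)) =
 fdr I (fdr J F) (p, r) - fdr J (fdr I F) (p, r))
 \<longleftrightarrow> (ALL I J K. ga I J K - ga J I K = CF I J K (phi p, r))" (is "?L \<longleftrightarrow> ?R")
proof -
 let ?y = "(phi p, r)"
 have x: "phi p : Om" and psip: "psi (phi p) = p" using p UV' by auto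
 define de where "de I J K = ga I J K - ga J I K - CF I J K ?y" for I J K
 have eqv: "(SUM K:UNIV. (ga I J K - ga J I K) * fdr K F (p, r)) =
 fdr I (fdr J F) (p, r) - fdr J (fdr I F) (p, r) \<longleftrightarrow>
 (SUM K:UNIV. de I J K * eo K G ?y) = 0"
 if S: "dom S" "?y : S" "regS G S" "!!x r. (x, r) : S ==> F (psi x, r) = G (x, r)" for I J F G S
 proof -
 have fd: "fdr I F (p, r) = eo I G ?y"
 "fdr I (fdr J F) (p, r) = eo I (eo J G) ?y" for I J
 using frame_deriv_eo[OF S(1,2,4,3)] frame_deriv_eo[OF S(1,2) frame_deriv_eo[OF S(1) _ S(4,3)] reg_eo[OF S(1,3)], of I J] by (simp_all add: psip)
 show ?thesis unfolding fd bracket[OF S(1-3)] by (simp add: de_def left_diff_distrib sum_subtractf)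
 qed
 show ?thesis
 proof
 assume ?R
 hence "de I J K = 0" for I J K by (simp add: de_def)
 thus ?L by (intro allI impI, elim open_germ[OF _ p]) (simp add: eqv)
 next
 assume L: ?L
 have z: "(SUM K:UNIV. de I J K * eo K G ?y) = 0" if G: "regS G (Om \<times> UNIV)" for I J G
 proof -
 define F where "F = (%y. G (phi (fst y), snd y))"
 have "regular_bfun Smooth M F (U \<times> UNIV)" unfolding regular_bfun_def
 using chart UV' op G by (auto intro!: bexI[of _ "(V, phi)"] exI[of _ "Om \<times> UNIV"] exI[of _ G] open_Times simp: F_def)
 hence "EX N. open N & (p, r) : N & regular_bfun Smooth M F N"
 using p U by (intro exI[of _ "U \<times> UNIV"]) (auto intro: open_Times)
 from L[rule_format, OF this] show ?thesis by (subst (asm) eqv[OF dom_UNIV _ G]) (use x UV' in "auto simp: F_def")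
 qed
 have o2: "open (Om \<times> (UNIV :: real set))" by (intro open_Times op open_UNIV)
 have d: "((%y. complex_of_real (snd y)) has_derivative (%h. of_real (snd h))) (at y)"
 "((%y. complex_of_real (fst y $ i)) has_derivative (%h. of_real (fst h $ i))) (at y)" for y :: "r3 \<times> real" and i
 by (auto intro!: derivative_eq_intros simp: cart_eq_inner_axis)
 have dinf: "de I J Xinf = 0" for I J using z[OF snd_smooth[OF o2], of I J] r by (simp add: sum_idx eo_def pdvI[OF d(1)])
 have h: "regS (%y. of_real (fst y $ i)) (Om \<times> (UNIV :: real set))" for i
 using reg_coord[OF o2 Basis_dx[OF axis_Basis], of Smooth i] by (simp add: inner_prod_def cart_eq_inner_axis)
 have e: "eo K (%y. of_real (fst y $ i)) ?y = (if K = Xinf then 0 else of_real r ^ wt K * zz K (axis i 1) (phi p))" for K i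
 by (simp add: eo_def pdvI[OF d(2)] sum_axis) (simp add: axis_def if_distrib cong: if_cong)
 have v: "(%i. de I J X0 * of_real r ^ 2 * t (phi p) i + de I J X1 * of_real r * z (phi p) i + de I J X1bar * of_real r * w (phi p) i) = (%i. 0)" for I J
 using z[OF h] by (simp add: sum_idx e zz_def ci_def mult_ac fun_eq_iff)
 have c: "c1 (phi p) (%i. k * t (phi p) i + m * z (phi p) i + n * w (phi p) i) = m"
 "cb (phi p) (%i. k * t (phi p) i + m * z (phi p) i + n * w (phi p) i) = n" for k m n using x by (simp_all add: c_add)
 have "dt (th (phi p)) (%i. 0) = 0" "c1 (phi p) (%i. 0) = 0" "cb (phi p) (%i. 0) = 0" by (simp_all add: dt_def c1_def cb_def)
 hence "de I J K = 0" for I J K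
 using v[THEN arg_cong, of "dt (th (phi p))" I J] v[THEN arg_cong, of "c1 (phi p)" I J] v[THEN arg_cong, of "cb (phi p)" I J] r dinf
 unfolding dt_lin3 c th_t[OF x] th_z[OF x] th_w[OF x] by (cases K) auto
 thus ?R by (simp add: de_def)
 qed
qed

definition cmp :: "'a => 'a tvec => idx => complex" where
 "cmp p u I = (case I of Xinf => fst u | X0 => c0p p (snd u) | X1 => c1p p (snd u) | X1bar => cbp p (snd u))"

definition vc :: "'a => (idx => complex) => 'a tvec" where
 "vc p v = (v Xinf, lincomb 1 (lincomb (v X0) (T p) (v X1) (Z p)) (v X1bar) (W p))"

lemma vc_fiber: "p : U ==> vc p v : TF p" unfolding vc_def theta_fiber_def using t_ct by (auto intro!: lincomb_tangent UV')

lemma cmp_vc: "p : U ==> cmp p (vc p v) I = v I" by (cases I) (simp_all add: cmp_def vc_def cp_lincomb)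

lemma vc_cmp: "p : U ==> u : TF p ==> vc p (cmp p u) = u"
 using cp_decomp[of p "snd u"] by (cases u) (auto simp: vc_def cmp_def theta_fiber_def lincomb_def)

lemma T_real: "p : U ==> conj_vec (T p) = T p" using Tv_real[of p] by (simp add: T_Tv UV' rtangent_def)

lemma vc_real:
 assumes p: "p : U" and v: "v Xinf : \<real>" "v X0 : \<real>" "v X1bar = cnj (v X1)"
 shows "vc p v : real_theta_fiber M p"
proof -
 have "conj_vec (snd (vc p v)) = snd (vc p v)"
 proof -
 have "conj_vec (snd (vc p v)) = lincomb 1 (lincomb (v X0) (T p) (cnj (v X1)) (W p)) (v X1) (Z p)"
 using v by (simp add: vc_def conj_lincomb T_real[OF p] Reals_cnj_iff)
 thus ?thesis by (auto simp: vc_def v(3) lincomb_def)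
 qed
 thus ?thesis using vc_fiber[OF p, of v] v by (auto simp: real_theta_fiber_def rtangent_def theta_fiber_def vc_def)
qed

lemma real_cmp: "p : U ==> u : real_theta_fiber M p ==>
 u : TF p & cmp p u Xinf : \<real> & cmp p u X0 : \<real> & cmp p u X1bar = cnj (cmp p u X1)"
 using cp_conj[of p "snd u"] by (auto simp: real_theta_fiber_def rtangent_def theta_fiber_def cmp_def Reals_cnj_iff)

lemma frame_vc: "p : U ==> theta_frame M tht Z I p = vc p (%J. if J = I then 1 else 0)" by (cases I) (auto simp: vc_def lincomb_def zero_vec_def)

end

locale sol = frame +
 fixes lam g assumes sol: "formal_solution M H Jc tht lam g"
begin

abbreviation "gc \<equiv> gcomp M tht Z g"

lemmas tm = conjunct1[OF sol[unfolded formal_solution_def]]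
lemmas nform = conjunct1[OF conjunct2[OF sol[unfolded formal_solution_def]], unfolded normal_form_ACH_def, rule_format, OF adm]
lemmas fsol = conjunct2[OF conjunct2[OF sol[unfolded formal_solution_def]], rule_format, OF adm]

lemma g_rules: assumes "r >= 0" shows "u : TF p ==> v : TF p ==> g (p, r) u v = g (p, r) v u"
 "u : TF p ==> v : TF p ==> w' : TF p ==> g (p, r) (tlincomb k u m v) w' = k * g (p, r) u w' + m * g (p, r) v w'"
 "u : real_theta_fiber M p ==> v : real_theta_fiber M p ==> g (p, r) u v : \<real>"
 "u : real_theta_fiber M p ==> u ~= (0, zero_vec) ==> Re (g (p, r) u u) > 0" using tm assms unfolding theta_metric_def by fastforce+

lemma g_expand:
 assumes p: "p : U" and r: "r >= 0" and u: "u : TF p" "v : TF p"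
 shows "g (p, r) u v = (SUM I:UNIV. SUM J:UNIV. cmp p u I * cmp p v J * gc I J (p, r))"
proof -
 let ?E = "%I. theta_frame M tht Z I p"
 have E: "?E I : TF p" for I unfolding frame_vc[OF p] by (rule vc_fiber[OF p])
 have tl: "tlincomb a u b v : TF p" if "u : TF p" "v : TF p" for a b u v
 using that lincomb_tangent[OF UV'[OF p]] by (auto simp: tlincomb_def theta_fiber_def)
 have l: "g (p, r) u v = (SUM I:UNIV. cmp p u I * g (p, r) (?E I) v)" if uv: "u : TF p" "v : TF p" for u v
 proof -
 have "u = tlincomb 1 (tlincomb (cmp p u Xinf) (?E Xinf) (cmp p u X0) (?E X0)) 1 (tlincomb (cmp p u X1) (?E X1) (cmp p u X1bar) (?E X1bar))"
 by (subst vc_cmp[OF p uv(1), symmetric]) (auto simp: vc_def tlincomb_def lincomb_def zero_vec_def)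
 hence "g (p, r) u v = g (p, r) (tlincomb 1 (tlincomb (cmp p u Xinf) (?E Xinf) (cmp p u X0) (?E X0)) 1 (tlincomb (cmp p u X1) (?E X1) (cmp p u X1bar) (?E X1bar))) v"
 by simp
 thus ?thesis by (simp only: g_rules(2)[OF r] tl E uv sum_idx) (simp only: mult_1 add.assoc)
 qed
 have "g (p, r) (?E I) v = (SUM J:UNIV. cmp p v J * gc I J (p, r))" for I
 using g_rules(1)[OF r E u(2)] l[OF u(2) E] g_rules(1)[OF r E E] by (simp add: gcomp_def)
 thus ?thesis unfolding l[OF u] by (simp add: sum_distrib_left mult.assoc)
qed

lemma gc_sym: "p : U ==> r >= 0 ==> gc I J (p, r) = gc J I (p, r)" unfolding gcomp_def by (rule g_rules(1)) (auto simp: frame_vc intro: vc_fiber)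

lemma gc_vc: "p : U ==> r >= 0 ==> g (p, r) (vc p v) (vc p v') = (SUM I:UNIV. SUM J:UNIV. v I * v' J * gc I J (p, r))"
 by (simp add: g_expand vc_fiber cmp_vc)

lemma gc_nf:
 assumes p: "p : U" and r: "r >= 0"
 shows "gc I J (p, r) = nf (of_real (Re (gc X0 X0 (p, r)))) (gc X0 X1 (p, r)) (gc X1 X1 (p, r)) (of_real (Re (gc X1 X1bar (p, r)))) I J"
proof -
 \<comment> \<open>The real vectors \<open>Z + conj Z\<close> and \<open>i (Z - conj Z)\<close> in
   components; evaluating the metric on them yields the reality relations.\<close>
 let ?a = "%J::idx. if J = X1 then 1 else if J = X1bar then 1 else 0 :: complex"
 let ?b = "%J::idx. if J = X1 then \<i> else if J = X1bar then - \<i> else 0 :: complex"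
 let ?e = "%I J::idx. if J = I then 1 else 0 :: complex"
 have R: "vc p ?a : real_theta_fiber M p" "vc p ?b : real_theta_fiber M p"
 "vc p (?e Xinf) : real_theta_fiber M p" "vc p (?e X0) : real_theta_fiber M p" by (rule vc_real[OF p]; simp)+
 have n: "gc Xinf Xinf (p, r) = 4" "gc Xinf X0 (p, r) = 0" "gc Xinf X1 (p, r) = 0" using nform p r by auto
 note s = gc_sym[OF p r]
 have b: "gc I X1bar (p, r) = cnj (gc I X1 (p, r))" if "I = Xinf \<or> I = X0" for I
 using that g_rules(3)[OF r R(3,1)] g_rules(3)[OF r R(3,2)] g_rules(3)[OF r R(4,1)] g_rules(3)[OF r R(4,2)]
 unfolding gc_vc[OF p r] by (auto simp: sum_idx complex_eq_iff complex_is_Real_iff)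
 have a: "gc X0 X0 (p, r) = of_real (Re (gc X0 X0 (p, r)))"
 using g_rules(3)[OF r R(4,4)] unfolding gc_vc[OF p r] by (auto simp: sum_idx)
 have c: "gc X1 X1bar (p, r) = of_real (Re (gc X1 X1bar (p, r)))" "gc X1bar X1bar (p, r) = cnj (gc X1 X1 (p, r))"
 using g_rules(3)[OF r R(1,1)] g_rules(3)[OF r R(1,2)] g_rules(3)[OF r R(2,2)] s[of X1bar X1]
 unfolding gc_vc[OF p r] by (auto simp: sum_idx complex_eq_iff complex_is_Real_iff)
 show ?thesis
 by (cases I; cases J) (simp_all add: nf_def n a[symmetric] c(1)[symmetric] c(2) b s[of X0 Xinf] s[of X1 Xinf] s[of X1bar Xinf] s[of X1 X0] s[of X1bar X0] s[of X1bar X1])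
qed

text \<open>Positivity is available for real vectors. A complex kernel vector is split into two real
  ones with the help of \<open>bar\<close>, which exchanges \<open>X1\<close> and
  \<open>X1bar\<close> and conjugates the matrix.\<close>

lemma gmat_invertible:
 assumes p: "p : U" and r: "r >= 0" shows "invertible (gmat M tht Z g (p, r))"
proof -
 let ?G = "%I J. gc I J (p, r)"
 have k0: "v = (%_. 0)" if v: "v Xinf : \<real>" "v X0 : \<real>" "v X1bar = cnj (v X1)" and k: "!!I. (SUM J:UNIV. ?G I J * v J) = 0" for v
 proof -
 have "g (p, r) (vc p v) (vc p v) = (SUM I:UNIV. v I * (SUM J:UNIV. ?G I J * v J))"
 unfolding gc_vc[OF p r] by (simp add: sum_distrib_left mult_ac)
 hence "g (p, r) (vc p v) (vc p v) = 0" by (simp add: k)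
 hence "vc p v = (0, zero_vec)" using g_rules(4)[OF r vc_real[OF p v]] by force
 also have "... = vc p (%_. 0)" by (auto simp: vc_def lincomb_def zero_vec_def)
 finally show ?thesis using cmp_vc[OF p] by metis
 qed
 have "v = 0" if "gmat M tht Z g (p, r) *v v = 0" for v
 proof -
 define bar where "bar I = (case I of X1 => X1bar | X1bar => X1 | _ => I)" for I
 have k: "(SUM J:UNIV. ?G I J * v $ J) = 0" for I using arg_cong[OF that, of "%v. v $ I"] by (simp add: matrix_vector_mult_def gmat_def)
 have Gb: "?G (bar I) (bar J) = cnj (?G I J)" for I J by (subst (1 2) gc_nf[OF p r]) (cases I; cases J; simp add: bar_def nf_def)
 have kb: "(SUM J:UNIV. ?G I J * cnj (v $ bar J)) = 0" for I
 using arg_cong[OF k[of "bar I"], of cnj] Gb[of "bar I" Xinf] Gb[of "bar I" X0] Gb[of "bar I" X1] Gb[of "bar I" X1bar] by (cases I) (simp_all add: sum_idx bar_def add_ac)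
 have "(%J. v $ J + cnj (v $ bar J)) = (%_. 0)" "(%J. \<i> * (v $ J - cnj (v $ bar J))) = (%_. 0)"
 using k kb by (intro k0; simp add: bar_def Reals_cnj_iff distrib_left right_diff_distrib sum.distrib sum_subtractf
 mult.left_commute[of _ \<i>] flip: sum_distrib_left)+
 hence "v $ J = 0" for J by (auto simp: fun_eq_iff complex_eq_iff)
 thus "v = 0" by (simp add: vec_eq_iff)
 qed
 thus ?thesis unfolding invertible_left_inverse matrix_left_invertible_ker by blast
qed

lemma matrix_inv_mult: "invertible A ==> A ** matrix_inv A = mat 1 & matrix_inv A ** A = mat 1"
 unfolding invertible_def matrix_inv_def by (rule someI_ex)

lemma gmat_inv: assumes p: "p : U" and r: "r >= 0"
 shows "(SUM J:UNIV. gc I J (p, r) * ginv M tht Z g J K (p, r)) = (if I = K then 1 else 0)"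
 "(SUM J:UNIV. ginv M tht Z g I J (p, r) * gc J K (p, r)) = (if I = K then 1 else 0)"
 using arg_cong[OF conjunct1[OF matrix_inv_mult[OF gmat_invertible[OF p r]]], of "%A. A $ I $ K"]
 arg_cong[OF conjunct2[OF matrix_inv_mult[OF gmat_invertible[OF p r]]], of "%A. A $ I $ K"]
 by (simp_all add: matrix_matrix_mult_def mat_def ginv_def gmat_def)

lemma gc_bfun: "regular_bfun Smooth M (gc I J) (UNIV \<times> {0..} Int U \<times> UNIV)" using tm adm unfolding theta_metric_def by blast

lemma fd_gc_sym: assumes p: "p : U" and r: "r > 0" shows "fdr K (gc I J) (p, r) = fdr K (gc J I) (p, r)"
proof -
 obtain S G where S: "dom S" "(phi p, r) : S" "regS G S"
 "!!x r. (x, r) : S ==> (psi x, r) : UNIV \<times> {0..} Int U \<times> UNIV ==> gc I J (psi x, r) = G (x, r)"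
 using bfun_germ[OF gc_bfun _ p, of r I J] p r by auto
 define S' where "S' = S Int UNIV \<times> {0<..}"
 have S': "dom S'" "(phi p, r) : S'" "regS G S'" using S r unfolding S'_def by (auto intro!: dom_Int open_Times elim: reg_subset)
 have "gc I J (psi x, s) = G (x, s)" "gc J I (psi x, s) = G (x, s)" if "(x, s) : S'" for x s
 using that S(4)[of x s] domD(2)[OF S(1), of "(x, s)"] im_sub[OF UV, of x] gc_sym[of "psi x" s I J] by (auto simp: S'_def)
 hence "fdr K (gc I J) (psi (phi p), r) = eo K G (phi p, r)" "fdr K (gc J I) (psi (phi p), r) = eo K G (phi p, r)"
 using frame_deriv_eo[OF S'(1,2) _ S'(3)] by blast+
 thus ?thesis by (simp add: UV' p)
qed

lemma LC_koszul:
 assumes p: "p : U" and r: "r > 0"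
 shows "LC M tht Z U g I J K (p, r) = (SUM L:UNIV. kz (%I J L. fdr I (gc J L) (p, r))
 (%I J K. CF I J K (phi p, r)) (%I J. gc I J (p, r)) I J L * ginv M tht Z g L K (p, r))"
proof -
 define ko where "ko I J K x = (SUM L:UNIV. kz (%I J L. fdr I (gc J L) x)
 (%I J K. CF I J K (phi (fst x), snd x)) (%I J. gc I J x) I J L * ginv M tht Z g L K x)" for I J K x
 have "levi_civita M tht Z U g \<Gamma> \<longleftrightarrow> (ALL x:U \<times> {0<..}. ALL I J K. \<Gamma> I J K x = ko I J K x)" for \<Gamma>
 unfolding levi_civita_def
 proof (rule ball_cong[OF refl])
 fix x :: "'a \<times> real" assume "x : U \<times> {0<..}"
 then obtain p r where x: "x = (p, r)" "p : U" "r > 0" by auto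
 show "(ALL I J F. (EX N. open N & x : N & regular_bfun Smooth M F N) -->
 (SUM K:UNIV. (\<Gamma> I J K x - \<Gamma> J I K x) * fdr K F x) =
 fdr I (fdr J F) x - fdr J (fdr I F) x) \<and>
 (ALL I J K. fdr K (gc I J) x = (SUM L:UNIV. \<Gamma> K I L x * gc L J x + \<Gamma> K J L x * gc I L x)) \<longleftrightarrow>
 (ALL I J K. \<Gamma> I J K x = ko I J K x)" unfolding x(1) fd_torsion[OF x(2,3), of "%I J K. \<Gamma> I J K (p, r)"] ko_def fst_conv snd_conv
 by (rule koszul, rule gc_sym[OF x(2) less_imp_le[OF x(3)]], rule gmat_inv(1)[OF x(2) less_imp_le[OF x(3)]],
 rule gmat_inv(2)[OF x(2) less_imp_le[OF x(3)]], rule CF_anti, rule fd_gc_sym[OF x(2,3)])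
 qed
 note * = this
 have "levi_civita M tht Z U g (LC M tht Z U g)" unfolding LC_def by (rule someI[of _ ko]) (simp add: *)
 thus ?thesis using * p r by (simp add: ko_def)
qed

end

section \<open>The formal Einstein metric of a formal solution\<close>

lemma reg_det:
 assumes S: "open S" and A: "!!I J. regular_on k (%y. A y $ I $ J) S"
 shows "regular_on k (%y. det (A y :: complex ^ idx ^ idx)) S" unfolding det_idx by (intro reg_add reg_diff reg_mult S A)

text \<open>Cramer's rule in place of \<open>matrix_inv\<close>: the entries are quotients of
  determinants, so smoothness of the inverse is immediate.\<close>

definition inv4 :: "complex i2 => complex i2" where
 "inv4 G I J = det (\<chi> i j. if j = I then (if i = J then 1 else 0) else G i j) / det (\<chi> i j. G i j)"

lemma inv4:
 assumes "det (\<chi> i j. G i j) ~= 0"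
 shows "(SUM J:UNIV. G I J * inv4 G J K) = (if I = K then 1 else 0)"
proof -
 have "(\<chi> i j. G i j) *v (\<chi> k. inv4 G k K) = (\<chi> i. if i = K then 1 else 0)"
 unfolding cramer[OF assms] by (simp add: inv4_def cong del: if_weak_cong)
 from arg_cong[OF this, of "%v. v $ I"] show ?thesis by (simp add: matrix_vector_mult_def)
qed

lemma inv4_unique:
 assumes d: "det (\<chi> i j. G i j) ~= 0" and H: "!!I K. (SUM J:UNIV. G I J * H J K) = (if I = K then 1 else 0)"
 shows "H I K = inv4 G I K"
proof -
 have "(\<chi> i j. G i j) *v (\<chi> k. H k K) = (\<chi> i. if i = K then 1 else 0)" by (simp add: matrix_vector_mult_def H)
 hence "(\<chi> k. H k K) = (\<chi> k. inv4 G k K)" unfolding cramer[OF d] by (simp add: inv4_def cong del: if_weak_cong)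
 thus ?thesis by (simp add: vec_eq_iff)
qed

definition det3 :: "complex => complex => complex => complex => complex" where
 "det3 a b c d = 4 * (a * (c * cnj c - d * d) - b * (b * cnj c - d * cnj b) + cnj b * (b * d - c * cnj b))"

lemma det_nf: "det (\<chi> i j. nf a b c d i j) = det3 a b c d" by (simp add: det_idx nf_def det3_def)

lemma det3_real: "cnj a = a ==> cnj d = d ==> of_real (Re (det3 a b c d)) = det3 a b c d"
proof -
 assume "cnj a = a" "cnj d = d"
 hence "cnj (det3 a b c d) = det3 a b c d" by (simp add: det3_def algebra_simps)
 thus ?thesis by (metis Reals_cnj_iff of_real_Re)
qed

text \<open>Curvature on the level of functions of \<open>(x, rho)\<close>, for an algebra of functions \<open>g\<close>, \<open>h\<close> and derivations \<open>E\<close>.\<close>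

type_synonym 'y fn = "'y => complex"

definition LoF :: "(idx => 'y fn => 'y fn) => 'y fn i3 => 'y fn i2 => 'y fn i3" where
 "LoF E C g I J L = (%y. 1/2 * (E I (g J L) y + E J (g I L) y - E L (g I J) y
 + (SUM M:UNIV. C I J M y * g M L y - C J L M y * g M I y - C I L M y * g M J y)))"

definition GaF :: "(idx => 'y fn => 'y fn) => 'y fn i3 => 'y fn i2 => 'y fn i2 =>
 'y fn i3" where
 "GaF E C g h I J K = (%y. SUM L:UNIV. LoF E C g I J L y * h L K y)"

definition RmF :: "(idx => 'y fn => 'y fn) => 'y fn i3 => 'y fn i4" where
 "RmF E G I J K L = (%y. E K (G L I J) y - E L (G K I J) y
 + (SUM N:UNIV. G L I N y * G K N J y - G K I N y * G L N J y)
 - (SUM N:UNIV. (G K L N y - G L K N y) * G N I J y))"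

definition RcF :: "(idx => 'y fn => 'y fn) => 'y fn i3 => 'y fn i2" where
 "RcF E G I J = (%y. SUM K:UNIV. RmF E G J K K I y)"

definition PF :: "(idx => 'y fn => 'y fn) => 'y fn i3 => 'y fn i2 => 'y fn i2 => 'y fn i2" where
 "PF E G g h I J = (%y. 1/2 * RcF E G I J y - 1/12 * ((SUM I:UNIV. SUM J:UNIV. h I J y * RcF E G I J y) * g I J y))"

definition WeF :: "(idx => 'y fn => 'y fn) => 'y fn i3 => 'y fn i2 => 'y fn i2 =>
 'y fn i4" where
 "WeF E G g h I J K L = (%y. (SUM N:UNIV. g J N y * RmF E G I N K L y) + g I K y * PF E G g h J L y - g J K y * PF E G g h I L y
 + g J L y * PF E G g h I K y - g I L y * PF E G g h J K y)"

definition WminF :: "(idx => 'y fn => 'y fn) => 'y fn i3 => 'y fn i2 => 'y fn i2 => 'y fn =>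
 'y fn i4" where
 "WminF E G g h s I J K L = (%y. 1/2 * (WeF E G g h I J K L y
 - 1/2 * (SUM A:UNIV. SUM B:UNIV. SUM P:UNIV. SUM Q:UNIV.
 (\<i> * alt_symbol K L A B) * (s y * h A P y * h B Q y * WeF E G g h I J P Q y))))"

context frame
begin

text \<open>Couples a function that is smooth across the boundary with its Taylor coefficients. The
  rules below carry this coupling from the metric to its curvature.\<close>

definition TS :: "(r3 \<times> real) set => (r3 \<times> real) fn => r3 ser => bool" where
 "TS S F f \<longleftrightarrow> regS F S & (ALL x n. (x, 0) : S --> tc F n x = f n x)"

context
 fixes S assumes S: "dom S"
begin

lemma TS_self: "regS F S ==> TS S F (tc F)" by (simp add: TS_def)

lemma TS_add: "TS S F f ==> TS S G g ==> TS S (%y. F y + G y) (%n x. f n x + g n x)"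
 and TS_diff: "TS S F f ==> TS S G g ==> TS S (%y. F y - G y) (%n x. f n x - g n x)"
 and TS_mult: "TS S F f ==> TS S G g ==> TS S (%y. F y * G y) (%n x. smul f g n x)"
 using domD(1)[OF S] by (auto simp: TS_def smul_def tc_add tc_diff tc_mult intro!: reg_add reg_diff reg_mult)

lemma TS_cmult: "TS S F f ==> TS S (%y. k * F y) (%n x. k * f n x)" using domD(1)[OF S] by (auto simp: TS_def tc_cmult intro!: reg_cmult)

lemma TS_sum: "(!!i. TS S (F i) (f i)) ==> TS S (%y. SUM i:(UNIV :: idx set). F i y) (%n x. SUM i:UNIV. f i n x)"
 using domD(1)[OF S] by (auto simp: TS_def tc_sum intro!: reg_sum)

lemma TS_eo: "TS S F f ==> TS S (eo I F) (%n x. Eop zz I f n x)" unfolding TS_def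
proof (intro conjI allI impI)
 assume F: "regS F S & (ALL x n. (x, 0) : S --> tc F n x = f n x)"
 note oS = domD(1)[OF S]
 show "regS (eo I F) S" using reg_eo[OF S] F by blast
 fix x n assume x: "(x, 0) : S"
 have rm: "tc (%y. of_real (snd y) ^ k * G y) n x = (if n < k then 0 else tc G (n - k) x)" if "regS G S" for G k n
 proof (induction k arbitrary: n)
 case (Suc k)
 have "tc (%y. of_real (snd y) * (of_real (snd y) ^ k * G y)) n x = (if n = 0 then 0 else tc (%y. of_real (snd y) ^ k * G y) (n - 1) x)"
 by (rule tc_rho_mult[OF oS x]) (intro reg_mult reg_power snd_smooth oS that)
 thus ?case using Suc by (auto simp: mult.assoc)
 qed simp
 show "tc (eo I F) n x = Eop zz I f n x"
 proof (cases "I = Xinf")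
 case True
 hence e: "eo I F = (%y. of_real (snd y) ^ 1 * dr F y)" by (auto simp: eo_def)
 have r: "regS (dr F) S" using F reg_pdv[OF oS _ Basis_dr] by blast
 show ?thesis unfolding e rm[OF r] using F x True by (cases n) (auto simp: Eop_def tc_dr)
 next
 case False
 define Q where "Q y = (SUM b:Basis. zz I b (fst y) * pdv (b, 0) F y)" for y
 have e: "eo I F = (%y. of_real (snd y) ^ wt I * Q y)" using False by (auto simp: eo_def Q_def)
 have r: "regS (%y. zz I b (fst y) * pdv (b, 0) F y) S" if "b : Basis" for b
 using F that by (intro reg_mult oS zz_fst S False reg_pdv Basis_dx) auto
 have Q: "regS Q S" unfolding Q_def[abs_def] by (intro reg_sum oS r) auto
 have "tc Q m x = Vf (zz I) (f m) x" for m
 proof -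
 have fm: "pdv b (tc F m) x = pdv b (f m) x" for b by (rule pdv_cong[OF sl_open[OF oS], of x 0]) (use F x in "auto simp: sl_def")
 have "tc (%y. zz I b (fst y) * pdv (b, 0) F y) m x = zz I b x * pdv b (f m) x" if b: "b : Basis" for b
 proof -
 have "tc (%y. zz I b (fst y) * pdv (b, 0) F y) m x = (\<Sum>i=0..m. tc (%y. zz I b (fst y)) i x * tc (pdv (b, 0) F) (m - i) x)"
 by (rule tc_mult[OF oS x zz_fst[OF S False b]]) (use F reg_pdv[OF oS _ Basis_dx[OF b]] in blast)
 also have "... = (\<Sum>i=0..m. if i = 0 then zz I b x * tc (pdv (b, 0) F) m x else 0)"
 by (rule sum.cong) (auto simp: tc_x[OF refl oS x zz_fst[OF S False b]])
 finally show ?thesis using tc_dx[OF oS x _ b, of F m] F fm by simp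
 qed
 thus ?thesis unfolding Q_def[abs_def] Vf_def using r by (subst tc_sum[OF oS x]) auto
 qed
 thus ?thesis unfolding e rm[OF Q] using False by (simp add: Eop_def)
 qed
qed

lemma TS_CF: "TS S (CF I J K) (Cs I J K)"
proof -
 note oS = domD(1)[OF S]
 have r: "regS (%y. Cs I J K n (fst y)) S" for n using reg_fst[OF S Cs_an] .
 have "tc (CF I J K) n x = Cs I J K n x" if x: "(x, 0) : S" for n x
 proof -
 have "tc (CF I J K) n x = (if n = 0 then Cs I J K 0 x else 0) + (if n = 0 then 0 else if n - 1 = 0 then Cs I J K 1 x else 0)
 + (if n = 0 then 0 else if n - 1 = 0 then 0 else if n - 1 - 1 = 0 then Cs I J K 2 x else 0)" unfolding CF_def using r
 by (simp only: tc_add[OF oS x] tc_rho_mult[OF oS x] tc_x[OF refl oS x r] reg_add[OF oS] reg_mult[OF oS] snd_smooth[OF oS])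
 moreover have "Cs I J K n x = 0" if "n > 2" using that by (simp add: Cs_def Ch_def)
 ultimately show ?thesis by (cases "n = 0"; cases "n = 1"; cases "n = 2"; simp)
 qed
 moreover have "regS (CF I J K) S" unfolding CF_def[abs_def] by (intro reg_add reg_mult snd_smooth oS r)
 ultimately show ?thesis by (simp add: TS_def)
qed

lemma TS_cong: "TS S F f ==> (!!x n. (x, 0) : S ==> f n x = f' n x) ==> TS S F f'" by (simp add: TS_def)

lemma TS_Rm:
 assumes g: "!!I J. TS S (g I J) (gs I J)" and h: "!!I J. TS S (h I J) (hs I J)"
 shows "TS S (GaF eo CF g h I J K) (Ga (Eop zz) Cs gs hs I J K)"
 "TS S (RmF eo (GaF eo CF g h) I J K L) (Rm (Eop zz) (Ga (Eop zz) Cs gs hs) I J K L)"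
 "TS S (RcF eo (GaF eo CF g h) I J) (Rc (Eop zz) (Ga (Eop zz) Cs gs hs) I J)"
proof -
 have L: "TS S (LoF eo CF g I J L) (Lo (Eop zz) Cs gs I J L)" for I J L
 unfolding LoF_def Lo_def by (intro TS_cmult TS_add TS_diff TS_sum TS_mult TS_eo TS_CF g)
 show G: "TS S (GaF eo CF g h I J K) (Ga (Eop zz) Cs gs hs I J K)" for I J K unfolding GaF_def Ga_def by (intro TS_sum TS_mult L h)
 show R: "TS S (RmF eo (GaF eo CF g h) I J K L) (Rm (Eop zz) (Ga (Eop zz) Cs gs hs) I J K L)" for I J K L
 unfolding RmF_def Rm_def by (intro TS_add TS_diff TS_sum TS_mult TS_eo G)
 show "TS S (RcF eo (GaF eo CF g h) I J) (Rc (Eop zz) (Ga (Eop zz) Cs gs hs) I J)" unfolding RcF_def Rc_def by (intro TS_sum R)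
qed

text \<open>For an Einstein metric the Schouten tensor is \<open>- g/4\<close>.\<close>

lemma TS_Wmin:
 fixes g h gs hs
 defines "G \<equiv> GaF eo CF g h" and "Gs \<equiv> Ga (Eop zz) Cs gs hs"
 assumes g: "!!I J. TS S (g I J) (gs I J)" and h: "!!I J. TS S (h I J) (hs I J)" and s: "TS S s ss"
 and hg: "!!I K n x. (x, 0) : S ==> (SUM J:UNIV. smul (hs I J) (gs J K) n x) = (if n = 0 & I = K then 1 else 0)"
 and sym: "!!I J. gs I J = gs J I"
 and Ein: "!!I J n x. (x, 0) : S ==> Rc (Eop zz) Gs I J n x + 3/2 * gs I J n x = 0"
 shows "TS S (WminF eo G g h s I J K L) (Wmin (Eop zz) Gs gs hs ss I J K L)"
proof -
 note R = TS_Rm[of g gs h hs, OF g h, folded G_def Gs_def]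
 have Rc: "TS S (RcF eo G I J) (%n x. - 3/2 * gs I J n x)" for I J by (rule TS_cong[OF R(3)]) (use Ein in "simp add: add_eq_0_iff2")
 have sm: "smul f (%n x. c * f' n x) n x = c * smul f f' n x" "smul f f' n x = smul f' f n x" for f f' :: "r3 ser" and c n x
 unfolding smul_def by (simp add: sum_distrib_left mult_ac)
 (rule sum.reindex_bij_witness[of _ "%i. n - i" "%i. n - i"]; simp)
 \<comment> \<open>The trace of the Einstein equation is four times \<open>- 3/2\<close>. The
   Schouten tensor then has the factor \<open>- 3/4 + 1/2 = - 1/4\<close>.\<close>
 have sc: "TS S (%y. SUM I:UNIV. SUM J:UNIV. h I J y * RcF eo G I J y) (%n x. if n = 0 then - 6 else 0)"
 proof (rule TS_cong[OF TS_sum[OF TS_sum[OF TS_mult[OF h Rc]]]])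
 fix x n assume x: "(x, 0) : S"
 have e: "smul (hs I J) (%n x. - 3/2 * gs I J n x) n x = - 3/2 * smul (hs I J) (gs J I) n x" for I J by (subst sm(1)) (simp only: sym[of I J])
 show "(SUM I:UNIV. SUM J:UNIV. smul (hs I J) (%n x. - 3/2 * gs I J n x) n x) = (if n = 0 then - 6 else 0)"
 unfolding e sum_distrib_left[symmetric] hg[OF x] by (simp add: UNIV_idx)
 qed
 have k: "smul (%n x. if n = 0 then c else 0) f n x = c * f n x" for c f n and x :: "r3"
 proof -
 have "smul (%n x. if n = 0 then c else 0) f n x = (\<Sum>i=0..n. if i = 0 then c * f n x else 0)" unfolding smul_def by (rule sum.cong) auto
 thus ?thesis by simp
 qed
 have P: "TS S (PF eo G g h I J) (%n x. - 1/4 * gs I J n x)" for I J unfolding PF_def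
 by (rule TS_cong[OF TS_diff[OF TS_cmult[OF Rc] TS_cmult[OF TS_mult[OF sc g]]]]) (simp add: k)
 have We: "TS S (WeF eo G g h I J K L) (We (Eop zz) Gs gs I J K L)" for I J K L unfolding WeF_def We_def
 proof (rule TS_cong[OF TS_diff[OF TS_add[OF TS_diff[OF TS_add[OF TS_sum[OF TS_mult[OF g R(2)]] TS_mult[OF g P]] TS_mult[OF g P]] TS_mult[OF g P]] TS_mult[OF g P]]])
 fix x n
 show "(SUM i:UNIV. smul (gs J i) (Rm (Eop zz) Gs I i K L) n x) + smul (gs I K) (%n x. - 1/4 * gs J L n x) n x
 - smul (gs J K) (%n x. - 1/4 * gs I L n x) n x + smul (gs J L) (%n x. - 1/4 * gs I K n x) n x - smul (gs I L) (%n x. - 1/4 * gs J K n x) n x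
 = (SUM N:UNIV. smul (gs J N) (Rm (Eop zz) Gs I N K L) n x) - 1/2 * (smul (gs I K) (gs J L) n x - smul (gs J K) (gs I L) n x)"
 unfolding sm(1) sm(2)[of "gs J L" "gs I K"] sm(2)[of "gs I L" "gs J K"] by (simp add: field_simps)
 qed
 show ?thesis unfolding WminF_def Wmin_def by (intro TS_cmult TS_diff TS_sum TS_mult We s h)
qed

end

end

lemma tc_cnj:
 assumes S: "open S" "(x, 0) : S" and F: "regS F S"
 shows "tc (%y. cnj (F y)) n x = cnj (tc F n x)"
proof -
 have "y : S ==> (pdv (0, 1) ^^ n) (%y. cnj (F y)) y = cnj ((pdv (0, 1) ^^ n) F y)" for y
 proof (induction n arbitrary: y)
 case (Suc n)
 have "pdv (0, 1) ((pdv (0, 1) ^^ n) (%y. cnj (F y))) y = pdv (0, 1) (%y. cnj ((pdv (0, 1) ^^ n) F y)) y" by (rule pdv_cong[OF S(1) Suc(2) Suc(1)])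
 also have "... = cnj (pdv (0, 1) ((pdv (0, 1) ^^ n) F) y)" by (rule pdv_cnj[OF reg_differentiable[OF S(1) dr_iter_smooth[OF S(1) F] Suc(2)]])
 finally show ?case by simp
 qed simp
 thus ?thesis using S(2) by (simp add: tc_def)
qed

lemma inv4_left:
 assumes "det (\<chi> i j. G i j) ~= 0"
 shows "(SUM J:UNIV. inv4 G I J * G J K) = (if I = K then 1 else 0)"
proof -
 have "(\<chi> i j. G i j) ** (\<chi> i j. inv4 G i j) = mat 1" by (simp add: matrix_matrix_mult_def inv4[OF assms] mat_def)
 hence "(\<chi> i j. inv4 G i j) ** (\<chi> i j. G i j) = mat 1" by (rule matrix_left_right_inverse[THEN iffD1])
 from arg_cong[OF this, of "%A. A $ I $ K"] show ?thesis by (simp add: matrix_matrix_mult_def mat_def)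
qed

lemma reg_nf:
 assumes S: "open S" and r: "regular_on k a S" "regular_on k b S" "regular_on k c S" "regular_on k d S"
 shows "regular_on k (%y. nf (a y) (b y) (c y) (d y) I J) S"
 using r reg_cnj[OF S r(2)] reg_cnj[OF S r(3)] by (cases I; cases J) (simp_all add: nf_def)

lemma segment_in:
 assumes "open S" "(x, 0) : (S :: ('x::euclidean_space \<times> real) set)"
 obtains e where "e > 0" "!!s. 0 <= s ==> s < e ==> (x, s) : S"
proof -
 obtain e where e: "e > 0" "ball (x, 0) e <= S" using assms open_contains_ball by metis
 show ?thesis by (rule that[OF e(1)]) (use e(2) in "auto simp: dist_Pair_Pair ")
qed

context frame
begin

lemma O_vanish:
 assumes O: "O_rho U m F" and S: "dom S" "(x, 0) : S" and G: "regS G S"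
 and FG: "!!r. (x, r) : S ==> r > 0 ==> F (psi x, r) = G (x, r)" and j: "j < m"
 shows "tc G j x = 0"
proof -
 have x: "psi x : U" using domD(2)[OF S] im_sub[OF UV] by auto
 obtain V' C e where V: "psi x : V'" "e > 0" "!!q r. q : V' Int U ==> r : {0<..<e} ==> norm (F (q, r)) <= C * r ^ m"
 using O x unfolding O_rho_def by metis
 obtain e' where e': "e' > 0" "!!s. 0 <= s ==> s < e' ==> (x, s) : S" using segment_in[OF domD(1)[OF S(1)] S(2)] by metis
 show ?thesis by (rule tc_vanish[OF domD(1)[OF S(1)] S(2) G, of "min e e'" C m j])
 (use V e' j x in "auto simp flip: FG")
qed

end

context sol
begin

lemmas fsolD = conjunct1[OF fsol, rule_format] conjunct1[OF conjunct2[OF fsol], rule_format] conjunct2[OF conjunct2[OF fsol], rule_format]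

lemma nO: "O_rho U 1 (%x. gc X0 X0 x - 1)" "O_rho U 1 (gc X0 X1)" "O_rho U 1 (gc X1 X1)"
 "O_rho U 1 (%x. gc X1 X1bar x - lev Z Z (fst x))" using nform by blast+

end

text \<open>Smooth extensions of four metric components across the boundary. At negative
  \<open>r\<close> nothing relates them to \<open>g\<close>, so \<open>gx\<close> is forced into
  normal form by taking real parts and inserting conjugates.\<close>

locale germ = sol +
 fixes S A B C D
 assumes S: "dom S" and sm: "regS A S" "regS B S" "regS C S" "regS D S"
 and ABCD: "!!x r. (x, r) : S ==> r >= 0 ==> gc X0 X0 (psi x, r) = A (x, r) & gc X0 X1 (psi x, r) = B (x, r) \<and>
 gc X1 X1 (psi x, r) = C (x, r) & gc X1 X1bar (psi x, r) = D (x, r)"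
begin

abbreviation "gx \<equiv> %I J y. nf (of_real (Re (A y))) (B y) (C y) (of_real (Re (D y))) I J"
definition dx :: "r3 \<times> real => complex" where
 "dx y = det3 (of_real (Re (A y))) (B y) (C y) (of_real (Re (D y)))"

lemmas oS = domD(1)[OF S]

lemma gx_smooth: "regS (gx I J) S" by (intro reg_nf oS reg_Re sm)

lemma dx_smooth: "regS dx S" unfolding dx_def[abs_def] det3_def by (intro reg_cmult reg_add reg_diff reg_mult reg_cnj reg_Re oS sm)

lemma in_U: "(x, r) : S ==> psi x : U & phi (psi x) = x" using domD(2)[OF S, of "(x, r)"] im_sub[OF UV] by auto

lemma gc_gx: "(x, r) : S ==> r >= 0 ==> gc I J (psi x, r) = gx I J (x, r)" using gc_nf[of "psi x" r I J] in_U ABCD by simp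

lemma gx_0: assumes x: "(x, 0) : S" shows "gx I J (x, 0) = g0 I J"
proof -
 have r: "regS (%y. A y - 1) S" "regS (%y. D y - 1) S" by (intro reg_diff oS sm reg_const)+
 have "tc (%y. A y - 1) 0 x = 0" by (rule O_vanish[OF nO(1) S x r(1)]) (use ABCD in auto)
 moreover have "tc B 0 x = 0" by (rule O_vanish[OF nO(2) S x sm(2)]) (use ABCD in auto)
 moreover have "tc C 0 x = 0" by (rule O_vanish[OF nO(3) S x sm(3)]) (use ABCD in auto)
 moreover have "tc (%y. D y - 1) 0 x = 0" by (rule O_vanish[OF nO(4) S x r(2)]) (use ABCD in_U levi1 in auto)
 ultimately show ?thesis by (cases I; cases J) (simp_all add: nf_def)
qed

end

text \<open>A domain on which the determinant keeps the sign that it has at the boundary, so that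
  the inverse and the root in the volume form are smooth.\<close>

locale germ_det = germ +
 assumes dneg: "!!y. y : S ==> Re (dx y) < 0"
begin

abbreviation "hx \<equiv> %I J y. inv4 (%I J. gx I J y) I J"
definition sx :: "r3 \<times> real => complex" where "sx y = of_real (sqrt (Re (- dx y)))"

lemma dx_nz: "y : S ==> dx y ~= 0" using dneg by fastforce

lemma hx_smooth: "regS (hx I J) S" unfolding inv4_def by (rule reg_divide[OF oS reg_det[OF oS] reg_det[OF oS]])
 (auto intro!: reg_if gx_smooth simp: det_nf dx_nz[unfolded dx_def])

lemma sx_smooth: "regS sx S" unfolding sx_def[abs_def] by (rule reg_sqrt[OF oS reg_minus[OF oS dx_smooth]]) (use dneg in auto)

lemma sx_sq: "y : S ==> sx y * sx y = - dx y"
proof -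
 assume y: "y : S"
 have "of_real (Re (dx y)) = dx y" unfolding dx_def by (rule det3_real) auto
 moreover have "sx y * sx y = of_real (Re (- dx y))" unfolding sx_def using dneg[OF y] by (simp flip: of_real_mult)
 ultimately show ?thesis by simp
qed

abbreviation "Om' \<equiv> sl S 0"
abbreviation "gs I J \<equiv> tc (gx I J)"
abbreviation "hs I J \<equiv> tc (hx I J)"
abbreviation "ss \<equiv> tc sx"

lemmas TSg = TS_self[OF S gx_smooth] and TSh = TS_self[OF S hx_smooth] and TSs = TS_self[OF S sx_smooth]

lemma TS_eq: "TS S F f ==> (!!y. y : S ==> F y = G y) ==> (x, 0) : S ==> f n x = tc G n x"
 unfolding TS_def using tc_cong[OF oS, of x F G n] by metis

lemma gh: "(x, 0) : S ==> (SUM J:UNIV. smul (gs I J) (hs J K) n x) = (if n = 0 & I = K then 1 else 0)"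
 and hg: "(x, 0) : S ==> (SUM J:UNIV. smul (hs I J) (gs J K) n x) = (if n = 0 & I = K then 1 else 0)"
proof -
 have d: "det (\<chi> i j. gx i j y) ~= 0" if "y : S" for y using dx_nz[OF that] by (simp add: det_nf dx_def)
 assume x: "(x, 0) : S"
 show "(SUM J:UNIV. smul (gs I J) (hs J K) n x) = (if n = 0 & I = K then 1 else 0)"
 proof -
 have T: "TS S (%y. SUM J:UNIV. gx I J y * hx J K y) (%n x. SUM J:UNIV. smul (gs I J) (hs J K) n x)" by (intro TS_sum TS_mult S TSg TSh)
 have "(SUM J:UNIV. gx I J y * hx J K y) = (if I = K then 1 else 0)" if "y : S" for y by (rule inv4[OF d[OF that]])
 from TS_eq[OF T this x] show ?thesis by (simp add: tc_const)
 qed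
 show "(SUM J:UNIV. smul (hs I J) (gs J K) n x) = (if n = 0 & I = K then 1 else 0)"
 proof -
 have T: "TS S (%y. SUM J:UNIV. hx I J y * gx J K y) (%n x. SUM J:UNIV. smul (hs I J) (gs J K) n x)" by (intro TS_sum TS_mult S TSg TSh)
 have "(SUM J:UNIV. hx I J y * gx J K y) = (if I = K then 1 else 0)" if "y : S" for y by (rule inv4_left[OF d[OF that]])
 from TS_eq[OF T this x] show ?thesis by (simp add: tc_const)
 qed
qed

abbreviation "Gx \<equiv> GaF eo CF gx hx"

lemma TS_G: "TS S (Gx I J K) (Ga (Eop zz) Cs gs hs I J K)"
 and TS_R: "TS S (RcF eo Gx I J) (Rc (Eop zz) (Ga (Eop zz) Cs gs hs) I J)"
 by (rule TS_Rm(1)[OF S], rule TSg, rule TSh, rule TS_Rm(3)[OF S], rule TSg, rule TSh)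

lemma Gx_smooth: "regS (Gx I J K) S" using TS_G by (simp add: TS_def)

text \<open>The interior part, where \<open>frame_deriv\<close> computes the curvature. Identities
  found here reach the boundary through the smooth extensions.\<close>

definition Sp where "Sp = S Int UNIV \<times> {0<..}"

lemma Sp: "dom Sp" "(x, r) : Sp \<longleftrightarrow> (x, r) : S & r > 0" "regS F S ==> regS F Sp"
 unfolding Sp_def using dom_Int[OF S open_Times[OF open_UNIV open_greaterThan]] by (auto elim: reg_subset)

lemma fd: "(x, r) : Sp ==> (!!x r. (x, r) : Sp ==> F (psi x, r) = G (x, r)) ==> regS G S ==>
 fdr I F (psi x, r) = eo I G (x, r)" using frame_deriv_eo[OF Sp(1) _ _ Sp(3)] by blast

context
 fixes x r assumes xr: "(x, r) : Sp"
begin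

lemma xr': "(x, r) : S" "r > 0" "r >= 0" "psi x : U" "phi (psi x) = x" using xr Sp(2) in_U by auto

lemma ginv_hx: "ginv M tht Z g I J (psi x, r) = hx I J (x, r)"
proof (rule inv4_unique)
 show "det (\<chi> i j. gx i j (x, r)) ~= 0" using dx_nz[OF xr'(1)] by (simp add: det_nf dx_def)
 show "(SUM J:UNIV. gx I J (x, r) * ginv M tht Z g J K (psi x, r)) = (if I = K then 1 else 0)" for I K
 using gmat_inv(1)[OF xr'(4,3)] gc_gx[OF xr'(1,3)] by simp
qed

end

lemma LC_Gx: assumes xr: "(x, r) : Sp" shows "LC M tht Z U g I J K (psi x, r) = Gx I J K (x, r)"
proof -
 note X = xr'[OF xr]
 have "fdr I (gc J L) (psi x, r) = eo I (gx J L) (x, r)" for I J L by (rule fd[OF xr _ gx_smooth]) (use gc_gx Sp(2) in auto)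
 thus ?thesis unfolding LC_koszul[OF X(4,2)] GaF_def LoF_def kz_def ginv_hx[OF xr] X(5) gc_gx[OF X(1,3)] by simp
qed

context
 fixes x r assumes xr: "(x, r) : Sp"
begin

lemma curv_Rm: "curv M tht Z U g I J K L (psi x, r) = RmF eo Gx I J K L (x, r)"
proof -
 have "fdr K (LC M tht Z U g L I J) (psi x, r) = eo K (Gx L I J) (x, r)" for K L I J by (rule fd[OF xr LC_Gx Gx_smooth])
 thus ?thesis by (simp add: curv_def RmF_def LC_Gx[OF xr])
qed

lemma ricci_Rc: "ricci M tht Z U g I J (psi x, r) = RcF eo Gx I J (x, r)" by (simp add: ricci_def RcF_def curv_Rm)

lemma weyl_We: "weyl M tht Z U g I J K L (psi x, r) = WeF eo Gx gx hx I J K L (x, r)"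
 by (simp add: weyl_def Let_def WeF_def curv_low_def curv_Rm schouten_def scal_def ricci_Rc PF_def ginv_hx[OF xr] gc_gx[OF xr'(1,3)[OF xr]])

lemma weyl_minus_Wmin: "weyl_minus M tht Z U g I J K L (psi x, r) = WminF eo Gx gx hx sx I J K L (x, r)"
proof -
 have "gmat M tht Z g (psi x, r) = (\<chi> i j. gx i j (x, r))" by (simp add: gmat_def gc_gx[OF xr'(1,3)[OF xr]])
 hence "vol_form M tht Z g K L A' B' (psi x, r) = \<i> * sx (x, r) * alt_symbol K L A' B'" for A' B'
 unfolding vol_form_def by (simp add: det_nf sx_def dx_def)
 thus ?thesis by (simp add: weyl_minus_def WminF_def weyl_We ginv_hx[OF xr] mult_ac)
qed

end

lemma Ein: assumes x: "(x, 0) : S"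
 shows "Rc (Eop zz) (Ga (Eop zz) Cs gs hs) I J n x + 3/2 * gs I J n x = 0"
proof -
 have T: "TS S (%y. RcF eo Gx I J y + 3/2 * gx I J y) (%n x. Rc (Eop zz) (Ga (Eop zz) Cs gs hs) I J n x + 3/2 * gs I J n x)"
 by (rule TS_add[OF S TS_R TS_cmult[OF S TSg]])
 have "tc (%y. RcF eo Gx I J y + 3/2 * gx I J y) n x = 0" by (rule O_vanish[where m = "Suc n", OF _ S x])
 (use fsolD(1) T ricci_Rc gc_gx Sp(2) in "auto simp: TS_def")
 thus ?thesis using T x by (simp add: TS_def)
qed

lemma TSW: "TS S (WminF eo Gx gx hx sx I J K L) (Wmin (Eop zz) (Ga (Eop zz) Cs gs hs) gs hs ss I J K L)"
 by (rule TS_Wmin[OF S], rule TSg, rule TSh, rule TSs, erule hg, simp add: nf_sym, erule Ein)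

lemma Wmin_low: "(x, 0) : S ==> n < 6 ==> tc (WminF eo Gx gx hx sx I J K L) n x = 0"
 by (rule O_vanish[where m = 6, OF _ S]) (use fsolD(2) TSW[of I J K L] weyl_minus_Wmin Sp(2) in "auto simp: TS_def")

text \<open>The limit that defines \<open>eta\<close> is the sixth Taylor coefficient, because the
  lower ones vanish.\<close>

lemma Wmin_6: assumes x: "(x, 0) : S"
 shows "Wmin (Eop zz) (Ga (Eop zz) Cs gs hs) gs hs ss Xinf X0 Xinf X0 6 x = of_real lam * obstruction M tht Z U (psi x)"
proof -
 let ?F = "WminF eo Gx gx hx sx Xinf X0 Xinf X0"
 have s: "regS ?F S" using TSW by (simp add: TS_def)
 have 1: "((%r. ?F (x, r) / of_real (r ^ 6)) \<longlongrightarrow> tc ?F 6 x) (at_right 0)" by (rule tc_limit[OF oS x s Wmin_low[OF x]])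
 obtain e where e: "e > 0" "!!s. 0 <= s ==> s < e ==> (x, s) : S" using segment_in[OF oS x] by metis
 have "eventually (%r. weyl_minus M tht Z U g Xinf X0 Xinf X0 (psi x, r) / of_real (r ^ 6) = ?F (x, r) / of_real (r ^ 6)) (at_right 0)"
 using eventually_at_right_real[OF e(1)] by eventually_elim (use e weyl_minus_Wmin Sp(2) in auto)
 moreover have "((%rho. weyl_minus M tht Z U g Xinf X0 Xinf X0 (psi x, rho) / of_real (rho ^ 6)) \<longlongrightarrow> of_real lam * obstruction M tht Z U (psi x)) (at_right 0)"
 using fsolD(3) in_U[OF x] by blast
 ultimately have "((%r. ?F (x, r) / of_real (r ^ 6)) \<longlongrightarrow> of_real lam * obstruction M tht Z U (psi x)) (at_right 0)"
 by (rule Lim_transform_eventually[rotated])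
 from tendsto_unique[OF trivial_limit_at_right_real 1 this] show ?thesis using TSW x by (simp add: TS_def)
qed

lemma gs_cnj: assumes x: "(x, 0) : S" shows "gs X1bar X1bar n x = cnj (gs X1 X1 n x)" "gs X0 X1bar n x = cnj (gs X0 X1 n x)"
 "cnj (gs X0 X0 n x) = gs X0 X0 n x" "cnj (gs X1 X1bar n x) = gs X1 X1bar n x"
 using tc_cnj[OF oS x gx_smooth, of X1 X1 n] tc_cnj[OF oS x gx_smooth, of X0 X1 n]
 tc_cnj[OF oS x gx_smooth, of X0 X0 n] tc_cnj[OF oS x gx_smooth, of X1 X1bar n] by (simp_all add: nf_def)

lemma gs_inf: "gs Xinf J n x = (if n = 0 & J = Xinf then 4 else 0)" by (simp_all add: nf_def tc_const)

lemma formal: "formal_einstein Om' zz Cs gs hs ss"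
proof
 have sub: "Om' <= Om" using domD(2)[OF S] by (auto simp: sl_def)
 show "open Om'" by (rule sl_open[OF oS])
 show "anl (zz I b) Om'" if "b : Basis" "I ~= Xinf" for I b using reg_subset[OF zz_an[OF that(2,1)] sub] by (simp add: regular_on.simps)
 show "anl (Cs I J K n) Om'" for I J K n using reg_subset[OF Cs_an sub] by (simp add: regular_on.simps)
 show "Cs I J K 0 x = C0 I J K" for I J K x by (simp add: Cs_def)
 show "n > 2 ==> Cs I J K n x = 0" for I J K n x by (simp add: Cs_def Ch_def)
 fix x assume "x : Om'"
 hence x: "(x, 0) : S" by (simp add: sl_def)
 show "gs I J n x = gs J I n x" for I J n by (simp add: nf_sym[of _ _ _ _ I J])
 show "gs I J 0 x = g0 I J" for I J using gx_0[OF x] by simp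
 show "n > 0 ==> gs Xinf I n x = 0" for I n by (simp add: gs_inf)
 show "(SUM J:UNIV. smul (gs I J) (hs J K) n x) = (if n = 0 & I = K then 1 else 0)" for I K n by (rule gh[OF x])
 show "ss 0 x = 2" using gx_0[OF x, of X0 X0] gx_0[OF x, of X0 X1] gx_0[OF x, of X1 X1] gx_0[OF x, of X1 X1bar]
 by (simp add: sx_def dx_def nf_def det3_def)
 show "smul ss ss n x = dets gs n x" for n
 proof -
 have "TS S (%y. (- 4) * (gx X0 X0 y * (gx X1 X1 y * gx X1bar X1bar y - gx X1 X1bar y * gx X1 X1bar y)
 - gx X0 X1 y * (gx X0 X1 y * gx X1bar X1bar y - gx X1 X1bar y * gx X0 X1bar y)
 + gx X0 X1bar y * (gx X0 X1 y * gx X1 X1bar y - gx X1 X1 y * gx X0 X1bar y))) (dets gs)"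
 unfolding dets_def by (intro TS_cmult TS_add TS_diff TS_mult S TSg)
 from TS_eq[OF this _ x, of "%y. sx y * sx y" n] show ?thesis
 using TS_mult[OF S TSs TSs] x by (simp add: sx_sq TS_def) (simp add: nf_def dx_def det3_def algebra_simps)
 qed
 show "gs X1bar X1bar n x = cnj (gs X1 X1 n x)" "gs X0 X1bar n x = cnj (gs X0 X1 n x)" for n by (rule gs_cnj[OF x])+
 show "Rc (Eop zz) (Ga (Eop zz) Cs gs hs) I J n x + 3/2 * gs I J n x = 0" for I J n by (rule Ein[OF x])
 show "Wmin (Eop zz) (Ga (Eop zz) Cs gs hs) gs hs ss Xinf X1 Xinf X1 4 x = 0"
 using TSW[of Xinf X1 Xinf X1] Wmin_low[OF x, of 4 Xinf X1 Xinf X1] x by (simp add: TS_def)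
next
 have "regA (%x. of_real lam * obstruction M tht Z U (psi x)) Om'"
 by (rule reg_subset[of _ _ Om]) (use AN_obstruction domD(2)[OF S] op in "auto simp: AN_def sl_def intro: reg_cmult")
 thus "anl (Wmin (Eop zz) (Ga (Eop zz) Cs gs hs) gs hs ss Xinf X0 Xinf X0 6) Om'" unfolding regular_on.simps(2)[symmetric]
 by (rule reg_cong[OF sl_open[OF oS], rotated]) (simp add: Wmin_6 sl_def)
qed

lemma taylor:
 assumes x: "(x, 0) : S" and f: "!!s. s >= 0 ==> f s = (SUM I:UNIV. SUM J:UNIV. k I J * gc I J (psi x, s))"
 shows "taylor_coeff f n = (SUM I:UNIV. SUM J:UNIV. k I J * gs I J n x)"
proof -
 obtain e where e: "e > 0" "!!s. 0 <= s ==> s < e ==> (x, s) : S" using segment_in[OF oS x] by metis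
 have T: "TS S (%y. SUM I:UNIV. SUM J:UNIV. k I J * gx I J y) (%n x. SUM I:UNIV. SUM J:UNIV. k I J * gs I J n x)"
 by (intro TS_sum TS_cmult S TSg)
 hence "taylor_coeff f n = tc (%y. SUM I:UNIV. SUM J:UNIV. k I J * gx I J y) n x"
 by (intro taylor_coeff_tc[OF oS e]) (use e gc_gx in "auto simp: TS_def f")
 thus ?thesis using T x by (simp add: TS_def)
qed

end

lemma (in sol) local_solution:
 assumes p: "p : U"
 obtains W' G where "open W'" "(phi p, 0) : W'" "!!I J. anl (G I J) W'" "!!x r. (x, r) : W' ==> x : Om"
 "!!x r I J. (x, r) : W' ==> G I J (x, r) =
 nf (of_real (Re (G X0 X0 (x, r)))) (G X0 X1 (x, r)) (G X1 X1 (x, r)) (of_real (Re (G X1 X1bar (x, r)))) I J"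
 "!!x I J. (x, 0) : W' ==> G I J (x, 0) = g0 I J"
 "!!x r k f. (x, r) : W' ==> (!!s. s >= 0 ==> f s = (SUM I:UNIV. SUM J:UNIV. k I J * gc I J (psi x, s))) ==>
 (%n. taylor_coeff f n * of_real r ^ n) sums (SUM I:UNIV. SUM J:UNIV. k I J * G I J (x, r))"
proof -
 have "EX S G. dom S & (phi p, 0) : S & regS G S & (ALL x r. (x, r) : S --> r >= 0 --> gc I J (psi x, r) = G (x, r))" for I J
 proof -
 obtain S G where S: "dom S" "(phi p, 0) : S" "regS G S"
 "!!x r. (x, r) : S ==> (psi x, r) : UNIV \<times> {0..} Int U \<times> UNIV ==> gc I J (psi x, r) = G (x, r)"
 using bfun_germ[OF gc_bfun _ p, of 0 I J] p by auto
 have "(psi x, r) : UNIV \<times> {0..} Int U \<times> UNIV" if "(x, r) : S" "r >= 0" for x r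
 using domD(2)[OF S(1) that(1)] that im_sub[OF UV, of x] by auto
 thus ?thesis using S by blast
 qed
 then obtain S G where SG: "!!I J. dom (S I J)" "!!I J. (phi p, 0) : S I J" "!!I J. regS (G I J) (S I J)"
 "!!I J x r. (x, r) : S I J ==> r >= 0 ==> gc I J (psi x, r) = G I J (x, r)" by metis
 define S1 where "S1 = S X0 X0 Int S X0 X1 Int S X1 X1 Int S X1 X1bar"
 have S1: "dom S1" "(phi p, 0) : S1" using SG(1,2) by (auto simp: S1_def intro!: dom_Int dest: domD)
 have sub: "S1 <= S X0 X0" "S1 <= S X0 X1" "S1 <= S X1 X1" "S1 <= S X1 X1bar" by (auto simp: S1_def)
 interpret g1: germ M V phi H Jc tht U Z lam g S1 "G X0 X0" "G X0 X1" "G X1 X1" "G X1 X1bar"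
 proof
 show "gc X0 X0 (psi x, r) = G X0 X0 (x, r) & gc X0 X1 (psi x, r) = G X0 X1 (x, r) & gc X1 X1 (psi x, r) = G X1 X1 (x, r) \<and>
 gc X1 X1bar (psi x, r) = G X1 X1bar (x, r)" if "(x, r) : S1" "r >= 0" for x r using that SG(4) sub by blast
 qed (use S1 SG(3) sub in "blast intro: reg_subset")+
 \<comment> \<open>At the boundary the determinant is -4, so it stays negative nearby.\<close>
 define S2 where "S2 = S1 Int {y : S1. Re (g1.dx y) < 0}"
 have "continuous_on S1 g1.dx" using g1.dx_smooth by (simp add: regular_on.simps) (metis Ck_on.simps(1))
 hence "open (S1 Int (%y. Re (g1.dx y)) -` {..<0})" by (intro continuous_open_preimage g1.oS continuous_intros)
 moreover have "S1 Int (%y. Re (g1.dx y)) -` {..<0} = {y : S1. Re (g1.dx y) < 0}" by auto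
 ultimately have S2: "dom S2" unfolding S2_def by (intro dom_Int[OF S1(1)]) simp
 have pS: "(phi p, 0) : S2"
 using S1(2) g1.gx_0[OF S1(2), of X0 X0] g1.gx_0[OF S1(2), of X0 X1] g1.gx_0[OF S1(2), of X1 X1] g1.gx_0[OF S1(2), of X1 X1bar]
 by (simp add: S2_def g1.dx_def nf_def det3_def)
 interpret g2: germ M V phi H Jc tht U Z lam g S2 "G X0 X0" "G X0 X1" "G X1 X1" "G X1 X1bar"
 by unfold_locales (use S2 g1.sm g1.ABCD in "auto simp: S2_def elim: reg_subset")
 interpret d: germ_det M V phi H Jc tht U Z lam g S2 "G X0 X0" "G X0 X1" "G X1 X1" "G X1 X1bar" by unfold_locales (simp add: S2_def)
 have "phi p : sl S2 0" using pS by (simp add: sl_def)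
 from formal_einstein.converges[OF d.formal this] obtain W' K where W: "open W'" "(phi p, 0) : W'"
 "!!I J. anl (K I J) W'"
 "!!x r I J. (x, r) : W' ==> x : sl S2 0 & (%n. d.gs I J n x * of_real r ^ n) sums K I J (x, r)" by blast
 have xS: "(x, 0) : S2" if "(x, r) : W'" for x r using W(4)[OF that] by (simp add: sl_def)
 show ?thesis
 proof (rule that[OF W(1-3)])
 fix x r assume xr: "(x, r) : W'"
 note sK = conjunct2[OF W(4)[OF xr]]
 show "x : Om" using domD(2)[OF S2 xS[OF xr]] by simp
 show "(%n. taylor_coeff f n * of_real r ^ n) sums (SUM I:UNIV. SUM J:UNIV. k I J * K I J (x, r))"
 if f: "!!s. s >= 0 ==> f s = (SUM I:UNIV. SUM J:UNIV. k I J * gc I J (psi x, s))" for k f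
 unfolding d.taylor[of x f k, OF xS[OF xr] f, simplified] sum_distrib_right mult.assoc by (intro sums_sum sums_mult sK)
 have cn: "cnj (K I J (x, r)) = K I' J' (x, r)" if "!!n. cnj (d.gs I J n x) = d.gs I' J' n x" for I J I' J'
 proof -
 have "(%n. cnj (d.gs I J n x * of_real r ^ n)) sums cnj (K I J (x, r))" by (rule iffD2[OF sums_cnj sK])
 thus ?thesis using sK[of I' J'] that by (simp add: sums_unique2)
 qed
 have sym: "K I J (x, r) = K J I (x, r)" for I J using sK[of I J] sK[of J I] by (simp add: nf_sym[of _ _ _ _ I J] sums_unique2)
 have inf: "K Xinf J (x, r) = (if J = Xinf then 4 else 0)" for J
 proof -
 have "(%n. if n = 0 then (if J = Xinf then 4 else 0) else (0::complex)) sums (if J = Xinf then 4 else 0)"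
 using sums_single[of 0 "%_. if J = Xinf then 4 else (0::complex)"] by simp
 moreover have "(%n. d.gs Xinf J n x * of_real r ^ n) = (%n. if n = 0 then (if J = Xinf then 4 else 0) else (0::complex))" by (auto simp: d.gs_inf)
 ultimately have "(%n. d.gs Xinf J n x * of_real r ^ n) sums (if J = Xinf then 4 else 0)" by simp
 thus ?thesis by (rule sums_unique2[OF sK[of Xinf J]])
 qed
 note c = cn[OF d.gs_cnj(1)[OF xS[OF xr], symmetric]] cn[OF d.gs_cnj(2)[OF xS[OF xr], symmetric]]
 cn[OF d.gs_cnj(3)[OF xS[OF xr]]] cn[OF d.gs_cnj(4)[OF xS[OF xr]]]
 have re: "of_real (Re u) = u" if "cnj u = u" for u :: complex using that by (simp add: complex_eq_iff)
 show "K I J (x, r) = nf (of_real (Re (K X0 X0 (x, r)))) (K X0 X1 (x, r)) (K X1 X1 (x, r)) (of_real (Re (K X1 X1bar (x, r)))) I J" for I J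
 unfolding re[OF c(3)] re[OF c(4)]
 by (cases I; cases J) (simp_all add: nf_def c inf sym[of X0 Xinf] sym[of X1 Xinf] sym[of X1bar Xinf] sym[of X1 X0] sym[of X1bar X0] sym[of X1bar X1])
 next
 fix x I J assume x: "(x, 0) : W'"
 have "(%n. d.gs I J n x * of_real 0 ^ n) sums K I J (x, 0)" using W(4)[OF x] by blast
 hence "d.gs I J 0 x = K I J (x, 0)" by simp
 thus "K I J (x, 0) = g0 I J" using g2.gx_0[OF xS[OF x], of I J] by simp
 qed
qed

section \<open>Assembly\<close>

text \<open>A joint series whose higher orders in the boundary variable vanish. It is expanded at 0
  and translated to \<open>r0\<close>, where it represents the same function.\<close>

lemma an_fst:
 fixes f :: "'x::euclidean_space => complex"
 assumes f: "anl f S"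
 shows "anl (%y. f (fst y)) (S \<times> (UNIV :: real set))" unfolding anl_iff_hps
proof
 fix y0 assume y0: "y0 : S \<times> (UNIV :: real set)"
 obtain x r0 where x: "y0 = (x, r0)" "x : S" using y0 by auto
 obtain c t where c: "hps f x c t" using f x by (auto simp: anl_iff_hps)
 note t = hps_pos[OF c]
 define c' where "c' n = (if n = 0 then c else (%_. 0))" for n :: nat
 have "asum (c' n) t" for n using hps_asum[OF c] by (auto simp: c'_def asum_def)
 moreover have "summable (%n. wn (c' n) t * t ^ n)" by (rule summable_finite[of "{0}"]) (auto simp: c'_def wn_def)
 ultimately obtain G where G: "hps G (x, 0::real) (jointc c') t"
 "!!y r. (y, r) : pd (x, 0) t ==> (%n. (\<Sum>\<^sub>\<infinity>\<alpha>\<in>MI. c' n \<alpha> * of_real (mon (y - x) \<alpha>)) * of_real r ^ n) sums G (y, r)"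
 using hps_joint[OF t, of c' x] by blast
 have Gf: "G y = f (fst y)" if y: "y : pd (x, 0) t" for y
 proof -
 obtain u r where u: "y = (u, r)" by (cases y)
 have "u : pd x t" using y unfolding pd_def u by (auto simp: Basis_prod_real)
 from infsumI[OF hps_sum[OF c this]]
 have "(%n. (\<Sum>\<^sub>\<infinity>\<alpha>\<in>MI. c' n \<alpha> * of_real (mon (u - x) \<alpha>)) * of_real r ^ n) = (%n. if n = 0 then f u else 0)"
 by (auto simp: c'_def)
 thus ?thesis using G(2)[of u r] y sums_single[of 0 "%_. f u"] sums_unique2 unfolding u by fastforce
 qed
 have sh: "(y - (0, r0)) : pd (x, 0) t \<longleftrightarrow> y : pd y0 t" "y - y0 = y - (0, r0) - (x, 0)" for y
 by (auto simp: x pd_def diff_diff_eq)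
 have "hps (%y. f (fst y)) y0 (jointc c') t" unfolding hps_def
 proof (intro conjI ballI)
 fix y assume y: "y : pd y0 t"
 have "((%\<alpha>. jointc c' \<alpha> * of_real (mon (y - (0, r0) - (x, 0)) \<alpha>)) has_sum G (y - (0, r0))) MI"
 by (rule hps_sum[OF G(1)]) (use sh(1) y in blast)
 thus "((%\<alpha>. jointc c' \<alpha> * of_real (mon (y - y0) \<alpha>)) has_sum f (fst y)) MI"
 using Gf[of "y - (0, r0)"] sh(1)[of y] y by (simp add: sh(2))
 qed (use hps_pos[OF G(1)] hps_asum[OF G(1)] in auto)
 thus "EX c t. hps (%y. f (fst y)) y0 c t" by blast
qed

text \<open>The mean value estimate with \<open>dr F\<close> bounded near the point;
  \<open>O_rho\<close> demands that it be uniform in \<open>x\<close>.\<close>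

lemma boundary_bound:
 fixes F :: "'x::euclidean_space \<times> real => complex"
 assumes W: "open W" "(x0, 0) : W" and F: "regS F W" and 0: "!!x. (x, 0) : W ==> F (x, 0) = 0"
 obtains de C where "de > 0" "C >= 0" "!!x r. dist x x0 < de ==> 0 <= r ==> r < de ==> (x, r) : W & norm (F (x, r)) <= C * r"
proof -
 have "regS (dr F) W" by (rule reg_pdv[OF W(1) F Basis_dr])
 hence "continuous_on W (dr F)" by (simp add: regular_on.simps) (metis Ck_on.simps(1))
 hence "isCont (dr F) (x0, 0)" using W continuous_on_eq_continuous_at by blast
 hence "ALL e>0. EX d>0. ALL y. dist y (x0, 0) < d --> dist (dr F y) (dr F (x0, 0)) < e" unfolding continuous_at_eps_delta by blast
 then obtain d where d: "d > 0" "!!y. dist y (x0, 0) < d ==> dist (dr F y) (dr F (x0, 0)) < 1" using zero_less_one by blast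
 obtain d' where d': "d' > 0" "ball (x0, 0) d' <= W" using W open_contains_ball by metis
 define de where "de = min d d' / 2"
 have near: "dist (x, r) (x0, 0) < d & (x, r) : W" if "dist x x0 < de" "0 <= r" "r < de" for x r
 proof -
 have "dist (x, r) (x0, 0) <= dist x x0 + dist r 0" unfolding dist_Pair_Pair by (rule sqrt_sum_squares_le_sum) auto
 also have "... < min d d'" using that by (simp add: de_def)
 finally show ?thesis using d' by (auto simp: dist_commute)
 qed
 define C where "C = norm (dr F (x0, 0)) + 1"
 show ?thesis
 proof (rule that[of de C])
 fix x r assume x: "dist x x0 < de" "0 <= r" "r < de"
 have "norm (F (x, r) - F (x, 0) - 0 * of_real (r ^ Suc 0)) <= C * r ^ Suc 0"
 proof (rule slice_bound[OF W(1) F])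
 show "(x, s) : W" if "0 <= s" "s <= r" for s using near[of x s] that x by auto
 fix s assume s: "0 < s" "s < r"
 have "norm (dr F (x, s)) <= norm (dr F (x0, 0)) + dist (dr F (x, s)) (dr F (x0, 0))"
 unfolding dist_norm using norm_triangle_ineq2[of "dr F (x, s)" "dr F (x0, 0)"] by simp
 also have "... <= C" using d(2)[of "(x, s)"] near[of x s] s x by (simp add: C_def)
 finally show "norm (dr F (x, s) - of_nat (Suc 0) * 0 * of_real (s ^ 0)) <= C * r ^ 0" by simp
 qed (rule x)
 thus "(x, r) : W & norm (F (x, r)) <= C * r" using near[OF x] near[of x 0] 0[of x] x by auto
 qed (use d d' in "auto simp: de_def C_def add_nonneg_pos")
qed

lemma nf_quadratic:
 assumes v: "v Xinf = of_real x" "v X0 = of_real y" "v X1bar = cnj (v X1)"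
 shows "(SUM I:UNIV. SUM J:UNIV. v I * v J * nf (of_real a) b c (of_real d) I J) =
 of_real (4 * x\<^sup>2 + a * y\<^sup>2 + 4 * y * Re (b * v X1) + 2 * Re (c * v X1 * v X1) + 2 * d * (norm (v X1))\<^sup>2)"
 unfolding cmod_power2 by (simp add: sum_idx nf_def v complex_eq_iff power2_eq_square algebra_simps)

text \<open>At the model the form is \<open>4 x^2 + y^2 + 2 k^2\<close>. With deviations below 1/10
  the mixed terms take away at most \<open>(y^2 + k^2) / 5\<close> and \<open>k^2 / 5\<close>, less
  than the diagonal retains.\<close>

lemma nf_positive:
 assumes v: "v Xinf = of_real x" "v X0 = of_real y" "v X1bar = cnj (v X1)" and nz: "v ~= (%_. 0)"
 and s: "\<bar>a - 1\<bar> < 1/10" "norm b < 1/10" "norm c < 1/10" "\<bar>d - 1\<bar> < 1/10"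
 shows "Re (SUM I:UNIV. SUM J:UNIV. v I * v J * nf (of_real a) b c (of_real d) I J) > 0"
proof -
 define k where "k = norm (v X1)"
 have k: "k >= 0" by (simp add: k_def)
 have "\<bar>Re (b * v X1)\<bar> <= 1/10 * k"
 using abs_Re_le_cmod[of "b * v X1"] mult_right_mono[OF less_imp_le[OF s(2)] k] by (simp add: norm_mult k_def)
 hence "\<bar>y * Re (b * v X1)\<bar> <= \<bar>y\<bar> * (1/10 * k)" unfolding abs_mult by (rule mult_left_mono) simp
 moreover have "\<bar>y\<bar> * k <= (y\<^sup>2 + k\<^sup>2) / 2" using sum_squares_bound[of "\<bar>y\<bar>" k] by simp
 ultimately have 1: "4 * y * Re (b * v X1) >= - (y\<^sup>2 + k\<^sup>2) / 5" by simp
 have "\<bar>Re (c * v X1 * v X1)\<bar> <= 1/10 * (k * k)"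
 using abs_Re_le_cmod[of "c * v X1 * v X1"] mult_right_mono[OF less_imp_le[OF s(3)], of "k * k"] by (simp add: norm_mult k_def)
 from abs_le_D2[OF this] have 2: "2 * Re (c * v X1 * v X1) >= - k\<^sup>2 / 5" unfolding power2_eq_square by linarith
 have 3: "a * y\<^sup>2 >= 9/10 * y\<^sup>2" "d * k\<^sup>2 >= 9/10 * k\<^sup>2"
 proof -
 have "9/10 <= a" "9/10 <= d" using s(1,4) by linarith+
 thus "a * y\<^sup>2 >= 9/10 * y\<^sup>2" "d * k\<^sup>2 >= 9/10 * k\<^sup>2" by (simp_all only: mult_right_mono zero_le_power2)
 qed
 have "x ~= 0 \<or> y ~= 0 \<or> k ~= 0"
 proof (rule ccontr)
 assume "~ ?thesis"
 hence "v I = 0" for I using v by (cases I) (auto simp: k_def)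
 thus False using nz by auto
 qed
 hence "x\<^sup>2 > 0 \<or> y\<^sup>2 > 0 \<or> k\<^sup>2 > 0" by simp
 moreover have "4 * X + A + P + C + 2 * D > 0" if "X > 0 \<or> Y > 0 \<or> K > 0" "X >= 0" "Y >= 0" "K >= 0"
 "A >= 9/10 * Y" "D >= 9/10 * K" "P >= - (Y + K) / 5" "C >= - K / 5" for X Y K A P C D :: real using that by auto
 ultimately have "4 * x\<^sup>2 + a * y\<^sup>2 + 4 * y * Re (b * v X1) + 2 * Re (c * v X1 * v X1) + 2 * (d * k\<^sup>2) > 0"
 using 1 2 3 zero_le_power2 by meson
 thus ?thesis unfolding nf_quadratic[OF v] k_def by simp
qed

text \<open>Summed for fixed vectors and therefore global by construction; the value is meaningful
  only where the series converges.\<close>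

definition gT :: "'a tmetric => 'a tmetric" where
 "gT g = (%(p, rho) u v. \<Sum>n. taylor_coeff (%r. g (p, r) u v) n * of_real rho ^ n)"

context frame
begin

text \<open>The fibre of type (1,0) is a complex line: a component along \<open>conj Z\<close> would
  put \<open>conj Z\<close> into it as well, against \<open>T10_conj\<close>.\<close>

lemma other_frame:
 assumes adm2: "admissible_frame M H Jc U2 Z2" and q: "q : U" "q : U2"
 shows "Z2 q = lincomb (c1p q (Z2 q)) (Z q) 0 (Z q)"
proof -
 note V = UV'[OF q(1)]
 have Z2: "Z2 q : T10 H Jc q" using adm2 q by (auto simp: admissible_frame_def)
 have t: "Z2 q : CT q" by (rule T10_ct[OF V Z2])
 have c0: "c0p q (Z2 q) = 0" using tht_c0p[OF q(1) t] T10_theta[OF V Z2] by simp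
 have e: "Z2 q = (%f. c1p q (Z2 q) * Z q f + cbp q (Z2 q) * W q f)" using cp_decomp[OF q(1) t] c0 by simp
 have "cbp q (Z2 q) = 0"
 proof (rule ccontr)
 assume n: "cbp q (Z2 q) ~= 0"
 have "W q = lincomb (1 / cbp q (Z2 q)) (Z2 q) (- c1p q (Z2 q) / cbp q (Z2 q)) (Z q)"
 proof
 fix f show "W q f = lincomb (1 / cbp q (Z2 q)) (Z2 q) (- c1p q (Z2 q) / cbp q (Z2 q)) (Z q) f"
 using fun_cong[OF e, of f] n by (simp add: lincomb_def field_simps)
 qed
 hence "W q : T10 H Jc q" using T10_lincomb[OF V Z2 F(4)[OF q(1)]] by metis
 thus False using T10_conj[OF V F(4)[OF q(1)]] F(5)[OF q(1)] by blast
 qed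
 thus ?thesis using e by (auto simp: lincomb_def)
qed

end

text \<open>A neighbourhood on which the component series have analytic sums \<open>G\<close> in
  normal form, so close to the model that positivity is guaranteed.\<close>

locale ana = sol +
 fixes N' G
 assumes N': "open N'" and Gan: "!!I J. anl (G I J) N'" and NOm: "!!x r. (x, r) : N' ==> x : Om"
 and Gnf: "!!x r I J. (x, r) : N' ==> G I J (x, r) =
 nf (of_real (Re (G X0 X0 (x, r)))) (G X0 X1 (x, r)) (G X1 X1 (x, r)) (of_real (Re (G X1 X1bar (x, r)))) I J"
 and G0: "!!x I J. (x, 0) : N' ==> G I J (x, 0) = g0 I J"
 and Gs: "!!x r k f. (x, r) : N' ==> (!!s. s >= 0 ==> f s = (SUM I:UNIV. SUM J:UNIV. k I J * gc I J (psi x, s))) ==>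
 (%n. taylor_coeff f n * of_real r ^ n) sums (SUM I:UNIV. SUM J:UNIV. k I J * G I J (x, r))"
 and small: "!!y I J. y : N' ==> norm (G I J y - g0 I J) < 1/10"
begin

lemma gT_sums:
 assumes q: "q : U" "(phi q, r) : N'" and u: "u : TF q" "v : TF q"
 shows "(%n. taylor_coeff (%r. g (q, r) u v) n * of_real r ^ n) sums gT g (q, r) u v"
 and "gT g (q, r) u v = (SUM I:UNIV. SUM J:UNIV. cmp q u I * cmp q v J * G I J (phi q, r))"
proof -
 have "(%n. taylor_coeff (%r. g (q, r) u v) n * of_real r ^ n) sums (SUM I:UNIV. SUM J:UNIV. cmp q u I * cmp q v J * G I J (phi q, r))"
 by (rule Gs[OF q(2)]) (use g_expand[OF q(1) _ u] q UV' in simp)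
 thus "(%n. taylor_coeff (%r. g (q, r) u v) n * of_real r ^ n) sums gT g (q, r) u v"
 "gT g (q, r) u v = (SUM I:UNIV. SUM J:UNIV. cmp q u I * cmp q v J * G I J (phi q, r))" by (auto simp: gT_def sums_iff)
qed

lemma Gsym: "(x, r) : N' ==> G I J (x, r) = G J I (x, r)" by (subst (1 2) Gnf) (auto simp: nf_sym)

lemma metric_at:
 assumes q: "q : U" "(phi q, r) : N'"
 shows "u : TF q ==> v : TF q ==> gT g (q, r) u v = gT g (q, r) v u"
 and "u : TF q ==> v : TF q ==> w' : TF q ==>
 gT g (q, r) (tlincomb k u m v) w' = k * gT g (q, r) u w' + m * gT g (q, r) v w'"
 and "u : real_theta_fiber M q ==> v : real_theta_fiber M q ==> gT g (q, r) u v : \<real>"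
 and "u : real_theta_fiber M q ==> u ~= (0, zero_vec) ==> Re (gT g (q, r) u u) > 0"
proof -
 note e = gT_sums(2)[OF q]
 show "gT g (q, r) u v = gT g (q, r) v u" if "u : TF q" "v : TF q"
 unfolding e[OF that] e[OF that(2,1)] by (subst sum.swap) (simp add: Gsym[OF q(2)] mult_ac)
 show "gT g (q, r) (tlincomb k u m v) w' = k * gT g (q, r) u w' + m * gT g (q, r) v w'"
 if t: "u : TF q" "v : TF q" "w' : TF q"
 proof -
 have l: "tlincomb k u m v : TF q" using t lincomb_tangent[OF UV'[OF q(1)]] by (auto simp: tlincomb_def theta_fiber_def)
 have "cmp q (tlincomb k u m v) I = k * cmp q u I + m * cmp q v I" for I by (cases I) (simp_all add: cmp_def tlincomb_def cp_lincomb)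
 thus ?thesis unfolding e[OF l t(3)] e[OF t(1,3)] e[OF t(2,3)] by (simp add: sum_distrib_left distrib_right sum.distrib mult.assoc)
 qed
 show "gT g (q, r) u v : \<real>" if "u : real_theta_fiber M q" "v : real_theta_fiber M q"
 proof -
 note R = real_cmp[OF q(1) that(1)] real_cmp[OF q(1) that(2)]
 show ?thesis using R unfolding e[OF conjunct1[OF R(1)] conjunct1[OF R(2)]] by (subst Gnf[OF q(2)]) (simp add: sum_idx nf_def Reals_cnj_iff)
 qed
 show "Re (gT g (q, r) u u) > 0" if u: "u : real_theta_fiber M q" "u ~= (0, zero_vec)"
 proof -
 note R = real_cmp[OF q(1) u(1)]
 have "cmp q u ~= (%_. 0)"
 proof
 assume "cmp q u = (%_. 0)"
 hence "u = vc q (%_. 0)" using vc_cmp[OF q(1), of u] R by simp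
 thus False using u(2) by (auto simp: vc_def lincomb_def zero_vec_def)
 qed
 moreover have c: "cmp q u Xinf = of_real (Re (cmp q u Xinf))" "cmp q u X0 = of_real (Re (cmp q u X0))" using R by auto
 moreover have "\<bar>Re (G I J (phi q, r)) - Re (g0 I J)\<bar> < 1/10" for I J
 using abs_Re_le_cmod[of "G I J (phi q, r) - g0 I J"] small[OF q(2), of I J] by simp
 from this[of X0 X0] this[of X1 X1bar] have "\<bar>Re (G X0 X0 (phi q, r)) - 1\<bar> < 1/10" "\<bar>Re (G X1 X1bar (phi q, r)) - 1\<bar> < 1/10" by simp_all
 ultimately show ?thesis unfolding e[OF conjunct1[OF R] conjunct1[OF R]] using small[OF q(2), of X0 X1] small[OF q(2), of X1 X1] R
 by (subst Gnf[OF q(2)]) (rule nf_positive[OF c]; simp)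
 qed
qed

context
 fixes U2 Z2 assumes adm2: "admissible_frame M H Jc U2 Z2"
begin

text \<open>Another admissible frame is a scalar multiple of \<open>Z\<close>, so the components
  change by these factors alone.\<close>

definition kap :: "'a => idx => complex" where
 "kap q I = (case I of X1 => c1p q (Z2 q) | X1bar => cnj (c1p q (Z2 q)) | _ => 1)"

lemma gT_frame:
 assumes q: "q : U" "q : U2" "(phi q, r) : N'"
 shows "gcomp M tht Z2 (gT g) I J (q, r) = kap q I * kap q J * G I J (phi q, r)"
proof -
 have Z2: "Z2 q = lincomb (c1p q (Z2 q)) (Z q) 0 (Z q)" by (rule other_frame[OF adm2 q(1,2)])
 hence W2: "conj_vec (Z2 q) = lincomb (cnj (c1p q (Z2 q))) (W q) 0 (W q)" by (metis conj_lincomb(1) complex_cnj_zero)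
 have "theta_frame M tht Z2 I q = vc q (%J. if J = I then kap q I else 0)" for I
 using fun_cong[OF Z2] fun_cong[OF W2] by (cases I) (auto simp: vc_def kap_def lincomb_def zero_vec_def fun_eq_iff)
 thus ?thesis by (simp add: gcomp_def gT_sums(2)[OF q(1,3)] vc_fiber[OF q(1)] cmp_vc[OF q(1)])
 (simp add: sum_idx, cases I; cases J; simp)
qed

lemma kap_analytic: "open (phi ` (U Int U2))" "regA (%x. kap (psi x) I) (phi ` (U Int U2))"
proof -
 have o: "open (U Int U2)" "U Int U2 <= V" using U adm2 by (auto simp: admissible_frame_def)
 show S: "open (phi ` (U Int U2))" by (rule sub_open[OF o])
 have Z2: "vfc Analytic (U Int U2) Z2" by (rule vfc_D[OF vf_subset o(2)]) (use adm2 in "auto simp: admissible_frame_def")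
 have sub: "phi ` (U Int U2) <= Om" by auto
 have "regA (%x. c1 x (ci Z2 x)) (phi ` (U Int U2))" unfolding c1_def DD_def using DD(1)
 by (intro reg_divide reg_dt reg_crs S reg_tzw[THEN reg_subset] sub reg_ci[OF Z2]) (auto simp: DD_def)
 hence c: "regA (%x. c1p (psi x) (Z2 (psi x))) (phi ` (U Int U2))"
 by (rule reg_cong[OF S, rotated]) (use UV in "auto simp: c1p_def ci_def[abs_def] zc_def ")
 show "regA (%x. kap (psi x) I) (phi ` (U Int U2))" using c reg_cnj[OF S c] by (cases I) (simp_all add: kap_def)
qed

lemma kap_levi: assumes q: "q : U" "q : U2" shows "lev Z2 Z2 q = kap q X1 * kap q X1bar"
proof -
 have o: "open (U Int U2)" "U Int U2 <= V" using U adm2 by (auto simp: admissible_frame_def)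
 have Z2: "vfc Smooth (U Int U2) Z2" by (rule vfc_smooth[OF o vfc_D[OF vf_subset o(2)]]) (use adm2 in "auto simp: admissible_frame_def")
 have e: "ci Z2 (phi q) = (%i. c1p q (Z2 q) * z (phi q) i)"
 using fun_cong[OF other_frame[OF adm2 q]] UV'[OF q(1)] by (auto simp: ci_def zc_def lincomb_def)
 have x: "phi q : Om" using q by auto
 have "dt c (crs (%i. k * u i) (%i. cnj (k * u i))) = (k * cnj k) * dt c (crs u (%i. cnj (u i)))" for c k u by (simp add: dt_def algebra_simps)
 thus ?thesis using levi_chart'[OF o Z2, of q] q curl_zw[OF x] cnj_tzw(2)[OF x] unfolding e by (simp only: kap_def) (simp add: mult_ac)
qed

lemma bfun_at:
 assumes q: "q : U" "q : U2" "(phi q, r) : N'"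
 shows "EX W K. open W & (phi q, r) : W & regA K W \<and>
 (ALL q:V. ALL s. (phi q, s) : W --> gcomp M tht Z2 (gT g) I J (q, s) = K (phi q, s))"
proof (intro exI conjI ballI allI impI)
 let ?W = "N' Int phi ` (U Int U2) \<times> UNIV"
 show oW: "open ?W" by (intro open_Int N' open_Times kap_analytic open_UNIV)
 show "(phi q, r) : ?W" using q by auto
 have "regA (%y. kap (psi (fst y)) K) ?W" for K
 proof -
 have "regA (%y. kap (psi (fst y)) K) (phi ` (U Int U2) \<times> (UNIV :: real set))"
 using an_fst[OF kap_analytic(2)[unfolded regular_on.simps, of K]] by (simp add: regular_on.simps)
 thus ?thesis by (rule reg_subset) auto
 qed
 moreover have "regA (G I J) ?W" using Gan[of I J] unfolding regular_on.simps real_analytic_on_def by blast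
 ultimately show "regA (%y. kap (psi (fst y)) I * kap (psi (fst y)) J * G I J y) ?W" by (intro reg_mult oW)
 fix q s assume qs: "q : V" "(phi q, s) : ?W"
 then obtain q' where q': "q' : U" "q' : U2" "phi q = phi q'" by auto
 hence "q = q'" using psiphi[OF qs(1)] psiphi[OF UV'[OF q'(1)]] by metis
 thus "gcomp M tht Z2 (gT g) I J (q, s) = kap (psi (fst (phi q, s))) I * kap (psi (fst (phi q, s))) J * G I J (phi q, s)"
 using gT_frame[of q s I J] q' qs by simp
qed

text \<open>\<open>G\<close> differs from the model by a term of first order in \<open>rho\<close>,
  and the factors \<open>kap\<close> are continuous, hence bounded near \<open>p\<close>.\<close>

lemma O_at:
 assumes p: "p : U" "p : U2" "(phi p, 0) : N'"
 shows "EX V' C ep. open V' & p : V' & ep > 0 & (ALL q:V' Int U2. ALL rho:{0<..<ep}.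
 norm (gcomp M tht Z2 (gT g) I J (q, rho) - kap q I * kap q J * g0 I J) <= C * rho ^ 1)"
proof -
 have sm: "regS (%y. G I J y - g0 I J) N'"
 by (rule reg_smooth[OF N' reg_diff[OF N' _ reg_const[of Analytic]]]) (use Gan[of I J] in "simp add: regular_on.simps")
 obtain de C where C: "de > 0" "C >= 0" "!!x r. dist x (phi p) < de ==> 0 <= r ==> r < de ==> (x, r) : N' & norm (G I J (x, r) - g0 I J) <= C * r"
 by (rule boundary_bound[OF N' p(3) sm]) (use G0 in auto)
 have x: "phi p : phi ` (U Int U2)" using p by auto
 have "EX de'>0. ALL x:phi ` (U Int U2). dist x (phi p) < de' --> norm (kap (psi x) K) <= norm (kap p K) + 1" for K
 proof -
 have "regS (%x. kap (psi x) K) (phi ` (U Int U2))" by (rule reg_smooth[OF kap_analytic])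
 hence "continuous_on (phi ` (U Int U2)) (%x. kap (psi x) K)" by (simp add: regular_on.simps) (metis Ck_on.simps(1))
 hence "ALL e>0. EX d>0. ALL x':phi ` (U Int U2). dist x' (phi p) < d --> dist (kap (psi x') K) (kap (psi (phi p)) K) < e"
 using x unfolding continuous_on_iff by blast
 then obtain d where d: "d > 0" "!!x'. x' : phi ` (U Int U2) ==> dist x' (phi p) < d ==> dist (kap (psi x') K) (kap p K) < 1"
 using p UV' zero_less_one by (metis psiphi)
 have "norm (kap (psi x') K) <= norm (kap p K) + 1" if "x' : phi ` (U Int U2)" "dist x' (phi p) < d" for x'
 using d(2)[OF that] norm_triangle_ineq2[of "kap (psi x') K" "kap p K"] by (simp add: dist_norm)
 thus ?thesis using d(1) by blast
 qed
 then obtain de' where k: "!!K. de' K > 0" "!!K x. x : phi ` (U Int U2) ==> dist x (phi p) < de' K ==> norm (kap (psi x) K) <= norm (kap p K) + 1"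
 by metis
 define ep where "ep = min de (min (de' I) (de' J))"
 have ep: "ep > 0" using C k(1) by (simp add: ep_def)
 define V' where "V' = {q : V. phi q : ball (phi p) ep} Int U"
 have "open V'" "p : V'" using pre_open[OF open_ball] U p ep by (auto simp: V'_def)
 moreover have "norm (gcomp M tht Z2 (gT g) I J (q, rho) - kap q I * kap q J * g0 I J) <= ((norm (kap p I) + 1) * (norm (kap p J) + 1) * C) * rho ^ 1"
 if q: "q : V' Int U2" and r: "rho : {0<..<ep}" for q rho
 proof -
 have d: "dist (phi q) (phi p) < de" "dist (phi q) (phi p) < de' I" "dist (phi q) (phi p) < de' J" and qU: "q : U" "q : U2" "psi (phi q) = q"
 using q by (auto simp: V'_def ep_def dist_commute)
 have b: "norm (kap q I) <= norm (kap p I) + 1" "norm (kap q J) <= norm (kap p J) + 1" using k(2)[of "phi q"] d qU by auto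
 have c: "(phi q, rho) : N'" "norm (G I J (phi q, rho) - g0 I J) <= C * rho" using C(3)[OF d(1), of rho] r by (auto simp: ep_def)
 have e: "gcomp M tht Z2 (gT g) I J (q, rho) - kap q I * kap q J * g0 I J = kap q I * kap q J * (G I J (phi q, rho) - g0 I J)"
 unfolding gT_frame[OF qU(1,2) c(1)] by (simp add: right_diff_distrib)
 have "norm (kap q I * kap q J * (G I J (phi q, rho) - g0 I J)) <= ((norm (kap p I) + 1) * (norm (kap p J) + 1)) * (C * rho)"
 unfolding norm_mult by (intro mult_mono b c) auto
 thus ?thesis unfolding e by simp
 qed
 ultimately show ?thesis using ep by blast
qed

end

end

lemma (in sol) ana_exists:
 assumes p: "p : U" obtains N' G where "ana M V phi H Jc tht U Z lam g N' G" "(phi p, 0) : N'"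
proof (rule local_solution[OF p])
 fix W' G assume W: "open W'" "(phi p, 0) : W'" "!!I J. anl (G I J) W'" "!!x r. (x, r) : W' ==> x : Om"
 and nf: "!!x r I J. (x, r) : W' ==> G I J (x, r) =
 nf (of_real (Re (G X0 X0 (x, r)))) (G X0 X1 (x, r)) (G X1 X1 (x, r)) (of_real (Re (G X1 X1bar (x, r)))) I J"
 and G0: "!!x I J. (x, 0) : W' ==> G I J (x, 0) = g0 I J"
 and Gs: "!!x r k f. (x, r) : W' ==> (!!s. s >= 0 ==> f s = (SUM I:UNIV. SUM J:UNIV. k I J * gc I J (psi x, s))) ==>
 (%n. taylor_coeff f n * of_real r ^ n) sums (SUM I:UNIV. SUM J:UNIV. k I J * G I J (x, r))"
 have c: "continuous_on W' (G I J)" for I J using an_smooth[OF W(1) W(3), of 0 I J] by simp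
 define N' where "N' = (\<Inter>I. \<Inter>J. W' Int (%y. norm (G I J y - g0 I J)) -` {..<1/10})"
 have "open (W' Int (%y. norm (G I J y - g0 I J)) -` {..<1/10})" for I J by (intro continuous_open_preimage W continuous_intros c)
 hence o: "open N'" unfolding N'_def by (intro open_INT ballI) auto
 have i: "y : W'" "norm (G I J y - g0 I J) < 1/10" if "y : N'" for y I J using that by (auto simp: N'_def)
 have "ana M V phi H Jc tht U Z lam g N' G"
 proof
 show "anl (G I J) N'" for I J using W(3)[of I J] i(1) unfolding real_analytic_on_def by blast
 qed (use o W(4) i nf G0 Gs in "blast+")
 moreover have "(phi p, 0) : N'" using W(2) G0[OF W(2)] by (simp add: N'_def)
 ultimately show ?thesis by (rule that)
qed

theorem theorem1p4:
  fixes M :: "('a::{t2_space, second_countable_topology}) atlas"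
    and H :: "'a \<Rightarrow> 'a cvec set"
    and J :: "'a \<Rightarrow> 'a cvec \<Rightarrow> 'a cvec"
    and \<theta> :: "'a form"
    and lam :: real
    and g :: "'a tmetric"
  assumes "cr_structure M H J"
    and "strictly_pseudoconvex M H J"
    and "contact_form Analytic M H J \<theta>"
    and "formal_solution M H J \<theta> lam g"
  shows "\<exists>N g'. openin (top_of_set (UNIV \<times> {0..})) N \<and> UNIV \<times> {0} \<subseteq> N \<and>
           theta_metric Analytic M H J \<theta> N g' \<and> normal_form_ACH M H J \<theta> N g' \<and>
           (\<forall>(p, \<rho>)\<in>N. \<forall>u\<in>theta_fiber M p. \<forall>v\<in>theta_fiber M p.
              (\<lambda>n. taylor_coeff (\<lambda>r. g (p, r) u v) n * of_real \<rho> ^ n) sums g' (p, \<rho>) u v)"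
proof -
 have at: "analytic_atlas M" using assms(1) by (simp add: cr_structure_def)
 \<comment> \<open>The points covered by some local solution. This is an open condition which holds
   on the whole boundary, so \<open>N\<close> is a neighbourhood of it, possibly of varying
   thickness.\<close>
 define Q where "Q q r \<longleftrightarrow> (\<exists>V \<phi> U Z N' G. ana M V \<phi> H J \<theta> U Z lam g N' G & q : U & (\<phi> q, r) : N')" for q r
 define N where "N = {(q, r). r >= 0 & Q q r}"
 have QE: P if "Q q r" "!!V \<phi> U Z N' G. ana M V \<phi> H J \<theta> U Z lam g N' G ==> q : U ==> (\<phi> q, r) : N' ==> P" for q r P
  using that unfolding Q_def by blast
 have Q0: "Q p 0" for p
 proof -
  obtain V \<phi> where c: "chart M V \<phi>" "p : V" by (rule atlas_chart[OF at])
  interpret cr M V \<phi> H J \<theta> using c assms by (simp add: cr_def cr_axioms_def)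
  obtain U Z where fr: "open U" "p : U" "U <= V" "admissible_frame M H J U Z" "!!q. q : U ==> levi_form M \<theta> Z Z q = 1"
   using unit_frame_exists[OF c(2)] by metis
  interpret sol M V \<phi> H J \<theta> U Z lam g using fr assms(4) by unfold_locales
  show ?thesis using ana_exists[OF fr(2)] fr(2) unfolding Q_def by metis
 qed
 have "open {(q, r). Q q r}"
 proof (subst open_subopen, intro ballI)
  fix y assume "y : {(q, r). Q q r}"
  then obtain q r where y: "y = (q, r)" "Q q r" by blast
  from y(2) show "EX T. open T & y : T & T <= {(q, r). Q q r}"
  proof (rule QE)
   fix V \<phi> U Z N' G assume a: "ana M V \<phi> H J \<theta> U Z lam g N' G" and q: "q : U" "(\<phi> q, r) : N'"
   interpret ana M V \<phi> H J \<theta> U Z lam g N' G by (rule a)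
   have "open ({(q, r). q : V & (\<phi> q, r) : N'} Int U \<times> UNIV)" by (intro open_Int pre_open2 N' open_Times U open_UNIV)
   moreover have "{(q, r). q : V & (\<phi> q, r) : N'} Int U \<times> UNIV <= {(q, r). Q q r}"
    using a unfolding Q_def by blast
   ultimately show ?thesis using q UV' y(1) by blast
  qed
 qed
 moreover have "N = UNIV \<times> {0..} Int {(q, r). Q q r}" by (auto simp: N_def)
 ultimately have oN: "openin (top_of_set (UNIV \<times> {0..})) N" by auto
 have tm: "theta_metric Analytic M H J \<theta> N (gT g)" unfolding theta_metric_def
 proof (intro conjI allI impI, goal_cases)
  case 1
  show ?case
  proof (clarify, goal_cases)
   case (1 p \<rho>)
   hence "Q p \<rho>" by (simp add: N_def)
   thus ?case
   proof (rule QE)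
    fix V \<phi> U Z N' G assume a: "ana M V \<phi> H J \<theta> U Z lam g N' G" and q: "p : U" "(\<phi> p, \<rho>) : N'"
    interpret ana M V \<phi> H J \<theta> U Z lam g N' G by (rule a)
    show ?case using metric_at[OF q] by (intro conjI ballI allI impI)
   qed
  qed
 next
  case (2 U2 Z2 I K)
  show ?case unfolding regular_bfun_def
  proof (clarify, goal_cases)
   case (1 p \<rho>)
   hence "Q p \<rho>" by (simp add: N_def)
   thus ?case
   proof (rule QE)
    fix V \<phi> U Z N' G assume a: "ana M V \<phi> H J \<theta> U Z lam g N' G" and q: "p : U" "(\<phi> p, \<rho>) : N'"
    interpret ana M V \<phi> H J \<theta> U Z lam g N' G by (rule a)
    show ?case using bfun_at[OF 2 q(1) _ q(2), of I K] 1 chart UV'[OF q(1)] by (intro bexI[of _ "(V, \<phi>)"]) auto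
   qed
  qed
 qed
 have nf: "normal_form_ACH M H J \<theta> N (gT g)" unfolding normal_form_ACH_def
 proof (intro allI impI)
  fix U2 Z2 assume adm2: "admissible_frame M H J U2 Z2"
  \<comment> \<open>The leading terms demanded by the normal form; by \<open>kap_levi\<close> they
    are the model components rescaled by \<open>kap\<close>.\<close>
  let ?k = "%I J q. if (I, J) = (X0, X0) then 1 else if (I, J) = (X1, X1bar) then levi_form M \<theta> Z2 Z2 q else 0"
  have O: "O_rho U2 1 (%x. gcomp M \<theta> Z2 (gT g) I K x - ?k I K (fst x))"
   if IK: "(I, K) : {(X0, X0), (X0, X1), (X1, X1), (X1, X1bar)}" for I K unfolding O_rho_def
  proof
   fix p assume p: "p : U2"
   show "\<exists>V C \<epsilon>. open V & p : V & \<epsilon> > 0 & (ALL q:V Int U2. \<forall>\<rho>\<in>{0<..<\<epsilon>}.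
     norm (gcomp M \<theta> Z2 (gT g) I K (q, \<rho>) - ?k I K (fst (q, \<rho>))) <= C * \<rho> ^ 1)"
   proof (rule QE[OF Q0[of p]])
    fix V \<phi> U Z N' G assume a: "ana M V \<phi> H J \<theta> U Z lam g N' G" and q: "p : U" "(\<phi> p, 0) : N'"
    interpret ana M V \<phi> H J \<theta> U Z lam g N' G by (rule a)
    obtain V' C \<epsilon> where V': "open V'" "p : V'" "\<epsilon> > 0" "!!q \<rho>. q : V' Int U2 ==> \<rho> : {0<..<\<epsilon>} ==>
     norm (gcomp M \<theta> Z2 (gT g) I K (q, \<rho>) - kap Z2 q I * kap Z2 q K * g0 I K) <= C * \<rho> ^ 1"
     using O_at[OF adm2 q(1) p q(2), of I K] by metis
    have "?k I K q = kap Z2 q I * kap Z2 q K * g0 I K" if "q : V' Int U Int U2" for q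
     using IK kap_levi[OF adm2, of q] that by (auto simp: kap_def[OF adm2])
    thus ?thesis using V' U q(1) by (intro exI[of _ "V' Int U"] exI[of _ C] exI[of _ \<epsilon>]) auto
   qed
  qed
  have 1: "gcomp M \<theta> Z2 (gT g) Xinf Xinf x = 4 & gcomp M \<theta> Z2 (gT g) Xinf X0 x = 0 & gcomp M \<theta> Z2 (gT g) Xinf X1 x = 0"
   if x: "x : N Int U2 \<times> UNIV" for x
  proof -
   obtain p r where p: "x = (p, r)" "Q p r" "p : U2" using x by (auto simp: N_def)
   show ?thesis
   proof (rule QE[OF p(2)])
    fix V \<phi> U Z N' G assume a: "ana M V \<phi> H J \<theta> U Z lam g N' G" and q: "p : U" "(\<phi> p, r) : N'"
    interpret ana M V \<phi> H J \<theta> U Z lam g N' G by (rule a)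
    show ?thesis unfolding p(1) gT_frame[OF adm2 q(1) p(3) q(2)]
     using Gnf[OF q(2), of Xinf Xinf] Gnf[OF q(2), of Xinf X0] Gnf[OF q(2), of Xinf X1] by (simp add: nf_def kap_def[OF adm2])
   qed
  qed
  show "(ALL x:N Int U2 \<times> UNIV. gcomp M \<theta> Z2 (gT g) Xinf Xinf x = 4 \<and>
     gcomp M \<theta> Z2 (gT g) Xinf X0 x = 0 & gcomp M \<theta> Z2 (gT g) Xinf X1 x = 0) \<and>
    O_rho U2 1 (%x. gcomp M \<theta> Z2 (gT g) X0 X0 x - 1) \<and>
    O_rho U2 1 (gcomp M \<theta> Z2 (gT g) X0 X1) \<and>
    O_rho U2 1 (gcomp M \<theta> Z2 (gT g) X1 X1) \<and>
    O_rho U2 1 (%x. gcomp M \<theta> Z2 (gT g) X1 X1bar x - levi_form M \<theta> Z2 Z2 (fst x))"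
   using 1 O[of X0 X0] O[of X0 X1] O[of X1 X1] O[of X1 X1bar] by simp
 qed
 have sm: "\<forall>(p, \<rho>)\<in>N. ALL u:theta_fiber M p. ALL v:theta_fiber M p.
   (%n. taylor_coeff (%r. g (p, r) u v) n * of_real \<rho> ^ n) sums gT g (p, \<rho>) u v" unfolding N_def by clarify (erule QE, rule ana.gT_sums(1))
 show ?thesis by (intro exI[of _ N] exI[of _ "gT g"] conjI oN tm nf sm) (use Q0 in "auto simp: N_def")
qed

end
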